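(* Let $n,d\ge 1$ be integers, $T>0$, and let $b,\delta:\Omega\times[0,T]\times\mathbb R^n\times\mathcal P(\mathbb R^n)\to\mathbb R^n$ and $\sigma:\Omega\times[0,T]\times\mathbb R^n\times\mathcal P(\mathbb R^n)\to\mathbb R^{n\times d}$ be such that for each fixed $(x,\mu)\in\mathbb R^n\times\mathcal P(\mathbb R^n)$ the processes $(\omega,t)\mapsto\varphi(\omega,t,x,\mu)$, $\varphi=b,\delta,\sigma$, are $\mathbb F'$-progressively measurable on $\Omega\times[0,T]$. Assume: (i) $\mathbb E\Big[\int_0^T|b(s,\mathbf 0,\delta_{\mathbf 0})|^2ds+\int_0^T\big(|\delta(s,\mathbf 0,\delta_{\mathbf 0})|^2+|\sigma(s,\mathbf 0,\delta_{\mathbf 0})|^2\big)dL_s\Big]<\infty$, where $\mathbf 0$ is the origin of $\mathbb R^n$ and $\delta_{\mathbf 0}$ is the Dirac measure at $\mathbf 0$; (ii) there are a constant $C_0>0$ and a set $\Omega_0\subset\Omega$ with $\mathbb P(\Omega_0)=1$ such that for all $\omega\in\Omega_0$, $t\in[0,T]$, $x_1,x_2\in\mathbb R^n$, $\mu_1,\mu_2\in\mathcal P(\mathbb R^n)$ and $\varphi=b,\delta,\sigma$, $$|\varphi(t,x_1,\mu_1)-\varphi(t,x_2,\mu_2)|\le C_0\big(|x_1-x_2|+\mathcal W_2(\mu_1,\mu_2)\big).$$ Then for every $x_0\in\mathbb R^n$ the mean-field SDE $$dX_t=b(t,X_t,\mathbb P_{X_t})\,dt+\delta(t,X_t,\mathbb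 P_{X_t})\,dL_t+\sigma(t,X_t,\mathbb P_{X_t})\,dB_{L_t},\quad t\in[0,T],\qquad X_0=x_0,$$ has a unique $L^2$ strong solution $X$, and $\mathbb E\big[\sup_{0\le t\le T}|X_t|^2\big]<\infty$.
   Context: On a complete probability space $(\Omega,\mathcal F,\mathbb P)$, $B$ is a standard Brownian motion on $\mathbb R^d$ starting from the origin, and $S=\{S_t;t\ge0\}$ is a subordinator independent of $B$ with $S_0=0$ and drift $\kappa>0$; that is, $S_t=\kappa t+S^0_t$, with $S^0$ a driftless subordinator with Lévy measure $\nu$. Its inverse is $L_t:=\inf\{r>0:S_r>t\}$, which is continuous in $t$. The sub-diffusion $B_{L_t}$ is a continuous martingale with $\langle B_L\rangle_t=L_t$. $\mathbb F'=\{\mathcal F'_t\}$ is the natural augmented filtration (right-continuous and containing the null sets) generated by $\{B_{L_t};t\ge0\}$. $\mathcal P(\mathbb R^n)$ is the set of probability measures on $\mathbb R^n$; $\mathcal W_2(\mu_1,\mu_2)=\inf_\pi\big(\int|x-y|^2\pi(dx,dy)\big)^{1/2}$, the infimum being over all couplings $\pi$ of $\mu_1$ and $\mu_2$. $\mathbb P_{X_t}$ is the law of $X_t$. The variable $\omega$ is suppressed in the coefficients. $\mathcal M[0,T]$ is the space of $\mathbb R^n$-valued $\mathbb F'$-progressively measurable processes $\psi$ on $[0,T]$ with $\mathbb E\int_0^T|\psi(t)|^2dt<\infty$. An $L^2$ strong solution is a process $X\in\mathcal M[0,T]$ such that for any $t\in[0,T]$ $$X_t=x_0+\int_0^tb(s,X_s,\mathbb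 P_{X_s})ds+\int_0^t\delta(s,X_s,\mathbb P_{X_s})dL_s+\int_0^t\sigma(s,X_s,\mathbb P_{X_s})dB_{L_s}.$$ Uniqueness means: if $X,\widetilde X\in\mathcal M[0,T]$ are two $L^2$ strong solutions, then with probability one $\widetilde X_t=X_t$ for all $t\in[0,T]$. *)

theory Defs
  imports "HOL-Probability.Probability"
begin

text \<open>
  A stochastic process is a function of type \<open>real \<Rightarrow> 'a \<Rightarrow> 'b\<close> (time first); only its values at
  times \<open>t \<ge> 0\<close>, or \<open>t \<in> {0..T}\<close>, matter. Path regularity is required almost surely.
\<close>

definition independent_increments :: "'a measure \<Rightarrow> (real \<Rightarrow> 'a \<Rightarrow> 'b::real_normed_vector) \<Rightarrow> bool" where
  "independent_increments M X \<longleftrightarrow>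
     (\<forall>(p::nat \<Rightarrow> real) k. 0 \<le> p 0 \<and> mono p \<longrightarrow>
        prob_space.indep_vars M (\<lambda>_. borel) (\<lambda>i \<omega>. X (p (Suc i)) \<omega> - X (p i) \<omega>) {..<k})"

text \<open>The product of normal densities is the density of \<open>N(0, (t - s) I)\<close>.\<close>

definition standard_brownian_motion :: "'a measure \<Rightarrow> (real \<Rightarrow> 'a \<Rightarrow> real ^ 'd) \<Rightarrow> bool" where
  "standard_brownian_motion M B \<longleftrightarrow>
     (\<forall>t\<ge>0. B t \<in> borel_measurable M) \<and>
     (AE \<omega> in M. B 0 \<omega> = 0) \<and>
     (\<forall>s t. 0 \<le> s \<and> s < t \<longrightarrow>
        distributed M lborel (\<lambda>\<omega>. B t \<omega> - B s \<omega>)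
          (\<lambda>x. ennreal (\<Prod>i\<in>UNIV. normal_density 0 (sqrt (t - s)) (x $ i)))) \<and>
     independent_increments M B \<and>
     (AE \<omega> in M. continuous_on {0..} (\<lambda>t. B t \<omega>))"

text \<open>
  The drift \<open>c\<close> and the Levy measure \<open>\<nu>\<close> of a subordinator are identified through its Laplace
  exponent \<open>c * u + \<integral> (1 - exp (- u * x)) \<nu>(dx)\<close>. Left limits exist automatically, since the
  paths are nondecreasing.
\<close>

definition is_subordinator ::
    "'a measure \<Rightarrow> real \<Rightarrow> real measure \<Rightarrow> (real \<Rightarrow> 'a \<Rightarrow> real) \<Rightarrow> bool" where
  "is_subordinator M c \<nu> S \<longleftrightarrow>
     (\<forall>t\<ge>0. S t \<in> borel_measurable M) \<and>
     (AE \<omega> in M. S 0 \<omega> = 0) \<and>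
     independent_increments M S \<and>
     (\<forall>s t. 0 \<le> s \<and> s \<le> t \<longrightarrow>
        distr M borel (\<lambda>\<omega>. S t \<omega> - S s \<omega>) = distr M borel (S (t - s))) \<and>
     (AE \<omega> in M. mono_on {0..} (\<lambda>t. S t \<omega>) \<and>
        (\<forall>t\<ge>0. continuous (at_right t) (\<lambda>t. S t \<omega>))) \<and>
     0 \<le> c \<and>
     sets \<nu> = sets borel \<and> emeasure \<nu> {..0} = 0 \<and>
     (\<integral>\<^sup>+ x. ennreal (min 1 x) \<partial>\<nu>) < \<infinity> \<and>
     (\<forall>t\<ge>0. \<forall>u\<ge>0.
        (\<integral>\<omega>. exp (- u * S t \<omega>) \<partial>M) =
        exp (- t * (c * u + (\<integral>x. 1 - exp (- u * x) \<partial>\<nu>))))"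

definition inverse_subordinator :: "(real \<Rightarrow> 'a \<Rightarrow> real) \<Rightarrow> real \<Rightarrow> 'a \<Rightarrow> real" where
  "inverse_subordinator S t \<omega> = Inf {r. 0 < r \<and> S r \<omega> > t}"

definition subdiffusion :: "(real \<Rightarrow> 'a \<Rightarrow> 'b) \<Rightarrow> (real \<Rightarrow> 'a \<Rightarrow> real) \<Rightarrow> real \<Rightarrow> 'a \<Rightarrow> 'b" where
  "subdiffusion B L t \<omega> = B (L t \<omega>) \<omega>"

definition process_events ::
    "'a measure \<Rightarrow> (real \<Rightarrow> 'a \<Rightarrow> 'b::topological_space) \<Rightarrow> real set \<Rightarrow> 'a set set" where
  "process_events M X I =
     sigma_sets (space M) {X t -` A \<inter> space M | t A. t \<in> I \<and> A \<in> sets borel}"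

definition augmented_filtration ::
    "'a measure \<Rightarrow> (real \<Rightarrow> 'a \<Rightarrow> 'b::topological_space) \<Rightarrow> real \<Rightarrow> 'a measure" where
  "augmented_filtration M Z t =
     sigma (space M)
       (\<Inter>u\<in>{t<..}. sigma_sets (space M) (process_events M Z {0..u} \<union> null_sets M))"

definition prog_measurable ::
    "(real \<Rightarrow> 'a measure) \<Rightarrow> real \<Rightarrow> (real \<Rightarrow> 'a \<Rightarrow> 'b::topological_space) \<Rightarrow> bool" where
  "prog_measurable F T X \<longleftrightarrow>
     (\<forall>t\<in>{0..T}. (\<lambda>(\<omega>, s). X s \<omega>) \<in> F t \<Otimes>\<^sub>M restrict_space borel {0..t} \<rightarrow>\<^sub>M borel)"

definition prog_L2 ::
    "'a measure \<Rightarrow> (real \<Rightarrow> 'a measure) \<Rightarrow> real \<Rightarrow> (real \<Rightarrow> 'a \<Rightarrow> 'b::real_normed_vector) set" where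
  "prog_L2 M F T =
     {X. prog_measurable F T X \<and>
         (\<integral>\<^sup>+ \<omega>. (\<integral>\<^sup>+ t\<in>{0..T}. ennreal ((norm (X t \<omega>))\<^sup>2) \<partial>lborel) \<partial>M) < \<infinity>}"

abbreviation prob_measures :: "'b::topological_space measure set" where
  "prob_measures \<equiv> space (prob_algebra borel)"

definition couplings ::
    "'b::topological_space measure \<Rightarrow> 'b measure \<Rightarrow> ('b \<times> 'b) measure set" where
  "couplings \<mu>1 \<mu>2 =
     {\<pi> \<in> space (prob_algebra (borel \<Otimes>\<^sub>M borel)).
        distr \<pi> borel fst = \<mu>1 \<and> distr \<pi> borel snd = \<mu>2}"

definition ennreal_sqrt :: "ennreal \<Rightarrow> ennreal" where
  "ennreal_sqrt a = (if a = \<infinity> then \<infinity> else ennreal (sqrt (enn2real a)))"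

text \<open>The value may be \<open>\<infinity>\<close>, as second moments need not be finite.\<close>

definition wasserstein2 ::
    "'b::real_normed_vector measure \<Rightarrow> 'b measure \<Rightarrow> ennreal" where
  "wasserstein2 \<mu>1 \<mu>2 =
     (INF \<pi>\<in>couplings \<mu>1 \<mu>2.
        ennreal_sqrt (\<integral>\<^sup>+ (x, y). ennreal ((norm (x - y))\<^sup>2) \<partial>\<pi>))"

text \<open>
  The Lebesgue--Stieltjes measure of the path \<open>t \<mapsto> A t \<omega>\<close>. For the inverse of a subordinator with
  positive drift, almost every path is continuous and nondecreasing on all of \<open>\<real>\<close> (it vanishes
  for \<open>t \<le> 0\<close>), as \<^const>\<open>interval_measure\<close> expects.
\<close>

definition path_measure :: "(real \<Rightarrow> 'a \<Rightarrow> real) \<Rightarrow> 'a \<Rightarrow> real measure" where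
  "path_measure A \<omega> = interval_measure (\<lambda>t. A t \<omega>)"

text \<open>
  A simple integrand is given by \<open>m\<close>, a partition \<open>0 = p 0 \<le> \<dots> \<le> p m = T\<close> and bounded
  coefficients \<open>\<xi> i\<close> that are measurable at time \<open>p i\<close>. Its value at time \<open>0\<close> is immaterial,
  since the integrators are continuous.
\<close>

definition simple_integrand ::
    "'a measure \<Rightarrow> (real \<Rightarrow> 'a measure) \<Rightarrow> real \<Rightarrow> nat \<Rightarrow> (nat \<Rightarrow> real) \<Rightarrow>
     (nat \<Rightarrow> 'a \<Rightarrow> real ^ 'd ^ 'n) \<Rightarrow> bool" where
  "simple_integrand M F T m p \<xi> \<longleftrightarrow>
     p 0 = 0 \<and> p m = T \<and>
     (\<forall>i<m. p i \<le> p (Suc i) \<and> \<xi> i \<in> borel_measurable (F (p i)) \<and>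
        (\<exists>C. \<forall>\<omega>\<in>space M. norm (\<xi> i \<omega>) \<le> C))"

definition simple_process ::
    "nat \<Rightarrow> (nat \<Rightarrow> real) \<Rightarrow> (nat \<Rightarrow> 'a \<Rightarrow> real ^ 'd ^ 'n) \<Rightarrow> real \<Rightarrow> 'a \<Rightarrow> real ^ 'd ^ 'n" where
  "simple_process m p \<xi> t \<omega> = (\<Sum>i<m. indicator {p i<..p (Suc i)} t *\<^sub>R \<xi> i \<omega>)"

definition simple_integral ::
    "(real \<Rightarrow> 'a \<Rightarrow> real ^ 'd) \<Rightarrow> nat \<Rightarrow> (nat \<Rightarrow> real) \<Rightarrow>
     (nat \<Rightarrow> 'a \<Rightarrow> real ^ 'd ^ 'n) \<Rightarrow> real \<Rightarrow> 'a \<Rightarrow> real ^ 'n" where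
  "simple_integral Z m p \<xi> t \<omega> =
     (\<Sum>i<m. \<xi> i \<omega> *v (Z (min t (p (Suc i))) \<omega> - Z (min t (p i)) \<omega>))"

text \<open>
  \<open>I\<close> is (a version of) the Ito integral process \<open>\<integral>\<^sub>0\<^sup>t H s dZ s\<close>, \<open>t \<in> {0..T}\<close>. Here \<open>Z\<close> is a
  continuous square-integrable martingale with values in \<open>\<real>\<^sup>d\<close> whose covariations are
  \<open>\<langle>Z\<^sup>i, Z\<^sup>j\<rangle> = \<delta>\<^sub>i\<^sub>j A\<close>, and the integrand is progressively measurable (up to a null event, which
  belongs to the complete filtration \<open>F\<close>) with \<open>E \<integral>\<^sub>0\<^sup>T |H|\<^sup>2 dA < \<infinity>\<close>. By the Ito isometry the
  continuous process \<open>I\<close> is unique up to indistinguishability and does not depend on the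
  approximating sequence. The norm on matrices is the Frobenius norm.
\<close>

definition ito_integral ::
    "'a measure \<Rightarrow> (real \<Rightarrow> 'a measure) \<Rightarrow> (real \<Rightarrow> 'a \<Rightarrow> real ^ 'd) \<Rightarrow> (real \<Rightarrow> 'a \<Rightarrow> real) \<Rightarrow>
     real \<Rightarrow> (real \<Rightarrow> 'a \<Rightarrow> real ^ 'd ^ 'n) \<Rightarrow> (real \<Rightarrow> 'a \<Rightarrow> real ^ 'n) \<Rightarrow> bool" where
  "ito_integral M F Z A T H I \<longleftrightarrow>
     (\<exists>K. prog_measurable F T K \<and> (AE \<omega> in M. \<forall>t\<in>{0..T}. H t \<omega> = K t \<omega>)) \<and>
     (\<integral>\<^sup>+ \<omega>. (\<integral>\<^sup>+ t\<in>{0..T}. ennreal ((norm (H t \<omega>))\<^sup>2) \<partial>path_measure A \<omega>) \<partial>M) < \<infinity> \<and>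
     (\<forall>t\<in>{0..T}. I t \<in> borel_measurable (F t)) \<and>
     (AE \<omega> in M. continuous_on {0..T} (\<lambda>t. I t \<omega>)) \<and>
     (\<exists>m p \<xi>.
        (\<forall>k. simple_integrand M F T (m k) (p k) (\<xi> k)) \<and>
        ((\<lambda>k. \<integral>\<^sup>+ \<omega>. (\<integral>\<^sup>+ t\<in>{0..T}.
            ennreal ((norm (H t \<omega> - simple_process (m k) (p k) (\<xi> k) t \<omega>))\<^sup>2)
            \<partial>path_measure A \<omega>) \<partial>M) \<longlonglongrightarrow> 0) \<and>
        (\<forall>t\<in>{0..T}.
          (\<lambda>k. \<integral>\<^sup>+ \<omega>. ennreal ((norm (I t \<omega> - simple_integral Z (m k) (p k) (\<xi> k) t \<omega>))\<^sup>2) \<partial>M)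
            \<longlonglongrightarrow> 0))"

text \<open>
  The equation is understood as an identity of processes up to indistinguishability, the
  stochastic integral being the continuous version: if the exceptional null event could depend
  on \<open>t\<close>, solutions could be altered at a random time and pathwise uniqueness would fail.
\<close>

definition strong_solution ::
    "'a measure \<Rightarrow> (real \<Rightarrow> 'a measure) \<Rightarrow> (real \<Rightarrow> 'a \<Rightarrow> real ^ 'd) \<Rightarrow> (real \<Rightarrow> 'a \<Rightarrow> real) \<Rightarrow> real \<Rightarrow>
     ('a \<Rightarrow> real \<Rightarrow> real ^ 'n \<Rightarrow> (real ^ 'n) measure \<Rightarrow> real ^ 'n) \<Rightarrow>
     ('a \<Rightarrow> real \<Rightarrow> real ^ 'n \<Rightarrow> (real ^ 'n) measure \<Rightarrow> real ^ 'n) \<Rightarrow>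
     ('a \<Rightarrow> real \<Rightarrow> real ^ 'n \<Rightarrow> (real ^ 'n) measure \<Rightarrow> real ^ 'd ^ 'n) \<Rightarrow>
     real ^ 'n \<Rightarrow> (real \<Rightarrow> 'a \<Rightarrow> real ^ 'n) \<Rightarrow> bool" where
  "strong_solution M F Z A T b \<delta> \<sigma> x0 X \<longleftrightarrow>
     X \<in> prog_L2 M F T \<and>
     (\<exists>I. ito_integral M F Z A T (\<lambda>s \<omega>. \<sigma> \<omega> s (X s \<omega>) (distr M borel (X s))) I \<and>
       (AE \<omega> in M.
          set_integrable lborel {0..T} (\<lambda>s. b \<omega> s (X s \<omega>) (distr M borel (X s))) \<and>
          set_integrable (path_measure A \<omega>) {0..T} (\<lambda>s. \<delta> \<omega> s (X s \<omega>) (distr M borel (X s))) \<and>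
          (\<forall>t\<in>{0..T}. X t \<omega> =
             x0 + (LINT s:{0..t}|lborel. b \<omega> s (X s \<omega>) (distr M borel (X s)))
                + (LINT s:{0..t}|path_measure A \<omega>. \<delta> \<omega> s (X s \<omega>) (distr M borel (X s)))
                + I t \<omega>)))"

text \<open>The Lipschitz condition at a fixed pair \<open>(\<omega>, t)\<close>.\<close>

definition lipschitz_W2 ::
    "real \<Rightarrow> (real ^ 'n \<Rightarrow> (real ^ 'n) measure \<Rightarrow> 'c::real_normed_vector) \<Rightarrow> bool" where
  "lipschitz_W2 C f \<longleftrightarrow>
     (\<forall>x1 x2. \<forall>\<mu>1\<in>prob_measures. \<forall>\<mu>2\<in>prob_measures.
        ennreal (norm (f x1 \<mu>1 - f x2 \<mu>2)) \<le>
          ennreal C * (ennreal (norm (x1 - x2)) + wasserstein2 \<mu>1 \<mu>2))"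

end

(*
  Since S grows at least at rate kappa, the clock L is (1/kappa)-Lipschitz, so dL is dominated by
  dt/kappa and both dt- and dL-integrals are controlled by integrals over time.

  Z = B_L is a martingale with bracket L: rounded up to a dyadic grid, the clock takes finitely many
  values l, and an event of F_s restricted to {L_s <= l} is independent of the increments of B after
  l. The first two moments of Brownian increments can therefore be summed over the grid, and the
  fourth moments give the uniform second moment bounds that carry the identities to the limit. The
  clock itself is adapted, being the almost sure limit of dyadic quadratic variations of Z.

  Ito integrals of progressively measurable integrands come from simple ones by the isometry and
  Doob's inequality. Coupling X_s and Y_s on the given space bounds W_2 of their laws by
  (E|X_s - Y_s|^2)^(1/2), so the Picard map Phi satisfies
  E sup_{s<=t} |Phi X - Phi Y|^2 <= K int_0^t E|X_s - Y_s|^2 ds;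
  iterating this gives the factor (K T)^k / k!, whence existence and uniqueness.
*)
theory Submission
  imports Defs
begin

text \<open>Two obstacles shape the proof. The filtration \<open>F\<close> is generated by
  \<open>Z\<close> alone, in which neither \<open>B\<close> nor \<open>S\<close> is visible
  separately. The martingale identities are therefore proved in a larger filtration,
  \<open>history\<close>, that knows the whole path of \<open>S\<close> from the start: each
  \<open>L u\<close> becomes a stopping time there, while independence of \<open>B\<close> and
  \<open>S\<close> keeps later increments of \<open>B\<close> independent of the past. Events of
  \<open>F s\<close> are shown to be prior to \<open>L u\<close> for every \<open>u > s\<close>, and
  a limit in \<open>u\<close> returns to \<open>s\<close>. The coefficients are measurable only for
  fixed \<open>x\<close> and \<mu>. Measurability along a process is derived from the Lipschitz
  bound, for processes with continuous paths and square-integrable supremum; the Picard iteration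
  stays in this class. A competing solution is at first merely progressively measurable, so the
  estimates for it bound possibly non-measurable integrands by measurable ones under
  \<open>nn_integral\<close>. Constants are not optimised, since the factorial absorbs any finite
  one.\<close>

type_synonym ('a, 'b) process = "real \<Rightarrow> 'a \<Rightarrow> 'b"

abbreviation (input) nn_sq :: "'a measure \<Rightarrow> ('a \<Rightarrow> 'b::real_normed_vector) \<Rightarrow> ennreal" where
  "nn_sq M f \<equiv> \<integral>\<^sup>+x. ennreal ((norm (f x))\<^sup>2) \<partial>M"

abbreviation (input) nn_sq_on :: "'a measure \<Rightarrow> 'a set \<Rightarrow> ('a \<Rightarrow> 'b::real_normed_vector) \<Rightarrow> ennreal" where
  "nn_sq_on M A f \<equiv> \<integral>\<^sup>+x\<in>A. ennreal ((norm (f x))\<^sup>2) \<partial>M"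

abbreviation (input) nn_sup_sq :: "'a measure \<Rightarrow> 't set \<Rightarrow> ('t \<Rightarrow> 'a \<Rightarrow> 'b::real_normed_vector) \<Rightarrow> ennreal" where
  "nn_sup_sq M I f \<equiv> \<integral>\<^sup>+x. (SUP t\<in>I. ennreal ((norm (f t x))\<^sup>2)) \<partial>M"

section \<open>Complete measures and square-integrable functions\<close>

text \<open>The preimages under \<open>f\<close> and \<open>g\<close> differ only inside the null
  set \<open>D\<close>. Nothing is known about \<open>g\<close> on \<open>D\<close>, but
  completeness makes every subset of \<open>D\<close> a null set, and \<open>N\<close> contains the
  null sets. This is how exceptional events are ignored in statements about adaptedness.\<close>

lemma measurable_AE_cong:
  fixes f g :: "'a \<Rightarrow> 'b::topological_space"
  assumes cm: "complete_measure M" and sub: "subalgebra M N" "null_sets M \<subseteq> sets N"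
    and f: "f \<in> borel_measurable N" and ae: "AE x in M. f x = g x"
  shows "g \<in> borel_measurable N"
proof (rule measurableI)
  fix A assume A: "A \<in> sets (borel :: 'b measure)"
  define D where "D = {x \<in> space M. f x \<noteq> g x}"
  have sp: "space N = space M" using sub(1) by (simp add: subalgebra_def)
  have D: "D \<in> null_sets M"
    using complete_measure.AE_iff_null_sets[OF cm, of "\<lambda>x. f x = g x"] ae by (simp add: D_def)
  have *: "g -` A \<inter> D \<in> null_sets M"
    by (rule complete_measure.complete2[OF cm _ D]) auto
  have "g -` A \<inter> space N = (f -` A \<inter> space N - D) \<union> (g -` A \<inter> D)"
    unfolding D_def sp by auto
  also have "\<dots> \<in> sets N"
    using f A D * sub(2) by (intro sets.Un sets.Diff measurable_sets[OF f]) auto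
  finally show "g -` A \<inter> space N \<in> sets N" .
qed auto

lemma subalgebra_refl: "subalgebra M M"
  by (simp add: subalgebra_def)

lemma measurable_AE_LIMSEQ:
  fixes g :: "'a \<Rightarrow> 'b::metric_space"
  assumes cm: "complete_measure M" and sub: "subalgebra M N" "null_sets M \<subseteq> sets N"
    and f: "\<And>n. f n \<in> borel_measurable N" and ae: "AE x in M. (\<lambda>n. f n x) \<longlonglongrightarrow> g x"
  shows "g \<in> borel_measurable N"
proof -
  define E where "E = {x \<in> space M. \<not> (\<lambda>n. f n x) \<longlonglongrightarrow> g x}"
  have E: "E \<in> null_sets M"
    using complete_measure.AE_iff_null_sets[OF cm, of "\<lambda>x. (\<lambda>n. f n x) \<longlonglongrightarrow> g x"] ae
    by (simp add: E_def)
  then have EN: "E \<in> sets N" using sub by auto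
  have sp: "space N = space M" using sub(1) by (simp add: subalgebra_def)
  fix c :: 'b
  \<comment> \<open>On \<open>E\<close> the limit and all members of the sequence take one and the
    same value, so the modified sequence converges everywhere.\<close>
  define g' where "g' = (\<lambda>x. if x \<in> E then undefined else g x)"
  define f' where "f' = (\<lambda>n x. if x \<in> E then undefined else f n x)"
  have "g' \<in> borel_measurable N"
  proof (rule borel_measurable_LIMSEQ_metric)
    show "f' n \<in> borel_measurable N" for n
      unfolding f'_def using f EN by (intro measurable_If_set) auto
    show "(\<lambda>n. f' n x) \<longlonglongrightarrow> g' x" if "x \<in> space N" for x
      using that by (auto simp: f'_def g'_def E_def sp)
  qed
  moreover have "AE x in M. g' x = g x"
    by (rule AE_I'[OF E]) (auto simp: g'_def)
  ultimately show ?thesis by (rule measurable_AE_cong[OF cm sub])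
qed

lemma measurable_subalgebra:
  "subalgebra M N \<Longrightarrow> f \<in> borel_measurable N \<Longrightarrow> f \<in> borel_measurable M"
  by (rule measurable_from_subalg)

text \<open>Cauchy-Schwarz against the indicator of \<open>A\<close>. The right side may be
  infinite, so that square-integrability does not have to be established first.\<close>

lemma ennreal_norm_set_integral_sq_le:
  fixes f :: "'a \<Rightarrow> 'b::{banach, second_countable_topology}"
  assumes f: "set_integrable \<mu> A f" and A: "A \<in> sets \<mu>"
  shows "ennreal ((norm (LINT s:A|\<mu>. f s))\<^sup>2) \<le>
    emeasure \<mu> A * (\<integral>\<^sup>+ s\<in>A. ennreal ((norm (f s))\<^sup>2) \<partial>\<mu>)"
proof -
  let ?g = "\<lambda>s. indicator A s *\<^sub>R f s"
  have i: "integrable \<mu> ?g" using f by (simp add: set_integrable_def)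
  have "ennreal (norm (LINT s:A|\<mu>. f s)) \<le> (\<integral>\<^sup>+ s. ennreal (norm (?g s)) \<partial>\<mu>)"
    unfolding set_lebesgue_integral_def
    using i by (rule integral_norm_bound_ennreal)
  also have "\<dots> = (\<integral>\<^sup>+ s. indicator A s * ennreal (norm (?g s)) \<partial>\<mu>)"
    by (intro nn_integral_cong) (auto simp: indicator_def)
  finally have "(ennreal (norm (LINT s:A|\<mu>. f s)))\<^sup>2 \<le> (\<integral>\<^sup>+ s. indicator A s * ennreal (norm (?g s)) \<partial>\<mu>)\<^sup>2"
    by (intro power_mono) auto
  also have "\<dots> \<le> (\<integral>\<^sup>+ s. (indicator A s)\<^sup>2 \<partial>\<mu>) * (\<integral>\<^sup>+ s. (ennreal (norm (?g s)))\<^sup>2 \<partial>\<mu>)"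
    using A borel_measurable_integrable[OF i]
    by (intro Cauchy_Schwarz_nn_integral measurable_compose[OF borel_measurable_norm measurable_ennreal]
        measurable_compose[of ?g _ _ "\<lambda>x. ennreal (norm x)"]) auto
  also have "(\<integral>\<^sup>+ s. (indicator A s)\<^sup>2 \<partial>\<mu>) = (\<integral>\<^sup>+ s. indicator A s \<partial>\<mu>)"
    by (intro nn_integral_cong) (auto simp: indicator_def)
  also have "\<dots> = emeasure \<mu> A" using A by simp
  also have "(\<integral>\<^sup>+ s. (ennreal (norm (?g s)))\<^sup>2 \<partial>\<mu>) = (\<integral>\<^sup>+ s\<in>A. ennreal ((norm (f s))\<^sup>2) \<partial>\<mu>)"
    by (intro nn_integral_cong) (auto simp: indicator_def ennreal_power)
  finally show ?thesis by (simp add: ennreal_power)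
qed

lemma norm_add_sq_le: "(norm (a + b))\<^sup>2 \<le> 2 * (norm a)\<^sup>2 + 2 * (norm (b::'b::real_normed_vector))\<^sup>2"
proof -
  have "(norm (a + b))\<^sup>2 \<le> (norm a + norm b)\<^sup>2" by (intro power_mono norm_triangle_ineq) auto
  also have "\<dots> \<le> 2 * (norm a)\<^sup>2 + 2 * (norm b)\<^sup>2"
    using sum_squares_bound[of "norm a" "norm b"] by (simp add: power2_sum)
  finally show ?thesis .
qed

lemma norm_add3_sq_le:
  "(norm (a + b + c))\<^sup>2 \<le> 3 * (norm a)\<^sup>2 + 3 * (norm b)\<^sup>2 + 3 * (norm (c::'b::real_normed_vector))\<^sup>2"
proof -
  have "(norm (a + b + c))\<^sup>2 \<le> (norm a + norm b + norm c)\<^sup>2"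
    by (intro power_mono) (auto intro: norm_triangle_le norm_triangle_ineq add_mono)
  also have "\<dots> \<le> 3 * (norm a)\<^sup>2 + 3 * (norm b)\<^sup>2 + 3 * (norm c)\<^sup>2"
    using sum_squares_bound[of "norm a" "norm b"] sum_squares_bound[of "norm a" "norm c"]
      sum_squares_bound[of "norm b" "norm c"]
    by (simp add: power2_eq_square algebra_simps)
  finally show ?thesis .
qed

lemma ennreal_norm_add_sq_le:
  "ennreal ((norm (a + b))\<^sup>2) \<le> 2 * ennreal ((norm a)\<^sup>2) + 2 * ennreal ((norm (b::'b::real_normed_vector))\<^sup>2)"
proof -
  have "ennreal ((norm (a + b))\<^sup>2) \<le> ennreal (2 * (norm a)\<^sup>2 + 2 * (norm b)\<^sup>2)"
    by (intro ennreal_leI norm_add_sq_le)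
  then show ?thesis by (simp add: ennreal_plus ennreal_mult)
qed

lemma ennreal_norm_diff_sq_le:
  "ennreal ((norm (a - b))\<^sup>2) \<le> 2 * ennreal ((norm a)\<^sup>2) + 2 * ennreal ((norm (b::'b::real_normed_vector))\<^sup>2)"
  using ennreal_norm_add_sq_le[of a "- b"] by simp

lemma ennreal_norm_add3_sq_le:
  "ennreal ((norm (a + b + c))\<^sup>2) \<le>
    3 * ennreal ((norm a)\<^sup>2) + 3 * ennreal ((norm b)\<^sup>2) + 3 * ennreal ((norm (c::'b::real_normed_vector))\<^sup>2)"
proof -
  have "ennreal ((norm (a + b + c))\<^sup>2) \<le> ennreal (3 * (norm a)\<^sup>2 + 3 * (norm b)\<^sup>2 + 3 * (norm c)\<^sup>2)"
    by (intro ennreal_leI norm_add3_sq_le)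
  then show ?thesis by (simp add: ennreal_plus ennreal_mult)
qed

definition L2 :: "'a measure \<Rightarrow> ('a \<Rightarrow> 'b::euclidean_space) \<Rightarrow> bool" where
  "L2 M f \<longleftrightarrow> f \<in> borel_measurable M \<and> integrable M (\<lambda>x. (norm (f x))\<^sup>2)"

lemma L2_measurable: "L2 M f \<Longrightarrow> f \<in> borel_measurable M"
  by (simp add: L2_def)

lemma L2_iff_nn:
  "L2 M f \<longleftrightarrow> f \<in> borel_measurable M \<and> (nn_sq M f) < \<infinity>"
  by (auto simp: L2_def integrable_iff_bounded)

lemma L2_nn_integral:
  "L2 M f \<Longrightarrow> (nn_sq M f) = ennreal (\<integral>x. (norm (f x))\<^sup>2 \<partial>M)"
  by (intro nn_integral_eq_integral) (auto simp: L2_def)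

lemma L2_add: assumes "L2 M f" "L2 M g" shows "L2 M (\<lambda>x. f x + g x)"
  unfolding L2_def
proof
  show m: "(\<lambda>x. f x + g x) \<in> borel_measurable M" using assms by (auto simp: L2_def)
  show "integrable M (\<lambda>x. (norm (f x + g x))\<^sup>2)"
    by (rule Bochner_Integration.integrable_bound[of M "\<lambda>x. 2 * (norm (f x))\<^sup>2 + 2 * (norm (g x))\<^sup>2"])
      (use assms m in \<open>auto simp: L2_def intro!: AE_I2 norm_add_sq_le\<close>)
qed

lemma L2_scaleR: "L2 M f \<Longrightarrow> L2 M (\<lambda>x. c *\<^sub>R f x)"
  by (auto simp: L2_def power_mult_distrib)

lemma L2_diff: assumes "L2 M f" "L2 M g" shows "L2 M (\<lambda>x. f x - g x)"
  using L2_add[OF assms(1) L2_scaleR[OF assms(2), of "-1"]] by simp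

lemma L2_zero [simp]: "L2 M (\<lambda>x. 0)"
  by (simp add: L2_def)

lemma L2_sum: "(\<And>i. i \<in> I \<Longrightarrow> L2 M (f i)) \<Longrightarrow> L2 M (\<lambda>x. \<Sum>i\<in>I. f i x)"
  by (induction I rule: infinite_finite_induct) (auto intro: L2_add)

lemma L2_norm_le:
  assumes "L2 M g" "f \<in> borel_measurable M" "AE x in M. norm (f x) \<le> norm (g x)"
  shows "L2 M f"
  unfolding L2_def
proof
  show "integrable M (\<lambda>x. (norm (f x))\<^sup>2)"
    by (rule Bochner_Integration.integrable_bound[of M "\<lambda>x. (norm (g x))\<^sup>2"])
      (use assms in \<open>auto simp: L2_def intro!: power_mono\<close>)
qed fact

lemma L2_AE_cong:
  assumes "complete_measure M" "L2 M f" "AE x in M. f x = g x"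
  shows "L2 M g"
proof (rule L2_norm_le[OF assms(2)])
  show "g \<in> borel_measurable M"
    using assms by (intro measurable_AE_cong[OF assms(1) subalgebra_refl _ _ assms(3)]) (auto simp: L2_def)
  show "AE x in M. norm (g x) \<le> norm (f x)" using assms(3) by eventually_elim simp
qed

lemma L2_inner_integrable:
  assumes "L2 M f" "L2 M g" shows "integrable M (\<lambda>x. f x \<bullet> g x)"
proof (rule Bochner_Integration.integrable_bound[of M "\<lambda>x. (norm (f x))\<^sup>2 + (norm (g x))\<^sup>2"])
  show "integrable M (\<lambda>x. (norm (f x))\<^sup>2 + (norm (g x))\<^sup>2)" using assms by (auto simp: L2_def)
  show "(\<lambda>x. f x \<bullet> g x) \<in> borel_measurable M" using assms by (auto simp: L2_def)
  have "norm (f x \<bullet> g x) \<le> norm ((norm (f x))\<^sup>2 + (norm (g x))\<^sup>2)" for x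
  proof -
    have "\<bar>f x \<bullet> g x\<bar> \<le> norm (f x) * norm (g x)" by (rule Cauchy_Schwarz_ineq2)
    also have "\<dots> \<le> (norm (f x))\<^sup>2 + (norm (g x))\<^sup>2"
      using sum_squares_bound[of "norm (f x)" "norm (g x)"]
        mult_nonneg_nonneg[OF norm_ge_zero[of "f x"] norm_ge_zero[of "g x"]] by linarith
    finally show ?thesis by simp
  qed
  then show "AE x in M. norm (f x \<bullet> g x) \<le> norm ((norm (f x))\<^sup>2 + (norm (g x))\<^sup>2)" by simp
qed

lemma L2_norm: "L2 M f \<Longrightarrow> L2 M (\<lambda>x. norm (f x))"
  by (auto simp: L2_def)

lemma L2_mult_bounded:
  fixes g :: "'a \<Rightarrow> 'b::euclidean_space"
  assumes "L2 M g" "f \<in> borel_measurable M" "\<And>x. x \<in> space M \<Longrightarrow> norm (f x) \<le> C * norm (g x)"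
  shows "L2 M f"
  by (rule L2_norm_le[OF L2_scaleR[OF assms(1), of C] assms(2)])
    (auto intro!: AE_I2 order_trans[OF assms(3)] mult_right_mono)

lemma (in finite_measure) L2_integrable:
  assumes "L2 M f" shows "integrable M f"
proof (rule Bochner_Integration.integrable_bound[of M "\<lambda>x. 1 + (norm (f x))\<^sup>2"])
  have "norm (f x) \<le> 1 + (norm (f x))\<^sup>2" for x
    using sum_squares_bound[of "norm (f x)" 1] zero_le_power2[of "norm (f x)"] norm_ge_zero[of "f x"]
    by (smt (verit) mult_cancel_left1 power_one)
  then show "AE x in M. norm (f x) \<le> norm (1 + (norm (f x))\<^sup>2)" by (auto simp: abs_of_nonneg)
qed (use assms in \<open>auto simp: L2_def\<close>)

text \<open>The vanishing integrals say that the conditional expectation of \<open>D\<close> given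
  \<open>N\<close> is zero, and an \<open>N\<close>-measurable factor can be pulled out of it.
  Martingale and bracket identities are stated below as vanishing integrals over events and become
  orthogonality relations here.\<close>

lemma (in prob_space) orth_subalgebra:
  fixes D f :: "'a \<Rightarrow> real"
  assumes sub: "subalgebra M N" and D: "integrable M D"
    and z: "\<And>A. A \<in> sets N \<Longrightarrow> (\<integral>x. indicator A x * D x \<partial>M) = 0"
    and f: "f \<in> borel_measurable N" and fD: "integrable M (\<lambda>x. f x * D x)"
  shows "(\<integral>x. f x * D x \<partial>M) = 0"
proof -
  interpret finite_measure_subalgebra M N
    by standard (rule sub)
  have "AE x in M. real_cond_exp M N D x = 0"
    by (rule real_cond_exp_charact)
      (use z D in \<open>auto simp: set_lebesgue_integral_def\<close>)
  moreover have "(\<integral>x. f x * real_cond_exp M N D x \<partial>M) = (\<integral>x. f x * D x \<partial>M)"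
    using fD f D by (intro real_cond_exp_intg) auto
  moreover have "(\<integral>x. f x * real_cond_exp M N D x \<partial>M) = (\<integral>x. 0 \<partial>M)" if "AE x in M. real_cond_exp M N D x = 0"
  proof (rule integral_cong_AE)
    show "(\<lambda>x. f x * real_cond_exp M N D x) \<in> borel_measurable M"
      using measurable_subalgebra[OF sub f] by auto
    show "AE x in M. f x * real_cond_exp M N D x = 0" using that by eventually_elim simp
  qed auto
  ultimately show ?thesis by simp
qed

lemma (in prob_space) orth_subalgebra_inner:
  fixes D Y :: "'a \<Rightarrow> 'b::euclidean_space"
  assumes sub: "subalgebra M N" and D: "L2 M D"
    and z: "\<And>A. A \<in> sets N \<Longrightarrow> (\<integral>x. indicator A x *\<^sub>R D x \<partial>M) = 0"
    and Y: "Y \<in> borel_measurable N" "L2 M Y"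
  shows "(\<integral>x. Y x \<bullet> D x \<partial>M) = 0"
proof -
  have Di: "integrable M D" by (rule L2_integrable[OF D])
  have comp: "L2 M (\<lambda>x. f x \<bullet> e)" if "L2 M f" "e \<in> Basis" for f and e :: 'b
    using that by (intro L2_norm_le[OF that(1)]) (auto simp: L2_def intro!: AE_I2 Basis_le_norm)
  have *: "(\<integral>x. (Y x \<bullet> e) * (D x \<bullet> e) \<partial>M) = 0" if e: "e \<in> Basis" for e
  proof (rule orth_subalgebra[OF sub])
    show "integrable M (\<lambda>x. D x \<bullet> e)" using Di by simp
    fix A assume A: "A \<in> sets N"
    have AM: "A \<in> sets M" using A sub by (auto simp: subalgebra_def)
    have "(\<integral>x. indicator A x * (D x \<bullet> e) \<partial>M) = (\<integral>x. (indicator A x *\<^sub>R D x) \<bullet> e \<partial>M)" by simp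
    also have "\<dots> = (\<integral>x. indicator A x *\<^sub>R D x \<partial>M) \<bullet> e"
      using Di AM by (intro integral_inner_left) (auto intro!: integrable_mult_indicator)
    finally show "(\<integral>x. indicator A x * (D x \<bullet> e) \<partial>M) = 0" using z[OF A] by simp
  next
    show "(\<lambda>x. Y x \<bullet> e) \<in> borel_measurable N" using Y by simp
    show "integrable M (\<lambda>x. (Y x \<bullet> e) * (D x \<bullet> e))"
      using L2_inner_integrable[OF comp[OF Y(2) e] comp[OF D e]] by (simp add: mult.commute)
  qed
  have i: "integrable M (\<lambda>x. (Y x \<bullet> e) * (D x \<bullet> e))" if "e \<in> Basis" for e
    using L2_inner_integrable[OF comp[OF Y(2) that] comp[OF D that]] by (simp add: mult.commute)
  have "(\<integral>x. Y x \<bullet> D x \<partial>M) = (\<integral>x. (\<Sum>e\<in>Basis. (Y x \<bullet> e) * (D x \<bullet> e)) \<partial>M)"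
    by (simp add: euclidean_inner[symmetric])
  also have "\<dots> = (\<Sum>e\<in>Basis. \<integral>x. (Y x \<bullet> e) * (D x \<bullet> e) \<partial>M)"
    by (rule Bochner_Integration.integral_sum) (rule i)
  finally show ?thesis using * by simp
qed

text \<open>A uniform bound in L2 gives uniform integrability, so almost sure convergence carries
  over to expectations; Fatou's lemma passes the bound itself to the limit.\<close>

lemma (in prob_space) tendsto_integral_L2_bounded:
  fixes X :: "nat \<Rightarrow> 'a \<Rightarrow> real"
  assumes lim: "AE x in M. (\<lambda>n. X n x) \<longlonglongrightarrow> Y x"
    and [measurable]: "\<And>n. X n \<in> borel_measurable M" "Y \<in> borel_measurable M"
    and bd: "\<And>n. (\<integral>\<^sup>+x. ennreal ((X n x)\<^sup>2) \<partial>M) \<le> ennreal C"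
  shows "integrable M Y" "(\<integral>\<^sup>+x. ennreal ((Y x)\<^sup>2) \<partial>M) \<le> ennreal C"
    "(\<lambda>n. \<integral>x. X n x \<partial>M) \<longlonglongrightarrow> (\<integral>x. Y x \<partial>M)"
proof -
  have "(\<integral>\<^sup>+x. ennreal ((Y x)\<^sup>2) \<partial>M) = (\<integral>\<^sup>+x. liminf (\<lambda>n. ennreal ((X n x)\<^sup>2)) \<partial>M)"
  proof (rule nn_integral_cong_AE)
    show "AE x in M. ennreal ((Y x)\<^sup>2) = liminf (\<lambda>n. ennreal ((X n x)\<^sup>2))"
      using lim
    proof eventually_elim
      case (elim x)
      then have "(\<lambda>n. ennreal ((X n x)\<^sup>2)) \<longlonglongrightarrow> ennreal ((Y x)\<^sup>2)"
        by (intro tendsto_ennrealI tendsto_intros)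
      then show ?case by (intro lim_imp_Liminf[symmetric]) auto
    qed
  qed
  also have "\<dots> \<le> liminf (\<lambda>n. \<integral>\<^sup>+x. ennreal ((X n x)\<^sup>2) \<partial>M)"
    by (rule nn_integral_liminf) simp
  also have "\<dots> \<le> ennreal C"
    using Liminf_mono[of "\<lambda>n. \<integral>\<^sup>+x. ennreal ((X n x)\<^sup>2) \<partial>M" "\<lambda>_. ennreal C" sequentially] bd
    by (simp add: Liminf_const)
  finally show YC: "(\<integral>\<^sup>+x. ennreal ((Y x)\<^sup>2) \<partial>M) \<le> ennreal C" .
  have L2X: "L2 M (X n)" for n
    unfolding L2_iff_nn using le_less_trans[OF bd[of n]] by (simp add: less_top)
  have L2Y: "L2 M Y" unfolding L2_iff_nn using le_less_trans[OF YC] by (simp add: less_top)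
  show iY: "integrable M Y" using L2_integrable[OF L2Y] .
  \<comment> \<open>Clipping to \<open>[-K, K]\<close> makes dominated convergence applicable. By
    the second moment bound it changes an expectation by at most \<open>max C 0 / K\<close>; the
    \<open>max\<close> covers a negative \<open>C\<close>, for which
    \<open>ennreal C = 0\<close>.\<close>
  define cl :: "real \<Rightarrow> real \<Rightarrow> real" where "cl = (\<lambda>K x. max (- K) (min K x))"
  have clm [measurable]: "cl K \<in> borel_measurable borel" for K unfolding cl_def by simp
  have cl_err: "\<bar>x - cl K x\<bar> \<le> x\<^sup>2 / K" if "K > 0" for x K
  proof (cases "\<bar>x\<bar> \<le> K")
    case True then have "cl K x = x" by (auto simp: cl_def)
    then show ?thesis using that by simp
  next
    case False
    have "\<bar>x - cl K x\<bar> \<le> \<bar>x\<bar>" using that by (auto simp: cl_def abs_if min_def max_def)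
    also have "\<dots> \<le> \<bar>x\<bar> * (\<bar>x\<bar> / K)" using False that
      by (intro mult_le_cancel_left1[THEN iffD2]) (auto simp: field_simps)
    also have "\<dots> = x\<^sup>2 / K" by (simp add: power2_eq_square flip: abs_mult)
    finally show ?thesis .
  qed
  have C: "C \<ge> 0 \<or> True" by simp
  have err: "\<bar>(\<integral>x. f x \<partial>M) - (\<integral>x. cl K (f x) \<partial>M)\<bar> \<le> max C 0 / K"
    if f: "L2 M f" "(\<integral>\<^sup>+x. ennreal ((f x)\<^sup>2) \<partial>M) \<le> ennreal C" and K: "K > 0" for f K
  proof -
    have [measurable]: "f \<in> borel_measurable M" using f by (simp add: L2_def)
    have fi: "integrable M f" by (rule L2_integrable[OF f(1)])
    have f2: "integrable M (\<lambda>x. (f x)\<^sup>2)" using f by (simp add: L2_def)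
    have ci: "integrable M (\<lambda>x. cl K (f x))"
      by (rule Bochner_Integration.integrable_bound[OF fi]) (use K in \<open>auto simp: cl_def abs_if min_def max_def\<close>)
    have "\<bar>(\<integral>x. f x \<partial>M) - (\<integral>x. cl K (f x) \<partial>M)\<bar> = \<bar>\<integral>x. f x - cl K (f x) \<partial>M\<bar>"
      using fi ci by simp
    also have "\<dots> \<le> (\<integral>x. \<bar>f x - cl K (f x)\<bar> \<partial>M)" by (rule integral_abs_bound)
    also have "\<dots> \<le> (\<integral>x. (f x)\<^sup>2 / K \<partial>M)"
      using fi ci f2 cl_err[OF K] by (intro integral_mono) auto
    also have "\<dots> = (\<integral>x. (f x)\<^sup>2 \<partial>M) / K" by simp
    also have "\<dots> \<le> max C 0 / K"
    proof -
      have "ennreal (\<integral>x. (f x)\<^sup>2 \<partial>M) \<le> ennreal C"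
        using f(2) nn_integral_eq_integral[OF f2] by simp
      then have "(\<integral>x. (f x)\<^sup>2 \<partial>M) \<le> max C 0"
        by (metis ennreal_le_iff2 max.cobounded2 max.coboundedI1 order.trans)
      then show ?thesis using K by (simp add: divide_right_mono)
    qed
    finally show ?thesis .
  qed
  show "(\<lambda>n. \<integral>x. X n x \<partial>M) \<longlonglongrightarrow> (\<integral>x. Y x \<partial>M)"
  proof (rule LIMSEQ_I)
    fix r :: real assume r: "r > 0"
    \<comment> \<open>Both clipping errors are then at most \<open>r / 4\<close>, and the clipped
      expectations eventually differ by less than \<open>r / 4\<close>; the \<open>+ 1\<close> keeps
      \<open>K\<close> positive.\<close>
    define K where "K = 4 * (max C 0 + 1) / r"
    have K: "K > 0" using r by (auto simp: K_def)
    have "max C 0 * r \<le> (max C 0 + 1) * r" using r by simp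
    then have rK: "max C 0 / K \<le> r / 4" using r unfolding K_def by (auto simp: field_simps)
    have "(\<lambda>n. \<integral>x. cl K (X n x) \<partial>M) \<longlonglongrightarrow> (\<integral>x. cl K (Y x) \<partial>M)"
    proof (rule integral_dominated_convergence[where w = "\<lambda>_. K"])
      show "AE x in M. (\<lambda>n. cl K (X n x)) \<longlonglongrightarrow> cl K (Y x)"
        using lim by eventually_elim (auto simp: cl_def intro!: tendsto_intros)
      show "AE x in M. norm (cl K (X n x)) \<le> K" for n using K by (auto simp: cl_def abs_if min_def max_def)
    qed auto
    then obtain n0 where n0: "\<And>n. n \<ge> n0 \<Longrightarrow> \<bar>(\<integral>x. cl K (X n x) \<partial>M) - (\<integral>x. cl K (Y x) \<partial>M)\<bar> < r / 4"
      using r by (metis LIMSEQ_D real_norm_def zero_less_divide_iff zero_less_numeral)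
    show "\<exists>n0. \<forall>n\<ge>n0. norm ((\<integral>x. X n x \<partial>M) - (\<integral>x. Y x \<partial>M)) < r"
    proof (intro exI allI impI)
      fix n assume "n \<ge> n0"
      then show "norm ((\<integral>x. X n x \<partial>M) - (\<integral>x. Y x \<partial>M)) < r"
        using n0[of n] err[OF L2X[of n] bd[of n] K] err[OF L2Y YC K] rK r unfolding real_norm_def by argo
    qed
  qed
qed

section \<open>Doob's maximal inequality for discrete martingales\<close>

primrec rmax :: "(nat \<Rightarrow> real) \<Rightarrow> nat \<Rightarrow> real" where
  "rmax s 0 = s 0"
| "rmax s (Suc n) = max (rmax s n) (s (Suc n))"

lemma rmax_ge: "i \<le> n \<Longrightarrow> s i \<le> rmax s n"
  by (induction n) (auto simp: le_Suc_eq intro: max.coboundedI1)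

lemma rmax_nonneg: "(\<And>i. 0 \<le> s i) \<Longrightarrow> 0 \<le> rmax s n"
  by (induction n) (auto intro: max.coboundedI1)

lemma rmax_le_sum: "(\<And>i. 0 \<le> s i) \<Longrightarrow> rmax s n \<le> (\<Sum>i\<le>n. s i)"
  by (induction n) (auto intro: order_trans add_increasing add_increasing2 sum_nonneg)

text \<open>Doob's inequality before taking expectations: the sum is a discrete stochastic integral
  of the running maximum, with nonnegative mean if \<open>s\<close> is a submartingale. Writing
  \<open>R\<close> for the final maximum and \<open>x\<close> for \<open>s m\<close>, induction
  bounds the sum by \<open>R x - R^2 / 2\<close>, and \<open>(2 x - R)^2 >= 0\<close> yields the
  factor 4.\<close>

lemma doob_pathwise:
  assumes "\<And>i. 0 \<le> s i"
  shows "(rmax s m)\<^sup>2 \<le> 4 * (s m)\<^sup>2 - 4 * (\<Sum>i<m. rmax s i * (s (Suc i) - s i))"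
proof -
  have "(\<Sum>i<m. rmax s i * (s (Suc i) - s i)) \<le> rmax s m * s m - (rmax s m)\<^sup>2 / 2"
  proof (induction m)
    case 0 then show ?case by (simp add: power2_eq_square)
  next
    case (Suc m)
    have "0 \<le> (s (Suc m) - rmax s m)\<^sup>2" by simp
    then show ?case using Suc by (auto simp: max_def power2_eq_square algebra_simps)
  qed
  moreover have "0 \<le> (2 * s m - rmax s m)\<^sup>2" by simp
  ultimately show ?thesis by (simp add: power2_eq_square algebra_simps)
qed

text \<open>This is the expectation of \<open>doob_pathwise\<close> along the path of norms; what
  remains is that the subtracted sum has nonnegative mean.\<close>

lemma (in prob_space) doob_discrete:
  fixes N :: "nat \<Rightarrow> 'a \<Rightarrow> 'v::euclidean_space"
  assumes sub: "\<And>i. i \<le> m \<Longrightarrow> subalgebra M (G i)"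
    and mono: "\<And>i j. i \<le> j \<Longrightarrow> j \<le> m \<Longrightarrow> sets (G i) \<subseteq> sets (G j)"
    and meas: "\<And>i. i \<le> m \<Longrightarrow> N i \<in> borel_measurable (G i)"
    and L2N: "\<And>i. i \<le> m \<Longrightarrow> L2 M (N i)"
    and mart: "\<And>i A. i < m \<Longrightarrow> A \<in> sets (G i) \<Longrightarrow> (\<integral>w. indicator A w *\<^sub>R (N (Suc i) w - N i w) \<partial>M) = 0"
  shows "nn_sup_sq M {..m} N \<le> 4 * nn_sq M (N m)"
proof -
  let ?s = "\<lambda>w i. norm (N i w)"
  have meas': "N k \<in> borel_measurable (G i)" if "k \<le> i" "i \<le> m" for k i
    using measurable_subalgebra[of "G i" "G k"] meas[of k] mono[of k i] sub[of k] sub[of i] that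
    by (auto simp: subalgebra_def)
  have rm: "(\<lambda>w. rmax (?s w) i) \<in> borel_measurable (G j)" if "i \<le> j" "j \<le> m" for i j
    using that
  proof (induction i)
    case 0 then show ?case using meas'[of 0 j] by (auto intro: borel_measurable_norm)
  next
    case (Suc i) then show ?case using meas'[of "Suc i" j] by (auto intro!: borel_measurable_max borel_measurable_norm)
  qed
  have rL2: "L2 M (\<lambda>w. rmax (?s w) i)" if "i \<le> m" for i
  proof (rule L2_norm_le[of _ "\<lambda>w. \<Sum>k\<le>i. norm (N k w)"])
    show "L2 M (\<lambda>w. \<Sum>k\<le>i. norm (N k w))" using that by (intro L2_sum L2_norm L2N) auto
    show "(\<lambda>w. rmax (?s w) i) \<in> borel_measurable M"
      using measurable_subalgebra[OF sub rm] that by auto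
    show "AE w in M. norm (rmax (?s w) i) \<le> norm (\<Sum>k\<le>i. norm (N k w))"
    proof (rule AE_I2)
      fix w
      have "0 \<le> rmax (?s w) i" by (rule rmax_nonneg) simp
      moreover have "rmax (?s w) i \<le> (\<Sum>k\<le>i. norm (N k w))" by (rule rmax_le_sum) simp
      ultimately show "norm (rmax (?s w) i) \<le> norm (\<Sum>k\<le>i. norm (N k w))" by simp
    qed
  qed
  have ge0: "(\<integral>w. rmax (?s w) i * (?s w (Suc i) - ?s w i) \<partial>M) \<ge> 0"
    and int0: "integrable M (\<lambda>w. rmax (?s w) i * (?s w (Suc i) - ?s w i))" if i: "i < m" for i
  proof -
    \<comment> \<open>\<open>sgn (N i w)\<close> is a subgradient of the norm at
      \<open>N i w\<close>, so the increment of the norm dominates its inner product with the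
      increment of \<open>N\<close>. That product, weighted by the running maximum, has mean
      zero.\<close>
    let ?Y = "\<lambda>w. rmax (?s w) i *\<^sub>R sgn (N i w)"
    have Ym: "?Y \<in> borel_measurable (G i)" using i meas[of i] rm[of i i] 
      by (intro borel_measurable_scaleR) (auto simp: sgn_div_norm)
    have rn: "0 \<le> rmax (?s w) i" for w by (rule rmax_nonneg) simp
    have YL2: "L2 M ?Y"
      by (rule L2_norm_le[OF rL2[of i]])
        (use i Ym measurable_subalgebra[OF sub[of i]] rn in \<open>auto simp: norm_sgn intro!: AE_I2\<close>)
    have DL2: "L2 M (\<lambda>w. N (Suc i) w - N i w)" using i by (intro L2_diff L2N) auto
    have *: "(\<integral>w. ?Y w \<bullet> (N (Suc i) w - N i w) \<partial>M) = 0"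
      using i by (intro orth_subalgebra_inner[OF sub[of i] DL2 mart Ym YL2]) auto
    show ii: "integrable M (\<lambda>w. rmax (?s w) i * (?s w (Suc i) - ?s w i))"
      using L2_inner_integrable[OF rL2[of i] L2_diff[OF L2_norm[OF L2N[of "Suc i"]] L2_norm[OF L2N[of i]]]] i
      by (simp add: mult.commute)
    have "0 = (\<integral>w. ?Y w \<bullet> (N (Suc i) w - N i w) \<partial>M)" using * by simp
    also have "\<dots> \<le> (\<integral>w. rmax (?s w) i * (?s w (Suc i) - ?s w i) \<partial>M)"
    proof (rule integral_mono[OF L2_inner_integrable[OF YL2 DL2] ii])
      fix w
      have "sgn (N i w) \<bullet> (N (Suc i) w - N i w) \<le> ?s w (Suc i) - ?s w i"
      proof -
        have a: "sgn (N i w) \<bullet> N i w = norm (N i w)"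
          by (cases "N i w = 0") (auto simp: sgn_div_norm dot_square_norm power2_eq_square)
        have "sgn (N i w) \<bullet> N (Suc i) w \<le> norm (sgn (N i w)) * norm (N (Suc i) w)"
          by (rule norm_cauchy_schwarz)
        also have "\<dots> \<le> norm (N (Suc i) w)" by (simp add: norm_sgn)
        finally show ?thesis using a by (simp add: inner_diff_right)
      qed
      from mult_left_mono[OF this rn[of w]]
      show "?Y w \<bullet> (N (Suc i) w - N i w) \<le> rmax (?s w) i * (?s w (Suc i) - ?s w i)" by simp
    qed
    finally show "(\<integral>w. rmax (?s w) i * (?s w (Suc i) - ?s w i) \<partial>M) \<ge> 0" .
  qed
  have r2: "integrable M (\<lambda>w. (rmax (?s w) m)\<^sup>2)" using rL2[of m] by (simp add: L2_def)
  have n2: "integrable M (\<lambda>w. (norm (N m w))\<^sup>2)" using L2N[of m] by (simp add: L2_def)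
  have "(\<integral>w. (rmax (?s w) m)\<^sup>2 \<partial>M) \<le>
      (\<integral>w. 4 * (norm (N m w))\<^sup>2 - 4 * (\<Sum>i<m. rmax (?s w) i * (?s w (Suc i) - ?s w i)) \<partial>M)"
    using r2 n2 int0
    by (intro integral_mono doob_pathwise Bochner_Integration.integrable_diff integrable_mult_right
        Bochner_Integration.integrable_sum) auto
  also have "\<dots> = 4 * (\<integral>w. (norm (N m w))\<^sup>2 \<partial>M) - 4 * (\<Sum>i<m. \<integral>w. rmax (?s w) i * (?s w (Suc i) - ?s w i) \<partial>M)"
    using n2 int0 by (subst Bochner_Integration.integral_diff) (auto simp: Bochner_Integration.integral_sum)
  also have "\<dots> \<le> 4 * (\<integral>w. (norm (N m w))\<^sup>2 \<partial>M)"
    using sum_nonneg[of "{..<m}", OF ge0] by simp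
  finally have le: "(\<integral>w. (rmax (?s w) m)\<^sup>2 \<partial>M) \<le> 4 * (\<integral>w. (norm (N m w))\<^sup>2 \<partial>M)" .
  have "nn_sup_sq M {..m} N \<le> (\<integral>\<^sup>+w. ennreal ((rmax (?s w) m)\<^sup>2) \<partial>M)"
    by (intro nn_integral_mono SUP_least ennreal_leI power_mono rmax_ge) auto
  also have "\<dots> = ennreal (\<integral>w. (rmax (?s w) m)\<^sup>2 \<partial>M)" using r2 by (intro nn_integral_eq_integral) auto
  also have "\<dots> \<le> ennreal (4 * (\<integral>w. (norm (N m w))\<^sup>2 \<partial>M))" using le by (rule ennreal_leI)
  also have "\<dots> = 4 * ennreal (\<integral>w. (norm (N m w))\<^sup>2 \<partial>M)" by (simp add: ennreal_mult)
  also have "\<dots> = 4 * nn_sq M (N m)"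
    using L2_nn_integral[OF L2N[of m]] by simp
  finally show ?thesis .
qed

section \<open>Filtrations and square-integrable martingales\<close>

lemma grid_approx:
  fixes t T :: real
  assumes "0 < T" "0 \<le> t" "t \<le> T"
  obtains i where "\<And>k. i k \<le> (2::nat) ^ k" "(\<lambda>k. T * real (i k) / 2 ^ k) \<longlonglongrightarrow> t"
proof
  define i where "i = (\<lambda>k::nat. nat \<lfloor>t / T * 2 ^ k\<rfloor>)"
  have tT: "0 \<le> t / T" "t / T \<le> 1" using assms by auto
  have "\<lfloor>t / T * 2 ^ k\<rfloor> \<le> \<lfloor>1 * 2 ^ k :: real\<rfloor>" for k
    using tT by (intro floor_mono mult_right_mono) auto
  then show "i k \<le> 2 ^ k" for k by (simp add: i_def nat_le_iff)
  have *: "\<bar>T * real (i k) / 2 ^ k - t\<bar> \<le> T * (1 / 2) ^ k" for k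
  proof -
    have "0 \<le> t / T * 2 ^ k" using tT by (intro mult_nonneg_nonneg) auto
    then have r: "real (i k) = of_int \<lfloor>t / T * 2 ^ k\<rfloor>" by (simp add: i_def del: times_divide_eq_left)
    have "\<bar>real (i k) - t / T * 2 ^ k\<bar> \<le> 1" unfolding r by linarith
    then have "\<bar>real (i k) - t / T * 2 ^ k\<bar> * (T / 2 ^ k) \<le> 1 * (T / 2 ^ k)"
      using assms by (intro mult_right_mono) auto
    also have "\<bar>real (i k) - t / T * 2 ^ k\<bar> * (T / 2 ^ k) = \<bar>(real (i k) - t / T * 2 ^ k) * (T / 2 ^ k)\<bar>"
      using assms by (simp add: abs_mult)
    also have "(real (i k) - t / T * 2 ^ k) * (T / 2 ^ k) = T * real (i k) / 2 ^ k - t"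
      using assms by (simp add: field_simps)
    finally show ?thesis by (simp add: power_one_over field_simps)
  qed
  have "(\<lambda>k. T * real (i k) / 2 ^ k - t) \<longlonglongrightarrow> 0"
  proof (rule Lim_null_comparison)
    show "\<forall>\<^sub>F k in sequentially. norm (T * real (i k) / 2 ^ k - t) \<le> T * (1 / 2) ^ k"
      using * by simp
    have "(\<lambda>k. T * (1 / 2) ^ k) \<longlonglongrightarrow> T * 0" by (intro tendsto_intros LIMSEQ_power_zero) auto
    then show "(\<lambda>k. T * (1 / 2) ^ k) \<longlonglongrightarrow> 0" by simp
  qed
  then show "(\<lambda>k. T * real (i k) / 2 ^ k) \<longlonglongrightarrow> t" by (simp add: LIM_zero_iff)
qed

lemma SUP_continuous_grid:
  fixes g :: "real \<Rightarrow> real"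
  assumes T: "0 < T" and g: "continuous_on {0..T} g"
  shows "(SUP t\<in>{0..T}. ennreal (g t)) = (SUP k. SUP i\<in>{..(2::nat) ^ k}. ennreal (g (T * real i / 2 ^ k)))"
proof (rule antisym)
  let ?R = "SUP k. SUP i\<in>{..(2::nat) ^ k}. ennreal (g (T * real i / 2 ^ k))"
  show "(SUP t\<in>{0..T}. ennreal (g t)) \<le> ?R"
  proof (rule SUP_least)
    fix t assume t: "t \<in> {0..T}"
    then obtain i where i: "\<And>k. i k \<le> (2::nat) ^ k" "(\<lambda>k. T * real (i k) / 2 ^ k) \<longlonglongrightarrow> t"
      using grid_approx[OF T] by auto
    have mem: "T * real (i k) / 2 ^ k \<in> {0..T}" for k
    proof -
      have "real (i k) \<le> 2 ^ k" using i(1)[of k] by (metis of_nat_le_iff of_nat_numeral of_nat_power)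
      then show ?thesis using T by (auto simp: field_simps)
    qed
    have "(\<lambda>k. ennreal (g (T * real (i k) / 2 ^ k))) \<longlonglongrightarrow> ennreal (g t)"
      by (intro tendsto_ennrealI continuous_on_tendsto_compose[OF g i(2) t]) (use mem in \<open>auto intro!: always_eventually\<close>)
    then show "ennreal (g t) \<le> ?R"
      by (rule LIMSEQ_le_const2) (auto intro!: exI[of _ 0] SUP_upper2 i)
  qed
  show "?R \<le> (SUP t\<in>{0..T}. ennreal (g t))"
  proof (intro SUP_least)
    fix k and i :: nat assume "i \<in> {..2 ^ k}"
    then have "real i \<le> 2 ^ k" by (metis atMost_iff of_nat_le_iff of_nat_numeral of_nat_power)
    then have "T * real i / 2 ^ k \<in> {0..T}" using T by (auto simp: field_simps)
    then show "ennreal (g (T * real i / 2 ^ k)) \<le> (SUP t\<in>{0..T}. ennreal (g t))" by (intro SUP_upper)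
  qed
qed

lemma grid_mem:
  assumes "0 < (T::real)" "i \<le> (2::nat) ^ k" shows "T * real i / 2 ^ k \<in> {0..T}"
proof -
  have "real i \<le> 2 ^ k" using assms(2) by (metis of_nat_le_iff of_nat_numeral of_nat_power)
  then show ?thesis using assms by (auto simp: field_simps)
qed

text \<open>The supremum runs over uncountably many times. Path continuity reduces it to countably
  many dyadic ones outside a null event, which completeness allows to be ignored.\<close>

lemma measurable_SUP_continuous:
  fixes X :: "('a, 'b::real_normed_vector) process"
  assumes cm: "complete_measure M" and T: "0 < T"
    and X: "\<And>t. t \<in> {0..T} \<Longrightarrow> X t \<in> borel_measurable M"
    and c: "AE w in M. continuous_on {0..T} (\<lambda>t. X t w)"
  shows "(\<lambda>w. SUP t\<in>{0..T}. ennreal ((norm (X t w))\<^sup>2)) \<in> borel_measurable M"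
proof (rule measurable_AE_cong[OF cm subalgebra_refl])
  show "(\<lambda>w. SUP k. SUP i\<in>{..(2::nat) ^ k}. ennreal ((norm (X (T * real i / 2 ^ k) w))\<^sup>2)) \<in> borel_measurable M"
    using X grid_mem[OF T] by (intro borel_measurable_SUP) (auto intro!: measurable_compose[OF _ measurable_ennreal] borel_measurable_power measurable_compose[OF _ borel_measurable_norm])
  show "AE w in M. (SUP k. SUP i\<in>{..(2::nat) ^ k}. ennreal ((norm (X (T * real i / 2 ^ k) w))\<^sup>2)) =
     (SUP t\<in>{0..T}. ennreal ((norm (X t w))\<^sup>2))"
    using c by eventually_elim (rule SUP_continuous_grid[OF T, symmetric], intro continuous_intros)
qed auto

locale complete_filtration = prob_space M for M :: "'a measure" +
  fixes G :: "real \<Rightarrow> 'a measure" and T :: real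
  assumes complete: "complete_measure M" and T_pos: "0 < T"
    and subalg: "t \<in> {0..T} \<Longrightarrow> subalgebra M (G t)"
    and null: "t \<in> {0..T} \<Longrightarrow> null_sets M \<subseteq> sets (G t)"
    and G_mono: "0 \<le> s \<Longrightarrow> s \<le> t \<Longrightarrow> t \<le> T \<Longrightarrow> sets (G s) \<subseteq> sets (G t)"
begin

lemma space_G: "t \<in> {0..T} \<Longrightarrow> space (G t) = space M"
  using subalg by (auto simp: subalgebra_def)

lemma subalgebra_G: "0 \<le> s \<Longrightarrow> s \<le> t \<Longrightarrow> t \<le> T \<Longrightarrow> subalgebra (G t) (G s)"
  using G_mono[of s t] space_G[of s] space_G[of t] by (auto simp: subalgebra_def)

lemma measurable_G_mono:
  "f \<in> borel_measurable (G s) \<Longrightarrow> 0 \<le> s \<Longrightarrow> s \<le> t \<Longrightarrow> t \<le> T \<Longrightarrow> f \<in> borel_measurable (G t)"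
  using measurable_subalgebra[OF subalgebra_G] .

lemma measurable_GM: "f \<in> borel_measurable (G s) \<Longrightarrow> s \<in> {0..T} \<Longrightarrow> f \<in> borel_measurable M"
  using measurable_subalgebra[OF subalg] .

text \<open>The martingale property is phrased through integrals over the events of
  \<open>G s\<close>, the form that \<open>orth_subalgebra\<close> takes as input and that passes
  easily to limits.\<close>

definition L2_martingale :: "(real \<Rightarrow> 'a \<Rightarrow> 'v::euclidean_space) \<Rightarrow> bool" where
  "L2_martingale X \<longleftrightarrow> (\<forall>t\<in>{0..T}. X t \<in> borel_measurable (G t) \<and> L2 M (X t)) \<and>
    (\<forall>s t A. 0 \<le> s \<and> s \<le> t \<and> t \<le> T \<and> A \<in> sets (G s) \<longrightarrow> (\<integral>w. indicator A w *\<^sub>R (X t w - X s w) \<partial>M) = 0)"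

lemma L2_martingaleD:
  assumes "L2_martingale X" "t \<in> {0..T}"
  shows "X t \<in> borel_measurable (G t)" "L2 M (X t)"
  using assms by (auto simp: L2_martingale_def)

lemma L2_martingale_orth:
  assumes X: "L2_martingale X" and "0 \<le> s" "s \<le> t" "t \<le> T"
    and Y: "Y \<in> borel_measurable (G s)" "L2 M Y"
  shows "(\<integral>w. Y w \<bullet> (X t w - X s w) \<partial>M) = 0"
  using assms by (intro orth_subalgebra_inner[OF subalg[of s]] L2_diff) (auto simp: L2_martingale_def)

lemma L2_martingale_diff:
  assumes X: "L2_martingale X" and Y: "L2_martingale Y"
  shows "L2_martingale (\<lambda>t w. X t w - Y t w)"
  unfolding L2_martingale_def
proof (intro conjI ballI allI impI)
  fix t assume "t \<in> {0..T}"
  then show "(\<lambda>w. X t w - Y t w) \<in> borel_measurable (G t)" "L2 M (\<lambda>w. X t w - Y t w)"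
    using L2_martingaleD[OF X] L2_martingaleD[OF Y] by (blast intro: L2_diff borel_measurable_diff)+
next
  fix s t A assume a: "0 \<le> s \<and> s \<le> t \<and> t \<le> T \<and> A \<in> sets (G s)"
  then have AM: "A \<in> sets M" using subalg[of s] by (auto simp: subalgebra_def)
  have i: "integrable M (\<lambda>w. indicator A w *\<^sub>R (X t w - X s w))" if "L2_martingale X" for X
    using that a AM by (intro integrable_mult_indicator Bochner_Integration.integrable_diff L2_integrable)
      (auto simp: L2_martingale_def)
  have "(\<integral>w. indicator A w *\<^sub>R (X t w - Y t w - (X s w - Y s w)) \<partial>M) =
    (\<integral>w. indicator A w *\<^sub>R (X t w - X s w) - indicator A w *\<^sub>R (Y t w - Y s w) \<partial>M)"
    by (intro Bochner_Integration.integral_cong) (auto simp: algebra_simps)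
  also have "\<dots> = 0" using X Y a by (subst Bochner_Integration.integral_diff[OF i[OF X] i[OF Y]]) (auto simp: L2_martingale_def)
  finally show "(\<integral>w. indicator A w *\<^sub>R (X t w - Y t w - (X s w - Y s w)) \<partial>M) = 0" .
qed

text \<open>The discrete inequality on dyadic grids of \<open>{0..T}\<close>. The grids are nested
  and paths are continuous, so the grid maxima increase to the supremum and monotone convergence
  applies.\<close>

lemma doob:
  fixes X :: "('a, 'v::euclidean_space) process"
  assumes X: "L2_martingale X" and c: "AE w in M. continuous_on {0..T} (\<lambda>t. X t w)"
  shows "nn_sup_sq M {0..T} X \<le> 4 * nn_sq M (X T)"
proof -
  let ?S = "\<lambda>k w. SUP i\<in>{..(2::nat) ^ k}. ennreal ((norm (X (T * real i / 2 ^ k) w))\<^sup>2)"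
  have Xm: "X t \<in> borel_measurable M" if "t \<in> {0..T}" for t
    using L2_martingaleD(2)[OF X that] by (rule L2_measurable)
  have Sm: "?S k \<in> borel_measurable M" for k
    using Xm grid_mem[OF T_pos] by (intro borel_measurable_SUP) (auto intro!: measurable_compose[OF _ measurable_ennreal] borel_measurable_power measurable_compose[OF _ borel_measurable_norm])
  have inc: "incseq ?S"
  proof (rule incseq_SucI, rule le_funI, rule SUP_least)
    fix k w and i :: nat assume "i \<in> {..2 ^ k}"
    then show "ennreal ((norm (X (T * real i / 2 ^ k) w))\<^sup>2) \<le> ?S (Suc k) w"
      by (intro SUP_upper2[of "2 * i"]) (auto simp: field_simps)
  qed
  have "nn_sup_sq M {0..T} X = (\<integral>\<^sup>+w. (SUP k. ?S k w) \<partial>M)"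
  proof (rule nn_integral_cong_AE)
    show "AE w in M. (SUP t\<in>{0..T}. ennreal ((norm (X t w))\<^sup>2)) = (SUP k. ?S k w)"
      using c by eventually_elim (rule SUP_continuous_grid[OF T_pos], intro continuous_intros)
  qed
  also have "\<dots> = (SUP k. \<integral>\<^sup>+w. ?S k w \<partial>M)"
    by (rule nn_integral_monotone_convergence_SUP[OF inc Sm])
  also have "\<dots> \<le> 4 * nn_sq M (X T)"
  proof (rule SUP_least)
    fix k :: nat
    let ?p = "\<lambda>i. T * real i / 2 ^ k"
    have pm: "?p i \<le> ?p j" if "i \<le> j" for i j using that T_pos by (auto intro!: divide_right_mono)
    have "(\<integral>\<^sup>+w. ?S k w \<partial>M) \<le> 4 * nn_sq M (\<lambda>w. X (?p (2 ^ k)) w)"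
    proof (rule doob_discrete[where G = "\<lambda>i. G (?p i)"])
      fix i j :: nat
      show "subalgebra M (G (?p i))" if "i \<le> 2 ^ k" using subalg grid_mem[OF T_pos that] by auto
      show "sets (G (?p i)) \<subseteq> sets (G (?p j))" if "i \<le> j" "j \<le> 2 ^ k"
        using G_mono[of "?p i" "?p j"] pm[OF that(1)] grid_mem[OF T_pos that(2)] T_pos by auto
      show "X (?p i) \<in> borel_measurable (G (?p i))" "L2 M (X (?p i))" if "i \<le> 2 ^ k"
        using L2_martingaleD[OF X grid_mem[OF T_pos that]] by auto
      show "(\<integral>w. indicator A w *\<^sub>R (X (?p (Suc i)) w - X (?p i) w) \<partial>M) = 0" if "i < 2 ^ k" "A \<in> sets (G (?p i))" for A
      proof -
        have "0 \<le> ?p i" using T_pos by auto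
        moreover have "?p i \<le> ?p (Suc i)" by (rule pm) simp
        moreover have "?p (Suc i) \<le> T" using grid_mem[OF T_pos, of "Suc i" k] that by auto
        ultimately show ?thesis using X that(2) unfolding L2_martingale_def by blast
      qed
    qed
    then show "(\<integral>\<^sup>+w. ?S k w \<partial>M) \<le> 4 * nn_sq M (X T)" by simp
  qed
  finally show ?thesis .
qed

text \<open>Completeness for continuous adapted processes, at a geometric rate. The weights
  \<open>4 ^ k\<close> in \<open>W\<close> lie between 1 and the rate \<open>16 ^ k\<close>:
  \<open>W\<close> stays integrable, and finiteness of \<open>W w\<close> forces the increments
  below \<open>sqrt (W w) / 2 ^ k\<close> uniformly in time. The same \<open>W\<close> dominates the
  mean square errors. Both the Ito integral and the solution are obtained from this lemma.\<close>

lemma uniform_limit_process: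
  fixes Y :: "nat \<Rightarrow> real \<Rightarrow> 'a \<Rightarrow> 'v::euclidean_space"
  assumes meas: "\<And>k t. t \<in> {0..T} \<Longrightarrow> Y k t \<in> borel_measurable (G t)"
    and cont: "\<And>k. AE w in M. continuous_on {0..T} (\<lambda>t. Y k t w)"
    and bound: "\<And>k. (nn_sup_sq M {0..T} (\<lambda>t w. Y (Suc k) t w - Y k t w)) \<le> ennreal (C * (1/16) ^ k)"
    and C: "0 \<le> C"
  obtains Yi where "\<And>t. t \<in> {0..T} \<Longrightarrow> Yi t \<in> borel_measurable (G t)"
    "\<And>w. continuous_on {0..T} (\<lambda>t. Yi t w)"
    "(\<lambda>k. \<integral>\<^sup>+w. (SUP t\<in>{0..T}. ennreal ((norm (Yi t w - Y k t w))\<^sup>2)) \<partial>M) \<longlonglongrightarrow> 0"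
proof -
  define D where "D k w = (SUP t\<in>{0..T}. ennreal ((norm (Y (Suc k) t w - Y k t w))\<^sup>2))" for k w
  have Dm [measurable]: "D k \<in> borel_measurable M" for k
    unfolding D_def
  proof (rule measurable_SUP_continuous[OF complete T_pos])
    show "(\<lambda>w. Y (Suc k) t w - Y k t w) \<in> borel_measurable M" if "t \<in> {0..T}" for t
      using measurable_GM[OF meas[OF that] that] by (intro borel_measurable_diff)
    show "AE w in M. continuous_on {0..T} (\<lambda>t. Y (Suc k) t w - Y k t w)"
      using cont[of k] cont[of "Suc k"] by eventually_elim (intro continuous_intros)
  qed
  define W where "W w = (\<Sum>k. ennreal (4 ^ k) * D k w)" for w
  have Wm [measurable]: "W \<in> borel_measurable M" unfolding W_def by measurable
  have "(\<integral>\<^sup>+w. W w \<partial>M) = (\<Sum>k. ennreal (4 ^ k) * (\<integral>\<^sup>+w. D k w \<partial>M))"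
    unfolding W_def by (subst nn_integral_suminf) (auto simp: nn_integral_cmult)
  also have "\<dots> \<le> (\<Sum>k. ennreal (C * (1/4) ^ k))"
  proof (rule suminf_le)
    fix k
    have "ennreal (4 ^ k) * (\<integral>\<^sup>+w. D k w \<partial>M) \<le> ennreal (4 ^ k) * ennreal (C * (1/16) ^ k)"
      unfolding D_def by (intro mult_left_mono bound) auto
    also have "\<dots> = ennreal (C * (4 ^ k * (1/16) ^ k))"
      using C by (subst ennreal_mult[symmetric]) (auto simp: algebra_simps)
    also have "(4::real) ^ k * (1/16) ^ k = (1/4) ^ k" by (simp flip: power_mult_distrib)
    finally show "ennreal (4 ^ k) * (\<integral>\<^sup>+w. D k w \<partial>M) \<le> ennreal (C * (1/4) ^ k)" .
  qed auto
  also have "\<dots> = ennreal (\<Sum>k. C * (1/4) ^ k)"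
    using C by (intro suminf_ennreal2 summable_mult summable_geometric) auto
  finally have EW: "(\<integral>\<^sup>+w. W w \<partial>M) < \<infinity>" by (simp add: less_top[symmetric] top_unique)
       (metis ennreal_less_top less_top order_le_less_trans)
  have W_AE: "AE w in M. W w \<noteq> \<infinity>" using EW by (intro nn_integral_noteq_infinite) auto
  define Gd where "Gd w \<longleftrightarrow> W w \<noteq> \<infinity> \<and> (\<forall>k. continuous_on {0..T} (\<lambda>t. Y k t w))" for w
  have Gd_AE: "AE w in M. Gd w"
    unfolding Gd_def using W_AE cont by (simp add: AE_all_countable)
  define wt where "wt w = sqrt (enn2real (W w))" for w
  have wt0: "wt w \<ge> 0" for w by (simp add: wt_def)
  have four: "(2 ^ k)\<^sup>2 = (4::real) ^ k" for k :: nat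
    using power_mult[of "2::real" k 2] power_mult[of "2::real" 2 k] by (simp add: mult.commute)
  have step: "norm (Y (Suc k) t w - Y k t w) \<le> wt w / 2 ^ k" if g: "Gd w" and t: "t \<in> {0..T}" for k t w
  proof -
    have "ennreal (4 ^ k) * D k w \<le> W w"
      using sum_le_suminf[of "\<lambda>k. ennreal (4 ^ k) * D k w" "{k}"] by (simp add: W_def)
    then have "ennreal (4 ^ k) * ennreal ((norm (Y (Suc k) t w - Y k t w))\<^sup>2) \<le> W w"
      using t by (elim order_trans[rotated]) (auto intro!: mult_left_mono SUP_upper simp: D_def)
    moreover have "W w = ennreal ((wt w)\<^sup>2)"
      using g by (simp add: wt_def Gd_def ennreal_enn2real less_top)
    ultimately have "4 ^ k * (norm (Y (Suc k) t w - Y k t w))\<^sup>2 \<le> (wt w)\<^sup>2"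
      by (simp add: ennreal_mult[symmetric])
    then have "(2 ^ k * norm (Y (Suc k) t w - Y k t w))\<^sup>2 \<le> (wt w)\<^sup>2"
      by (simp only: power_mult_distrib four)
    then have "2 ^ k * norm (Y (Suc k) t w - Y k t w) \<le> wt w"
      using wt0 by (rule power2_le_imp_le)
    then show ?thesis by (simp add: field_simps)
  qed
  \<comment> \<open>The geometric tail is kept as a difference of two terms so that the induction on
    \<open>m\<close> closes.\<close>
  have diff: "norm (Y (k + m) t w - Y k t w) \<le> 2 * wt w / 2 ^ k - 2 * wt w / 2 ^ (k + m)"
    if g: "Gd w" and t: "t \<in> {0..T}" for k m t w
  proof (induction m)
    case (Suc m)
    have "norm (Y (k + Suc m) t w - Y k t w) \<le> norm (Y (Suc (k + m)) t w - Y (k + m) t w) + norm (Y (k + m) t w - Y k t w)"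
      by (metis add_Suc_right norm_triangle_ineq diff_add_cancel add_diff_eq)
    also have "\<dots> \<le> wt w / 2 ^ (k + m) + (2 * wt w / 2 ^ k - 2 * wt w / 2 ^ (k + m))"
      by (intro add_mono step[OF g t] Suc)
    also have "\<dots> = 2 * wt w / 2 ^ k - 2 * wt w / 2 ^ (k + Suc m)" by (simp add: field_simps)
    finally show ?case .
  qed simp
  have pow0: "(\<lambda>k. c / 2 ^ k :: real) \<longlonglongrightarrow> 0" for c
  proof -
    have "(\<lambda>k. c * (1/2) ^ k :: real) \<longlonglongrightarrow> c * 0" by (intro tendsto_intros LIMSEQ_power_zero) auto
    then show ?thesis by (simp add: power_one_over)
  qed
  have diff': "norm (Y n t w - Y k t w) \<le> 2 * wt w / 2 ^ k" if g: "Gd w" "t \<in> {0..T}" and kn: "k \<le> n" for k n t w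
  proof -
    obtain m where n: "n = k + m" using kn le_Suc_ex by blast
    have "0 \<le> 2 * wt w / 2 ^ (k + m)" using wt0 by simp
    then show ?thesis using diff[OF g, of k m] unfolding n by linarith
  qed
  have cauchy: "Cauchy (\<lambda>k. Y k t w)" if g: "Gd w" and t: "t \<in> {0..T}" for t w
  proof (rule metric_CauchyI)
    fix e :: real assume "e > 0"
    then obtain N where N: "2 * (2 * wt w) / 2 ^ N < e"
      using LIMSEQ_D[OF pow0[of "2 * (2 * wt w)"], of e] wt0[of w] by auto
    show "\<exists>N. \<forall>m\<ge>N. \<forall>n\<ge>N. dist (Y m t w) (Y n t w) < e"
    proof (intro exI[of _ N] allI impI)
      fix m n assume "m \<ge> N" "n \<ge> N"
      then have "dist (Y m t w) (Y N t w) \<le> 2 * wt w / 2 ^ N" "dist (Y n t w) (Y N t w) \<le> 2 * wt w / 2 ^ N"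
        using diff'[OF g t] by (auto simp: dist_norm)
      then have "dist (Y m t w) (Y n t w) \<le> 2 * wt w / 2 ^ N + 2 * wt w / 2 ^ N"
        by (intro order_trans[OF dist_triangle2 add_mono])
      also have "\<dots> = 2 * (2 * wt w) / 2 ^ N" by simp
      finally show "dist (Y m t w) (Y n t w) < e" using N by simp
    qed
  qed
  \<comment> \<open>Outside the good event the path is set to zero, so that every path is
    continuous; the exceptional event is null, so adaptedness survives.\<close>
  define Yi where "Yi t w = (if Gd w then lim (\<lambda>k. Y k t w) else 0)" for t w
  have lim: "(\<lambda>k. Y k t w) \<longlonglongrightarrow> Yi t w" if g: "Gd w" and t: "t \<in> {0..T}" for t w
    using cauchy[OF g t] g by (simp add: Yi_def Cauchy_convergent_iff convergent_LIMSEQ_iff)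
  have err: "norm (Yi t w - Y k t w) \<le> 2 * wt w / 2 ^ k" if g: "Gd w" and t: "t \<in> {0..T}" for t k w
  proof (rule Lim_norm_ubound[OF trivial_limit_sequentially])
    show "(\<lambda>n. Y n t w - Y k t w) \<longlonglongrightarrow> Yi t w - Y k t w" by (intro tendsto_intros lim g t)
    show "\<forall>\<^sub>F n in sequentially. norm (Y n t w - Y k t w) \<le> 2 * wt w / 2 ^ k"
      using eventually_ge_at_top[of k] by eventually_elim (rule diff'[OF g t])
  qed
  show ?thesis
  proof (rule that[of Yi])
    fix t assume t: "t \<in> {0..T}"
    show "Yi t \<in> borel_measurable (G t)"
    proof (rule measurable_AE_LIMSEQ[OF complete subalg[OF t] null[OF t] meas[OF t]])
      show "AE w in M. (\<lambda>n. Y n t w) \<longlonglongrightarrow> Yi t w"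
        using Gd_AE by eventually_elim (rule lim[OF _ t])
    qed
  next
    fix w
    show "continuous_on {0..T} (\<lambda>t. Yi t w)"
    proof (cases "Gd w")
      case True
      have "uniform_limit {0..T} (\<lambda>k t. Y k t w) (\<lambda>t. Yi t w) sequentially"
      proof (rule uniform_limitI)
        fix e :: real assume "e > 0"
        then have "\<forall>\<^sub>F k in sequentially. 2 * wt w / 2 ^ k < e"
          by (rule order_tendstoD(2)[OF pow0])
        then show "\<forall>\<^sub>F k in sequentially. \<forall>t\<in>{0..T}. dist (Y k t w) (Yi t w) < e"
        proof eventually_elim
          case (elim k)
          show ?case
          proof
            fix t assume "t \<in> {0..T}"
            then have "dist (Y k t w) (Yi t w) \<le> 2 * wt w / 2 ^ k"
              using err[OF True, of t k] by (simp add: dist_norm norm_minus_commute)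
            then show "dist (Y k t w) (Yi t w) < e" using elim by simp
          qed
        qed
      qed
      then show ?thesis
        by (rule uniform_limit_theorem[rotated]) (use True in \<open>auto simp: Gd_def\<close>)
    next
      case False then show ?thesis by (simp add: Yi_def)
    qed
  next
    have le: "nn_sup_sq M {0..T} (\<lambda>t w. Yi t w - Y k t w) \<le> ennreal (4 / 4 ^ k) * (\<integral>\<^sup>+w. W w \<partial>M)" for k
    proof -
      have "nn_sup_sq M {0..T} (\<lambda>t w. Yi t w - Y k t w) \<le> (\<integral>\<^sup>+w. ennreal (4 / 4 ^ k) * W w \<partial>M)"
      proof (rule nn_integral_mono_AE)
        show "AE w in M. (SUP t\<in>{0..T}. ennreal ((norm (Yi t w - Y k t w))\<^sup>2)) \<le> ennreal (4 / 4 ^ k) * W w"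
          using Gd_AE
        proof eventually_elim
          case (elim w)
          have W: "W w = ennreal ((wt w)\<^sup>2)"
            using elim by (simp add: wt_def Gd_def ennreal_enn2real less_top)
          show ?case
          proof (rule SUP_least)
            fix t assume t: "t \<in> {0..T}"
            have "(norm (Yi t w - Y k t w))\<^sup>2 \<le> (2 * wt w / 2 ^ k)\<^sup>2"
              using err[OF elim t] by (intro power_mono) auto
            also have "\<dots> = 4 / 4 ^ k * (wt w)\<^sup>2" by (simp only: power_divide power_mult_distrib four) simp
            finally show "ennreal ((norm (Yi t w - Y k t w))\<^sup>2) \<le> ennreal (4 / 4 ^ k) * W w"
              unfolding W by (subst ennreal_mult[symmetric]) (auto intro: ennreal_leI)
          qed
        qed
      qed
      also have "\<dots> = ennreal (4 / 4 ^ k) * (\<integral>\<^sup>+w. W w \<partial>M)" by (simp add: nn_integral_cmult)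
      finally show ?thesis .
    qed
    have "(\<lambda>k. 4 * (1 / 4) ^ k * enn2real (\<integral>\<^sup>+w. W w \<partial>M)) \<longlonglongrightarrow> 4 * 0 * enn2real (\<integral>\<^sup>+w. W w \<partial>M)"
      by (intro tendsto_intros LIMSEQ_power_zero) auto
    then have "(\<lambda>k. ennreal (4 * (1 / 4) ^ k * enn2real (\<integral>\<^sup>+w. W w \<partial>M))) \<longlonglongrightarrow> ennreal 0"
      by (intro tendsto_ennrealI) simp
    moreover have "ennreal (4 / 4 ^ k) * (\<integral>\<^sup>+w. W w \<partial>M) = ennreal (4 * (1 / 4) ^ k * enn2real (\<integral>\<^sup>+w. W w \<partial>M))" for k
    proof -
      have "(\<integral>\<^sup>+w. W w \<partial>M) = ennreal (enn2real (\<integral>\<^sup>+w. W w \<partial>M))" using EW by simp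
      then have "ennreal (4 / 4 ^ k) * (\<integral>\<^sup>+w. W w \<partial>M) = ennreal (4 / 4 ^ k) * ennreal (enn2real (\<integral>\<^sup>+w. W w \<partial>M))" by (rule arg_cong)
      also have "\<dots> = ennreal (4 / 4 ^ k * enn2real (\<integral>\<^sup>+w. W w \<partial>M))" by (rule ennreal_mult[symmetric]) auto
      also have "4 / 4 ^ k * enn2real (\<integral>\<^sup>+w. W w \<partial>M) = 4 * (1 / 4 :: real) ^ k * enn2real (\<integral>\<^sup>+w. W w \<partial>M)"
        by (simp add: power_divide)
      finally show ?thesis .
    qed
    ultimately have "(\<lambda>k. ennreal (4 / 4 ^ k) * (\<integral>\<^sup>+w. W w \<partial>M)) \<longlonglongrightarrow> 0" by simp
    then show "(\<lambda>k. \<integral>\<^sup>+w. (SUP t\<in>{0..T}. ennreal ((norm (Yi t w - Y k t w))\<^sup>2)) \<partial>M) \<longlonglongrightarrow> 0"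
      by (rule tendsto_sandwich[rotated 3, where f = "\<lambda>_. 0"]) (auto simp: le)
  qed
qed

end

section \<open>Step approximation by averages over the preceding grid cell\<close>

definition step_average :: "real \<Rightarrow> nat \<Rightarrow> (real \<Rightarrow> 'b::euclidean_space) \<Rightarrow> nat \<Rightarrow> 'b" where
  "step_average T k f i = (if i = 0 then 0 else
     (k / T) *\<^sub>R (LINT s:{T * real (i - 1) / k<..T * real i / k}|lborel. f s))"

text \<open>Cell \<open>i\<close> carries the average of \<open>f\<close> over cell
  \<open>i - 1\<close>. Its value is thus known at the left end of the cell, and the approximation
  of an adapted process is adapted. Cell 0 has no predecessor and carries 0; the factor
  \<open>k / T\<close> is the reciprocal cell length.\<close>

definition step_approx :: "real \<Rightarrow> nat \<Rightarrow> (real \<Rightarrow> 'b::euclidean_space) \<Rightarrow> real \<Rightarrow> 'b" where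
  "step_approx T k f t =
     (\<Sum>i<k. indicator {T * real i / k<..T * real (Suc i) / k} t *\<^sub>R step_average T k f i)"

lemma set_integrable_bounded:
  fixes f :: "real \<Rightarrow> 'b::euclidean_space"
  assumes "f \<in> borel_measurable borel" "\<And>x. norm (f x) \<le> C"
  shows "set_integrable lborel {a<..b} f"
  unfolding set_integrable_def
proof (rule Bochner_Integration.integrable_bound[of _ "\<lambda>x. indicator {a<..b} x *\<^sub>R C"])
  show "integrable lborel (\<lambda>x. indicator {a<..b} x *\<^sub>R C)"
    by (cases "a \<le> b") (auto intro!: integrable_scaleR_left integrable_real_indicator)
  show "AE x in lborel. norm (indicator {a<..b} x *\<^sub>R f x) \<le> norm (indicator {a<..b} x *\<^sub>R C)"
    using assms(2) by (auto simp: indicator_def intro!: AE_I2 order_trans[OF assms(2)])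
qed (use assms in auto)

lemma norm_step_average_le:
  assumes f: "f \<in> borel_measurable borel" "\<And>x. norm (f x) \<le> C" and T: "0 < T" and k: "0 < k"
  shows "norm (step_average T k f i) \<le> C"
    "ennreal (norm (step_average T k f i)) \<le>
       (if i = 0 then 0 else ennreal (k / T) * (\<integral>\<^sup>+ s\<in>{T * real (i - 1) / k<..T * real i / k}. ennreal (norm (f s)) \<partial>lborel))"
proof -
  let ?A = "{T * real (i - 1) / k<..T * real i / k}"
  have si: "set_integrable lborel ?A f" by (rule set_integrable_bounded[OF f])
  have C: "0 \<le> C" using order_trans[OF norm_ge_zero f(2)[of 0]] .
  have 2: "ennreal (norm (LINT s:?A|lborel. f s)) \<le> (\<integral>\<^sup>+ s\<in>?A. ennreal (norm (f s)) \<partial>lborel)"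
  proof -
    have "ennreal (norm (LINT s:?A|lborel. f s)) \<le> (\<integral>\<^sup>+ s. ennreal (norm (indicator ?A s *\<^sub>R f s)) \<partial>lborel)"
      using si unfolding set_lebesgue_integral_def set_integrable_def by (rule integral_norm_bound_ennreal)
    also have "\<dots> = (\<integral>\<^sup>+ s\<in>?A. ennreal (norm (f s)) \<partial>lborel)"
      by (intro nn_integral_cong) (auto simp: indicator_def)
    finally show ?thesis .
  qed
  show A: "ennreal (norm (step_average T k f i)) \<le>
       (if i = 0 then 0 else ennreal (k / T) * (\<integral>\<^sup>+ s\<in>?A. ennreal (norm (f s)) \<partial>lborel))"
  proof (cases "i = 0")
    case False
    then have "ennreal (norm (step_average T k f i)) = ennreal (k / T) * ennreal (norm (LINT s:?A|lborel. f s))"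
      using T by (simp add: step_average_def ennreal_mult[symmetric] del: of_nat_diff)
    also have "\<dots> \<le> ennreal (k / T) * (\<integral>\<^sup>+ s\<in>?A. ennreal (norm (f s)) \<partial>lborel)"
      using 2 by (intro mult_left_mono) auto
    finally show ?thesis using False by simp
  qed (simp add: step_average_def)
  show "norm (step_average T k f i) \<le> C"
  proof (cases "i = 0")
    case False
    have "(\<integral>\<^sup>+ s\<in>?A. ennreal (norm (f s)) \<partial>lborel) \<le> (\<integral>\<^sup>+ s\<in>?A. ennreal C \<partial>lborel)"
      using f by (intro nn_integral_mono mult_right_mono ennreal_leI) auto
    also have "\<dots> = ennreal C * ennreal (T / k)"
    proof -
      have "T * real i / k - T * real (i - 1) / k = T / k" using False
        by (simp add: of_nat_diff diff_divide_distrib[symmetric] algebra_simps)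
      moreover have "T * real (i - 1) / k \<le> T * real i / k" using T by (auto intro!: divide_right_mono)
      ultimately show ?thesis by (simp add: nn_integral_cmult_indicator)
    qed
    finally have bd: "(\<integral>\<^sup>+ s\<in>?A. ennreal (norm (f s)) \<partial>lborel) \<le> ennreal C * ennreal (T / k)" .
    have "ennreal (norm (step_average T k f i)) \<le> ennreal (k / T) * (\<integral>\<^sup>+ s\<in>?A. ennreal (norm (f s)) \<partial>lborel)"
      using A unfolding if_not_P[OF False] .
    also have "\<dots> \<le> ennreal (k / T) * (ennreal C * ennreal (T / k))"
      by (rule mult_left_mono[OF bd]) simp
    also have "\<dots> = ennreal C" using T k C by (simp add: ennreal_mult[symmetric])
    finally show ?thesis using C by simp
  qed (simp add: step_average_def C)
qed

lemma grid_less_iff: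
  assumes "0 < T" "0 < k"
  shows "T * real i / real k < T * real j / real k \<longleftrightarrow> i < j"
proof -
  have "0 < T / real k" using assms by simp
  from mult_less_cancel_left_pos[OF this, of "real i" "real j"] show ?thesis
    by (simp only: times_divide_eq_left of_nat_less_iff)
qed

lemma step_approx_eq:
  assumes T: "0 < T" and i: "i < k" and t: "T * real i / k < t" "t \<le> T * real (Suc i) / k"
  shows "step_approx T k f t = step_average T k f i"
proof -
  have "indicator {T * real j / k<..T * real (Suc j) / k} t = (if j = i then 1 else 0 :: real)" for j
  proof -
    have "j = i" if "T * real j / k < t" "t \<le> T * real (Suc j) / k"
    proof -
      have k: "k > 0" using i by simp
      have "T * real j / k < T * real (Suc i) / k" "T * real i / k < T * real (Suc j) / k" using that t by linarith+
      then have "j < Suc i" "i < Suc j" unfolding grid_less_iff[OF T k] .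
      then show "j = i" by linarith
    qed
    then have "j \<noteq> i \<Longrightarrow> t \<notin> {T * real j / k<..T * real (Suc j) / k}" by force
    moreover have "t \<in> {T * real i / k<..T * real (Suc i) / k}" using t by simp
    ultimately show ?thesis by (cases "j = i") (simp_all only: indicator_simps if_True if_False refl simp_thms not_False_eq_True)
  qed
  then have "step_approx T k f t = (\<Sum>j<k. (if j = i then 1 else 0) *\<^sub>R step_average T k f j)"
    by (simp add: step_approx_def)
  also have "\<dots> = (\<Sum>j<k. if j = i then step_average T k f j else 0)" by (intro sum.cong) auto
  finally show ?thesis using i by simp
qed

lemma grid_cell:
  assumes T: "0 < T" and k: "0 < (k::nat)" and t: "0 < t" "t \<le> T"
  obtains i where "i < k" "T * real i / k < t" "t \<le> T * real (Suc i) / k"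
proof
  define i where "i = nat (\<lceil>t * k / T\<rceil> - 1)"
  have "0 < t * k / T" "t * k / T \<le> k" using assms by (auto simp: field_simps)
  then have c: "1 \<le> \<lceil>t * k / T\<rceil>" "\<lceil>t * k / T\<rceil> \<le> k" by (auto simp: ceiling_le_iff)
  then have i: "real i = of_int \<lceil>t * k / T\<rceil> - 1" unfolding i_def by simp
  show "i < k" using c k unfolding i_def by linarith
  have "real i < t * k / T" "t * k / T \<le> real (Suc i)" using i by (simp_all, linarith+)
  then show "T * real i / k < t" "t \<le> T * real (Suc i) / k" using T k by (auto simp: field_simps)
qed

lemma norm_step_approx_le:
  assumes f: "f \<in> borel_measurable borel" "\<And>x. norm (f x) \<le> C" and T: "0 < T" and k: "0 < k"
    and t: "t \<in> {0..T}"
  shows "norm (step_approx T k f t) \<le> C"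
proof (cases "t = 0")
  case True
  have "C \<ge> 0" using order_trans[OF norm_ge_zero f(2)[of 0]] .
  moreover have "indicator {T * real i / k<..T * real (Suc i) / k} t = (0::real)" for i
    using True T by (auto simp: indicator_def zero_le_divide_iff not_less)
  ultimately show ?thesis by (simp add: step_approx_def)
next
  case False
  then obtain i where "i < k" "T * real i / k < t" "t \<le> T * real (Suc i) / k"
    using grid_cell[OF T k, of t] t by auto
  then show ?thesis using step_approx_eq[OF T] norm_step_average_le(1)[OF f T k] by metis
qed

lemma step_approx_measurable [measurable]: "step_approx T k f \<in> borel_measurable borel"
  unfolding step_approx_def by measurable

text \<open>Averaging does not increase the L1 norm on a cell, and the shift moves the mass of cell
  \<open>i - 1\<close> to cell \<open>i\<close>, dropping that of the last cell. Being a
  contraction, the operator only has to be studied on a dense class.\<close>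

lemma step_approx_L1_le:
  assumes f: "f \<in> borel_measurable borel" "\<And>x. norm (f x) \<le> C" and T: "0 < T" and k: "0 < k"
  shows "(\<integral>\<^sup>+ t\<in>{0..T}. ennreal (norm (step_approx T k f t)) \<partial>lborel) \<le> (\<integral>\<^sup>+ t\<in>{0..T}. ennreal (norm (f t)) \<partial>lborel)"
proof -
  have [measurable]: "f \<in> borel_measurable borel" by fact
  let ?I = "\<lambda>i. {T * real i / k<..T * real (Suc i) / k}"
  have le: "T * real i / k \<le> T * real (Suc i) / k" for i using T by (auto intro!: divide_right_mono)
  have em: "emeasure lborel (?I i) = ennreal (T / k)" for i
  proof -
    have "T * real (Suc i) / k - T * real i / k = T / k"
      by (simp add: diff_divide_distrib[symmetric] algebra_simps)
    then show ?thesis using le[of i] by simp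
  qed
  have "(\<integral>\<^sup>+ t\<in>{0..T}. ennreal (norm (step_approx T k f t)) \<partial>lborel)
      \<le> (\<integral>\<^sup>+ t. (\<Sum>i<k. ennreal (norm (step_average T k f i)) * indicator (?I i) t) \<partial>lborel)"
  proof (rule nn_integral_mono)
    fix t
    have "ennreal (norm (step_approx T k f t)) \<le> ennreal (\<Sum>i<k. norm (indicator (?I i) t *\<^sub>R step_average T k f i))"
      unfolding step_approx_def by (intro ennreal_leI norm_sum)
    also have "\<dots> = (\<Sum>i<k. ennreal (norm (indicator (?I i) t *\<^sub>R step_average T k f i)))" by (simp add: sum_ennreal)
    also have "\<dots> = (\<Sum>i<k. ennreal (norm (step_average T k f i)) * indicator (?I i) t)"
      by (intro sum.cong) (auto simp: indicator_def)
    finally show "ennreal (norm (step_approx T k f t)) * indicator {0..T} t \<le> (\<Sum>i<k. ennreal (norm (step_average T k f i)) * indicator (?I i) t)"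
      by (auto simp: indicator_def)
  qed
  also have "\<dots> = (\<Sum>i<k. ennreal (norm (step_average T k f i)) * ennreal (T / k))"
    using em by (subst nn_integral_sum) (auto simp: nn_integral_cmult_indicator)
  also have "\<dots> \<le> (\<Sum>i<k. if i = 0 then 0 else (\<integral>\<^sup>+ s\<in>?I (i - 1). ennreal (norm (f s)) \<partial>lborel))"
  proof (rule sum_mono)
    fix i
    show "ennreal (norm (step_average T k f i)) * ennreal (T / k) \<le> (if i = 0 then 0 else (\<integral>\<^sup>+ s\<in>?I (i - 1). ennreal (norm (f s)) \<partial>lborel))"
    proof (cases "i = 0")
      case False
      have "ennreal (norm (step_average T k f i)) * ennreal (T / k) \<le>
        (ennreal (k / T) * (\<integral>\<^sup>+ s\<in>?I (i - 1). ennreal (norm (f s)) \<partial>lborel)) * ennreal (T / k)"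
        using norm_step_average_le(2)[OF f T k, of i] False by (intro mult_right_mono) auto
      also have "\<dots> = (ennreal (k / T) * ennreal (T / k)) * (\<integral>\<^sup>+ s\<in>?I (i - 1). ennreal (norm (f s)) \<partial>lborel)"
        by (simp add: ac_simps)
      also have "ennreal (k / T) * ennreal (T / k) = 1" using T k by (simp add: ennreal_mult[symmetric])
      finally show ?thesis using False by simp
    qed (simp add: step_average_def)
  qed
  also have "\<dots> = (\<Sum>i\<in>{1..<k}. (\<integral>\<^sup>+ s\<in>?I (i - 1). ennreal (norm (f s)) \<partial>lborel))"
    by (rule sum.mono_neutral_cong_right) auto
  also have "\<dots> = (\<integral>\<^sup>+ s. (\<Sum>i\<in>{1..<k}. ennreal (norm (f s)) * indicator (?I (i - 1)) s) \<partial>lborel)"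
    by (subst nn_integral_sum) auto
  also have "\<dots> \<le> (\<integral>\<^sup>+ t\<in>{0..T}. ennreal (norm (f t)) \<partial>lborel)"
  proof (rule nn_integral_mono)
    fix s
    \<comment> \<open>The cells with indices 0 to \<open>k - 2\<close> are disjoint subsets of
      \<open>{0..T}\<close>, so at most one of these indicators is 1.\<close>
    have le1: "(\<Sum>i\<in>{1..<k}. indicator (?I (i - 1)) s :: ennreal) \<le> indicator {0..T} s"
    proof (cases "\<exists>i\<in>{1..<k}. s \<in> ?I (i - 1)")
      case True
      then obtain i where i: "i \<in> {1..<k}" "s \<in> ?I (i - 1)" by auto
      have "T * real (i - 1) / k \<ge> 0" using T by auto
      moreover have "T * real i / k \<le> T" using T i by (auto simp: field_simps)
      ultimately have s: "s \<in> {0..T}" using i by auto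
      have uniq: "j = i" if "j \<in> {1..<k}" "s \<in> ?I (j - 1)" for j
      proof -
        have "T * real (i - 1) / k < T * real j / k" "T * real (j - 1) / k < T * real i / k" using i that by auto
        then have "i - 1 < j" "j - 1 < i" unfolding grid_less_iff[OF T k] .
        then show "j = i" using i that by auto
      qed
      then have "(\<Sum>j\<in>{1..<k}. indicator (?I (j - 1)) s :: ennreal) = (\<Sum>j\<in>{1..<k}. if j = i then 1 else 0)"
      proof (intro sum.cong refl)
        fix j assume "j \<in> {1..<k}"
        then have "j \<noteq> i \<Longrightarrow> s \<notin> ?I (j - 1)" using uniq by blast
        then show "indicator (?I (j - 1)) s = (if j = i then 1 else 0 :: ennreal)"
          using i(2) by (cases "j = i") (simp_all only: indicator_simps if_True if_False refl simp_thms not_False_eq_True)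
      qed
      then show ?thesis using i s by simp
    next
      case False
      then have "(\<Sum>j\<in>{1..<k}. indicator (?I (j - 1)) s :: ennreal) = 0" by (intro sum.neutral) (auto simp: indicator_def)
      then show ?thesis by simp
    qed
    have "(\<Sum>i\<in>{1..<k}. ennreal (norm (f s)) * indicator (?I (i - 1)) s) = ennreal (norm (f s)) * (\<Sum>i\<in>{1..<k}. indicator (?I (i - 1)) s)"
      by (rule sum_distrib_left[symmetric])
    also have "\<dots> \<le> ennreal (norm (f s)) * indicator {0..T} s" by (rule mult_left_mono[OF le1]) simp
    finally show "(\<Sum>i\<in>{1..<k}. ennreal (norm (f s)) * indicator (?I (i - 1)) s) \<le> ennreal (norm (f s)) * indicator {0..T} s" .
  qed
  finally show ?thesis .
qed

lemma step_approx_tendsto_continuous: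
  assumes g: "continuous_on UNIV g" "\<And>x. norm (g x) \<le> C" and T: "0 < T" and t: "0 < t" "t \<le> T"
  shows "(\<lambda>k. step_approx T (Suc k) g t) \<longlonglongrightarrow> g t"
proof (rule LIMSEQ_I)
  fix e :: real assume e: "e > 0"
  have gm: "g \<in> borel_measurable borel" using g(1) by (rule borel_measurable_continuous_onI)
  obtain d where d: "d > 0" "\<And>s. dist s t < d \<Longrightarrow> dist (g s) (g t) < e / 2"
    using g(1) e unfolding continuous_on_iff by (metis UNIV_I half_gt_zero)
  \<comment> \<open>The point \<open>t\<close> and the cell averaged for it lie in two adjacent
    cells of total length \<open>2 * T / Suc k\<close>. Being below \<open>d\<close> puts them
    within the range of continuity, and being below \<open>t\<close> excludes the first cell with
    its value 0.\<close>
  have "(\<lambda>k. 2 * T / real (Suc k)) \<longlonglongrightarrow> 0"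
    using tendsto_mult[OF tendsto_const[of "2 * T"] LIMSEQ_inverse_real_of_nat] by (simp add: field_simps)
  then have "\<forall>\<^sub>F k in sequentially. 2 * T / real (Suc k) < min d t"
    using d(1) t by (intro order_tendstoD(2)) auto
  then obtain k0 where k0: "\<And>k. k \<ge> k0 \<Longrightarrow> 2 * T / real (Suc k) < min d t"
    by (auto simp: eventually_sequentially)
  show "\<exists>k0. \<forall>k\<ge>k0. norm (step_approx T (Suc k) g t - g t) < e"
  proof (intro exI[of _ k0] allI impI)
    fix k assume "k \<ge> k0"
    then have k: "2 * T / real (Suc k) < d" "2 * T / real (Suc k) < t" using k0[of k] by auto
    let ?k = "Suc k"
    obtain i where i: "i < ?k" "T * real i / ?k < t" "t \<le> T * real (Suc i) / ?k"
      using grid_cell[OF T, of ?k t] t by auto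
    have i0: "i \<noteq> 0"
    proof
      assume "i = 0" then have "t \<le> T / ?k" using i by simp
      then show False using k T by (simp add: field_simps)
    qed
    let ?A = "{T * real (i - 1) / ?k<..T * real i / ?k}"
    have Ale: "T * real (i - 1) / ?k \<le> T * real i / ?k" using T by (auto intro!: divide_right_mono mult_left_mono)
    have mA: "measure lborel ?A = T / ?k"
    proof -
      have "T * real i / ?k - T * real (i - 1) / ?k = T / ?k"
        using i0 by (simp add: of_nat_diff diff_divide_distrib[symmetric] algebra_simps)
      then show ?thesis using Ale by simp
    qed
    have sig: "set_integrable lborel ?A g" by (rule set_integrable_bounded[OF gm g(2)])
    have sic: "set_integrable lborel ?A (\<lambda>s. g t)"
      by (rule set_integrable_bounded[of _ "norm (g t)"]) auto
    have "(LINT s:?A|lborel. g t) = (T / ?k) *\<^sub>R g t"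
    proof -
      have "integrable lborel (indicator ?A :: real \<Rightarrow> real)" using Ale by (intro integrable_real_indicator) auto
      then show ?thesis using mA unfolding set_lebesgue_integral_def
        by (subst Bochner_Integration.integral_scaleR_left) auto
    qed
    then have "(LINT s:?A|lborel. g s) - (T / ?k) *\<^sub>R g t = (LINT s:?A|lborel. g s - g t)"
      using set_integral_diff(2)[OF sig sic] by simp
    moreover have "norm (LINT s:?A|lborel. g s - g t) \<le> T / ?k * (e / 2)"
    proof -
      have "norm (LINT s:?A|lborel. g s - g t) \<le> (LINT s:?A|lborel. norm (g s - g t))"
        by (rule set_integral_norm_bound) (rule set_integral_diff(1)[OF sig sic])
      also have "\<dots> \<le> (LINT s:?A|lborel. e / 2)"
      proof (rule set_integral_mono)
        show "set_integrable lborel ?A (\<lambda>s. norm (g s - g t))"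
          by (rule set_integrable_norm) (rule set_integral_diff(1)[OF sig sic])
        show "set_integrable lborel ?A (\<lambda>s. e / 2)" by (rule set_integrable_bounded[of _ "e/2"]) (use e in auto)
        fix s assume s: "s \<in> ?A"
        have "T * real (Suc i) / ?k - T * real (i - 1) / ?k = 2 * T / ?k"
          using i0 by (simp add: of_nat_diff diff_divide_distrib[symmetric] algebra_simps)
        then have "dist s t < d" using s i k(1) by (auto simp: dist_real_def)
        then show "norm (g s - g t) \<le> e / 2" using d(2)[of s] by (simp add: dist_norm less_imp_le)
      qed
      also have "\<dots> = T / ?k * (e / 2)" using mA by (simp add: set_lebesgue_integral_def)
      finally show ?thesis .
    qed
    ultimately have *: "norm ((LINT s:?A|lborel. g s) - (T / ?k) *\<^sub>R g t) \<le> T / ?k * (e / 2)" by simp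
    have "step_approx T ?k g t - g t = (?k / T) *\<^sub>R ((LINT s:?A|lborel. g s) - (T / ?k) *\<^sub>R g t)"
      using step_approx_eq[OF T i] i0 T by (simp add: step_average_def scaleR_diff_right)
    then have "norm (step_approx T ?k g t - g t) = ?k / T * norm ((LINT s:?A|lborel. g s) - (T / ?k) *\<^sub>R g t)"
      using T by simp
    also have "\<dots> \<le> ?k / T * (T / ?k * (e / 2))" using * T by (intro mult_left_mono) auto
    also have "\<dots> = (?k / T * (T / ?k)) * (e / 2)" by (simp only: mult.assoc)
    also have "?k / T * (T / ?k) = 1" using T by (simp del: of_nat_Suc)
    finally show "norm (step_approx T (Suc k) g t - g t) < e" using e by simp
  qed
qed

lemma step_approx_diff:
  assumes f: "f \<in> borel_measurable borel" "\<And>x. norm (f x) \<le> C"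
    and g: "g \<in> borel_measurable borel" "\<And>x. norm (g x) \<le> C"
  shows "step_approx T k (\<lambda>t. f t - g t) t = step_approx T k f t - step_approx T k g t"
proof -
  have "step_average T k (\<lambda>t. f t - g t) i = step_average T k f i - step_average T k g i" for i
    unfolding step_average_def
    by (auto simp: set_integral_diff(2)[OF set_integrable_bounded[OF f] set_integrable_bounded[OF g]] scaleR_diff_right)
  then show ?thesis by (simp add: step_approx_def scaleR_diff_right sum_subtractf)
qed

lemma nn_integral_bounded_tendsto_0:
  fixes h :: "nat \<Rightarrow> real \<Rightarrow> 'b::euclidean_space"
  assumes [measurable]: "\<And>k. h k \<in> borel_measurable borel" and b: "\<And>k t. t \<in> {0..T} \<Longrightarrow> norm (h k t) \<le> C"
    and l: "AE t in lborel. t \<in> {0..T} \<longrightarrow> (\<lambda>k. h k t) \<longlonglongrightarrow> 0"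
  shows "(\<lambda>k. \<integral>\<^sup>+ t\<in>{0..T}. ennreal (norm (h k t)) \<partial>lborel) \<longlonglongrightarrow> 0"
proof -
  have "(\<lambda>k. (\<integral>\<^sup>+ t. ennreal (norm (h k t)) * indicator {0..T} t \<partial>lborel)) \<longlonglongrightarrow> (\<integral>\<^sup>+ t. 0 \<partial>(lborel :: real measure))"
  proof (rule nn_integral_dominated_convergence[where w = "\<lambda>t. ennreal C * indicator {0..T} t"])
    show "(\<integral>\<^sup>+ t. ennreal C * indicator {0..T} t \<partial>lborel) < \<infinity>"
      by (cases "0 \<le> T") (auto simp: nn_integral_cmult_indicator ennreal_mult_less_top)
    show "AE t in lborel. ennreal (norm (h k t)) * indicator {0..T} t \<le> ennreal C * indicator {0..T} t" for k
      using b by (intro AE_I2) (auto simp: indicator_def intro: ennreal_leI)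
    show "AE t in lborel. (\<lambda>k. ennreal (norm (h k t)) * indicator {0..T} t) \<longlonglongrightarrow> 0"
      using l
    proof eventually_elim
      case (elim t)
      show ?case
      proof (cases "t \<in> {0..T}")
        case True
        then have "(\<lambda>k. ennreal (norm (h k t))) \<longlonglongrightarrow> ennreal (norm (0::'b))"
          using elim by (intro tendsto_ennrealI tendsto_norm) auto
        then show ?thesis using True by simp
      qed simp
    qed
  qed auto
  then show ?thesis by simp
qed

text \<open>A density argument: \<open>f\<close> is approximated in L1 by continuous functions, for
  which averages over shrinking cells converge pointwise, and the L1 contraction controls the
  averages of the difference. Each of the three errors is below \<open>r / 4\<close>.\<close>

lemma step_approx_tendsto:
  fixes f :: "real \<Rightarrow> 'b::euclidean_space"
  assumes f: "f \<in> borel_measurable borel" "\<And>x. norm (f x) \<le> C" and T: "0 < T"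
  shows "(\<lambda>k. \<integral>\<^sup>+ t\<in>{0..T}. ennreal (norm (step_approx T (Suc k) f t - f t)) \<partial>lborel) \<longlonglongrightarrow> 0"
proof (rule tendsto_zero_ennreal)
  fix r :: real assume r: "r > 0"
  have C: "0 \<le> C" using order_trans[OF norm_ge_zero f(2)[of 0]] .
  have [measurable]: "f \<in> borel_measurable borel" by fact
  have "f \<in> borel_measurable lebesgue" using f(1) by (simp add: measurable_completion)
  then have "f measurable_on UNIV" by (rule lebesgue_measurable_imp_measurable_on) auto
  then obtain N g where N: "negligible N" and gc: "\<And>n. continuous_on UNIV (g n)"
    and gl: "\<And>x. x \<notin> N \<Longrightarrow> (\<lambda>n. g n x) \<longlonglongrightarrow> f x"
    unfolding measurable_on_def by auto
  \<comment> \<open>The nearest-point projection onto the ball of radius \<open>C\<close> is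
    continuous, fixes the values of \<open>f\<close>, and gives the approximants the bound needed
    for dominated convergence.\<close>
  define c where "c = closest_point (cball (0::'b) C)"
  have cc: "continuous_on UNIV c" unfolding c_def using C by (intro continuous_on_closest_point) auto
  have cb: "norm (c x) \<le> C" for x
    unfolding c_def using closest_point_in_set[of "cball (0::'b) C" x] C by auto
  define h where "h n t = c (g n t)" for n t
  have hc: "continuous_on UNIV (h n)" for n
    unfolding h_def using continuous_on_compose2[OF cc gc[of n]] by auto
  have hm [measurable]: "h n \<in> borel_measurable borel" for n using hc by (rule borel_measurable_continuous_onI)
  have hb: "norm (h n t) \<le> C" for n t by (simp add: h_def cb)
  have hl: "(\<lambda>n. h n x) \<longlonglongrightarrow> f x" if "x \<notin> N" for x
  proof -
    have "(\<lambda>n. c (g n x)) \<longlonglongrightarrow> c (f x)"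
      by (rule continuous_on_tendsto_compose[OF cc gl[OF that]]) auto
    moreover have "c (f x) = f x" unfolding c_def using f(2) by (intro closest_point_self) auto
    ultimately show ?thesis by (simp add: h_def)
  qed
  have "AE x in lebesgue. x \<notin> N" using N by (simp add: AE_not_in negligible_iff_null_sets)
  then have "AE x in lborel. x \<notin> N" by (simp add: AE_completion_iff)
  then have "AE t in lborel. t \<in> {0..T} \<longrightarrow> (\<lambda>k. f t - h k t) \<longlonglongrightarrow> 0"
  proof eventually_elim
    case (elim t) then show ?case using tendsto_diff[OF tendsto_const[of "f t"] hl[of t]] by simp
  qed
  then have "(\<lambda>n. \<integral>\<^sup>+ t\<in>{0..T}. ennreal (norm (f t - h n t)) \<partial>lborel) \<longlonglongrightarrow> 0"
  proof (rule nn_integral_bounded_tendsto_0[where C = "C + C", rotated 2])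
    show "norm (f t - h n t) \<le> C + C" for n t
      by (rule order_trans[OF norm_triangle_ineq4 add_mono[OF f(2) hb]])
  qed (rule borel_measurable_diff[OF f(1) hm])
  then have "\<forall>\<^sub>F n in sequentially. (\<integral>\<^sup>+ t\<in>{0..T}. ennreal (norm (f t - h n t)) \<partial>lborel) < ennreal (r / 4)"
    using r by (intro order_tendstoD(2)) auto
  then obtain n where n: "(\<integral>\<^sup>+ t\<in>{0..T}. ennreal (norm (f t - h n t)) \<partial>lborel) < ennreal (r / 4)"
    by (auto simp: eventually_sequentially)
  have "AE t in lborel. t \<noteq> (0::real)" by (rule AE_lborel_singleton)
  then have "AE t in lborel. t \<in> {0..T} \<longrightarrow> (\<lambda>k. step_approx T (Suc k) (h n) t - h n t) \<longlonglongrightarrow> 0"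
  proof eventually_elim
    case (elim t)
    show ?case
    proof
      assume "t \<in> {0..T}"
      then have "(\<lambda>k. step_approx T (Suc k) (h n) t) \<longlonglongrightarrow> h n t"
        using elim by (intro step_approx_tendsto_continuous[OF hc hb T]) auto
      then show "(\<lambda>k. step_approx T (Suc k) (h n) t - h n t) \<longlonglongrightarrow> 0" by (simp add: LIM_zero)
    qed
  qed
  then have "(\<lambda>k. \<integral>\<^sup>+ t\<in>{0..T}. ennreal (norm (step_approx T (Suc k) (h n) t - h n t)) \<partial>lborel) \<longlonglongrightarrow> 0"
  proof (rule nn_integral_bounded_tendsto_0[where C = "C + C", rotated 2])
    show "norm (step_approx T (Suc k) (h n) t - h n t) \<le> C + C" if "t \<in> {0..T}" for k t
      by (rule order_trans[OF norm_triangle_ineq4 add_mono[OF norm_step_approx_le[OF hm hb T _ that] hb]]) simp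
  qed (rule borel_measurable_diff[OF step_approx_measurable hm])
  then have "\<forall>\<^sub>F k in sequentially. (\<integral>\<^sup>+ t\<in>{0..T}. ennreal (norm (step_approx T (Suc k) (h n) t - h n t)) \<partial>lborel) < ennreal (r / 4)"
    using r by (intro order_tendstoD(2)) auto
  then show "\<forall>\<^sub>F k in sequentially. (\<integral>\<^sup>+ t\<in>{0..T}. ennreal (norm (step_approx T (Suc k) f t - f t)) \<partial>lborel) < ennreal r"
  proof eventually_elim
    case (elim k)
    let ?d = "\<lambda>t. f t - h n t"
    have db: "norm (?d t) \<le> C + C" for t by (rule order_trans[OF norm_triangle_ineq4 add_mono[OF f(2) hb]])
    have "(\<integral>\<^sup>+ t\<in>{0..T}. ennreal (norm (step_approx T (Suc k) f t - f t)) \<partial>lborel)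
      \<le> (\<integral>\<^sup>+ t\<in>{0..T}. (ennreal (norm (step_approx T (Suc k) ?d t)) + ennreal (norm (?d t))
           + ennreal (norm (step_approx T (Suc k) (h n) t - h n t))) \<partial>lborel)"
    proof (intro nn_integral_mono mult_right_mono)
      fix t
      have eq: "step_approx T (Suc k) f t - f t = step_approx T (Suc k) ?d t - ?d t + (step_approx T (Suc k) (h n) t - h n t)"
        by (simp add: step_approx_diff[OF f hm hb])
      have "norm (step_approx T (Suc k) f t - f t) \<le> norm (step_approx T (Suc k) ?d t) + norm (?d t) + norm (step_approx T (Suc k) (h n) t - h n t)"
        unfolding eq
        by (intro order_trans[OF norm_triangle_ineq] add_right_mono norm_triangle_ineq4)
      then show "ennreal (norm (step_approx T (Suc k) f t - f t)) \<le> ennreal (norm (step_approx T (Suc k) ?d t)) + ennreal (norm (?d t))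
           + ennreal (norm (step_approx T (Suc k) (h n) t - h n t))"
        by (simp add: ennreal_plus[symmetric] del: ennreal_plus)
    qed auto
    also have "\<dots> = (\<integral>\<^sup>+ t\<in>{0..T}. ennreal (norm (step_approx T (Suc k) ?d t)) \<partial>lborel) + (\<integral>\<^sup>+ t\<in>{0..T}. ennreal (norm (?d t)) \<partial>lborel)
        + (\<integral>\<^sup>+ t\<in>{0..T}. ennreal (norm (step_approx T (Suc k) (h n) t - h n t)) \<partial>lborel)"
      by (simp add: distrib_right nn_integral_add)
    also have "\<dots> \<le> ennreal (r / 4) + ennreal (r / 4) + ennreal (r / 4)"
      using n elim step_approx_L1_le[OF borel_measurable_diff[OF f(1) hm] db T, where k = "Suc k"]
      by (intro add_mono less_imp_le[OF n] less_imp_le[OF elim]) (auto intro: order_trans)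
    also have "\<dots> = ennreal (3 * r / 4)" using r by (simp add: ennreal_plus[symmetric] del: ennreal_plus)
    also have "\<dots> < ennreal r" using r by (intro ennreal_lessI) auto
    finally show ?case .
  qed
qed

section \<open>Regular clocks\<close>

text \<open>What is kept of a path of the inverse subordinator. It is stated on the whole line, with
  value zero left of the origin, because \<open>interval_measure\<close> expects a function on all
  of the reals.\<close>

definition regular_clock :: "real \<Rightarrow> (real \<Rightarrow> real) \<Rightarrow> bool" where
  "regular_clock \<kappa> l \<longleftrightarrow> (\<forall>t\<le>0. l t = 0) \<and> (\<forall>s t. s \<le> t \<longrightarrow> l s \<le> l t \<and> l t - l s \<le> (t - s) / \<kappa>)"

lemma regular_clock_continuous:
  assumes "regular_clock \<kappa> l" "0 < \<kappa>"
  shows "continuous_on UNIV l"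
proof (rule continuous_onI)
  fix x e :: real assume "e > 0"
  have lip: "\<bar>l y - l x\<bar> \<le> \<bar>y - x\<bar> / \<kappa>" for y
  proof (cases "x \<le> y")
    case True
    then have "l x \<le> l y" "l y - l x \<le> (y - x) / \<kappa>" using assms unfolding regular_clock_def by blast+
    then show ?thesis using True by simp
  next
    case False
    then have "l y \<le> l x" "l x - l y \<le> (x - y) / \<kappa>" using assms unfolding regular_clock_def by (meson linear)+
    then show ?thesis using False by simp
  qed
  then have "dist (l y) (l x) < e" if "dist y x < e * \<kappa>" for y
  proof -
    have "\<bar>y - x\<bar> / \<kappa> < e" using that assms(2) by (simp add: dist_real_def pos_divide_less_eq)
    then show ?thesis using lip[of y] by (simp add: dist_real_def)
  qed
  then show "\<exists>d>0. \<forall>y\<in>UNIV. dist y x < d \<longrightarrow> dist (l y) (l x) \<le> e"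
    using \<open>e > 0\<close> assms(2) by (intro exI[of _ "e * \<kappa>"]) (auto intro: less_imp_le)
qed

text \<open>The boxes that characterise \<open>lborel\<close> are open intervals, while
  \<open>interval_measure\<close> is computed on half-open ones; by continuity the end point carries
  no mass.\<close>

lemma interval_measure_open:
  assumes m: "\<And>x y. x \<le> y \<Longrightarrow> f x \<le> f y" and c: "continuous_on UNIV f" and ab: "a \<le> b"
  shows "emeasure (interval_measure f) {a<..<b} = ennreal (f b - f a)"
proof (cases "a = b")
  case False
  then have "{a<..b} = {a<..<b} \<union> {b}" using ab by auto
  moreover have "{b} \<in> null_sets (interval_measure f)"
    using emeasure_interval_measure_Icc[of b b f] m c by (auto simp: null_sets_def)
  ultimately have "emeasure (interval_measure f) {a<..b} = emeasure (interval_measure f) {a<..<b}"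
    using emeasure_Un_null_set[of "{a<..<b}" "interval_measure f" "{b}"] by simp
  moreover have "emeasure (interval_measure f) {a<..b} = ennreal (f b - f a)"
    using c by (intro emeasure_interval_measure_Ioc ab m)
      (auto simp: continuous_on_eq_continuous_at intro: continuous_at_imp_continuous_at_within)
  ultimately show ?thesis by simp
qed simp

text \<open>Domination without densities: the defect \<open>r t = t / \<kappa> - l t\<close> is
  again nondecreasing and continuous, so \<open>\<kappa>\<close> times the sum of the measures of
  \<open>l\<close> and \<open>r\<close> agrees with Lebesgue measure on intervals and hence equals
  it. Dropping the summand of \<open>r\<close> leaves the bound.\<close>

lemma interval_measure_le_lborel:
  assumes l: "regular_clock \<kappa> l" and \<kappa>: "0 < \<kappa>"
  shows "interval_measure l \<le> scale_measure (ennreal (1 / \<kappa>)) lborel"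
proof -
  define r where "r t = t / \<kappa> - l t" for t
  have lm: "l x \<le> l y" if "x \<le> y" for x y using l that by (auto simp: regular_clock_def)
  have rm: "r x \<le> r y" if "x \<le> y" for x y
  proof -
    have "l y - l x \<le> (y - x) / \<kappa>" using l that unfolding regular_clock_def by blast
    then show ?thesis by (simp add: r_def diff_divide_distrib)
  qed
  have lc: "continuous_on UNIV l" by (rule regular_clock_continuous[OF l \<kappa>])
  have rc: "continuous_on UNIV r" unfolding r_def using lc \<kappa> by (intro continuous_intros) auto
  define \<mu> where "\<mu> A = ennreal \<kappa> * (emeasure (interval_measure l) A + emeasure (interval_measure r) A)" for A
  \<comment> \<open>The weighted sum is turned into a measure in its own right so that
    \<open>lborel_eqI\<close> can identify it from its values on boxes.\<close>
  define N where "N = measure_of UNIV (sets borel) \<mu>"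
  have sN: "sets N = sets borel" unfolding N_def by (simp add: sets.sigma_sets_eq[of borel, simplified])
  have ms: "measure_space UNIV (sets borel) \<mu>"
  proof -
    have "countably_additive (sets borel) \<mu>"
    proof (rule countably_additiveI)
      fix A :: "nat \<Rightarrow> real set" assume A: "range A \<subseteq> sets borel" "disjoint_family A" "(\<Union>i. A i) \<in> sets borel"
      have "(\<Sum>i. \<mu> (A i)) = ennreal \<kappa> * ((\<Sum>i. emeasure (interval_measure l) (A i)) + (\<Sum>i. emeasure (interval_measure r) (A i)))"
        unfolding \<mu>_def by (simp add: suminf_add[symmetric])
      also have "\<dots> = \<mu> (\<Union>i. A i)"
        using A unfolding \<mu>_def by (subst (1 2) suminf_emeasure) auto
      finally show "(\<Sum>i. \<mu> (A i)) = \<mu> (\<Union>i. A i)" .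
    qed
    moreover have "positive (sets borel) \<mu>" by (simp add: positive_def \<mu>_def)
    moreover have "sigma_algebra UNIV (sets (borel::real measure))"
      using sets.sigma_algebra_axioms[of "borel::real measure"] by simp
    ultimately show ?thesis by (simp add: measure_space_def)
  qed
  have eN: "emeasure N A = \<mu> A" if "A \<in> sets borel" for A
    unfolding N_def using ms that by (intro emeasure_measure_of_sigma) (auto simp: measure_space_def)
  have "lborel = N"
  proof (rule lborel_eqI)
    fix a b :: real assume "\<And>i. i \<in> Basis \<Longrightarrow> a \<bullet> i \<le> b \<bullet> i"
    then have ab: "a \<le> b" by simp
    have "emeasure N (box a b) = ennreal \<kappa> * (ennreal (l b - l a) + ennreal (r b - r a))"
      using ab by (simp add: eN \<mu>_def box_real interval_measure_open[OF lm lc] interval_measure_open[OF rm rc])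
    also have "\<dots> = ennreal (\<kappa> * ((l b - l a) + (r b - r a)))"
      using lm[OF ab] rm[OF ab] \<kappa> by (subst ennreal_plus[symmetric]) (auto simp: ennreal_mult)
    also have "\<kappa> * ((l b - l a) + (r b - r a)) = b - a" using \<kappa> by (simp add: r_def field_simps)
    finally show "emeasure N (box a b) = ennreal (\<Prod>i\<in>Basis. (b - a) \<bullet> i)" by simp
  qed (rule sN)
  then have *: "emeasure lborel A = \<mu> A" if "A \<in> sets borel" for A using eN[OF that] by simp
  show ?thesis
  proof (subst le_measure, simp, rule ballI)
    fix A assume "A \<in> sets (interval_measure l)"
    then have A: "A \<in> sets borel" by simp
    have "emeasure (interval_measure l) A \<le> ennreal (1 / \<kappa>) * (ennreal \<kappa> * (emeasure (interval_measure l) A + emeasure (interval_measure r) A))"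
      using \<kappa> by (simp add: mult.assoc[symmetric] ennreal_mult[symmetric])
    then show "emeasure (interval_measure l) A \<le> emeasure (scale_measure (ennreal (1 / \<kappa>)) lborel) A"
      by (simp add: *[OF A] \<mu>_def)
  qed
qed

section \<open>Progressively measurable processes and their time integrals\<close>

lemma prog_measurable_compose:
  assumes "prog_measurable F T X" "h \<in> borel_measurable borel"
  shows "prog_measurable F T (\<lambda>s w. h (X s w))"
  unfolding prog_measurable_def
proof
  fix t assume "t \<in> {0..T}"
  then have "(\<lambda>(w, s). X s w) \<in> F t \<Otimes>\<^sub>M restrict_space borel {0..t} \<rightarrow>\<^sub>M borel"
    using assms(1) by (auto simp: prog_measurable_def)
  from measurable_compose[OF this assms(2)]
  show "(\<lambda>(w, s). h (X s w)) \<in> F t \<Otimes>\<^sub>M restrict_space borel {0..t} \<rightarrow>\<^sub>M borel"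
    by (simp add: case_prod_unfold)
qed

lemma prog_measurable_compose2:
  fixes X :: "('a, 'b::second_countable_topology) process" and Y :: "('a, 'c::second_countable_topology) process"
  assumes X: "prog_measurable F T X" and Y: "prog_measurable F T Y"
    and h: "(\<lambda>(x, y). h x y) \<in> borel_measurable borel"
  shows "prog_measurable F T (\<lambda>s w. h (X s w) (Y s w))"
proof -
  have "prog_measurable F T (\<lambda>s w. (X s w, Y s w))"
    unfolding prog_measurable_def
  proof
    fix t assume "t \<in> {0..T}"
    then have "(\<lambda>(w, s). X s w) \<in> F t \<Otimes>\<^sub>M restrict_space borel {0..t} \<rightarrow>\<^sub>M borel"
      "(\<lambda>(w, s). Y s w) \<in> F t \<Otimes>\<^sub>M restrict_space borel {0..t} \<rightarrow>\<^sub>M borel"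
      using X Y by (auto simp: prog_measurable_def)
    then show "(\<lambda>(w, s). (X s w, Y s w)) \<in> F t \<Otimes>\<^sub>M restrict_space borel {0..t} \<rightarrow>\<^sub>M borel"
      by (simp add: case_prod_unfold borel_prod[symmetric])
  qed
  from prog_measurable_compose[OF this h] show ?thesis by simp
qed

lemma prog_measurable_diff:
  fixes X Y :: "('a, 'b::euclidean_space) process"
  shows "prog_measurable F T X \<Longrightarrow> prog_measurable F T Y \<Longrightarrow> prog_measurable F T (\<lambda>s w. X s w - Y s w)"
  by (rule prog_measurable_compose2[where h = "\<lambda>x y. x - y"]) (auto simp: case_prod_unfold borel_prod[symmetric])

lemma prog_measurable_norm_sq:
  fixes X :: "('a, 'b::euclidean_space) process"
  shows "prog_measurable F T X \<Longrightarrow> prog_measurable F T (\<lambda>s w. ennreal ((norm (X s w))\<^sup>2))"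
  by (rule prog_measurable_compose) auto

text \<open>Clipping the time replaces the restricted Borel space on \<open>{0..t}\<close> by the
  full one, as integrals over the line require; multiplied by the indicator of
  \<open>{0..t}\<close>, the clipped process is the original one.\<close>

lemma prog_measurable_clip:
  assumes "prog_measurable F T X" "t \<in> {0..T}"
  shows "(\<lambda>(w, s). X (max 0 (min t s)) w) \<in> F t \<Otimes>\<^sub>M borel \<rightarrow>\<^sub>M borel"
proof -
  have "(\<lambda>(w, s). X s w) \<in> F t \<Otimes>\<^sub>M restrict_space borel {0..t} \<rightarrow>\<^sub>M borel"
    using assms by (auto simp: prog_measurable_def)
  moreover have "(\<lambda>x. (fst x, max 0 (min t (snd x)))) \<in> F t \<Otimes>\<^sub>M borel \<rightarrow>\<^sub>M F t \<Otimes>\<^sub>M restrict_space borel {0..t}"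
    using assms(2) by (intro measurable_Pair measurable_restrict_space2) auto
  ultimately show ?thesis
    using measurable_compose[of "\<lambda>x. (fst x, max 0 (min t (snd x)))" _ _ "\<lambda>(w, s). X s w"]
    by (simp add: case_prod_unfold)
qed

lemma prog_measurable_section:
  assumes X: "prog_measurable F T X" and t: "t \<in> {0..T}" "s \<in> {0..t}"
  shows "X s \<in> F t \<rightarrow>\<^sub>M borel"
proof -
  have "(\<lambda>w. (w, s)) \<in> F t \<rightarrow>\<^sub>M F t \<Otimes>\<^sub>M borel" by simp
  moreover have "max 0 (min t s) = s" using t(2) by auto
  ultimately show ?thesis
    using measurable_compose[of "\<lambda>w. (w, s)", OF _ prog_measurable_clip[OF X t(1)]] by simp
qed

lemma prog_measurable_path:
  assumes X: "prog_measurable F T X" and T: "0 \<le> T" and w: "w \<in> space (F T)"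
  shows "(\<lambda>s. X (max 0 (min T s)) w) \<in> borel \<rightarrow>\<^sub>M borel"
proof -
  have "(\<lambda>s. (w, s)) \<in> borel \<rightarrow>\<^sub>M F T \<Otimes>\<^sub>M borel" using w by simp
  from measurable_compose[OF this prog_measurable_clip[OF X, of T]] T show ?thesis by simp
qed

lemma (in complete_filtration) nn_integral_lborel_adapted:
  fixes g :: "('a, ennreal) process"
  assumes g: "prog_measurable G T g" and t: "t \<in> {0..T}"
  shows "(\<lambda>w. \<integral>\<^sup>+ s\<in>{0..t}. g s w \<partial>lborel) \<in> borel_measurable (G t)"
proof -
  have [measurable]: "(\<lambda>(w, s). g (max 0 (min t s)) w) \<in> G t \<Otimes>\<^sub>M borel \<rightarrow>\<^sub>M borel"
    by (rule prog_measurable_clip[OF g t])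
  have "(\<lambda>w. \<integral>\<^sup>+ s. g (max 0 (min t s)) w * indicator {0..t} s \<partial>lborel) \<in> borel_measurable (G t)"
    by measurable
  moreover have "(\<integral>\<^sup>+ s. g (max 0 (min t s)) w * indicator {0..t} s \<partial>lborel) = (\<integral>\<^sup>+ s\<in>{0..t}. g s w \<partial>lborel)" for w
    by (intro nn_integral_cong) (auto simp: indicator_def max_def min_def)
  ultimately show ?thesis by simp
qed

text \<open>The interface between the two halves of the proof: integration and the equation rest on
  the properties listed here, and the process built from \<open>B\<close> and \<open>S\<close> is
  shown at the end to have them. \<open>Z_mart\<close> and \<open>Z_qv\<close> express the
  martingale property and the brackets of the coordinates as vanishing integrals over past
  events.\<close>

locale driver = complete_filtration M F T for M :: "'a measure" and F :: "real \<Rightarrow> 'a measure" and T :: real +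
  fixes Z :: "('a, real ^ 'd) process" and L :: "('a, real) process" and \<kappa> :: real
  assumes \<kappa>_pos: "0 < \<kappa>"
    and Z_adapted: "t \<in> {0..T} \<Longrightarrow> Z t \<in> borel_measurable (F t)"
    and Z_cont: "AE w in M. continuous_on {0..T} (\<lambda>t. Z t w)"
    and Z_L2: "t \<in> {0..T} \<Longrightarrow> L2 M (Z t)"
    and L_adapted: "t \<in> {0..T} \<Longrightarrow> L t \<in> borel_measurable (F t)"
    and L_regular: "AE w in M. regular_clock \<kappa> (\<lambda>t. L t w)"
    and Z_mart: "0 \<le> s \<Longrightarrow> s \<le> t \<Longrightarrow> t \<le> T \<Longrightarrow> A \<in> sets (F s) \<Longrightarrow>
      (\<integral>w. indicator A w * (Z t w $ i - Z s w $ i) \<partial>M) = 0"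
    and Z_qv: "0 \<le> s \<Longrightarrow> s \<le> t \<Longrightarrow> t \<le> T \<Longrightarrow> A \<in> sets (F s) \<Longrightarrow>
      (\<integral>w. indicator A w * ((Z t w $ i - Z s w $ i) * (Z t w $ j - Z s w $ j)
         - (if i = j then L t w - L s w else 0)) \<partial>M) = 0"
begin

abbreviation "reg w \<equiv> regular_clock \<kappa> (\<lambda>t. L t w)"

lemma sets_path [simp, measurable_cong]: "sets (path_measure L w) = sets borel"
  by (simp add: path_measure_def)

lemma space_path [simp]: "space (path_measure L w) = UNIV"
  by (simp add: path_measure_def)

lemma regD:
  assumes "reg w"
  shows "t \<le> 0 \<Longrightarrow> L t w = 0" "s \<le> t \<Longrightarrow> L s w \<le> L t w" "s \<le> t \<Longrightarrow> L t w - L s w \<le> (t - s) / \<kappa>" "0 \<le> L t w"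
proof -
  show 1: "t \<le> 0 \<Longrightarrow> L t w = 0" and 2: "s \<le> t \<Longrightarrow> L s w \<le> L t w" "s \<le> t \<Longrightarrow> L t w - L s w \<le> (t - s) / \<kappa>" for s t
    using assms by (auto simp: regular_clock_def)
  show "0 \<le> L t w" using 1[of "min 0 t"] 2[of "min 0 t" t] by simp
qed

lemma path_Ioc:
  assumes "reg w" "a \<le> b" shows "emeasure (path_measure L w) {a<..b} = ennreal (L b w - L a w)"
  unfolding path_measure_def using regular_clock_continuous[OF assms(1) \<kappa>_pos] regD(2)[OF assms(1)]
  by (intro emeasure_interval_measure_Ioc assms(2))
    (auto simp: continuous_on_eq_continuous_at intro: continuous_at_imp_continuous_at_within)

lemma path_Icc:
  assumes "reg w" "a \<le> b" shows "emeasure (path_measure L w) {a..b} = ennreal (L b w - L a w)"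
  unfolding path_measure_def using regular_clock_continuous[OF assms(1) \<kappa>_pos] regD(2)[OF assms(1)]
  by (intro emeasure_interval_measure_Icc assms(2)) auto

text \<open>For a non-measurable \<open>f\<close> the integral is a supremum over simple functions
  below \<open>f\<close>, and each of these scales with the measure; so the bound can be applied to
  arbitrary integrands.\<close>

lemma path_le:
  assumes "reg w"
  shows "(\<integral>\<^sup>+ s. f s \<partial>path_measure L w) \<le> ennreal (1 / \<kappa>) * (\<integral>\<^sup>+ s. f s \<partial>lborel)"
proof (cases "f \<in> borel_measurable borel")
  case True
  have "(\<integral>\<^sup>+ s. f s \<partial>path_measure L w) \<le> (\<integral>\<^sup>+ s. f s \<partial>scale_measure (ennreal (1 / \<kappa>)) lborel)"
    unfolding path_measure_def
    by (intro nn_integral_mono_measure interval_measure_le_lborel[OF assms \<kappa>_pos]) simp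
  also have "\<dots> = ennreal (1 / \<kappa>) * (\<integral>\<^sup>+ s. f s \<partial>lborel)"
    using True by (intro nn_integral_scale_measure) simp
  finally show ?thesis .
next
  case False
  have "(\<integral>\<^sup>+ s. f s \<partial>path_measure L w) \<le> (\<integral>\<^sup>+ s. f s \<partial>scale_measure (ennreal (1 / \<kappa>)) lborel)"
    unfolding path_measure_def
    by (intro nn_integral_mono_measure interval_measure_le_lborel[OF assms \<kappa>_pos]) simp
  also have "\<dots> \<le> ennreal (1 / \<kappa>) * (\<integral>\<^sup>+ s. f s \<partial>lborel)"
    unfolding nn_integral_def
  proof (rule SUP_least)
    fix g assume g: "g \<in> {g. simple_function (scale_measure (ennreal (1 / \<kappa>)) lborel) g \<and> g \<le> f}"
    then have g': "simple_function lborel g" "g \<le> f" by (auto simp: simple_function_def space_scale_measure)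
    have "integral\<^sup>S (scale_measure (ennreal (1 / \<kappa>)) lborel) g = integral\<^sup>N (scale_measure (ennreal (1 / \<kappa>)) lborel) g"
      using g by (intro nn_integral_eq_simple_integral[symmetric]) auto
    also have "\<dots> = ennreal (1 / \<kappa>) * integral\<^sup>N lborel g"
      using g' by (intro nn_integral_scale_measure borel_measurable_simple_function)
    also have "integral\<^sup>N lborel g = integral\<^sup>S lborel g" using g' by (intro nn_integral_eq_simple_integral)
    also have "ennreal (1 / \<kappa>) * \<dots> \<le> ennreal (1 / \<kappa>) * (SUP g\<in>{g. simple_function lborel g \<and> g \<le> f}. integral\<^sup>S lborel g)"
      using g' by (intro mult_left_mono SUP_upper) auto
    finally show "integral\<^sup>S (scale_measure (ennreal (1 / \<kappa>)) lborel) g \<le> ennreal (1 / \<kappa>) * (SUP g\<in>{g. simple_function lborel g \<and> g \<le> f}. integral\<^sup>S lborel g)" .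
  qed
  finally show ?thesis .
qed

text \<open>Here the integrating measure depends on \<open>w\<close>. Normalised and cut off to
  \<open>{0..t}\<close>, the path measure becomes a subprobability kernel, and integrals of jointly
  measurable functions against a measurable kernel are measurable. The kernel is tested on
  half-lines, where its mass is a multiple of an increment of \<open>L\<close>.\<close>

lemma nn_integral_path_adapted:
  fixes g :: "('a, ennreal) process"
  assumes g: "prog_measurable F T g" and t: "t \<in> {0..T}"
  shows "(\<lambda>w. \<integral>\<^sup>+ s\<in>{0..t}. g s w \<partial>path_measure L w) \<in> borel_measurable (F t)"
proof -
  \<comment> \<open>\<open>L t w - L 0 w\<close> is at most \<open>T / \<kappa>\<close>, so the
    factor \<open>\<kappa> / T\<close> brings the mass to at most 1. Irregular paths form a null
    event and get the null measure.\<close>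
  define K where "K w = (if reg w then scale_measure (ennreal (\<kappa> / T)) (density (path_measure L w) (indicator {0..t}))
     else null_measure borel)" for w
  have t0: "0 \<le> t" "t \<le> T" using t by auto
  have em: "emeasure (K w) A = ennreal (\<kappa> / T) * emeasure (path_measure L w) ({0..t} \<inter> A)" if "reg w" "A \<in> sets borel" for w A
  proof -
    have "emeasure (density (path_measure L w) (indicator {0..t})) A = (\<integral>\<^sup>+ s. indicator {0..t} s * indicator A s \<partial>path_measure L w)"
      using that by (intro emeasure_density) auto
    also have "\<dots> = (\<integral>\<^sup>+ s. indicator ({0..t} \<inter> A) s \<partial>path_measure L w)" by (simp only: indicator_inter_arith)
    also have "\<dots> = emeasure (path_measure L w) ({0..t} \<inter> A)" using that by (intro nn_integral_indicator) auto
    finally show ?thesis using that by (simp add: K_def)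
  qed
  have sK: "sets (K w) = sets borel" for w by (simp add: K_def)
  have K: "K \<in> F t \<rightarrow>\<^sub>M subprob_algebra borel"
  proof (rule measurable_subprob_algebra_generated[where G = "range (\<lambda>a. {..a})" and \<Omega> = UNIV])
    show "sets borel = sigma_sets UNIV (range (\<lambda>a::real. {..a}))"
      by (subst borel_eq_atMost) simp
    show "Int_stable (range (\<lambda>a::real. {..a}))" by (auto simp: Int_stable_def)
    show "range (\<lambda>a::real. {..a}) \<subseteq> Pow UNIV" by simp
    show "subprob_space (K w)" if "w \<in> space (F t)" for w
    proof
      show "emeasure (K w) (space (K w)) \<le> 1"
      proof (cases "reg w")
        case True
        have "emeasure (K w) (space (K w)) = ennreal (\<kappa> / T) * ennreal (L t w - L 0 w)"
          using em[OF True, of UNIV] path_Icc[OF True t0(1)] sets_eq_imp_space_eq[OF sK[of w]] by simp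
        also have "\<dots> \<le> ennreal (\<kappa> / T) * ennreal (T / \<kappa>)"
          using regD(3)[OF True t0(1)] t0 \<kappa>_pos by (intro mult_left_mono ennreal_leI order_trans[OF regD(3)[OF True t0(1)]]) (auto intro: divide_right_mono)
        also have "\<dots> = 1" using \<kappa>_pos T_pos by (simp add: ennreal_mult[symmetric])
        finally show ?thesis .
      qed (simp add: K_def)
      show "space (K w) \<noteq> {}" using sets_eq_imp_space_eq[OF sK[of w]] by simp
    qed
    show "sets (K w) = sets borel" for w by (rule sK)
    have aux: "(\<lambda>w. emeasure (K w) A) \<in> borel_measurable (F t)"
      if A: "A \<in> sets borel" "{0..t} \<inter> A = {0..u} \<or> {0..t} \<inter> A = {}" "u \<in> {0..t}" for A u
    proof (rule measurable_AE_cong[OF complete subalg[OF t] null[OF t]])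
      let ?f = "\<lambda>w. if {0..t} \<inter> A = {} then 0 else ennreal (\<kappa> / T) * ennreal (L u w - L 0 w)"
      have "L u \<in> borel_measurable (F t)" "L 0 \<in> borel_measurable (F t)"
        using A(3) t0 by (auto intro!: measurable_G_mono[OF L_adapted])
      then show "?f \<in> borel_measurable (F t)" by simp
      show "AE w in M. ?f w = emeasure (K w) A"
        using L_regular
      proof eventually_elim
        case (elim w)
        then show ?case using em[OF elim A(1)] A path_Icc[OF elim, of 0 u] by auto
      qed
    qed
    show "(\<lambda>w. emeasure (K w) A) \<in> borel_measurable (F t)" if "A \<in> range (\<lambda>a. {..a})" for A
    proof -
      obtain a where a: "A = {..a}" using \<open>A \<in> range (\<lambda>a. {..a})\<close> by auto
      show ?thesis
      proof (cases "0 \<le> a")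
        case True
        then have "{0..t} \<inter> A = {0..min t a}" using a by auto
        then show ?thesis using a True t0 by (intro aux[of A "min t a"]) auto
      next
        case False
        then have "{0..t} \<inter> A = {}" using a by auto
        then show ?thesis using a t0 by (intro aux[of A 0]) auto
      qed
    qed
    show "(\<lambda>w. emeasure (K w) UNIV) \<in> borel_measurable (F t)"
      using t0 by (intro aux[of UNIV t]) auto
  qed
  have gm: "(\<lambda>(w, s). g (max 0 (min t s)) w) \<in> borel_measurable (F t \<Otimes>\<^sub>M borel)"
    by (rule prog_measurable_clip[OF g t])
  have "(\<lambda>w. \<integral>\<^sup>+ s. g (max 0 (min t s)) w \<partial>K w) \<in> borel_measurable (F t)"
    by (rule nn_integral_measurable_subprob_algebra2[OF gm K])
  then have m: "(\<lambda>w. ennreal (T / \<kappa>) * (\<integral>\<^sup>+ s. g (max 0 (min t s)) w \<partial>K w)) \<in> borel_measurable (F t)" by simp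
  show ?thesis
  proof (rule measurable_AE_cong[OF complete subalg[OF t] null[OF t] m])
    show "AE w in M. ennreal (T / \<kappa>) * (\<integral>\<^sup>+ s. g (max 0 (min t s)) w \<partial>K w) = (\<integral>\<^sup>+ s\<in>{0..t}. g s w \<partial>path_measure L w)"
      using L_regular AE_space
    proof eventually_elim
      case (elim w)
      have w: "w \<in> space (F t)" using elim space_G[OF t] by simp
      have [measurable]: "(\<lambda>s. g (max 0 (min t s)) w) \<in> borel_measurable borel"
      proof -
        have "(\<lambda>s. (w, s)) \<in> borel \<rightarrow>\<^sub>M F t \<Otimes>\<^sub>M borel" using w by simp
        from measurable_compose[OF this gm] show ?thesis by simp
      qed
      have "(\<integral>\<^sup>+ s. g (max 0 (min t s)) w \<partial>K w) = ennreal (\<kappa> / T) * (\<integral>\<^sup>+ s. indicator {0..t} s * g (max 0 (min t s)) w \<partial>path_measure L w)"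
        using elim by (simp add: K_def nn_integral_scale_measure nn_integral_density)
      also have "(\<integral>\<^sup>+ s. indicator {0..t} s * g (max 0 (min t s)) w \<partial>path_measure L w) = (\<integral>\<^sup>+ s\<in>{0..t}. g s w \<partial>path_measure L w)"
        by (intro nn_integral_cong) (auto simp: indicator_def max_def min_def)
      finally show ?case using \<kappa>_pos T_pos by (simp add: mult.assoc[symmetric] ennreal_mult[symmetric])
    qed
  qed
qed

end

text \<open>The assumption \<open>nn\<close> abstracts from the measure \<open>N w\<close>, so that
  one proof serves Lebesgue measure and the path measure. The vector integral is assembled from the
  positive and negative parts of its coordinates.\<close>

lemma (in complete_filtration) set_lebesgue_integral_adapted:
  fixes f :: "('a, 'v::euclidean_space) process"
  assumes nn: "\<And>g. prog_measurable G T g \<Longrightarrow> (\<lambda>w. \<integral>\<^sup>+ s\<in>{0..t}. g s w \<partial>N w) \<in> borel_measurable (G t)"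
    and f: "prog_measurable G T f" and t: "t \<in> {0..T}"
    and i: "AE w in M. set_integrable (N w) {0..t} (\<lambda>s. f s w)"
  shows "(\<lambda>w. LINT s:{0..t}|N w. f s w) \<in> borel_measurable (G t)"
proof (rule measurable_AE_cong[OF complete subalg[OF t] null[OF t]])
  let ?p = "\<lambda>b w. \<integral>\<^sup>+ s\<in>{0..t}. ennreal (f s w \<bullet> b) \<partial>N w" and ?n = "\<lambda>b w. \<integral>\<^sup>+ s\<in>{0..t}. ennreal (- (f s w \<bullet> b)) \<partial>N w"
  have "?p b \<in> borel_measurable (G t)" "?n b \<in> borel_measurable (G t)" for b
    by (rule nn, rule prog_measurable_compose[OF f], simp)+
  then show "(\<lambda>w. \<Sum>b\<in>Basis. (enn2real (?p b w) - enn2real (?n b w)) *\<^sub>R b) \<in> borel_measurable (G t)"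
    by measurable
  show "AE w in M. (\<Sum>b\<in>Basis. (enn2real (?p b w) - enn2real (?n b w)) *\<^sub>R b) = (LINT s:{0..t}|N w. f s w)"
    using i
  proof eventually_elim
    case (elim w)
    let ?g = "\<lambda>s. indicator {0..t} s *\<^sub>R f s w"
    have gi: "integrable (N w) ?g" using elim by (simp add: set_integrable_def)
    have "(\<integral>s. ?g s \<partial>N w) \<bullet> b = enn2real (?p b w) - enn2real (?n b w)" for b
    proof -
      have "(\<integral>s. ?g s \<partial>N w) \<bullet> b = (\<integral>s. ?g s \<bullet> b \<partial>N w)" using gi by (rule integral_inner_left[symmetric])
      also have "\<dots> = enn2real (\<integral>\<^sup>+ s. ennreal (?g s \<bullet> b) \<partial>N w) - enn2real (\<integral>\<^sup>+ s. ennreal (- (?g s \<bullet> b)) \<partial>N w)"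
        by (rule real_lebesgue_integral_def) (rule integrable_inner_left, rule gi)
      also have "(\<integral>\<^sup>+ s. ennreal (?g s \<bullet> b) \<partial>N w) = ?p b w"
        by (intro nn_integral_cong) (auto simp: indicator_def)
      also have "(\<integral>\<^sup>+ s. ennreal (- (?g s \<bullet> b)) \<partial>N w) = ?n b w"
        by (intro nn_integral_cong) (auto simp: indicator_def)
      finally show ?thesis .
    qed
    then show ?case
      unfolding set_lebesgue_integral_def using euclidean_representation[of "\<integral>s. ?g s \<partial>N w"] by simp
  qed
qed

section \<open>Ito isometry\<close>

lemma vec_nth_measurable [measurable]: "(\<lambda>x::'b::euclidean_space ^ 'n. x $ i) \<in> borel_measurable borel"
  by (intro borel_measurable_continuous_onI continuous_intros)

lemma norm_matrix_vector_le: "norm ((A :: real ^ 'd ^ 'n) *v x) \<le> norm A * norm x"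
proof -
  have "norm ((A *v x) $ i) \<le> norm (A $ i) * norm x" for i
    by (simp add: matrix_vector_mul_component Cauchy_Schwarz_ineq2)
  then have "norm (A *v x) \<le> L2_set (\<lambda>i. norm (A $ i) * norm x) UNIV"
    unfolding norm_vec_def[of "A *v x"] by (intro L2_set_mono) auto
  also have "\<dots> = norm A * norm x" by (simp add: L2_set_left_distrib norm_vec_def[of A])
  finally show ?thesis .
qed

lemma matrix_vector_measurable [measurable]:
  fixes A :: "'a \<Rightarrow> real ^ 'd ^ 'n"
  assumes A: "A \<in> borel_measurable M" and x: "x \<in> borel_measurable M"
  shows "(\<lambda>w. A w *v x w) \<in> borel_measurable M"
proof (subst borel_measurable_euclidean_space, rule ballI)
  fix e :: "real ^ 'n" assume "e \<in> Basis"
  then obtain i where e: "e = axis i 1" by (auto simp: Basis_vec_def)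
  have "(\<lambda>w. A w $ i) \<in> borel_measurable M" using A by measurable
  then have "(\<lambda>w. A w $ i \<bullet> x w) \<in> borel_measurable M" using x by (rule borel_measurable_inner)
  then show "(\<lambda>w. (A w *v x w) \<bullet> e) \<in> borel_measurable M"
    by (simp add: e inner_axis matrix_vector_mul_component)
qed

text \<open>The weighted sum of rows is the transpose of \<open>A\<close> applied to
  \<open>y\<close>. This moves a random matrix into the factor that is known in the past.\<close>

lemma inner_matrix_vector:
  fixes A :: "real ^ 'd ^ 'n"
  shows "y \<bullet> (A *v x) = (\<Sum>i\<in>UNIV. y $ i *\<^sub>R A $ i) \<bullet> x"
  by (simp add: inner_vec_def[of y] matrix_vector_mul_component inner_sum_left)

lemma norm_sum_rows_le:
  fixes A :: "real ^ 'd ^ 'n"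
  shows "norm (\<Sum>i\<in>UNIV. y $ i *\<^sub>R A $ i) \<le> real CARD('n) * norm A * norm y"
proof -
  have "norm (\<Sum>i\<in>UNIV. y $ i *\<^sub>R A $ i) \<le> (\<Sum>i\<in>(UNIV::'n set). norm A * norm y)"
  proof (rule order_trans[OF norm_sum sum_mono])
    fix i
    have "norm (y $ i) * norm (A $ i) \<le> norm y * norm A"
      by (intro mult_mono Finite_Cartesian_Product.norm_nth_le) auto
    then show "norm (y $ i *\<^sub>R A $ i) \<le> norm A * norm y" by (simp add: mult.commute)
  qed
  then show ?thesis by simp
qed

lemma integrable_mult_bounded:
  fixes f D :: "'a \<Rightarrow> real"
  assumes "f \<in> borel_measurable M" "\<And>x. x \<in> space M \<Longrightarrow> \<bar>f x\<bar> \<le> C" "integrable M D"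
  shows "integrable M (\<lambda>x. f x * D x)"
proof (rule Bochner_Integration.integrable_bound[of M "\<lambda>x. C * D x"])
  show "AE x in M. norm (f x * D x) \<le> norm (C * D x)"
  proof (rule AE_I2)
    fix x assume "x \<in> space M"
    then have "\<bar>f x\<bar> \<le> \<bar>C\<bar>" using assms(2)[of x] by linarith
    then show "norm (f x * D x) \<le> norm (C * D x)" by (simp add: abs_mult mult_right_mono)
  qed
qed (use assms in auto)

context complete_filtration
begin

lemma L2_martingale_zero: "L2_martingale (\<lambda>t w. 0)"
  by (simp add: L2_martingale_def)

lemma L2_martingale_add:
  assumes X: "L2_martingale X" and Y: "L2_martingale Y"
  shows "L2_martingale (\<lambda>t w. X t w + Y t w)"
  using L2_martingale_diff[OF X L2_martingale_diff[OF L2_martingale_zero Y]] by simp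

lemma L2_martingale_sum:
  assumes "\<And>i. i \<in> I \<Longrightarrow> L2_martingale (X i)"
  shows "L2_martingale (\<lambda>t w. \<Sum>i\<in>I. X i t w)"
  using assms by (induction I rule: infinite_finite_induct) (auto intro: L2_martingale_zero L2_martingale_add)

text \<open>The coefficients allowed in a simple process from time \<open>s\<close> on; boundedness
  keeps their products with increments of \<open>Z\<close> square-integrable.\<close>

definition bounded_at :: "real \<Rightarrow> ('a \<Rightarrow> 'v::euclidean_space) \<Rightarrow> bool" where
  "bounded_at s xi \<longleftrightarrow> s \<in> {0..T} \<and> xi \<in> borel_measurable (G s) \<and> (\<exists>C. \<forall>w\<in>space M. norm (xi w) \<le> C)"

lemma bounded_at_mono: "bounded_at s xi \<Longrightarrow> s \<le> t \<Longrightarrow> t \<le> T \<Longrightarrow> bounded_at t xi"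
  unfolding bounded_at_def by (auto intro: measurable_G_mono)

lemma bounded_at_measurable: "bounded_at s xi \<Longrightarrow> xi \<in> borel_measurable M"
  using measurable_GM unfolding bounded_at_def by blast

end

section \<open>Isometry for single increments\<close>

context driver
begin

lemma Z_measurable: "t \<in> {0..T} \<Longrightarrow> Z t \<in> borel_measurable M"
  using measurable_GM[OF Z_adapted] by simp

lemma L_measurable: "t \<in> {0..T} \<Longrightarrow> L t \<in> borel_measurable M"
  using measurable_GM[OF L_adapted] by simp

lemma L2_component: "L2 M X \<Longrightarrow> L2 M (\<lambda>w. X w $ i)" for X :: "'a \<Rightarrow> real ^ 'k"
  by (rule L2_norm_le) (auto simp: L2_def intro!: AE_I2 component_le_norm_cart)

lemma Z_martingale: "L2_martingale Z"
  unfolding L2_martingale_def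
proof (intro conjI ballI allI impI)
  fix s t A assume a: "0 \<le> s \<and> s \<le> t \<and> t \<le> T \<and> A \<in> sets (F s)"
  then have A: "A \<in> sets M" using subalg[of s] by (auto simp: subalgebra_def)
  have i: "integrable M (\<lambda>w. indicator A w *\<^sub>R (Z t w - Z s w))"
    using a A by (intro integrable_mult_indicator L2_integrable L2_diff Z_L2) auto
  show "(\<integral>w. indicator A w *\<^sub>R (Z t w - Z s w) \<partial>M) = 0"
  proof (rule euclidean_eqI)
    fix e :: "real ^ 'd" assume "e \<in> Basis"
    then obtain j where e: "e = axis j 1" by (auto simp: Basis_vec_def)
    have "(\<integral>w. indicator A w *\<^sub>R (Z t w - Z s w) \<partial>M) \<bullet> e = (\<integral>w. (indicator A w *\<^sub>R (Z t w - Z s w)) \<bullet> e \<partial>M)"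
      by (rule integral_inner_left[symmetric]) (rule i)
    also have "\<dots> = (\<integral>w. indicator A w * (Z t w $ j - Z s w $ j) \<partial>M)"
      by (simp add: e inner_axis)
    also have "\<dots> = 0" using a by (intro Z_mart) auto
    finally show "(\<integral>w. indicator A w *\<^sub>R (Z t w - Z s w) \<partial>M) \<bullet> e = 0 \<bullet> e" by simp
  qed
qed (auto simp: Z_adapted Z_L2)

lemma L2_increment:
  fixes xi :: "'a \<Rightarrow> real ^ 'd ^ 'n"
  assumes xi: "bounded_at u xi" and "s \<in> {0..T}" "q \<in> {0..T}"
  shows "L2 M (\<lambda>w. xi w *v (Z q w - Z s w))"
proof -
  obtain C where C: "\<And>w. w \<in> space M \<Longrightarrow> norm (xi w) \<le> C" using xi by (auto simp: bounded_at_def)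
  show ?thesis
  proof (rule L2_mult_bounded)
    show "L2 M (\<lambda>w. Z q w - Z s w)" using assms by (intro L2_diff Z_L2)
    show "(\<lambda>w. xi w *v (Z q w - Z s w)) \<in> borel_measurable M"
      using bounded_at_measurable[OF xi] Z_measurable assms by measurable
    show "norm (xi w *v (Z q w - Z s w)) \<le> C * norm (Z q w - Z s w)" if "w \<in> space M" for w
      by (rule order_trans[OF norm_matrix_vector_le mult_right_mono[OF C[OF that]]]) simp
  qed
qed

text \<open>Transposing collects \<open>Y\<close> and \<open>xi\<close> into one factor that is
  measurable at time \<open>s\<close> and, \<open>xi\<close> being bounded, square-integrable; the
  increment of \<open>Z\<close> is orthogonal to it.\<close>

lemma increment_orth:
  fixes xi :: "'a \<Rightarrow> real ^ 'd ^ 'n"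
  assumes xi: "bounded_at s xi" and q: "s \<le> q" "q \<le> T"
    and Y: "Y \<in> borel_measurable (F s)" "L2 M Y"
  shows "(\<integral>w. Y w \<bullet> (xi w *v (Z q w - Z s w)) \<partial>M) = 0"
proof -
  have s: "0 \<le> s" "s \<in> {0..T}" using xi q by (auto simp: bounded_at_def)
  have xim: "xi \<in> borel_measurable (F s)" using xi by (simp add: bounded_at_def)
  obtain C where C: "\<And>w. w \<in> space M \<Longrightarrow> norm (xi w) \<le> C" using xi by (auto simp: bounded_at_def)
  let ?Y = "\<lambda>w. \<Sum>i\<in>UNIV. Y w $ i *\<^sub>R xi w $ i"
  have Ym: "?Y \<in> borel_measurable (F s)" using xim Y(1) by measurable
  have "(\<integral>w. ?Y w \<bullet> (Z q w - Z s w) \<partial>M) = 0"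
  proof (rule L2_martingale_orth[OF Z_martingale s(1) q Ym])
    show "L2 M ?Y"
    proof (rule L2_mult_bounded[OF Y(2)])
      show "?Y \<in> borel_measurable M" using measurable_GM[OF Ym s(2)] .
      show "norm (?Y w) \<le> real CARD('n) * C * norm (Y w)" if "w \<in> space M" for w
        by (rule order_trans[OF norm_sum_rows_le]) (intro mult_right_mono mult_left_mono C that, auto)
    qed
  qed
  then show ?thesis by (simp add: inner_matrix_vector)
qed

lemma L_bounded: "reg w \<Longrightarrow> t \<in> {0..T} \<Longrightarrow> \<bar>L t w\<bar> \<le> T / \<kappa>"
  using regD(3)[of w 0 t] regD(1)[of w 0] regD(4)[of w t] \<kappa>_pos divide_right_mono[of t T \<kappa>] by auto

lemma L_integrable: assumes "t \<in> {0..T}" shows "integrable M (L t)"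
proof (rule Bochner_Integration.integrable_bound[of M "\<lambda>_. T / \<kappa>"])
  show "AE w in M. norm (L t w) \<le> norm (T / \<kappa>)"
    using L_regular
    by eventually_elim (unfold real_norm_def, rule order_trans[OF L_bounded[OF _ assms] abs_ge_self])
qed (use assms L_measurable in auto)

text \<open>In coordinates the difference of both sides is a finite sum of bounded factors known at
  time \<open>s\<close> times the compensated products \<open>?D\<close>, whose integrals over
  events of \<open>F s\<close> vanish by \<open>Z_qv\<close>. Two matrices are allowed because
  integrands on different partitions will be compared.\<close>

lemma increment_iso:
  fixes xi eta :: "'a \<Rightarrow> real ^ 'd ^ 'n"
  assumes xi: "bounded_at s xi" and eta: "bounded_at s eta" and q: "s \<le> q" "q \<le> T"
  shows "(\<integral>w. (xi w *v (Z q w - Z s w)) \<bullet> (eta w *v (Z q w - Z s w)) \<partial>M) = (\<integral>w. (xi w \<bullet> eta w) * (L q w - L s w) \<partial>M)"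
proof -
  have s: "0 \<le> s" "s \<in> {0..T}" "q \<in> {0..T}" using xi q by (auto simp: bounded_at_def)
  obtain C where C: "\<And>w. w \<in> space M \<Longrightarrow> norm (xi w) \<le> C" using xi by (auto simp: bounded_at_def)
  obtain C' where C': "\<And>w. w \<in> space M \<Longrightarrow> norm (eta w) \<le> C'" using eta by (auto simp: bounded_at_def)
  have xim: "xi \<in> borel_measurable (F s)" and etam: "eta \<in> borel_measurable (F s)" using xi eta by (auto simp: bounded_at_def)
  let ?l = "\<lambda>w. L q w - L s w" and ?d = "\<lambda>w i. Z q w $ i - Z s w $ i"
  let ?D = "\<lambda>i j w. ?d w i * ?d w j - (if i = j then ?l w else 0)"
  let ?f = "\<lambda>a i j w. xi w $ a $ i * eta w $ a $ j"
  have dL2: "L2 M (\<lambda>w. ?d w i)" for i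
    using L2_component[OF L2_diff[OF Z_L2[OF s(3)] Z_L2[OF s(2)]], of i] by simp
  have li: "integrable M ?l" using L_integrable s by auto
  have Di: "integrable M (?D i j)" for i j
    using L2_inner_integrable[OF dL2[of i] dL2[of j]] li by (cases "i = j") auto
  have fm: "?f a i j \<in> borel_measurable (F s)" for a i j
    using xim etam by measurable
  have fb: "\<bar>?f a i j w\<bar> \<le> C * C'" if w: "w \<in> space M" for a i j w
  proof -
    have comp: "\<bar>A $ a $ i\<bar> \<le> norm A" for A :: "real ^ 'd ^ 'n" and a i
      using order_trans[OF component_le_norm_cart Finite_Cartesian_Product.norm_nth_le] by blast
    have "0 \<le> C" using order_trans[OF norm_ge_zero C[OF w]] .
    then show ?thesis unfolding abs_mult
      by (intro mult_mono order_trans[OF comp C[OF w]] order_trans[OF comp C'[OF w]]) auto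
  qed
  have fDi: "integrable M (\<lambda>w. ?f a i j w * ?D i j w)" for a i j
    using measurable_GM[OF fm s(2)] fb by (intro integrable_mult_bounded[OF _ _ Di]) auto
  have z: "(\<integral>w. ?f a i j w * ?D i j w \<partial>M) = 0" for a i j
  proof (rule orth_subalgebra[OF subalg[OF s(2)] Di _ fm fDi])
    fix A assume "A \<in> sets (F s)"
    then show "(\<integral>w. indicator A w * ?D i j w \<partial>M) = 0"
      using Z_qv[OF s(1) q, of A i j] by simp
  qed
  have eq: "(xi w *v (Z q w - Z s w)) \<bullet> (eta w *v (Z q w - Z s w)) - (xi w \<bullet> eta w) * ?l w
      = (\<Sum>a\<in>UNIV. \<Sum>i\<in>UNIV. \<Sum>j\<in>UNIV. ?f a i j w * ?D i j w)" for w
  proof -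
    have "(xi w *v (Z q w - Z s w)) \<bullet> (eta w *v (Z q w - Z s w)) =
        (\<Sum>a\<in>UNIV. (\<Sum>i\<in>UNIV. xi w $ a $ i * ?d w i) * (\<Sum>j\<in>UNIV. eta w $ a $ j * ?d w j))"
      by (simp add: inner_vec_def matrix_vector_mult_def)
    also have "\<dots> = (\<Sum>a\<in>UNIV. \<Sum>i\<in>UNIV. \<Sum>j\<in>UNIV. ?f a i j w * (?d w i * ?d w j))"
      unfolding sum_product by (intro sum.cong refl) (simp add: ac_simps)
    finally have 1: "(xi w *v (Z q w - Z s w)) \<bullet> (eta w *v (Z q w - Z s w)) = (\<Sum>a\<in>UNIV. \<Sum>i\<in>UNIV. \<Sum>j\<in>UNIV. ?f a i j w * (?d w i * ?d w j))" .
    have "(\<Sum>j\<in>UNIV. ?f a i j w * (if i = j then ?l w else 0)) = ?f a i i w * ?l w" for a i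
    proof -
      have "(\<Sum>j\<in>UNIV. ?f a i j w * (if i = j then ?l w else 0)) = (\<Sum>j\<in>UNIV. if j = i then ?f a i i w * ?l w else 0)"
        by (intro sum.cong) auto
      then show ?thesis by simp
    qed
    then have 2: "(xi w \<bullet> eta w) * ?l w = (\<Sum>a\<in>UNIV. \<Sum>i\<in>UNIV. \<Sum>j\<in>UNIV. ?f a i j w * (if i = j then ?l w else 0))"
      by (simp add: inner_vec_def sum_distrib_right)
    show ?thesis unfolding 1 2 by (simp only: sum_subtractf[symmetric] right_diff_distrib[symmetric])
  qed
  have i1: "integrable M (\<lambda>w. (xi w *v (Z q w - Z s w)) \<bullet> (eta w *v (Z q w - Z s w)))"
    using L2_increment[OF xi s(2,3)] L2_increment[OF eta s(2,3)] by (rule L2_inner_integrable)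
  have i2: "integrable M (\<lambda>w. (xi w \<bullet> eta w) * ?l w)"
  proof (rule integrable_mult_bounded[OF _ _ li])
    show "(\<lambda>w. xi w \<bullet> eta w) \<in> borel_measurable M"
      using bounded_at_measurable[OF xi] bounded_at_measurable[OF eta] by measurable
    show "\<bar>xi w \<bullet> eta w\<bar> \<le> C * C'" if w: "w \<in> space M" for w
    proof -
      have "0 \<le> C" using order_trans[OF norm_ge_zero C[OF w]] .
      then show ?thesis
        by (intro order_trans[OF Cauchy_Schwarz_ineq2] mult_mono C[OF w] C'[OF w]) auto
    qed
  qed
  have "(\<integral>w. (xi w *v (Z q w - Z s w)) \<bullet> (eta w *v (Z q w - Z s w)) \<partial>M) - (\<integral>w. (xi w \<bullet> eta w) * ?l w \<partial>M)
     = (\<integral>w. (\<Sum>a\<in>UNIV. \<Sum>i\<in>UNIV. \<Sum>j\<in>UNIV. ?f a i j w * ?D i j w) \<partial>M)"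
    by (subst Bochner_Integration.integral_diff[OF i1 i2, symmetric]) (simp only: eq)
  also have "\<dots> = (\<Sum>a\<in>UNIV. \<Sum>i\<in>UNIV. \<Sum>j\<in>UNIV. \<integral>w. ?f a i j w * ?D i j w \<partial>M)"
    by (simp only: Bochner_Integration.integral_sum Bochner_Integration.integrable_sum fDi)
  also have "\<dots> = 0" by (simp only: z sum.neutral_const)
  finally show ?thesis by simp
qed

definition elementary :: "real \<Rightarrow> real \<Rightarrow> ('a \<Rightarrow> real ^ 'd ^ 'n) \<Rightarrow> real \<Rightarrow> 'a \<Rightarrow> real ^ 'n" where
  "elementary p q xi t w = xi w *v (Z (min t q) w - Z (min t p) w)"

lemma elementary_L2:
  assumes "bounded_at p xi" "p \<le> q" "q \<le> T" "t \<in> {0..T}"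
  shows "L2 M (elementary p q xi t)"
  using assms L2_increment[OF assms(1), of "min t p" "min t q"]
  unfolding elementary_def by (auto simp: bounded_at_def)

lemma elementary_adapted:
  assumes "bounded_at p xi" "p \<le> q" "q \<le> T" "t \<in> {0..T}"
  shows "elementary p q xi t \<in> borel_measurable (F t)"
proof (cases "t \<le> p")
  case True
  then have "elementary p q xi t = (\<lambda>w. 0)" using assms by (auto simp: elementary_def fun_eq_iff)
  then show ?thesis by simp
next
  case False
  then have "xi \<in> borel_measurable (F t)"
    using bounded_at_mono[OF assms(1), of t] assms by (auto simp: bounded_at_def)
  moreover have "Z (min t q) \<in> borel_measurable (F t)" "Z (min t p) \<in> borel_measurable (F t)"
    using assms by (auto simp: bounded_at_def intro!: measurable_G_mono[OF Z_adapted])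
  ultimately show ?thesis unfolding elementary_def by measurable
qed

lemma elementary_martingale:
  assumes xi: "bounded_at p xi" and q: "p \<le> q" "q \<le> T"
  shows "L2_martingale (elementary p q xi)"
  unfolding L2_martingale_def
proof (intro conjI ballI allI impI)
  fix t assume "t \<in> {0..T}"
  then show "elementary p q xi t \<in> borel_measurable (F t)" "L2 M (elementary p q xi t)"
    using elementary_adapted[OF assms] elementary_L2[OF assms] by auto
next
  fix s t A assume a: "0 \<le> s \<and> s \<le> t \<and> t \<le> T \<and> A \<in> sets (F s)"
  \<comment> \<open>The increment over \<open>(s, t]\<close> of the elementary integral comes from
    the overlap of \<open>(s, t]\<close> with \<open>(p, q]\<close>, which is \<open>(u, v]\<close>;
    \<open>v = u\<close> when there is none.\<close>
  define u where "u = max s p"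
  define v where "v = max u (min t q)"
  have p: "0 \<le> p" "p \<le> T" using xi by (auto simp: bounded_at_def)
  have uv: "0 \<le> u" "u \<le> v" "v \<le> T" "s \<le> u" "p \<le> u" "u \<in> {0..T}" "v \<in> {0..T}"
    using a q p by (auto simp: u_def v_def)
  have eq: "elementary p q xi t w - elementary p q xi s w = xi w *v (Z v w - Z u w)" for w
  proof -
    have "Z (min t q) w - Z (min t p) w - (Z (min s q) w - Z (min s p) w) = Z v w - Z u w"
      using a q p by (auto simp: u_def v_def min_def max_def)
    then show ?thesis unfolding elementary_def matrix_vector_mult_diff_distrib[symmetric] by simp
  qed
  have Au: "A \<in> sets (F u)" using a G_mono[of s u] uv by auto
  then have AM: "A \<in> sets M" using subalg[of u] uv by (auto simp: subalgebra_def)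
  have i: "integrable M (\<lambda>w. indicator A w *\<^sub>R (xi w *v (Z v w - Z u w)))"
    using uv by (intro integrable_mult_indicator AM L2_integrable L2_increment[OF xi]) auto
  have "(\<integral>w. indicator A w *\<^sub>R (xi w *v (Z v w - Z u w)) \<partial>M) = 0"
  proof (rule euclidean_eqI)
    fix e :: "real ^ 'b"
    have "(\<integral>w. indicator A w *\<^sub>R (xi w *v (Z v w - Z u w)) \<partial>M) \<bullet> e = (\<integral>w. (indicator A w *\<^sub>R (xi w *v (Z v w - Z u w))) \<bullet> e \<partial>M)"
      by (rule integral_inner_left[symmetric]) (rule i)
    also have "\<dots> = (\<integral>w. (indicator A w *\<^sub>R e) \<bullet> (xi w *v (Z v w - Z u w)) \<partial>M)"
      by (simp add: inner_commute)
    also have "\<dots> = 0"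
    proof (rule increment_orth[OF bounded_at_mono[OF xi uv(5)] uv(2,3)])
      show "(\<lambda>w. indicator A w *\<^sub>R e) \<in> borel_measurable (F u)" using Au by measurable
      show "L2 M (\<lambda>w. indicator A w *\<^sub>R e)"
      proof (rule L2_norm_le[of M "\<lambda>w. e"])
        show "AE w in M. norm (indicator A w *\<^sub>R e) \<le> norm e" by (intro AE_I2) (auto simp: indicator_def)
        show "(\<lambda>w. indicator A w *\<^sub>R e) \<in> borel_measurable M" using AM by measurable
      qed (simp add: L2_def)
    qed (use uv in auto)
    finally show "(\<integral>w. indicator A w *\<^sub>R (xi w *v (Z v w - Z u w)) \<partial>M) \<bullet> e = 0 \<bullet> e" by simp
  qed
  then show "(\<integral>w. indicator A w *\<^sub>R (elementary p q xi t w - elementary p q xi s w) \<partial>M) = 0"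
    by (simp only: eq)
qed

lemma increment_adapted:
  fixes xi :: "'a \<Rightarrow> real ^ 'd ^ 'n"
  assumes "bounded_at s xi" "s \<le> u" "u \<le> T" "0 \<le> a" "a \<le> u" "0 \<le> b" "b \<le> u"
  shows "(\<lambda>w. xi w *v (Z b w - Z a w)) \<in> borel_measurable (F u)"
proof -
  have "xi \<in> borel_measurable (F u)" using bounded_at_mono[OF assms(1-3)] by (simp add: bounded_at_def)
  moreover have "Z b \<in> borel_measurable (F u)" "Z a \<in> borel_measurable (F u)"
    using assms by (auto intro!: measurable_G_mono[OF Z_adapted])
  ultimately show ?thesis by measurable
qed

text \<open>The intervals \<open>(a, c]\<close> and \<open>(b, e]\<close> share
  \<open>(b, m]\<close> with \<open>m = min c e\<close>. In every other pair of pieces one increment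
  comes after everything in the other factor and is therefore orthogonal to it, so only the shared
  piece contributes.\<close>

lemma increment_cross:
  fixes xi eta :: "'a \<Rightarrow> real ^ 'd ^ 'n"
  assumes xi: "bounded_at a xi" and eta: "bounded_at b eta" and ord: "a \<le> b" "b \<le> c" "c \<le> T" "b \<le> e" "e \<le> T"
  shows "(\<integral>w. (xi w *v (Z c w - Z a w)) \<bullet> (eta w *v (Z e w - Z b w)) \<partial>M) =
    (\<integral>w. (xi w \<bullet> eta w) * (L (min c e) w - L b w) \<partial>M)"
proof -
  have a0: "0 \<le> a" "0 \<le> b" using xi eta by (auto simp: bounded_at_def)
  have xib: "bounded_at b xi" using bounded_at_mono[OF xi ord(1)] ord by simp
  define m where "m = min c e"
  have m: "b \<le> m" "m \<le> T" "m \<le> c" "m \<le> e" using ord by (auto simp: m_def)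
  have L2xi: "L2 M (\<lambda>w. xi w *v (Z y w - Z x w))" and L2eta: "L2 M (\<lambda>w. eta w *v (Z y w - Z x w))"
    if "0 \<le> x" "x \<le> T" "0 \<le> y" "y \<le> T" for x y
    using that by (auto intro: L2_increment[OF xi] L2_increment[OF eta])
  have 1: "(\<integral>w. (xi w *v (Z b w - Z a w)) \<bullet> (eta w *v (Z e w - Z b w)) \<partial>M) = 0"
    using ord a0 by (intro increment_orth[OF eta] L2xi increment_adapted[OF xi]) auto
  have 2: "(\<integral>w. (xi w *v (Z m w - Z b w)) \<bullet> (eta w *v (Z m w - Z b w)) \<partial>M) = (\<integral>w. (xi w \<bullet> eta w) * (L m w - L b w) \<partial>M)"
    using m by (intro increment_iso[OF xib eta])
  have 3: "(\<integral>w. (xi w *v (Z m w - Z b w)) \<bullet> (eta w *v (Z e w - Z m w)) \<partial>M) = 0"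
    using m ord a0 by (intro increment_orth[OF bounded_at_mono[OF eta]] L2xi increment_adapted[OF xib]) auto
  have 4: "(\<integral>w. (xi w *v (Z c w - Z m w)) \<bullet> (eta w *v (Z e w - Z b w)) \<partial>M) = 0"
  proof (cases "c = m")
    case False
    then have em: "e = m" using ord by (auto simp: m_def)
    have "(\<integral>w. (eta w *v (Z m w - Z b w)) \<bullet> (xi w *v (Z c w - Z m w)) \<partial>M) = 0"
      using m ord a0 by (intro increment_orth[OF bounded_at_mono[OF xib]] L2eta increment_adapted[OF eta]) auto
    then show ?thesis by (simp add: em inner_commute)
  qed simp
  have eq: "(xi w *v (Z c w - Z a w)) \<bullet> (eta w *v (Z e w - Z b w)) =
      (xi w *v (Z b w - Z a w)) \<bullet> (eta w *v (Z e w - Z b w)) + (xi w *v (Z m w - Z b w)) \<bullet> (eta w *v (Z m w - Z b w))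
      + (xi w *v (Z m w - Z b w)) \<bullet> (eta w *v (Z e w - Z m w)) + (xi w *v (Z c w - Z m w)) \<bullet> (eta w *v (Z e w - Z b w))" for w
    by (simp add: matrix_vector_mult_diff_distrib inner_add_left inner_add_right inner_diff_left inner_diff_right)
  have i: "integrable M (\<lambda>w. (xi w *v (Z y w - Z x w)) \<bullet> (eta w *v (Z y' w - Z x' w)))"
    if "0 \<le> x" "x \<le> T" "0 \<le> y" "y \<le> T" "0 \<le> x'" "x' \<le> T" "0 \<le> y'" "y' \<le> T" for x y x' y'
    using that by (intro L2_inner_integrable L2xi L2eta)
  show ?thesis
  proof -
    have i1: "integrable M (\<lambda>w. (xi w *v (Z b w - Z a w)) \<bullet> (eta w *v (Z e w - Z b w)))"
      using ord a0 m by (intro i) linarith+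
    have i2: "integrable M (\<lambda>w. (xi w *v (Z m w - Z b w)) \<bullet> (eta w *v (Z m w - Z b w)))"
      using ord a0 m by (intro i) linarith+
    have i3: "integrable M (\<lambda>w. (xi w *v (Z m w - Z b w)) \<bullet> (eta w *v (Z e w - Z m w)))"
      using ord a0 m by (intro i) linarith+
    have i4: "integrable M (\<lambda>w. (xi w *v (Z c w - Z m w)) \<bullet> (eta w *v (Z e w - Z b w)))"
      using ord a0 m by (intro i) linarith+
    note i12 = Bochner_Integration.integrable_add[OF i1 i2]
    note i123 = Bochner_Integration.integrable_add[OF i12 i3]
    show ?thesis
      unfolding eq m_def[symmetric] Bochner_Integration.integral_add[OF i123 i4]
        Bochner_Integration.integral_add[OF i12 i3] Bochner_Integration.integral_add[OF i1 i2] 1 2 3 4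
      by simp
  qed
qed

text \<open>The outer \<open>max\<close> makes the right side vanish when the two intervals, stopped
  at \<open>t\<close>, do not overlap. By symmetry the interval that starts later may be taken
  second.\<close>

lemma elementary_inner:
  fixes xi eta :: "'a \<Rightarrow> real ^ 'd ^ 'n"
  assumes xi: "bounded_at p xi" "p \<le> q" "q \<le> T" and eta: "bounded_at p' eta" "p' \<le> q'" "q' \<le> T" and t: "t \<in> {0..T}"
  shows "(\<integral>w. elementary p q xi t w \<bullet> elementary p' q' eta t w \<partial>M) =
    (\<integral>w. (xi w \<bullet> eta w) * (L (max (max p p') (min (min q q') t)) w - L (max p p') w) \<partial>M)"
proof -
  have main: "(\<integral>w. elementary p q xi t w \<bullet> elementary p' q' eta t w \<partial>M) =
    (\<integral>w. (xi w \<bullet> eta w) * (L (max p' (min (min q q') t)) w - L p' w) \<partial>M)"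
    if xi: "bounded_at p xi" "p \<le> q" "q \<le> T" and eta: "bounded_at p' eta" "p' \<le> q'" "q' \<le> T" and pp: "p \<le> p'"
    for p q p' q' and xi eta :: "'a \<Rightarrow> real ^ 'd ^ 'n"
  proof -
    have p0: "0 \<le> p" "0 \<le> p'" using xi eta by (auto simp: bounded_at_def)
    consider "t \<le> p'" | "p' < t" "min t q \<le> p'" | "p' < t" "p' < min t q" by linarith
    then show ?thesis
    proof cases
      case 1
      then have "elementary p' q' eta t w = 0" for w using eta by (simp add: elementary_def min_def)
      moreover have "max p' (min (min q q') t) = p'" using 1 by auto
      ultimately show ?thesis by simp
    next
      case 2
      have *: "max p' (min (min q q') t) = p'" using 2 by auto
      have "(\<integral>w. elementary p q xi t w \<bullet> (eta w *v (Z (min t q') w - Z p' w)) \<partial>M) = 0"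
      proof (rule increment_orth[OF eta(1)])
        have "elementary p q xi t = (\<lambda>w. xi w *v (Z (min t q) w - Z p w))"
          using 2 pp by (simp add: elementary_def fun_eq_iff min_def)
        then show "elementary p q xi t \<in> borel_measurable (F p')"
          using 2 xi eta p0 pp t by (simp only:) (intro increment_adapted[OF xi(1)], auto)
        show "L2 M (elementary p q xi t)" using xi t by (intro elementary_L2)
      qed (use 2 eta t in auto)
      moreover have "elementary p' q' eta t w = eta w *v (Z (min t q') w - Z p' w)" for w
        using 2 by (simp add: elementary_def)
      ultimately show ?thesis by (simp add: *)
    next
      case 3
      have "(\<integral>w. (xi w *v (Z (min t q) w - Z p w)) \<bullet> (eta w *v (Z (min t q') w - Z p' w)) \<partial>M) =
        (\<integral>w. (xi w \<bullet> eta w) * (L (min (min t q) (min t q')) w - L p' w) \<partial>M)"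
        using 3 xi eta pp t by (intro increment_cross[OF xi(1) eta(1)]) auto
      moreover have "min (min t q) (min t q') = max p' (min (min q q') t)" using 3 eta by auto
      moreover have "elementary p q xi t w = xi w *v (Z (min t q) w - Z p w)" "elementary p' q' eta t w = eta w *v (Z (min t q') w - Z p' w)" for w
        using 3 pp by (auto simp: elementary_def min_def)
      ultimately show ?thesis by simp
    qed
  qed
  show ?thesis
  proof (cases "p \<le> p'")
    case True
    then show ?thesis using main[OF xi eta] by (simp add: max_def)
  next
    case False
    then have "(\<integral>w. elementary p' q' eta t w \<bullet> elementary p q xi t w \<partial>M) =
      (\<integral>w. (eta w \<bullet> xi w) * (L (max p (min (min q' q) t)) w - L p w) \<partial>M)" using main[OF eta xi] by simp
    moreover have "max p p' = p" using False by simp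
    ultimately show ?thesis by (simp add: inner_commute min.commute)
  qed
qed

end

section \<open>Simple integrals and their isometry\<close>

lemma integral_double_sum:
  fixes f :: "nat \<Rightarrow> nat \<Rightarrow> 'a \<Rightarrow> real"
  assumes f: "\<And>i j. i < m \<Longrightarrow> j < n \<Longrightarrow> integrable M (f i j)"
  shows "(\<integral>w. (\<Sum>i<m. \<Sum>j<n. f i j w) \<partial>M) = (\<Sum>i<m. \<Sum>j<n. \<integral>w. f i j w \<partial>M)"
proof -
  have "(\<integral>w. (\<Sum>i<m. \<Sum>j<n. f i j w) \<partial>M) = (\<Sum>i<m. \<integral>w. (\<Sum>j<n. f i j w) \<partial>M)"
    by (rule Bochner_Integration.integral_sum) (auto intro!: Bochner_Integration.integrable_sum f)
  also have "\<dots> = (\<Sum>i<m. \<Sum>j<n. \<integral>w. f i j w \<partial>M)"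
    by (intro sum.cong refl Bochner_Integration.integral_sum) (auto intro: f)
  finally show ?thesis .
qed

context driver
begin

lemma simple_integrandD:
  assumes "simple_integrand M F T m p xi"
  shows "i < m \<Longrightarrow> bounded_at (p i) (xi i)" "i < m \<Longrightarrow> p i \<le> p (Suc i)" "i < m \<Longrightarrow> p (Suc i) \<le> T" "i < m \<Longrightarrow> 0 \<le> p i"
proof -
  have s: "p 0 = 0" "p m = T" "\<And>i. i < m \<Longrightarrow> p i \<le> p (Suc i) \<and> xi i \<in> borel_measurable (F (p i)) \<and> (\<exists>C. \<forall>w\<in>space M. norm (xi i w) \<le> C)"
    using assms by (auto simp: simple_integrand_def)
  have mono: "i \<le> j \<Longrightarrow> j \<le> m \<Longrightarrow> p i \<le> p j" for i j
  proof (induction j)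
    case (Suc j)
    show ?case
    proof (cases "i = Suc j")
      case False
      then have "p i \<le> p j" using Suc by auto
      also have "p j \<le> p (Suc j)" using s(3)[of j] Suc by auto
      finally show ?thesis .
    qed simp
  qed simp
  have r: "0 \<le> p i" "p i \<le> T" if "i \<le> m" for i using mono[of 0 i] mono[of i m] s that by auto
  show "i < m \<Longrightarrow> bounded_at (p i) (xi i)" using s(3)[of i] r[of i] by (auto simp: bounded_at_def)
  show "i < m \<Longrightarrow> p i \<le> p (Suc i)" "i < m \<Longrightarrow> p (Suc i) \<le> T" "i < m \<Longrightarrow> 0 \<le> p i" using s(3)[of i] r[of i] r[of "Suc i"] by auto
qed

lemma simple_integral_elementary:
  "simple_integral Z m p xi t = (\<lambda>w. \<Sum>i<m. elementary (p i) (p (Suc i)) (xi i) t w)"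
  by (simp add: simple_integral_def elementary_def fun_eq_iff)

lemma simple_integral_martingale:
  assumes "simple_integrand M F T m p xi"
  shows "L2_martingale (simple_integral Z m p xi)"
proof -
  have "L2_martingale (\<lambda>t w. \<Sum>i<m. elementary (p i) (p (Suc i)) (xi i) t w)"
    using simple_integrandD[OF assms] by (intro L2_martingale_sum elementary_martingale) auto
  then show ?thesis by (simp add: simple_integral_elementary[abs_def])
qed

lemma simple_integral_continuous:
  fixes xi :: "nat \<Rightarrow> 'a \<Rightarrow> real ^ 'd ^ 'n"
  assumes "simple_integrand M F T m p xi"
  shows "AE w in M. continuous_on {0..T} (\<lambda>t. simple_integral Z m p xi t w)"
  using Z_cont
proof eventually_elim
  case (elim w)
  have "continuous_on {0..T} (\<lambda>t. Z (min t r) w)" if "0 \<le> r" for r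
    by (rule continuous_on_compose2[OF elim]) (use that in \<open>auto intro!: continuous_intros\<close>)
  then have "continuous_on {0..T} (\<lambda>t. xi i w *v (Z (min t (p (Suc i))) w - Z (min t (p i)) w))" if "i < m" for i
  proof -
    have c: "continuous_on UNIV (\<lambda>x. xi i w *v x)"
      by (intro linear_continuous_on linear_conv_bounded_linear[THEN iffD1] matrix_vector_mul_linear)
    show ?thesis
      using simple_integrandD[OF assms that] \<open>\<And>r. 0 \<le> r \<Longrightarrow> continuous_on {0..T} (\<lambda>t. Z (min t r) w)\<close>
      by (intro continuous_on_compose2[OF c] continuous_on_diff) auto
  qed
  then show ?case unfolding simple_integral_def by (intro continuous_on_sum) auto
qed

text \<open>For two simple processes on unrelated partitions this is the closed form of the
  \<open>dL\<close>-integral of their inner product over \<open>{0..t}\<close>. Summing over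
  pairwise overlaps of cells avoids common refinements.\<close>

definition simple_pairing :: "nat \<Rightarrow> (nat \<Rightarrow> real) \<Rightarrow> (nat \<Rightarrow> 'a \<Rightarrow> real ^ 'd ^ 'n) \<Rightarrow>
    nat \<Rightarrow> (nat \<Rightarrow> real) \<Rightarrow> (nat \<Rightarrow> 'a \<Rightarrow> real ^ 'd ^ 'n) \<Rightarrow> real \<Rightarrow> 'a \<Rightarrow> real" where
  "simple_pairing m p xi m' p' xi' t w = (\<Sum>i<m. \<Sum>j<m'. (xi i w \<bullet> xi' j w) *
     (L (max (max (p i) (p' j)) (min (min (p (Suc i)) (p' (Suc j))) t)) w - L (max (p i) (p' j)) w))"

lemma simple_pairing_term_integrable:
  fixes xi eta :: "'a \<Rightarrow> real ^ 'd ^ 'n"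
  assumes xi: "bounded_at p xi" and eta: "bounded_at p' eta" and "u \<in> {0..T}" "v \<in> {0..T}"
  shows "integrable M (\<lambda>w. (xi w \<bullet> eta w) * (L u w - L v w))"
proof -
  obtain C where C: "\<And>w. w \<in> space M \<Longrightarrow> norm (xi w) \<le> C" using xi by (auto simp: bounded_at_def)
  obtain C' where C': "\<And>w. w \<in> space M \<Longrightarrow> norm (eta w) \<le> C'" using eta by (auto simp: bounded_at_def)
  show ?thesis
  proof (rule integrable_mult_bounded)
    show "(\<lambda>w. xi w \<bullet> eta w) \<in> borel_measurable M"
      using bounded_at_measurable[OF xi] bounded_at_measurable[OF eta] by measurable
    show "integrable M (\<lambda>w. L u w - L v w)" using assms by (intro Bochner_Integration.integrable_diff L_integrable)
    show "\<bar>xi w \<bullet> eta w\<bar> \<le> C * C'" if w: "w \<in> space M" for w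
    proof -
      have "0 \<le> C" using order_trans[OF norm_ge_zero C[OF w]] .
      then show ?thesis
        by (intro order_trans[OF Cauchy_Schwarz_ineq2] mult_mono C[OF w] C'[OF w]) auto
    qed
  qed
qed

lemma simple_pairing_expectation:
  fixes xi xi' :: "nat \<Rightarrow> 'a \<Rightarrow> real ^ 'd ^ 'n"
  assumes S: "simple_integrand M F T m p xi" and S': "simple_integrand M F T m' p' xi'" and t: "t \<in> {0..T}"
  shows "integrable M (simple_pairing m p xi m' p' xi' t)"
    "(\<integral>w. simple_integral Z m p xi t w \<bullet> simple_integral Z m' p' xi' t w \<partial>M) = (\<integral>w. simple_pairing m p xi m' p' xi' t w \<partial>M)"
proof -
  note D = simple_integrandD[OF S] and D' = simple_integrandD[OF S']
  have i: "integrable M (\<lambda>w. (xi i w \<bullet> xi' j w) *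
     (L (max (max (p i) (p' j)) (min (min (p (Suc i)) (p' (Suc j))) t)) w - L (max (p i) (p' j)) w))"
    if ij: "i < m" "j < m'" for i j
  proof (rule simple_pairing_term_integrable[OF D(1)[OF ij(1)] D'(1)[OF ij(2)]])
    show "max (p i) (p' j) \<in> {0..T}" "max (max (p i) (p' j)) (min (min (p (Suc i)) (p' (Suc j))) t) \<in> {0..T}"
      using D[OF ij(1)] D'[OF ij(2)] t by (auto simp: bounded_at_def)
  qed
  show int: "integrable M (simple_pairing m p xi m' p' xi' t)"
    unfolding simple_pairing_def[abs_def] by (intro Bochner_Integration.integrable_sum i) auto
  have L2e: "L2 M (elementary (p i) (p (Suc i)) (xi i) t)" if "i < m" for i
    using D[OF that] t by (intro elementary_L2)
  have L2e': "L2 M (elementary (p' i) (p' (Suc i)) (xi' i) t)" if "i < m'" for i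
    using D'[OF that] t by (intro elementary_L2)
  have "(\<integral>w. simple_integral Z m p xi t w \<bullet> simple_integral Z m' p' xi' t w \<partial>M) =
    (\<integral>w. (\<Sum>i<m. \<Sum>j<m'. elementary (p i) (p (Suc i)) (xi i) t w \<bullet> elementary (p' j) (p' (Suc j)) (xi' j) t w) \<partial>M)"
    by (simp only: simple_integral_elementary inner_sum_left inner_sum_right)
      (rule arg_cong[where f = "integral\<^sup>L M"], rule ext, rule sum.swap)
  also have "\<dots> = (\<Sum>i<m. \<Sum>j<m'. \<integral>w. elementary (p i) (p (Suc i)) (xi i) t w \<bullet> elementary (p' j) (p' (Suc j)) (xi' j) t w \<partial>M)"
    by (rule integral_double_sum) (rule L2_inner_integrable[OF L2e L2e'])
  also have "\<dots> = (\<Sum>i<m. \<Sum>j<m'. \<integral>w. (xi i w \<bullet> xi' j w) *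
     (L (max (max (p i) (p' j)) (min (min (p (Suc i)) (p' (Suc j))) t)) w - L (max (p i) (p' j)) w) \<partial>M)"
    using D D' t by (intro sum.cong refl elementary_inner) auto
  also have "\<dots> = (\<integral>w. simple_pairing m p xi m' p' xi' t w \<partial>M)"
    unfolding simple_pairing_def by (rule integral_double_sum[symmetric]) (rule i)
  finally show "(\<integral>w. simple_integral Z m p xi t w \<bullet> simple_integral Z m' p' xi' t w \<partial>M) = (\<integral>w. simple_pairing m p xi m' p' xi' t w \<partial>M)" .
qed

lemma simple_pairing_path:
  fixes xi xi' :: "nat \<Rightarrow> 'a \<Rightarrow> real ^ 'd ^ 'n"
  assumes S: "simple_integrand M F T m p xi" and S': "simple_integrand M F T m' p' xi'" and t: "t \<in> {0..T}"
    and reg: "reg w"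
  shows "has_bochner_integral (path_measure L w) (\<lambda>s. indicator {0..t} s * (simple_process m p xi s w \<bullet> simple_process m' p' xi' s w))
    (simple_pairing m p xi m' p' xi' t w)"
proof -
  note D = simple_integrandD[OF S] and D' = simple_integrandD[OF S']
  let ?u = "\<lambda>i j. max (p i) (p' j)" and ?v = "\<lambda>i j. min (min (p (Suc i)) (p' (Suc j))) t"
  have m: "has_bochner_integral (path_measure L w) (indicator {a<..b}) (L (max a b) w - L a w)" for a b
  proof -
    have "{a<..b} = {a<..max a b}" by auto
    moreover have e: "emeasure (path_measure L w) {a<..max a b} = ennreal (L (max a b) w - L a w)"
      by (intro path_Ioc reg) simp
    moreover have "0 \<le> L (max a b) w - L a w" using regD(2)[OF reg, of a "max a b"] by simp
    ultimately show ?thesis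
      using has_bochner_integral_real_indicator[of "{a<..max a b}" "path_measure L w"]
      by (simp add: measure_def)
  qed
  have eq: "indicator {0..t} s * (simple_process m p xi s w \<bullet> simple_process m' p' xi' s w) =
    (\<Sum>i<m. \<Sum>j<m'. (xi i w \<bullet> xi' j w) * indicator {?u i j<..?v i j} s)" for s
  proof -
    have "indicator {0..t} s * (simple_process m p xi s w \<bullet> simple_process m' p' xi' s w) =
      (\<Sum>i<m. \<Sum>j<m'. indicator {0..t} s * ((indicator {p i<..p (Suc i)} s *\<^sub>R xi i w) \<bullet> (indicator {p' j<..p' (Suc j)} s *\<^sub>R xi' j w)))"
      unfolding simple_process_def
      by (subst sum.swap) (simp only: inner_sum_left inner_sum_right sum_distrib_left)
    also have "\<dots> = (\<Sum>i<m. \<Sum>j<m'. (xi i w \<bullet> xi' j w) * indicator {?u i j<..?v i j} s)"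
    proof (intro sum.cong refl)
      fix i j assume "i \<in> {..<m}" "j \<in> {..<m'}"
      then have "0 \<le> p i" using D by auto
      then show "indicator {0..t} s * ((indicator {p i<..p (Suc i)} s *\<^sub>R xi i w) \<bullet> (indicator {p' j<..p' (Suc j)} s *\<^sub>R xi' j w)) =
        (xi i w \<bullet> xi' j w) * indicator {?u i j<..?v i j} s" by (auto simp: indicator_def)
    qed
    finally show ?thesis .
  qed
  show ?thesis unfolding eq simple_pairing_def
    by (intro has_bochner_integral_sum has_bochner_integral_mult_right m)
qed

text \<open>The square is expanded into three pairings, each of which is a path integral for regular
  \<open>w\<close> and has the expected product of the simple integrals as its mean. In this way the
  difference itself never has to be written as a simple process.\<close>

lemma simple_diff_iso:
  fixes xi xi' :: "nat \<Rightarrow> 'a \<Rightarrow> real ^ 'd ^ 'n"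
  assumes S: "simple_integrand M F T m p xi" and S': "simple_integrand M F T m' p' xi'" and t: "t \<in> {0..T}"
  shows "nn_sq M (\<lambda>w. simple_integral Z m p xi t w - simple_integral Z m' p' xi' t w) =
    (\<integral>\<^sup>+w. nn_sq_on (path_measure L w) {0..t} (\<lambda>s. simple_process m p xi s w - simple_process m' p' xi' s w) \<partial>M)"
proof -
  let ?J = "simple_integral Z m p xi t" and ?J' = "simple_integral Z m' p' xi' t"
  let ?P = "simple_pairing m p xi m p xi t" and ?Q = "simple_pairing m p xi m' p' xi' t" and ?R = "simple_pairing m' p' xi' m' p' xi' t"
  let ?h = "\<lambda>s w. simple_process m p xi s w" and ?h' = "\<lambda>s w. simple_process m' p' xi' s w"
  have J: "L2 M ?J" "L2 M ?J'"
    using L2_martingaleD(2)[OF simple_integral_martingale[OF S] t] L2_martingaleD(2)[OF simple_integral_martingale[OF S'] t] by auto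
  have sq: "(norm (x - y))\<^sup>2 = x \<bullet> x - 2 * (x \<bullet> y) + y \<bullet> y" for x y :: "'v::real_inner"
    by (simp add: power2_norm_eq_inner inner_diff_left inner_diff_right inner_commute)
  have PQR: "integrable M ?P" "integrable M ?Q" "integrable M ?R"
    using simple_pairing_expectation(1)[OF S S t] simple_pairing_expectation(1)[OF S S' t] simple_pairing_expectation(1)[OF S' S' t] by auto
  have h: "has_bochner_integral (path_measure L w) (\<lambda>s. indicator {0..t} s * (norm (?h s w - ?h' s w))\<^sup>2) (?P w - 2 * ?Q w + ?R w)"
    if "reg w" for w
  proof -
    have "has_bochner_integral (path_measure L w) (\<lambda>s. indicator {0..t} s * (?h s w \<bullet> ?h s w) - 2 * (indicator {0..t} s * (?h s w \<bullet> ?h' s w)) + indicator {0..t} s * (?h' s w \<bullet> ?h' s w))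
        (?P w - 2 * ?Q w + ?R w)"
      by (intro has_bochner_integral_add has_bochner_integral_diff has_bochner_integral_mult_right
          simple_pairing_path[OF S S t that] simple_pairing_path[OF S S' t that] simple_pairing_path[OF S' S' t that])
    moreover have "indicator {0..t} s * (?h s w \<bullet> ?h s w) - 2 * (indicator {0..t} s * (?h s w \<bullet> ?h' s w)) + indicator {0..t} s * (?h' s w \<bullet> ?h' s w)
       = indicator {0..t} s * (norm (?h s w - ?h' s w))\<^sup>2" for s
      unfolding sq by (simp add: algebra_simps)
    ultimately show ?thesis by simp
  qed
  have nn: "nn_sq_on (path_measure L w) {0..t} (\<lambda>s. ?h s w - ?h' s w) = ennreal (?P w - 2 * ?Q w + ?R w)"
    and pos: "0 \<le> ?P w - 2 * ?Q w + ?R w" if "reg w" for w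
  proof -
    have i: "integrable (path_measure L w) (\<lambda>s. indicator {0..t} s * (norm (?h s w - ?h' s w))\<^sup>2)"
      "(\<integral>s. indicator {0..t} s * (norm (?h s w - ?h' s w))\<^sup>2 \<partial>path_measure L w) = ?P w - 2 * ?Q w + ?R w"
      using h[OF that] by (auto simp: has_bochner_integral_iff)
    have "nn_sq_on (path_measure L w) {0..t} (\<lambda>s. ?h s w - ?h' s w) = (\<integral>\<^sup>+s. ennreal (indicator {0..t} s * (norm (?h s w - ?h' s w))\<^sup>2) \<partial>path_measure L w)"
      by (intro nn_integral_cong) (auto simp: indicator_def)
    also have "\<dots> = ennreal (\<integral>s. indicator {0..t} s * (norm (?h s w - ?h' s w))\<^sup>2 \<partial>path_measure L w)"
      by (intro nn_integral_eq_integral i AE_I2) auto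
    finally show "nn_sq_on (path_measure L w) {0..t} (\<lambda>s. ?h s w - ?h' s w) = ennreal (?P w - 2 * ?Q w + ?R w)"
      using i by simp
    show "0 \<le> ?P w - 2 * ?Q w + ?R w" unfolding i(2)[symmetric] by (intro integral_nonneg_AE AE_I2) auto
  qed
  have JJ: "integrable M (\<lambda>w. ?J w \<bullet> ?J w)" "integrable M (\<lambda>w. ?J w \<bullet> ?J' w)" "integrable M (\<lambda>w. ?J' w \<bullet> ?J' w)"
    using J by (auto intro: L2_inner_integrable)
  have "nn_sq M (\<lambda>w. ?J w - ?J' w) = ennreal (\<integral>w. (norm (?J w - ?J' w))\<^sup>2 \<partial>M)"
    by (rule L2_nn_integral[OF L2_diff[OF J]])
  also have "(\<integral>w. (norm (?J w - ?J' w))\<^sup>2 \<partial>M) = (\<integral>w. ?J w \<bullet> ?J w - 2 * (?J w \<bullet> ?J' w) + ?J' w \<bullet> ?J' w \<partial>M)"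
    by (simp only: sq)
  also have "\<dots> = (\<integral>w. ?J w \<bullet> ?J w \<partial>M) - 2 * (\<integral>w. ?J w \<bullet> ?J' w \<partial>M) + (\<integral>w. ?J' w \<bullet> ?J' w \<partial>M)"
    using JJ by simp
  also have "\<dots> = (\<integral>w. ?P w \<partial>M) - 2 * (\<integral>w. ?Q w \<partial>M) + (\<integral>w. ?R w \<partial>M)"
    by (simp only: simple_pairing_expectation(2)[OF S S t] simple_pairing_expectation(2)[OF S S' t] simple_pairing_expectation(2)[OF S' S' t])
  also have "\<dots> = (\<integral>w. ?P w - 2 * ?Q w + ?R w \<partial>M)" using PQR by simp
  also have "ennreal \<dots> = (\<integral>\<^sup>+w. ennreal (?P w - 2 * ?Q w + ?R w) \<partial>M)"
    using PQR L_regular by (intro nn_integral_eq_integral[symmetric]) (auto elim!: eventually_mono intro: pos)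
  also have "\<dots> = (\<integral>\<^sup>+w. nn_sq_on (path_measure L w) {0..t} (\<lambda>s. ?h s w - ?h' s w) \<partial>M)"
    using L_regular by (intro nn_integral_cong_AE) (auto elim!: eventually_mono simp: nn)
  finally show ?thesis .
qed

lemma simple_process_prog:
  fixes xi :: "nat \<Rightarrow> 'a \<Rightarrow> real ^ 'd ^ 'n"
  assumes S: "simple_integrand M F T m p xi"
  shows "prog_measurable F T (simple_process m p xi)"
  unfolding prog_measurable_def
proof
  fix t assume t: "t \<in> {0..T}"
  let ?N = "F t \<Otimes>\<^sub>M restrict_space borel {0..t}"
  have "(\<lambda>x. indicator {p i<..p (Suc i)} (snd x) *\<^sub>R xi i (fst x)) \<in> borel_measurable ?N" if i: "i < m" for i
  \<comment> \<open>For \<open>t < p i\<close> the coefficient \<open>xi i\<close> may be unknown at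
    time \<open>t\<close>, but then its interval lies beyond \<open>{0..t}\<close>.\<close>
  proof (cases "p i \<le> t")
    case True
    have [measurable]: "xi i \<in> borel_measurable (F t)"
      using bounded_at_mono[OF simple_integrandD(1)[OF S i] True] t by (simp add: bounded_at_def)
    have [measurable]: "(indicator {p i<..p (Suc i)} :: real \<Rightarrow> real) \<in> borel_measurable (restrict_space borel {0..t})"
      by (rule measurable_restrict_space1) simp
    show ?thesis by measurable
  next
    case False
    have "(\<lambda>x. indicator {p i<..p (Suc i)} (snd x) *\<^sub>R xi i (fst x)) \<in> borel_measurable ?N \<longleftrightarrow> (\<lambda>x. 0 :: real ^ 'd ^ 'n) \<in> borel_measurable ?N"
      using False by (intro measurable_cong) (auto simp: space_pair_measure space_restrict_space indicator_def)
    then show ?thesis by simp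
  qed
  then show "(\<lambda>(w, s). simple_process m p xi s w) \<in> borel_measurable ?N"
    unfolding simple_process_def case_prod_unfold by (intro borel_measurable_sum) auto
qed

text \<open>The squared L2 norm for the measure \<open>dP dL\<close> up to time \<open>t\<close>.
  Since it is squared, the triangle inequality appears below with factors 2.\<close>

definition clock_norm :: "real \<Rightarrow> (real \<Rightarrow> 'a \<Rightarrow> 'v::euclidean_space) \<Rightarrow> ennreal" where
  "clock_norm t H = (\<integral>\<^sup>+w. nn_sq_on (path_measure L w) {0..t} (\<lambda>s. H s w) \<partial>M)"

lemma prog_path_measurable:
  fixes g :: "('a, ennreal) process"
  assumes g: "prog_measurable F T g" and t: "t \<in> {0..T}" and w: "w \<in> space M"
  shows "(\<lambda>s. g s w * indicator {0..t} s) \<in> borel_measurable borel"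
proof -
  have "(\<lambda>s. g (max 0 (min T s)) w * indicator {0..t} s) \<in> borel_measurable borel"
    using prog_measurable_path[OF g, of w] w space_G[of T] T_pos by (intro borel_measurable_times_ennreal) auto
  moreover have "(\<lambda>s. g (max 0 (min T s)) w * indicator {0..t} s) = (\<lambda>s. g s w * indicator {0..t} s)"
  proof
    fix s
    have "s \<in> {0..t} \<Longrightarrow> max 0 (min T s) = s" using t by auto
    then show "g (max 0 (min T s)) w * indicator {0..t} s = g s w * indicator {0..t} s" by (cases "s \<in> {0..t}") auto
  qed
  ultimately show ?thesis by simp
qed

lemma clock_norm_inner_measurable:
  fixes H :: "('a, 'v::euclidean_space) process"
  assumes "prog_measurable F T H" "t \<in> {0..T}"
  shows "(\<lambda>w. \<integral>\<^sup>+s\<in>{0..t}. ennreal ((norm (H s w))\<^sup>2) \<partial>path_measure L w) \<in> borel_measurable M"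
  using measurable_GM[OF nn_integral_path_adapted[OF prog_measurable_norm_sq[OF assms(1)] assms(2)] assms(2)] .

lemma clock_norm_add:
  fixes H K :: "('a, 'v::euclidean_space) process"
  assumes H: "prog_measurable F T H" and K: "prog_measurable F T K" and t: "t \<in> {0..T}"
  shows "clock_norm t (\<lambda>s w. H s w + K s w) \<le> 2 * clock_norm t H + 2 * clock_norm t K"
proof -
  have "clock_norm t (\<lambda>s w. H s w + K s w) \<le>
    (\<integral>\<^sup>+w. 2 * nn_sq_on (path_measure L w) {0..t} (\<lambda>s. H s w) + 2 * nn_sq_on (path_measure L w) {0..t} (\<lambda>s. K s w) \<partial>M)"
    unfolding clock_norm_def
  proof (rule nn_integral_mono)
    fix w assume w: "w \<in> space M"
    have m: "(\<lambda>s. ennreal ((norm (H s w))\<^sup>2) * indicator {0..t} s) \<in> borel_measurable (path_measure L w)"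
      "(\<lambda>s. ennreal ((norm (K s w))\<^sup>2) * indicator {0..t} s) \<in> borel_measurable (path_measure L w)"
      using prog_path_measurable[OF prog_measurable_norm_sq[OF H] t w] prog_path_measurable[OF prog_measurable_norm_sq[OF K] t w] by auto
    have "nn_sq_on (path_measure L w) {0..t} (\<lambda>s. H s w + K s w) \<le>
      (\<integral>\<^sup>+s. 2 * (ennreal ((norm (H s w))\<^sup>2) * indicator {0..t} s) + 2 * (ennreal ((norm (K s w))\<^sup>2) * indicator {0..t} s) \<partial>path_measure L w)"
      by (rule nn_integral_mono) (auto simp: indicator_def intro: ennreal_norm_add_sq_le)
    also have "\<dots> = 2 * nn_sq_on (path_measure L w) {0..t} (\<lambda>s. H s w) + 2 * nn_sq_on (path_measure L w) {0..t} (\<lambda>s. K s w)"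
      using m by (simp add: nn_integral_add nn_integral_cmult)
    finally show "nn_sq_on (path_measure L w) {0..t} (\<lambda>s. H s w + K s w) \<le>
      2 * nn_sq_on (path_measure L w) {0..t} (\<lambda>s. H s w) + 2 * nn_sq_on (path_measure L w) {0..t} (\<lambda>s. K s w)" .
  qed
  also have "\<dots> = 2 * clock_norm t H + 2 * clock_norm t K"
    unfolding clock_norm_def using clock_norm_inner_measurable[OF H t] clock_norm_inner_measurable[OF K t]
    by (simp add: nn_integral_add nn_integral_cmult)
  finally show ?thesis .
qed

lemma clock_norm_diff3:
  fixes A B C D :: "('a, 'v::euclidean_space) process"
  assumes A: "prog_measurable F T A" and B: "prog_measurable F T B" and C: "prog_measurable F T C"
    and D: "prog_measurable F T D" and t: "t \<in> {0..T}"
  shows "clock_norm t (\<lambda>s w. A s w - D s w) \<le>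
    2 * clock_norm t (\<lambda>s w. A s w - B s w) + 2 * (2 * clock_norm t (\<lambda>s w. B s w - C s w) + 2 * clock_norm t (\<lambda>s w. C s w - D s w))"
proof -
  have "clock_norm t (\<lambda>s w. A s w - D s w) = clock_norm t (\<lambda>s w. (A s w - B s w) + ((B s w - C s w) + (C s w - D s w)))"
    by simp
  also have "\<dots> \<le> 2 * clock_norm t (\<lambda>s w. A s w - B s w) + 2 * clock_norm t (\<lambda>s w. (B s w - C s w) + (C s w - D s w))"
    using clock_norm_add[OF prog_measurable_diff[OF A B] prog_measurable_diff[OF A B] t]
    by (intro clock_norm_add t prog_measurable_diff A B)
      (use prog_measurable_diff[OF B D] in \<open>simp\<close>)
  also have "\<dots> \<le> 2 * clock_norm t (\<lambda>s w. A s w - B s w) + 2 * (2 * clock_norm t (\<lambda>s w. B s w - C s w) + 2 * clock_norm t (\<lambda>s w. C s w - D s w))"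
    by (intro add_left_mono mult_left_mono clock_norm_add t prog_measurable_diff B C D) auto
  finally show ?thesis .
qed

lemma clock_norm_cong:
  assumes "AE w in M. \<forall>s\<in>{0..T}. H s w = K s w" "t \<in> {0..T}"
  shows "clock_norm t H = clock_norm t K"
  unfolding clock_norm_def
proof (rule nn_integral_cong_AE)
  show "AE w in M. (nn_sq_on (path_measure L w) {0..t} (\<lambda>s. H s w)) = nn_sq_on (path_measure L w) {0..t} (\<lambda>s. K s w)"
    using assms(1) by eventually_elim (use assms(2) in \<open>auto intro!: nn_integral_cong simp: indicator_def\<close>)
qed

lemma clock_norm_mono_time:
  "s \<le> t \<Longrightarrow> clock_norm s H \<le> clock_norm t H"
  unfolding clock_norm_def by (intro nn_integral_mono mult_left_mono) (auto simp: indicator_def)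

lemma clock_norm_minus: "clock_norm t (\<lambda>s w. H s w - K s w) = clock_norm t (\<lambda>s w. K s w - H s w)"
  unfolding clock_norm_def by (simp add: norm_minus_commute)

end

section \<open>The Ito integral\<close>

lemma (in prob_space) integral_tendsto_L2:
  fixes f :: "'a \<Rightarrow> 'v::euclidean_space"
  assumes f: "L2 M f" and g: "\<And>k. L2 M (g k)" and A: "A \<in> sets M"
    and lim: "(\<lambda>k. \<integral>\<^sup>+w. ennreal ((norm (f w - g k w))\<^sup>2) \<partial>M) \<longlonglongrightarrow> 0"
  shows "(\<lambda>k. \<integral>w. indicator A w *\<^sub>R g k w \<partial>M) \<longlonglongrightarrow> (\<integral>w. indicator A w *\<^sub>R f w \<partial>M)"
proof -
  have i: "integrable M (\<lambda>w. indicator A w *\<^sub>R f w)" "integrable M (\<lambda>w. indicator A w *\<^sub>R g k w)" for k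
    using A L2_integrable[OF f] L2_integrable[OF g] by (auto intro!: integrable_mult_indicator)
  have le: "ennreal ((norm ((\<integral>w. indicator A w *\<^sub>R g k w \<partial>M) - (\<integral>w. indicator A w *\<^sub>R f w \<partial>M)))\<^sup>2) \<le>
    (nn_sq M (\<lambda>w. f w - g k w))" for k
  proof -
    have "(\<integral>w. indicator A w *\<^sub>R g k w \<partial>M) - (\<integral>w. indicator A w *\<^sub>R f w \<partial>M) = (LINT w:A|M. g k w - f w)"
      using i by (simp add: set_lebesgue_integral_def scaleR_diff_right)
    moreover have "ennreal ((norm (LINT w:A|M. g k w - f w))\<^sup>2) \<le> emeasure M A * (\<integral>\<^sup>+w\<in>A. ennreal ((norm (g k w - f w))\<^sup>2) \<partial>M)"
      using i by (intro ennreal_norm_set_integral_sq_le A) (simp add: set_integrable_def scaleR_diff_right)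
    moreover have "emeasure M A * (\<integral>\<^sup>+w\<in>A. ennreal ((norm (g k w - f w))\<^sup>2) \<partial>M) \<le> 1 * nn_sq M (\<lambda>w. f w - g k w)"
      by (intro mult_mono emeasure_le_1 nn_integral_mono) (auto simp: indicator_def norm_minus_commute)
    ultimately show ?thesis by simp
  qed
  have "(\<lambda>k. ennreal ((norm ((\<integral>w. indicator A w *\<^sub>R g k w \<partial>M) - (\<integral>w. indicator A w *\<^sub>R f w \<partial>M)))\<^sup>2)) \<longlonglongrightarrow> 0"
    by (rule tendsto_sandwich[OF _ _ tendsto_const lim]) (auto simp: le)
  then have "(\<lambda>k. (norm ((\<integral>w. indicator A w *\<^sub>R g k w \<partial>M) - (\<integral>w. indicator A w *\<^sub>R f w \<partial>M)))\<^sup>2) \<longlonglongrightarrow> 0"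
    by (subst (asm) ennreal_0[symmetric], subst (asm) tendsto_ennreal_iff) auto
  then have "(\<lambda>k. sqrt ((norm ((\<integral>w. indicator A w *\<^sub>R g k w \<partial>M) - (\<integral>w. indicator A w *\<^sub>R f w \<partial>M)))\<^sup>2)) \<longlonglongrightarrow> sqrt 0"
    by (rule tendsto_real_sqrt)
  then have "(\<lambda>k. norm ((\<integral>w. indicator A w *\<^sub>R g k w \<partial>M) - (\<integral>w. indicator A w *\<^sub>R f w \<partial>M))) \<longlonglongrightarrow> 0" by simp
  then show ?thesis by (metis LIM_zero_cancel tendsto_norm_zero_cancel)
qed

context driver
begin

text \<open>The exceptional event has to be common to all times, since the path measure sees
  uncountably many of them. The lemma lets coefficients along a process be exchanged for
  progressively measurable versions.\<close>

lemma ito_integral_cong: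
  assumes I: "ito_integral M F Z L T H I" and HK: "AE w in M. \<forall>s\<in>{0..T}. H s w = K s w"
  shows "ito_integral M F Z L T K I"
proof -
  obtain H' where H': "prog_measurable F T H'" "AE w in M. \<forall>t\<in>{0..T}. H t w = H' t w"
    using I by (auto simp: ito_integral_def)
  have 1: "\<exists>H'. prog_measurable F T H' \<and> (AE w in M. \<forall>t\<in>{0..T}. K t w = H' t w)"
  proof (intro exI conjI)
    show "AE w in M. \<forall>t\<in>{0..T}. K t w = H' t w" using H'(2) HK by eventually_elim auto
  qed (rule H'(1))
  have 2: "(\<integral>\<^sup>+w. nn_sq_on (path_measure L w) {0..T} (\<lambda>t. K t w) \<partial>M) =
     (\<integral>\<^sup>+w. nn_sq_on (path_measure L w) {0..T} (\<lambda>t. H t w) \<partial>M)"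
    using clock_norm_cong[OF HK, of T] T_pos by (simp add: clock_norm_def)
  have 3: "(\<integral>\<^sup>+w. nn_sq_on (path_measure L w) {0..T} (\<lambda>t. K t w - S t w) \<partial>M) =
     (\<integral>\<^sup>+w. nn_sq_on (path_measure L w) {0..T} (\<lambda>t. H t w - S t w) \<partial>M)" for S
  proof -
    have "AE w in M. \<forall>s\<in>{0..T}. H s w - S s w = K s w - S s w" using HK by eventually_elim auto
    from clock_norm_cong[OF this, of T] show ?thesis using T_pos by (simp add: clock_norm_def)
  qed
  show ?thesis using I 1 unfolding ito_integral_def 2 3 by blast
qed

lemma ito_integralE:
  assumes I: "ito_integral M F Z L T H I"
  obtains m p xi where "\<And>k. simple_integrand M F T (m k) (p k) (xi k)"
    "(\<lambda>k. clock_norm T (\<lambda>s w. H s w - simple_process (m k) (p k) (xi k) s w)) \<longlonglongrightarrow> 0"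
    "\<And>t. t \<in> {0..T} \<Longrightarrow> (\<lambda>k. \<integral>\<^sup>+w. ennreal ((norm (I t w - simple_integral Z (m k) (p k) (xi k) t w))\<^sup>2) \<partial>M) \<longlonglongrightarrow> 0"
  using I unfolding ito_integral_def clock_norm_def by blast

lemma ito_integral_adapted:
  "ito_integral M F Z L T H I \<Longrightarrow> t \<in> {0..T} \<Longrightarrow> I t \<in> borel_measurable (F t)"
  unfolding ito_integral_def by blast

lemma ito_integral_continuous:
  "ito_integral M F Z L T H I \<Longrightarrow> AE w in M. continuous_on {0..T} (\<lambda>t. I t w)"
  unfolding ito_integral_def by blast

text \<open>Convergence in L2 preserves vanishing integrals over a fixed event, hence the martingale
  property of the simple integrals.\<close>

lemma ito_integral_martingale:
  assumes I: "ito_integral M F Z L T H I"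
  shows "L2_martingale I"
proof -
  obtain m p xi where S: "\<And>k. simple_integrand M F T (m k) (p k) (xi k)"
    and "(\<lambda>k. clock_norm T (\<lambda>s w. H s w - simple_process (m k) (p k) (xi k) s w)) \<longlonglongrightarrow> 0"
    and lim: "\<And>t. t \<in> {0..T} \<Longrightarrow> (\<lambda>k. \<integral>\<^sup>+w. ennreal ((norm (I t w - simple_integral Z (m k) (p k) (xi k) t w))\<^sup>2) \<partial>M) \<longlonglongrightarrow> 0"
    by (rule ito_integralE[OF I]) (rule that)
  define J where "J k = simple_integral Z (m k) (p k) (xi k)" for k
  have J: "L2_martingale (J k)" for k unfolding J_def by (rule simple_integral_martingale[OF S])
  have lim': "(\<lambda>k. \<integral>\<^sup>+w. ennreal ((norm (I t w - J k t w))\<^sup>2) \<partial>M) \<longlonglongrightarrow> 0" if "t \<in> {0..T}" for t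
    unfolding J_def by (rule lim[OF that])
  have L2I: "L2 M (I t)" if t: "t \<in> {0..T}" for t
  proof -
    have Im: "I t \<in> borel_measurable M" using measurable_GM[OF ito_integral_adapted[OF I t] t] .
    have "\<forall>\<^sub>F k in sequentially. (nn_sq M (\<lambda>w. I t w - J k t w)) < 1"
      using lim'[OF t] by (rule order_tendstoD) simp
    then obtain k where k: "nn_sq M (\<lambda>w. I t w - J k t w) < 1"
      by (auto simp: eventually_sequentially)
    have JL2: "L2 M (J k t)" using L2_martingaleD(2)[OF J t] .
    have "L2 M (\<lambda>w. I t w - J k t w)"
      unfolding L2_iff_nn using Im L2_measurable[OF JL2] less_trans[OF k, of top] by auto
    from L2_add[OF this JL2] show ?thesis by simp
  qed
  show ?thesis
    unfolding L2_martingale_def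
  proof (intro conjI ballI allI impI)
    fix t assume "t \<in> {0..T}"
    then show "I t \<in> borel_measurable (F t)" "L2 M (I t)" using ito_integral_adapted[OF I] L2I by auto
  next
    fix s t A assume a: "0 \<le> s \<and> s \<le> t \<and> t \<le> T \<and> A \<in> sets (F s)"
    then have A: "A \<in> sets M" and st: "s \<in> {0..T}" "t \<in> {0..T}" using subalg[of s] by (auto simp: subalgebra_def)
    have conv: "(\<lambda>k. \<integral>w. indicator A w *\<^sub>R J k u w \<partial>M) \<longlonglongrightarrow> (\<integral>w. indicator A w *\<^sub>R I u w \<partial>M)" if "u \<in> {0..T}" for u
      using that by (intro integral_tendsto_L2 L2I A lim' L2_martingaleD(2)[OF J])
    have split: "(\<integral>w. indicator A w *\<^sub>R (X t w - X s w) \<partial>M) = (\<integral>w. indicator A w *\<^sub>R X t w \<partial>M) - (\<integral>w. indicator A w *\<^sub>R X s w \<partial>M)"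
      if "L2 M (X t)" "L2 M (X s)" for X :: "('a, real ^ 'b) process"
      using A L2_integrable[OF that(1)] L2_integrable[OF that(2)]
      by (simp add: scaleR_diff_right integrable_mult_indicator)
    have "(\<integral>w. indicator A w *\<^sub>R J k t w \<partial>M) - (\<integral>w. indicator A w *\<^sub>R J k s w \<partial>M) = 0" for k
      using split[of "J k", OF L2_martingaleD(2)[OF J st(2)] L2_martingaleD(2)[OF J st(1)]] J[of k] a
      unfolding L2_martingale_def by metis
    then have "(\<lambda>k. 0) \<longlonglongrightarrow> (\<integral>w. indicator A w *\<^sub>R I t w \<partial>M) - (\<integral>w. indicator A w *\<^sub>R I s w \<partial>M)"
      using tendsto_diff[OF conv[OF st(2)] conv[OF st(1)]] by simp
    then have "(\<integral>w. indicator A w *\<^sub>R I t w \<partial>M) - (\<integral>w. indicator A w *\<^sub>R I s w \<partial>M) = 0"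
      using LIMSEQ_unique tendsto_const by blast
    then show "(\<integral>w. indicator A w *\<^sub>R (I t w - I s w) \<partial>M) = 0"
      using split[of I, OF L2I[OF st(2)] L2I[OF st(1)]] by simp
  qed
qed

text \<open>The two integrals come with unrelated approximating sequences, which are compared
  through the isometry for simple integrals. The isometry itself would give the constant 1; 16
  arises from four uses of \<open>(a + b)^2 <= 2 a^2 + 2 b^2\<close> on the term that survives in
  the limit.\<close>

lemma ito_integral_diff_prog:
  fixes H H' :: "('a, real ^ 'd ^ 'n) process"
  assumes I: "ito_integral M F Z L T H I" and I': "ito_integral M F Z L T H' I'"
    and H: "prog_measurable F T H" and H': "prog_measurable F T H'" and t: "t \<in> {0..T}"
  shows "nn_sq M (\<lambda>w. I t w - I' t w) \<le> 16 * clock_norm t (\<lambda>s w. H s w - H' s w)"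
proof -
  obtain m p xi where S: "\<And>k. simple_integrand M F T (m k) (p k) (xi k)"
    and lim1: "(\<lambda>k. clock_norm T (\<lambda>s w. H s w - simple_process (m k) (p k) (xi k) s w)) \<longlonglongrightarrow> 0"
    and l2: "\<And>t. t \<in> {0..T} \<Longrightarrow> (\<lambda>k. \<integral>\<^sup>+w. ennreal ((norm (I t w - simple_integral Z (m k) (p k) (xi k) t w))\<^sup>2) \<partial>M) \<longlonglongrightarrow> 0"
    by (rule ito_integralE[OF I]) (rule that)
  note lim2 = l2[OF t]
  obtain m' p' xi' where S': "\<And>k. simple_integrand M F T (m' k) (p' k) (xi' k)"
    and lim1': "(\<lambda>k. clock_norm T (\<lambda>s w. H' s w - simple_process (m' k) (p' k) (xi' k) s w)) \<longlonglongrightarrow> 0"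
    and l2': "\<And>t. t \<in> {0..T} \<Longrightarrow> (\<lambda>k. \<integral>\<^sup>+w. ennreal ((norm (I' t w - simple_integral Z (m' k) (p' k) (xi' k) t w))\<^sup>2) \<partial>M) \<longlonglongrightarrow> 0"
    by (rule ito_integralE[OF I']) (rule that)
  note lim2' = l2'[OF t]
  define J J' h h' where "J k = simple_integral Z (m k) (p k) (xi k) t" and "J' k = simple_integral Z (m' k) (p' k) (xi' k) t"
    and "h k = simple_process (m k) (p k) (xi k)" and "h' k = simple_process (m' k) (p' k) (xi' k)" for k
  have m: "I t \<in> borel_measurable M" "I' t \<in> borel_measurable M"
    using measurable_GM[OF ito_integral_adapted[OF I t] t] measurable_GM[OF ito_integral_adapted[OF I' t] t] by auto
  have Jm: "J k \<in> borel_measurable M" "J' k \<in> borel_measurable M" for k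
    unfolding J_def J'_def using L2_martingaleD(2)[OF simple_integral_martingale[OF S] t] L2_martingaleD(2)[OF simple_integral_martingale[OF S'] t]
    by (auto intro: L2_measurable)
  have hp: "prog_measurable F T (h k)" "prog_measurable F T (h' k)" for k
    unfolding h_def h'_def by (rule simple_process_prog[OF S]) (rule simple_process_prog[OF S'])
  let ?e = "\<lambda>k. \<integral>\<^sup>+w. ennreal ((norm (I t w - J k w))\<^sup>2) \<partial>M" and ?e' = "\<lambda>k. \<integral>\<^sup>+w. ennreal ((norm (I' t w - J' k w))\<^sup>2) \<partial>M"
  let ?\<epsilon> = "\<lambda>k. clock_norm T (\<lambda>s w. H s w - h k s w)" and ?\<epsilon>' = "\<lambda>k. clock_norm T (\<lambda>s w. H' s w - h' k s w)"
  let ?Q = "clock_norm t (\<lambda>s w. H s w - H' s w)"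
  have le: "nn_sq M (\<lambda>w. I t w - I' t w) \<le> 2 * ?e k + 2 * (2 * (2 * ?\<epsilon> k + 2 * (2 * ?Q + 2 * ?\<epsilon>' k)) + 2 * ?e' k)" for k
  proof -
    let ?d = "\<integral>\<^sup>+w. ennreal ((norm (J k w - J' k w))\<^sup>2) \<partial>M"
    have "nn_sq M (\<lambda>w. I t w - I' t w) \<le>
       (\<integral>\<^sup>+w. 2 * ennreal ((norm (I t w - J k w))\<^sup>2) + 2 * (2 * ennreal ((norm (J k w - J' k w))\<^sup>2) + 2 * ennreal ((norm (I' t w - J' k w))\<^sup>2)) \<partial>M)"
    proof (rule nn_integral_mono)
      fix w
      have "ennreal ((norm (I t w - I' t w))\<^sup>2) \<le> 2 * ennreal ((norm (I t w - J k w))\<^sup>2) + 2 * ennreal ((norm (J k w - I' t w))\<^sup>2)"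
        using ennreal_norm_add_sq_le[of "I t w - J k w" "J k w - I' t w"] by simp
      also have "\<dots> \<le> 2 * ennreal ((norm (I t w - J k w))\<^sup>2) + 2 * (2 * ennreal ((norm (J k w - J' k w))\<^sup>2) + 2 * ennreal ((norm (I' t w - J' k w))\<^sup>2))"
        using ennreal_norm_diff_sq_le[of "J k w - J' k w" "I' t w - J' k w"]
        by (intro add_left_mono mult_left_mono) auto
      finally show "ennreal ((norm (I t w - I' t w))\<^sup>2) \<le> 2 * ennreal ((norm (I t w - J k w))\<^sup>2) + 2 * (2 * ennreal ((norm (J k w - J' k w))\<^sup>2) + 2 * ennreal ((norm (I' t w - J' k w))\<^sup>2))" .
    qed
    also have "\<dots> = 2 * ?e k + 2 * (2 * ?d + 2 * ?e' k)"
      using m Jm[of k] by (simp add: nn_integral_add nn_integral_cmult)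
    also have "?d = clock_norm t (\<lambda>s w. h k s w - h' k s w)"
      unfolding J_def J'_def h_def h'_def clock_norm_def by (rule simple_diff_iso[OF S S' t])
    finally have 1: "nn_sq M (\<lambda>w. I t w - I' t w) \<le> 2 * ?e k + 2 * (2 * clock_norm t (\<lambda>s w. h k s w - h' k s w) + 2 * ?e' k)" .
    have "clock_norm t (\<lambda>s w. h k s w - h' k s w) \<le> 2 * clock_norm t (\<lambda>s w. h k s w - H s w) + 2 * (2 * ?Q + 2 * clock_norm t (\<lambda>s w. H' s w - h' k s w))"
      by (rule clock_norm_diff3[OF hp(1) H H' hp(2) t])
    also have "\<dots> \<le> 2 * ?\<epsilon> k + 2 * (2 * ?Q + 2 * ?\<epsilon>' k)"
      using t clock_norm_mono_time[of t T "\<lambda>s w. H s w - h k s w"] clock_norm_mono_time[of t T "\<lambda>s w. H' s w - h' k s w"]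
        clock_norm_minus[of t "h k" H] by (intro add_mono mult_left_mono order_refl) auto
    finally have 2: "clock_norm t (\<lambda>s w. h k s w - h' k s w) \<le> 2 * ?\<epsilon> k + 2 * (2 * ?Q + 2 * ?\<epsilon>' k)" .
    show ?thesis
      by (rule order_trans[OF 1]) (intro add_left_mono add_right_mono mult_left_mono 2, auto)
  qed
  have "(\<lambda>k. 2 * ?e k + 2 * (2 * (2 * ?\<epsilon> k + 2 * (2 * ?Q + 2 * ?\<epsilon>' k)) + 2 * ?e' k)) \<longlonglongrightarrow> 2 * 0 + 2 * (2 * (2 * 0 + 2 * (2 * ?Q + 2 * 0)) + 2 * 0)"
    using lim1 lim2 lim1' lim2' unfolding J_def[symmetric] J'_def[symmetric] h_def[symmetric] h'_def[symmetric]
    by (intro tendsto_add ennreal_tendsto_cmult tendsto_const) auto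
  then have "nn_sq M (\<lambda>w. I t w - I' t w) \<le> 2 * 0 + 2 * (2 * (2 * 0 + 2 * (2 * ?Q + 2 * 0)) + 2 * 0)"
    by (rule LIMSEQ_le_const) (use le in auto)
  also have "\<dots> = 16 * ?Q" by (simp add: mult.assoc[symmetric])
  finally show ?thesis .
qed

lemma ito_integral_diff:
  fixes H H' :: "('a, real ^ 'd ^ 'n) process"
  assumes I: "ito_integral M F Z L T H I" and I': "ito_integral M F Z L T H' I'" and t: "t \<in> {0..T}"
  shows "nn_sq M (\<lambda>w. I t w - I' t w) \<le> 16 * clock_norm t (\<lambda>s w. H s w - H' s w)"
proof -
  obtain K where K: "prog_measurable F T K" "AE w in M. \<forall>t\<in>{0..T}. H t w = K t w"
    using I by (auto simp: ito_integral_def)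
  obtain K' where K': "prog_measurable F T K'" "AE w in M. \<forall>t\<in>{0..T}. H' t w = K' t w"
    using I' by (auto simp: ito_integral_def)
  have "nn_sq M (\<lambda>w. I t w - I' t w) \<le> 16 * clock_norm t (\<lambda>s w. K s w - K' s w)"
    by (rule ito_integral_diff_prog[OF ito_integral_cong[OF I K(2)] ito_integral_cong[OF I' K'(2)] K(1) K'(1) t])
  also have "clock_norm t (\<lambda>s w. K s w - K' s w) = clock_norm t (\<lambda>s w. H s w - H' s w)"
  proof (rule clock_norm_cong[OF _ t])
    show "AE w in M. \<forall>s\<in>{0..T}. K s w - K' s w = H s w - H' s w"
      using K(2) K'(2) by eventually_elim auto
  qed
  finally show ?thesis .
qed

text \<open>64 is Doob's constant 4 times the constant 16 of the estimate at a fixed time.\<close>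

lemma ito_integral_diff_sup:
  fixes H H' :: "('a, real ^ 'd ^ 'n) process"
  assumes I: "ito_integral M F Z L T H I" and I': "ito_integral M F Z L T H' I'"
  shows "nn_sup_sq M {0..T} (\<lambda>t w. I t w - I' t w) \<le> 64 * clock_norm T (\<lambda>s w. H s w - H' s w)"
proof -
  have "nn_sup_sq M {0..T} (\<lambda>t w. I t w - I' t w) \<le> 4 * nn_sq M (\<lambda>w. I T w - I' T w)"
  proof (rule doob[OF L2_martingale_diff[OF ito_integral_martingale[OF I] ito_integral_martingale[OF I']]])
    show "AE w in M. continuous_on {0..T} (\<lambda>t. I t w - I' t w)"
      using ito_integral_continuous[OF I] ito_integral_continuous[OF I'] by eventually_elim (rule continuous_on_diff)
  qed
  also have "\<dots> \<le> 4 * (16 * clock_norm T (\<lambda>s w. H s w - H' s w))"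
    using T_pos by (intro mult_left_mono ito_integral_diff[OF I I']) auto
  finally show ?thesis by (simp add: mult.assoc[symmetric])
qed

lemma ito_integral_sup_finite:
  fixes H :: "('a, real ^ 'd ^ 'n) process"
  assumes I: "ito_integral M F Z L T H I"
  shows "nn_sup_sq M {0..T} I < \<infinity>"
proof -
  have "nn_sup_sq M {0..T} I \<le> 4 * nn_sq M (I T)"
    by (rule doob[OF ito_integral_martingale[OF I] ito_integral_continuous[OF I]])
  also have "\<dots> < \<infinity>"
    using L2_martingaleD(2)[OF ito_integral_martingale[OF I], of T] T_pos
    by (simp add: L2_iff_nn ennreal_mult_less_top)
  finally show ?thesis .
qed

section \<open>Density of simple integrands and existence of the integral\<close>

lemma truncation_clock_norm:
  fixes K :: "('a, 'v::euclidean_space) process"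
  assumes K: "prog_measurable F T K" and fin: "clock_norm T K < \<infinity>"
  shows "(\<lambda>N. clock_norm T (\<lambda>s w. K s w - (if norm (K s w) \<le> real N then K s w else 0))) \<longlonglongrightarrow> 0"
proof -
  let ?R = "\<lambda>N s w. K s w - (if norm (K s w) \<le> real N then K s w else 0)"
  have T: "T \<in> {0..T}" using T_pos by simp
  have Rp: "prog_measurable F T (?R N)" for N
    by (rule prog_measurable_compose[OF K, where h = "\<lambda>x. x - (if norm x \<le> real N then x else 0)"]) measurable
  have Rle: "ennreal ((norm (?R N s w))\<^sup>2) \<le> ennreal ((norm (K s w))\<^sup>2)" for N s w by (auto intro: ennreal_leI)
  have R0: "(\<lambda>N. ennreal ((norm (?R N s w))\<^sup>2)) \<longlonglongrightarrow> 0" for s w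
  proof (rule tendsto_eventually)
    obtain N0 :: nat where "norm (K s w) \<le> real N0" using real_arch_simple by blast
    then show "\<forall>\<^sub>F N in sequentially. ennreal ((norm (?R N s w))\<^sup>2) = 0"
      by (auto simp: eventually_sequentially intro!: exI[of _ N0])
  qed
  have AEfin: "AE w in M. (nn_sq_on (path_measure L w) {0..T} (\<lambda>s. K s w)) \<noteq> \<infinity>"
    using fin clock_norm_inner_measurable[OF K T] unfolding clock_norm_def
    by (intro nn_integral_noteq_infinite) auto
  have "(\<lambda>N. clock_norm T (?R N)) \<longlonglongrightarrow> (\<integral>\<^sup>+w. 0 \<partial>M)"
    unfolding clock_norm_def
  proof (rule nn_integral_dominated_convergence[where w = "\<lambda>w. \<integral>\<^sup>+s\<in>{0..T}. ennreal ((norm (K s w))\<^sup>2) \<partial>path_measure L w"])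
    show "AE w in M. nn_sq_on (path_measure L w) {0..T} (\<lambda>s. ?R N s w) \<le> nn_sq_on (path_measure L w) {0..T} (\<lambda>s. K s w)" for N
      by (intro AE_I2 nn_integral_mono mult_right_mono Rle) auto
    show "(\<integral>\<^sup>+w. nn_sq_on (path_measure L w) {0..T} (\<lambda>s. K s w) \<partial>M) < \<infinity>"
      using fin by (simp add: clock_norm_def)
    show "AE w in M. (\<lambda>N. \<integral>\<^sup>+s\<in>{0..T}. ennreal ((norm (?R N s w))\<^sup>2) \<partial>path_measure L w) \<longlonglongrightarrow> 0"
      using AEfin AE_space
    proof eventually_elim
      case (elim w)
      have m: "(\<lambda>s. ennreal ((norm (X s w))\<^sup>2) * indicator {0..T} s) \<in> borel_measurable (path_measure L w)" if "prog_measurable F T X" for X :: "('a, 'v) process"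
        using prog_path_measurable[OF prog_measurable_norm_sq[OF that] T elim(2)] by simp
      have "(\<lambda>N. \<integral>\<^sup>+s. ennreal ((norm (?R N s w))\<^sup>2) * indicator {0..T} s \<partial>path_measure L w) \<longlonglongrightarrow> (\<integral>\<^sup>+s. 0 \<partial>path_measure L w)"
      proof (rule nn_integral_dominated_convergence[where w = "\<lambda>s. ennreal ((norm (K s w))\<^sup>2) * indicator {0..T} s"])
        show "(\<integral>\<^sup>+s. ennreal ((norm (K s w))\<^sup>2) * indicator {0..T} s \<partial>path_measure L w) < \<infinity>"
          using elim(1) by (simp add: less_top)
        show "AE s in path_measure L w. ennreal ((norm (?R N s w))\<^sup>2) * indicator {0..T} s \<le> ennreal ((norm (K s w))\<^sup>2) * indicator {0..T} s" for N
          by (intro AE_I2 mult_right_mono Rle) auto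
        show "AE s in path_measure L w. (\<lambda>N. ennreal ((norm (?R N s w))\<^sup>2) * indicator {0..T} s) \<longlonglongrightarrow> 0"
        proof (rule AE_I2)
          fix s
          show "(\<lambda>N. ennreal ((norm (?R N s w))\<^sup>2) * indicator {0..T} s) \<longlonglongrightarrow> 0"
            using R0[of s w] by (cases "s \<in> {0..T}") auto
        qed
      qed (use m[OF Rp] m[OF K] in auto)
      then show ?case by simp
    qed
  qed (use clock_norm_inner_measurable[OF Rp T] clock_norm_inner_measurable[OF K T] in auto)
  then show ?thesis by simp
qed

text \<open>Pathwise L1 convergence in time suffices: the error is bounded by \<open>2 * C\<close>,
  so its square is at most \<open>2 * C\<close> times its absolute value, and \<open>dL\<close> is
  at most \<open>dt / \<kappa>\<close>. Together these give the constant
  \<open>2 * C / \<kappa>\<close>.\<close>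

lemma simple_approximation_bounded:
  fixes K :: "('a, real ^ 'd ^ 'n) process"
  assumes K: "prog_measurable F T K" and b: "\<And>s w. norm (K s w) \<le> C"
  shows "\<exists>m p xi. (\<forall>k. simple_integrand M F T (m k) (p k) (xi k)) \<and>
    (\<lambda>k. clock_norm T (\<lambda>s w. K s w - simple_process (m k) (p k) (xi k) s w)) \<longlonglongrightarrow> 0"
proof -
  have T: "T \<in> {0..T}" using T_pos by simp
  have C: "0 \<le> C" using order_trans[OF norm_ge_zero b[of 0 undefined]] .
  define f where "f w s = K (max 0 (min T s)) w" for w s
  have fm: "f w \<in> borel_measurable borel" if "w \<in> space M" for w
    unfolding f_def[abs_def] using prog_measurable_path[OF K, of w] that space_G[OF T] T_pos by auto
  have fb: "norm (f w s) \<le> C" for w s by (simp add: f_def b)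
  define p where "p k i = T * real i / real (Suc k)" for k i
  define xi where "xi k i w = step_average T (Suc k) (f w) i" for k i w
  have pr: "p k i \<in> {0..T}" if "i \<le> Suc k" for k i
    using that T_pos by (auto simp: p_def field_simps simp del: of_nat_Suc)
  have sp: "simple_process (Suc k) (p k) (xi k) s w = step_approx T (Suc k) (f w) s" for k s w
    by (simp add: simple_process_def step_approx_def p_def xi_def)
  have S: "simple_integrand M F T (Suc k) (p k) (xi k)" for k
    unfolding simple_integrand_def
  proof (intro conjI allI impI)
    show "p k 0 = 0" "p k (Suc k) = T" by (simp_all add: p_def del: of_nat_Suc)
    fix i assume i: "i < Suc k"
    show "p k i \<le> p k (Suc i)" using T_pos unfolding p_def by (intro divide_right_mono mult_left_mono) auto
    have pi: "p k i \<in> {0..T}" using i by (intro pr) simp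
    show "xi k i \<in> borel_measurable (F (p k i))"
    proof (cases "i = 0")
      case True
      then have "xi k i = (\<lambda>w. 0)" by (simp add: xi_def step_average_def fun_eq_iff)
      then show ?thesis by simp
    next
      case False
      \<comment> \<open>Only the path up to \<open>p k i\<close> enters the average, so the time may
        be clipped there and progressive measurability at \<open>p k i\<close> applies.\<close>
      have [measurable]: "(\<lambda>(w, s). K (max 0 (min (p k i) s)) w) \<in> F (p k i) \<Otimes>\<^sub>M borel \<rightarrow>\<^sub>M borel"
        by (rule prog_measurable_clip[OF K pi])
      have "(\<lambda>w. \<integral>s. indicator {p k (i - 1)<..p k i} s *\<^sub>R K (max 0 (min (p k i) s)) w \<partial>lborel) \<in> borel_measurable (F (p k i))"
        by measurable
      moreover have "indicator {p k (i - 1)<..p k i} s *\<^sub>R K (max 0 (min (p k i) s)) w = indicator {p k (i - 1)<..p k i} s *\<^sub>R f w s" for s w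
      proof (cases "s \<in> {p k (i - 1)<..p k i}")
        case True
        moreover have "0 \<le> p k (i - 1)" using pr[of "i - 1" k] i by auto
        ultimately have "max 0 (min (p k i) s) = s" "max 0 (min T s) = s" using pi by auto
        then show ?thesis by (simp add: f_def)
      qed simp
      ultimately have "(\<lambda>w. LINT s:{p k (i - 1)<..p k i}|lborel. f w s) \<in> borel_measurable (F (p k i))"
        by (simp only: set_lebesgue_integral_def)
      then show ?thesis using False unfolding xi_def step_average_def p_def by (simp del: of_nat_Suc of_nat_diff)
    qed
    show "\<exists>C. \<forall>w\<in>space M. norm (xi k i w) \<le> C"
      using norm_step_average_le(1)[OF fm fb T_pos, of _ "Suc k" i] unfolding xi_def by blast
  qed
  have hp: "prog_measurable F T (simple_process (Suc k) (p k) (xi k))" for k by (rule simple_process_prog[OF S])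
  let ?d = "\<lambda>k s w. norm (K s w - simple_process (Suc k) (p k) (xi k) s w)"
  let ?A = "\<lambda>k w. \<integral>\<^sup>+s\<in>{0..T}. ennreal (?d k s w) \<partial>lborel"
  have dp: "prog_measurable F T (\<lambda>s w. ennreal (?d k s w))" for k
    by (rule prog_measurable_compose[OF prog_measurable_diff[OF K hp]]) simp
  have Am: "?A k \<in> borel_measurable M" for k
    using measurable_GM[OF nn_integral_lborel_adapted[OF dp T] T] .
  have d2C: "?d k s w \<le> 2 * C" if "w \<in> space M" "s \<in> {0..T}" for k s w
  proof -
    have "norm (simple_process (Suc k) (p k) (xi k) s w) \<le> C"
      unfolding sp by (rule norm_step_approx_le[OF fm[OF that(1)] fb T_pos _ that(2)]) simp
    then show ?thesis using b[of s w] norm_triangle_ineq4[of "K s w" "simple_process (Suc k) (p k) (xi k) s w"] by simp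
  qed
  have "(\<lambda>k. \<integral>\<^sup>+w. ?A k w \<partial>M) \<longlonglongrightarrow> (\<integral>\<^sup>+w. 0 \<partial>M)"
  proof (rule nn_integral_dominated_convergence[where w = "\<lambda>w. ennreal (2 * C) * ennreal T"])
    show "AE w in M. ?A k w \<le> ennreal (2 * C) * ennreal T" for k
    proof (rule AE_I2)
      fix w assume w: "w \<in> space M"
      have "?A k w \<le> (\<integral>\<^sup>+s\<in>{0..T}. ennreal (2 * C) \<partial>lborel)"
        using d2C[OF w] by (intro nn_integral_mono) (auto simp: indicator_def intro!: ennreal_leI)
      also have "\<dots> = ennreal (2 * C) * ennreal T" using T_pos by (simp add: nn_integral_cmult_indicator)
      finally show "?A k w \<le> ennreal (2 * C) * ennreal T" .
    qed
    show "(\<integral>\<^sup>+w. ennreal (2 * C) * ennreal T \<partial>M) < \<infinity>" by (simp add: emeasure_space_1 ennreal_mult_less_top)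
    show "AE w in M. (\<lambda>k. ?A k w) \<longlonglongrightarrow> 0"
    proof (rule AE_I2)
      fix w assume w: "w \<in> space M"
      have "?A k w = (\<integral>\<^sup>+s\<in>{0..T}. ennreal (norm (step_approx T (Suc k) (f w) s - f w s)) \<partial>lborel)" for k
        unfolding sp by (intro nn_integral_cong) (auto simp: f_def indicator_def norm_minus_commute)
      then show "(\<lambda>k. ?A k w) \<longlonglongrightarrow> 0" using step_approx_tendsto[OF fm[OF w] fb T_pos] by simp
    qed
  qed (use Am in auto)
  then have lim: "(\<lambda>k. ennreal (2 * C / \<kappa>) * (\<integral>\<^sup>+w. ?A k w \<partial>M)) \<longlonglongrightarrow> 0"
    using ennreal_tendsto_cmult[of "ennreal (2 * C / \<kappa>)" "\<lambda>k. \<integral>\<^sup>+w. ?A k w \<partial>M" 0] by simp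
  have le: "clock_norm T (\<lambda>s w. K s w - simple_process (Suc k) (p k) (xi k) s w) \<le> ennreal (2 * C / \<kappa>) * (\<integral>\<^sup>+w. ?A k w \<partial>M)" for k
  proof -
    have "clock_norm T (\<lambda>s w. K s w - simple_process (Suc k) (p k) (xi k) s w) \<le> (\<integral>\<^sup>+w. ennreal (2 * C / \<kappa>) * ?A k w \<partial>M)"
      unfolding clock_norm_def
    proof (rule nn_integral_mono_AE)
      show "AE w in M. (\<integral>\<^sup>+s\<in>{0..T}. ennreal ((?d k s w)\<^sup>2) \<partial>path_measure L w) \<le> ennreal (2 * C / \<kappa>) * ?A k w"
        using L_regular AE_space
      proof eventually_elim
        case (elim w)
        have "(\<integral>\<^sup>+s\<in>{0..T}. ennreal ((?d k s w)\<^sup>2) \<partial>path_measure L w) \<le> ennreal (1 / \<kappa>) * (\<integral>\<^sup>+s\<in>{0..T}. ennreal ((?d k s w)\<^sup>2) \<partial>lborel)"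
          by (rule path_le[OF elim(1)])
        also have "(\<integral>\<^sup>+s\<in>{0..T}. ennreal ((?d k s w)\<^sup>2) \<partial>lborel) \<le> (\<integral>\<^sup>+s. ennreal (2 * C) * (ennreal (?d k s w) * indicator {0..T} s) \<partial>lborel)"
        proof (rule nn_integral_mono)
          fix s
          have "(?d k s w)\<^sup>2 \<le> 2 * C * ?d k s w" if "s \<in> {0..T}"
            unfolding power2_eq_square by (intro mult_right_mono d2C elim that) auto
          then show "ennreal ((?d k s w)\<^sup>2) * indicator {0..T} s \<le> ennreal (2 * C) * (ennreal (?d k s w) * indicator {0..T} s)"
            using C by (auto simp: indicator_def ennreal_mult[symmetric] intro: ennreal_leI)
        qed
        also have "\<dots> = ennreal (2 * C) * ?A k w"
          using prog_path_measurable[OF dp T elim(2)] by (intro nn_integral_cmult) simp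
        finally have "(\<integral>\<^sup>+s\<in>{0..T}. ennreal ((?d k s w)\<^sup>2) \<partial>path_measure L w) \<le> ennreal (1 / \<kappa>) * (ennreal (2 * C) * ?A k w)"
          by (simp add: mult_left_mono)
        also have "\<dots> = ennreal (2 * C / \<kappa>) * ?A k w"
          using C \<kappa>_pos by (simp add: mult.assoc[symmetric] ennreal_mult[symmetric])
        finally show ?case .
      qed
    qed
    also have "\<dots> = ennreal (2 * C / \<kappa>) * (\<integral>\<^sup>+w. ?A k w \<partial>M)" using Am by (intro nn_integral_cmult)
    finally show ?thesis .
  qed
  have "(\<lambda>k. clock_norm T (\<lambda>s w. K s w - simple_process (Suc k) (p k) (xi k) s w)) \<longlonglongrightarrow> 0"
    by (rule tendsto_sandwich[OF _ _ tendsto_const lim]) (auto simp: le)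
  then show ?thesis using S by (intro exI[of _ Suc] exI[of _ p] exI[of _ xi]) auto
qed

lemma simple_approximation:
  fixes K :: "('a, real ^ 'd ^ 'n) process"
  assumes K: "prog_measurable F T K" and fin: "clock_norm T K < \<infinity>" and e: "0 < (e::real)"
  shows "\<exists>m p xi. simple_integrand M F T m p xi \<and> clock_norm T (\<lambda>s w. K s w - simple_process m p xi s w) < ennreal e"
proof -
  have T: "T \<in> {0..T}" using T_pos by simp
  define R where "R N s w = (if norm (K s w) \<le> real N then K s w else 0)" for N :: nat and s w
  have Rp: "prog_measurable F T (R N)" for N
    unfolding R_def by (rule prog_measurable_compose[OF K, where h = "\<lambda>x. if norm x \<le> real N then x else 0"]) measurable
  have "\<forall>\<^sub>F N in sequentially. clock_norm T (\<lambda>s w. K s w - R N s w) < ennreal (e / 4)"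
    using truncation_clock_norm[OF K fin] e unfolding R_def by (intro order_tendstoD(2)) auto
  then obtain N where N: "clock_norm T (\<lambda>s w. K s w - R N s w) < ennreal (e / 4)"
    by (auto simp: eventually_sequentially)
  have "norm (R N s w) \<le> real N" for s w by (simp add: R_def)
  from simple_approximation_bounded[OF Rp this]
  obtain m p xi where "\<forall>k. simple_integrand M F T (m k) (p k) (xi k)"
    and lim: "(\<lambda>k. clock_norm T (\<lambda>s w. R N s w - simple_process (m k) (p k) (xi k) s w)) \<longlonglongrightarrow> 0"
    by (elim exE conjE) (rule that)
  then have S: "\<And>k. simple_integrand M F T (m k) (p k) (xi k)" by simp
  have "\<forall>\<^sub>F k in sequentially. clock_norm T (\<lambda>s w. R N s w - simple_process (m k) (p k) (xi k) s w) < ennreal (e / 4)"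
    using lim e by (intro order_tendstoD(2)) auto
  then obtain k where k: "clock_norm T (\<lambda>s w. R N s w - simple_process (m k) (p k) (xi k) s w) < ennreal (e / 4)"
    by (auto simp: eventually_sequentially)
  have "clock_norm T (\<lambda>s w. K s w - simple_process (m k) (p k) (xi k) s w) =
      clock_norm T (\<lambda>s w. (K s w - R N s w) + (R N s w - simple_process (m k) (p k) (xi k) s w))" by simp
  also have "\<dots> \<le> 2 * clock_norm T (\<lambda>s w. K s w - R N s w) + 2 * clock_norm T (\<lambda>s w. R N s w - simple_process (m k) (p k) (xi k) s w)"
    by (intro clock_norm_add prog_measurable_diff K Rp simple_process_prog S T)
  also have "\<dots> < 2 * ennreal (e / 4) + 2 * ennreal (e / 4)"
    using N k by (intro add_strict_mono ennreal_mult_strict_left_mono) auto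
  also have "2 * ennreal (e / 4) + 2 * ennreal (e / 4) = ennreal 4 * ennreal (e / 4)"
    unfolding distrib_right[symmetric] by simp
  also have "\<dots> = ennreal (4 * (e / 4))" using e by (intro ennreal_mult[symmetric]) auto
  also have "\<dots> = ennreal e" by simp
  finally show ?thesis using S by blast
qed

text \<open>The approximations are chosen at the rate \<open>(1/16) ^ k\<close>. Doob's inequality
  bounds consecutive differences of the simple integrals by \<open>4 * (2 + 2)\<close> times this
  rate, as \<open>uniform_limit_process\<close> requires; continuity of the integral comes with the
  uniform limit.\<close>

lemma ito_integral_exists:
  fixes K :: "('a, real ^ 'd ^ 'n) process"
  assumes K: "prog_measurable F T K" and fin: "clock_norm T K < \<infinity>"
  shows "\<exists>I. ito_integral M F Z L T K I"
proof -
  have T: "T \<in> {0..T}" using T_pos by simp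
  have "\<forall>k. \<exists>x. simple_integrand M F T (fst x) (fst (snd x)) (snd (snd x)) \<and>
      clock_norm T (\<lambda>s w. K s w - simple_process (fst x) (fst (snd x)) (snd (snd x)) s w) < ennreal ((1/16) ^ k)"
  proof
    fix k :: nat
    obtain m p xi where "simple_integrand M F T m p xi \<and> clock_norm T (\<lambda>s w. K s w - simple_process m p xi s w) < ennreal ((1/16) ^ k)"
      using simple_approximation[OF K fin, of "(1/16) ^ k"] by auto
    then show "\<exists>x. simple_integrand M F T (fst x) (fst (snd x)) (snd (snd x)) \<and>
      clock_norm T (\<lambda>s w. K s w - simple_process (fst x) (fst (snd x)) (snd (snd x)) s w) < ennreal ((1/16) ^ k)"
      by (intro exI[of _ "(m, p, xi)"]) simp
  qed
  from choice[OF this] obtain x where x: "\<And>k. simple_integrand M F T (fst (x k)) (fst (snd (x k))) (snd (snd (x k)))"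
    "\<And>k. clock_norm T (\<lambda>s w. K s w - simple_process (fst (x k)) (fst (snd (x k))) (snd (snd (x k))) s w) < ennreal ((1/16) ^ k)"
    by blast
  define m p xi where "m k = fst (x k)" and "p k = fst (snd (x k))" and "xi k = snd (snd (x k))" for k
  have S: "\<And>k. simple_integrand M F T (m k) (p k) (xi k)"
    and close: "\<And>k. clock_norm T (\<lambda>s w. K s w - simple_process (m k) (p k) (xi k) s w) < ennreal ((1/16) ^ k)"
    unfolding m_def p_def xi_def by (rule x)+
  define J where "J k = simple_integral Z (m k) (p k) (xi k)" for k
  define h where "h k = simple_process (m k) (p k) (xi k)" for k
  have hp: "prog_measurable F T (h k)" for k unfolding h_def by (rule simple_process_prog[OF S])
  have Jm: "L2_martingale (J k)" for k unfolding J_def by (rule simple_integral_martingale[OF S])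
  have Jc: "AE w in M. continuous_on {0..T} (\<lambda>t. J k t w)" for k unfolding J_def by (rule simple_integral_continuous[OF S])
  have bound: "nn_sup_sq M {0..T} (\<lambda>t w. J (Suc k) t w - J k t w) \<le> ennreal (16 * (1/16) ^ k)" for k
  proof -
    have "nn_sup_sq M {0..T} (\<lambda>t w. J (Suc k) t w - J k t w) \<le> 4 * nn_sq M (\<lambda>w. J (Suc k) T w - J k T w)"
    proof (rule doob[OF L2_martingale_diff[OF Jm Jm]])
      show "AE w in M. continuous_on {0..T} (\<lambda>t. J (Suc k) t w - J k t w)"
        using Jc[of "Suc k"] Jc[of k] by eventually_elim (rule continuous_on_diff)
    qed
    also have "nn_sq M (\<lambda>w. J (Suc k) T w - J k T w) = clock_norm T (\<lambda>s w. h (Suc k) s w - h k s w)"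
      unfolding J_def h_def clock_norm_def by (rule simple_diff_iso[OF S S T])
    also have "\<dots> = clock_norm T (\<lambda>s w. (h (Suc k) s w - K s w) + (K s w - h k s w))" by simp
    also have "\<dots> \<le> 2 * clock_norm T (\<lambda>s w. h (Suc k) s w - K s w) + 2 * clock_norm T (\<lambda>s w. K s w - h k s w)"
      by (intro clock_norm_add prog_measurable_diff K hp T)
    also have "\<dots> \<le> 2 * ennreal ((1/16) ^ k) + 2 * ennreal ((1/16) ^ k)"
    proof (intro add_mono mult_left_mono)
      have "clock_norm T (\<lambda>s w. h (Suc k) s w - K s w) \<le> ennreal ((1/16) ^ Suc k)"
        using close[of "Suc k"] clock_norm_minus[of T "h (Suc k)" K] unfolding h_def by simp
      also have "\<dots> \<le> ennreal ((1/16) ^ k)" by (intro ennreal_leI) simp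
      finally show "clock_norm T (\<lambda>s w. h (Suc k) s w - K s w) \<le> ennreal ((1/16) ^ k)" .
      show "clock_norm T (\<lambda>s w. K s w - h k s w) \<le> ennreal ((1/16) ^ k)"
        using close[of k] unfolding h_def by simp
    qed auto
    finally have "nn_sup_sq M {0..T} (\<lambda>t w. J (Suc k) t w - J k t w) \<le> 4 * (2 * ennreal ((1/16) ^ k) + 2 * ennreal ((1/16) ^ k))"
      by (simp add: mult_left_mono)
    also have "\<dots> = ennreal (16 * (1/16) ^ k)"
      by (simp add: ennreal_mult distrib_left[symmetric] mult_2[symmetric] mult.assoc[symmetric])
    finally show ?thesis .
  qed
  obtain I where Im: "\<And>t. t \<in> {0..T} \<Longrightarrow> I t \<in> borel_measurable (F t)" and Ic: "\<And>w. continuous_on {0..T} (\<lambda>t. I t w)"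
    and lim: "(\<lambda>k. \<integral>\<^sup>+w. (SUP t\<in>{0..T}. ennreal ((norm (I t w - J k t w))\<^sup>2)) \<partial>M) \<longlonglongrightarrow> 0"
    using uniform_limit_process[OF L2_martingaleD(1)[OF Jm] Jc bound] by auto
  have "ito_integral M F Z L T K I"
    unfolding ito_integral_def
  proof (intro conjI)
    show "\<exists>K'. prog_measurable F T K' \<and> (AE w in M. \<forall>t\<in>{0..T}. K t w = K' t w)" using K by auto
    show "(\<integral>\<^sup>+w. nn_sq_on (path_measure L w) {0..T} (\<lambda>t. K t w) \<partial>M) < \<infinity>" using fin by (simp add: clock_norm_def)
    show "\<forall>t\<in>{0..T}. I t \<in> borel_measurable (F t)" using Im by blast
    show "AE w in M. continuous_on {0..T} (\<lambda>t. I t w)" using Ic by simp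
    have l1: "(\<lambda>k. clock_norm T (\<lambda>s w. K s w - simple_process (m k) (p k) (xi k) s w)) \<longlonglongrightarrow> 0"
    proof (rule tendsto_sandwich[OF _ _ tendsto_const])
      have "(\<lambda>k. ennreal ((1/16) ^ k)) \<longlonglongrightarrow> ennreal 0" by (intro tendsto_ennrealI LIMSEQ_power_zero) simp
      then show "(\<lambda>k. ennreal ((1/16) ^ k)) \<longlonglongrightarrow> 0" by simp
    qed (use close in \<open>auto intro!: always_eventually less_imp_le\<close>)
    have l2: "(\<lambda>k. \<integral>\<^sup>+w. ennreal ((norm (I t w - J k t w))\<^sup>2) \<partial>M) \<longlonglongrightarrow> 0" if t: "t \<in> {0..T}" for t
    proof (rule tendsto_sandwich[OF _ _ tendsto_const lim])
      show "\<forall>\<^sub>F k in sequentially. (nn_sq M (\<lambda>w. I t w - J k t w)) \<le> nn_sup_sq M {0..T} (\<lambda>t w. I t w - J k t w)"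
        by (intro always_eventually allI nn_integral_mono SUP_upper t)
    qed simp
    show "\<exists>m p xi. (\<forall>k. simple_integrand M F T (m k) (p k) (xi k)) \<and>
        (\<lambda>k. \<integral>\<^sup>+w. nn_sq_on (path_measure L w) {0..T} (\<lambda>t. K t w - simple_process (m k) (p k) (xi k) t w) \<partial>M) \<longlonglongrightarrow> 0 \<and>
        (\<forall>t\<in>{0..T}. (\<lambda>k. \<integral>\<^sup>+w. ennreal ((norm (I t w - simple_integral Z (m k) (p k) (xi k) t w))\<^sup>2) \<partial>M) \<longlonglongrightarrow> 0)"
      using S l1 l2 unfolding clock_norm_def J_def by blast
  qed
  then show ?thesis by blast
qed

end

section \<open>Wasserstein distance and coefficients\<close>

lemma exp_series_term_le:
  assumes "0 \<le> (x::real)" shows "x ^ n / fact n \<le> exp x"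
proof -
  have "(\<Sum>k\<in>{n}. x ^ k /\<^sub>R fact k) \<le> (\<Sum>k. x ^ k /\<^sub>R fact k)"
    using assms by (intro sum_le_suminf summable_exp_generic) auto
  then show ?thesis by (simp add: exp_def divide_inverse mult.commute)
qed

lemma exp_series_term_tendsto_0: "(\<lambda>n. (x::real) ^ n / fact n) \<longlonglongrightarrow> 0"
  using summable_LIMSEQ_zero[OF summable_exp_generic[of x]] by (simp add: divide_inverse mult.commute)

text \<open>The functions may vary with the index: a constant sequence gives Gronwall's inequality,
  successive differences of Picard iterates give their rate of convergence. Each integration of the
  bound contributes one factor \<open>K * t / (k + 1)\<close>.\<close>

lemma gronwall_iterate:
  fixes h :: "nat \<Rightarrow> real \<Rightarrow> ennreal"
  assumes K: "0 \<le> K" and c: "0 \<le> c"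
    and h0: "\<And>t. t \<in> {0..T} \<Longrightarrow> h 0 t \<le> ennreal c"
    and hS: "\<And>k t. t \<in> {0..T} \<Longrightarrow> h (Suc k) t \<le> ennreal K * (\<integral>\<^sup>+ s\<in>{0..t}. h k s \<partial>lborel)"
    and t: "t \<in> {0..T}"
  shows "h k t \<le> ennreal (c * ((K * t) ^ k / fact k))"
  using t
proof (induction k arbitrary: t)
  case 0 then show ?case using h0 by simp
next
  case (Suc k)
  let ?f = "\<lambda>s. c * ((K * s) ^ k / fact k)" and ?F = "\<lambda>s. c * (K ^ k * s ^ Suc k / fact (Suc k))"
  have "h (Suc k) t \<le> ennreal K * (\<integral>\<^sup>+ s\<in>{0..t}. h k s \<partial>lborel)" by (rule hS[OF Suc.prems])
  also have "(\<integral>\<^sup>+ s\<in>{0..t}. h k s \<partial>lborel) \<le> (\<integral>\<^sup>+ s\<in>{0..t}. ennreal (?f s) \<partial>lborel)"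
  proof (rule nn_integral_mono)
    fix s
    show "h k s * indicator {0..t} s \<le> ennreal (?f s) * indicator {0..t} s"
      using Suc.IH[of s] Suc.prems by (cases "s \<in> {0..t}") auto
  qed
  also have "\<dots> = ennreal (?F t - ?F 0)"
  proof (rule nn_integral_FTC_Icc)
    fix s assume "s \<in> {0..t}"
    then show "0 \<le> ?f s" using K c by auto
    have "(?F has_real_derivative c * (K ^ k * (real (Suc k) * s ^ k) / fact (Suc k))) (at s)"
      by (auto intro!: derivative_eq_intros simp del: power_Suc)
    moreover have "c * (K ^ k * (real (Suc k) * s ^ k) / fact (Suc k)) = ?f s"
      by (simp add: power_mult_distrib fact_Suc field_simps del: of_nat_Suc)
    ultimately show "(?F has_real_derivative ?f s) (at s)" by (simp only:)
  qed (use Suc.prems in auto)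
  also have "?F t - ?F 0 = ?F t" by simp
  finally have "h (Suc k) t \<le> ennreal K * ennreal (?F t)" by (simp add: mult_left_mono)
  also have "\<dots> = ennreal (K * ?F t)" using K c Suc.prems by (intro ennreal_mult[symmetric]) auto
  also have "K * ?F t = c * ((K * t) ^ Suc k / fact (Suc k))" by (simp add: power_mult_distrib del: fact_Suc)
  finally show ?case .
qed

text \<open>By Cauchy-Schwarz the squared increment over \<open>(s, t]\<close> is at most the mass
  of \<open>(s, t]\<close> times the total square integral, so the integral is Hoelder continuous
  with exponent 1/2 in its upper limit.\<close>

lemma norm_integral_interval_continuous:
  fixes f :: "real \<Rightarrow> 'v::euclidean_space"
  assumes sN: "sets N = sets borel" and em: "\<And>s t. 0 \<le> s \<Longrightarrow> s \<le> t \<Longrightarrow> t \<le> T \<Longrightarrow> emeasure N {s<..t} \<le> ennreal (c * (t - s))"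
    and c: "0 \<le> c" and f: "set_integrable N {0..T} f"
    and fin: "nn_sq_on N {0..T} f < \<infinity>"
  shows "continuous_on {0..T} (\<lambda>t. LINT s:{0..t}|N. f s)"
proof -
  define B where "B = enn2real (nn_sq_on N {0..T} f)"
  have B: "nn_sq_on N {0..T} f = ennreal B" "0 \<le> B" using fin by (auto simp: B_def)
  have si: "set_integrable N A f" if "A \<in> sets borel" "A \<subseteq> {0..T}" for A
    using f sN that by (intro set_integrable_subset[OF f]) auto
  have est: "(norm ((LINT r:{0..t}|N. f r) - (LINT r:{0..s}|N. f r)))\<^sup>2 \<le> c * (t - s) * B"
    if st: "0 \<le> s" "s \<le> t" "t \<le> T" for s t
  proof -
    have "(LINT r:{0..s} \<union> {s<..t}|N. f r) = (LINT r:{0..s}|N. f r) + (LINT r:{s<..t}|N. f r)"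
      using st by (intro set_integral_Un si) auto
    moreover have "{0..s} \<union> {s<..t} = {0..t}" using st by auto
    ultimately have "(LINT r:{0..t}|N. f r) - (LINT r:{0..s}|N. f r) = (LINT r:{s<..t}|N. f r)" by simp
    moreover have "ennreal ((norm (LINT r:{s<..t}|N. f r))\<^sup>2) \<le> emeasure N {s<..t} * nn_sq_on N {s<..t} f"
      using st sN by (intro ennreal_norm_set_integral_sq_le si) auto
    moreover have "\<dots> \<le> ennreal (c * (t - s)) * nn_sq_on N {0..T} f"
      using st by (intro mult_mono em nn_integral_mono) (auto simp: indicator_def)
    ultimately have "ennreal ((norm ((LINT r:{0..t}|N. f r) - (LINT r:{0..s}|N. f r)))\<^sup>2) \<le> ennreal (c * (t - s)) * ennreal B"
      unfolding B(1)[symmetric] by simp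
    also have "\<dots> = ennreal (c * (t - s) * B)" using c st B by (intro ennreal_mult[symmetric]) auto
    finally show ?thesis using c st B by simp
  qed
  let ?g = "\<lambda>t. LINT r:{0..t}|N. f r"
  have est2: "norm (?g t - ?g s) \<le> sqrt (c * B * \<bar>t - s\<bar>)" if "s \<in> {0..T}" "t \<in> {0..T}" for s t
  proof (cases "s \<le> t")
    case True
    then show ?thesis using est[of s t] that by (intro real_le_rsqrt) (auto simp: ac_simps)
  next
    case False
    then show ?thesis using est[of t s] that by (subst norm_minus_commute, intro real_le_rsqrt) (auto simp: ac_simps)
  qed
  show ?thesis
    unfolding continuous_on_def
  proof
    fix s assume s: "s \<in> {0..T}"
    have "((\<lambda>t. sqrt (c * B * \<bar>t - s\<bar>)) \<longlongrightarrow> sqrt (c * B * \<bar>s - s\<bar>)) (at s within {0..T})"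
      by (intro tendsto_intros)
    then have "((\<lambda>t. sqrt (c * B * \<bar>t - s\<bar>)) \<longlongrightarrow> 0) (at s within {0..T})" by simp
    then have "((\<lambda>t. ?g t - ?g s) \<longlongrightarrow> 0) (at s within {0..T})"
      by (rule Lim_null_comparison[rotated]) (use est2[OF s] in \<open>auto simp: eventually_at_filter\<close>)
    then show "(?g \<longlongrightarrow> ?g s) (at s within {0..T})" by (simp add: LIM_zero_iff)
  qed
qed

lemma (in prob_space) distr_prob_measure:
  "X \<in> borel_measurable M \<Longrightarrow> distr M borel X \<in> prob_measures"
  by (simp add: space_prob_algebra prob_space_distr)

lemma (in prob_space) distr_zero: "distr M borel (\<lambda>w. 0) = return borel 0"
  by (rule distr_const) simp

lemma (in prob_space) wasserstein2_le:
  fixes X Y :: "'a \<Rightarrow> 'b::euclidean_space"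
  assumes [measurable]: "X \<in> borel_measurable M" "Y \<in> borel_measurable M"
  shows "wasserstein2 (distr M borel X) (distr M borel Y) \<le> ennreal_sqrt (nn_sq M (\<lambda>w. X w - Y w))"
proof -
  let ?\<pi> = "distr M (borel \<Otimes>\<^sub>M borel) (\<lambda>w. (X w, Y w))"
  have "?\<pi> \<in> couplings (distr M borel X) (distr M borel Y)"
    by (auto simp: couplings_def space_prob_algebra distr_distr comp_def intro!: prob_space_distr)
  then have "wasserstein2 (distr M borel X) (distr M borel Y) \<le> ennreal_sqrt (\<integral>\<^sup>+ (x, y). ennreal ((norm (x - y))\<^sup>2) \<partial>?\<pi>)"
    unfolding wasserstein2_def by (rule INF_lower)
  also have "(\<integral>\<^sup>+ (x, y). ennreal ((norm (x - y))\<^sup>2) \<partial>?\<pi>) = nn_sq M (\<lambda>w. X w - Y w)"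
    by (subst nn_integral_distr) (auto simp: case_prod_unfold)
  finally show ?thesis .
qed

text \<open>The points \<open>x\<close>, \<open>y\<close> are independent of the variables
  \<open>X\<close>, \<open>Y\<close> that supply the laws: later they are the values at a single
  \<open>w\<close>, whereas the mean square distance is deterministic. An infinite second moment of
  the difference makes the right side infinite.\<close>

lemma (in prob_space) lipschitz_W2_sq:
  fixes X Y :: "'a \<Rightarrow> real ^ 'n" and f :: "real ^ 'n \<Rightarrow> (real ^ 'n) measure \<Rightarrow> 'c::real_normed_vector"
  assumes f: "lipschitz_W2 C f" and C: "0 < C"
    and m: "X \<in> borel_measurable M" "Y \<in> borel_measurable M"
  shows "ennreal ((norm (f x (distr M borel X) - f y (distr M borel Y)))\<^sup>2) \<le>
    ennreal (2 * C\<^sup>2) * (ennreal ((norm (x - y))\<^sup>2) + nn_sq M (\<lambda>w. X w - Y w))"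
proof (cases "nn_sq M (\<lambda>w. X w - Y w) = \<infinity>")
  case True
  then show ?thesis using C by (simp add: ennreal_mult_top)
next
  case False
  define d where "d = enn2real (nn_sq M (\<lambda>w. X w - Y w))"
  have d: "nn_sq M (\<lambda>w. X w - Y w) = ennreal d" "0 \<le> d"
    using False by (auto simp: d_def less_top)
  let ?r = "norm (f x (distr M borel X) - f y (distr M borel Y))"
  have "ennreal ?r \<le> ennreal C * (ennreal (norm (x - y)) + wasserstein2 (distr M borel X) (distr M borel Y))"
    using f distr_prob_measure[OF m(1)] distr_prob_measure[OF m(2)] by (simp add: lipschitz_W2_def)
  also have "\<dots> \<le> ennreal C * (ennreal (norm (x - y)) + ennreal (sqrt d))"
    using wasserstein2_le[OF m] d by (intro mult_left_mono add_left_mono) (auto simp: ennreal_sqrt_def)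
  also have "\<dots> = ennreal (C * (norm (x - y) + sqrt d))"
    using C d by (simp add: ennreal_mult ennreal_plus)
  finally have "?r \<le> C * (norm (x - y) + sqrt d)" using C d by simp
  then have "?r\<^sup>2 \<le> (C * (norm (x - y) + sqrt d))\<^sup>2" by (intro power_mono) auto
  also have "\<dots> \<le> C\<^sup>2 * (2 * (norm (x - y))\<^sup>2 + 2 * d)"
    using sum_squares_bound[of "norm (x - y)" "sqrt d"] d
    by (simp add: power_mult_distrib power2_sum mult_left_mono)
  also have "\<dots> = 2 * C\<^sup>2 * ((norm (x - y))\<^sup>2 + d)" by (simp add: algebra_simps)
  finally have "ennreal (?r\<^sup>2) \<le> ennreal (2 * C\<^sup>2 * ((norm (x - y))\<^sup>2 + d))" by (rule ennreal_leI)
  then show ?thesis using d by (simp add: ennreal_mult ennreal_plus)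
qed

section \<open>Measurability of coefficients along a process\<close>

context complete_filtration
begin

lemma Omega_adapted: assumes "\<Omega>0 \<in> sets M" "measure M \<Omega>0 = 1" "t \<in> {0..T}" shows "\<Omega>0 \<in> sets (G t)"
proof -
  have "space M - \<Omega>0 \<in> null_sets M"
    using assms prob_compl[of \<Omega>0] by (auto simp: null_sets_def emeasure_eq_measure)
  then have "space M - \<Omega>0 \<in> sets (G t)" using null[OF assms(3)] by auto
  then have "space (G t) - (space M - \<Omega>0) \<in> sets (G t)" by (rule sets.compl_sets)
  moreover have "space (G t) - (space M - \<Omega>0) = \<Omega>0"
    using sets.sets_into_space[OF assms(1)] space_G[OF assms(3)] by auto
  ultimately show ?thesis by simp
qed

definition time_index :: "real \<Rightarrow> nat \<Rightarrow> real \<Rightarrow> nat" where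
  "time_index t k s = nat \<lfloor>2 ^ k * s / t\<rfloor>"

lemma time_index_tendsto:
  assumes t: "0 < t" and s: "s \<in> {0..t}"
  shows "(\<lambda>k. t * real (time_index t k s) / 2 ^ k) \<longlonglongrightarrow> s"
proof -
  have *: "\<bar>t * real (time_index t k s) / 2 ^ k - s\<bar> \<le> t * (1 / 2) ^ k" for k
  proof -
    have "0 \<le> 2 ^ k * s / t" using t s by auto
    then have r: "real (time_index t k s) = of_int \<lfloor>2 ^ k * s / t\<rfloor>" by (simp add: time_index_def)
    have "\<bar>real (time_index t k s) - 2 ^ k * s / t\<bar> \<le> 1" unfolding r by linarith
    then have "\<bar>real (time_index t k s) - 2 ^ k * s / t\<bar> * (t / 2 ^ k) \<le> 1 * (t / 2 ^ k)"
      using t by (intro mult_right_mono) auto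
    also have "\<bar>real (time_index t k s) - 2 ^ k * s / t\<bar> * (t / 2 ^ k) = \<bar>(real (time_index t k s) - 2 ^ k * s / t) * (t / 2 ^ k)\<bar>"
      using t by (simp add: abs_mult)
    also have "(real (time_index t k s) - 2 ^ k * s / t) * (t / 2 ^ k) = t * real (time_index t k s) / 2 ^ k - s"
      using t by (simp add: field_simps)
    finally show ?thesis by (simp add: power_divide)
  qed
  have "(\<lambda>k. t * real (time_index t k s) / 2 ^ k - s) \<longlonglongrightarrow> 0"
  proof (rule Lim_null_comparison)
    show "\<forall>\<^sub>F k in sequentially. norm (t * real (time_index t k s) / 2 ^ k - s) \<le> t * (1 / 2) ^ k"
      using * by simp
    have "(\<lambda>k. t * (1 / 2) ^ k) \<longlonglongrightarrow> t * 0" by (intro tendsto_intros LIMSEQ_power_zero) auto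
    then show "(\<lambda>k. t * (1 / 2) ^ k) \<longlonglongrightarrow> 0" by simp
  qed
  then show ?thesis by (simp add: LIM_zero_iff)
qed

lemma time_index_measurable [measurable]: "time_index t k \<in> borel \<rightarrow>\<^sub>M count_space UNIV"
  unfolding time_index_def[abs_def] by measurable

text \<open>Sampling on the dyadic grid of \<open>{0..t}\<close>, rather than of
  \<open>{0..T}\<close>, uses only values known at time \<open>t\<close>; a countable selection
  among them is jointly measurable, and continuity gives the limit.\<close>

lemma continuous_adapted_prog:
  fixes X :: "('a, 'v::euclidean_space) process"
  assumes X: "\<And>t. t \<in> {0..T} \<Longrightarrow> X t \<in> borel_measurable (G t)"
    and c: "\<And>w. continuous_on {0..T} (\<lambda>t. X t w)"
  shows "prog_measurable G T X"
  unfolding prog_measurable_def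
proof
  fix t assume t: "t \<in> {0..T}"
  let ?N = "G t \<Otimes>\<^sub>M restrict_space borel {0..t}"
  show "(\<lambda>(w, s). X s w) \<in> ?N \<rightarrow>\<^sub>M borel"
  proof (cases "t = 0")
    case True
    have "(\<lambda>x. X 0 (fst x)) \<in> ?N \<rightarrow>\<^sub>M borel" using X[of 0] True t by simp
    moreover have "(\<lambda>(w, s). X s w) \<in> ?N \<rightarrow>\<^sub>M borel \<longleftrightarrow> (\<lambda>x. X 0 (fst x)) \<in> ?N \<rightarrow>\<^sub>M borel"
      using True by (intro measurable_cong) (auto simp: space_pair_measure space_restrict_space)
    ultimately show ?thesis by simp
  next
    case False
    then have t0: "0 < t" using t by auto
    let ?x = "\<lambda>k s. min t (t * real (time_index t k s) / 2 ^ k)"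
    show ?thesis
    proof (rule borel_measurable_LIMSEQ_metric)
      fix k
      \<comment> \<open>The cap \<open>min t\<close> makes this true for every index
        \<open>i\<close>, including those beyond the grid.\<close>
      have Xi: "X (min t (t * real i / 2 ^ k)) \<in> borel_measurable (G t)" for i :: nat
        using t t0 by (auto intro!: measurable_G_mono[OF X])
      have gi: "(\<lambda>x. time_index t k (snd x)) \<in> ?N \<rightarrow>\<^sub>M count_space UNIV"
        by (rule measurable_compose[OF measurable_snd measurable_restrict_space1[OF time_index_measurable]])
      show "(\<lambda>x. X (?x k (snd x)) (fst x)) \<in> ?N \<rightarrow>\<^sub>M borel"
        by (rule measurable_compose_countable[OF _ gi]) (rule measurable_compose[OF measurable_fst Xi])
    next
      fix x assume "x \<in> space ?N"
      then have s: "snd x \<in> {0..t}" by (auto simp: space_pair_measure space_restrict_space)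
      have "(\<lambda>k. ?x k (snd x)) \<longlonglongrightarrow> min t (snd x)"
        by (intro tendsto_min tendsto_const time_index_tendsto[OF t0 s])
      then have "(\<lambda>k. ?x k (snd x)) \<longlonglongrightarrow> snd x" using s by simp
      then have "(\<lambda>k. X (?x k (snd x)) (fst x)) \<longlonglongrightarrow> X (snd x) (fst x)"
        by (rule continuous_on_tendsto_compose[OF c]) (use s t t0 in \<open>auto intro!: always_eventually simp: min.coboundedI1\<close>)
      then show "(\<lambda>k. X (?x k (snd x)) (fst x)) \<longlonglongrightarrow> (case x of (w, s) \<Rightarrow> X s w)" by (simp add: case_prod_unfold)
    qed
  qed
qed

text \<open>Dominated convergence under the square-integrable supremum. Its purpose is continuity of
  the laws in the Wasserstein distance, since values at two times are coupled on the given
  space.\<close>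

lemma mean_square_continuous:
  fixes X :: "('a, 'v::euclidean_space) process"
  assumes X: "\<And>t. t \<in> {0..T} \<Longrightarrow> X t \<in> borel_measurable (G t)"
    and c: "\<And>w. continuous_on {0..T} (\<lambda>t. X t w)"
    and fin: "nn_sup_sq M {0..T} X < \<infinity>"
    and s: "s \<in> {0..T}" "\<And>k. u k \<in> {0..T}" "u \<longlonglongrightarrow> s"
  shows "(\<lambda>k. \<integral>\<^sup>+w. ennreal ((norm (X (u k) w - X s w))\<^sup>2) \<partial>M) \<longlonglongrightarrow> 0"
proof -
  have Xm: "X t \<in> borel_measurable M" if "t \<in> {0..T}" for t using measurable_GM[OF X[OF that] that] .
  have Sm: "(\<lambda>w. SUP t\<in>{0..T}. ennreal ((norm (X t w))\<^sup>2)) \<in> borel_measurable M"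
    by (rule measurable_SUP_continuous[OF complete T_pos Xm]) (use c in auto)
  have "(\<lambda>k. \<integral>\<^sup>+w. ennreal ((norm (X (u k) w - X s w))\<^sup>2) \<partial>M) \<longlonglongrightarrow> (\<integral>\<^sup>+w. 0 \<partial>M)"
  proof (rule nn_integral_dominated_convergence[where w = "\<lambda>w. 4 * (SUP t\<in>{0..T}. ennreal ((norm (X t w))\<^sup>2))"])
    show "(\<integral>\<^sup>+w. 4 * (SUP t\<in>{0..T}. ennreal ((norm (X t w))\<^sup>2)) \<partial>M) < \<infinity>"
      using fin Sm by (simp add: nn_integral_cmult ennreal_mult_less_top)
    show "AE w in M. ennreal ((norm (X (u k) w - X s w))\<^sup>2) \<le> 4 * (SUP t\<in>{0..T}. ennreal ((norm (X t w))\<^sup>2))" for k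
    proof (rule AE_I2)
      fix w
      let ?S = "SUP t\<in>{0..T}. ennreal ((norm (X t w))\<^sup>2)"
      have "ennreal ((norm (X (u k) w - X s w))\<^sup>2) \<le> 2 * ennreal ((norm (X (u k) w))\<^sup>2) + 2 * ennreal ((norm (X s w))\<^sup>2)"
        by (rule ennreal_norm_diff_sq_le)
      also have "\<dots> \<le> 2 * ?S + 2 * ?S" using s by (intro add_mono mult_left_mono SUP_upper) auto
      also have "\<dots> = 4 * ?S" unfolding distrib_right[symmetric] by simp
      finally show "ennreal ((norm (X (u k) w - X s w))\<^sup>2) \<le> 4 * ?S" .
    qed
    show "AE w in M. (\<lambda>k. ennreal ((norm (X (u k) w - X s w))\<^sup>2)) \<longlonglongrightarrow> 0"
    proof (rule AE_I2)
      fix w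
      have "(\<lambda>k. X (u k) w) \<longlonglongrightarrow> X s w"
        by (rule continuous_on_tendsto_compose[OF c s(3,1)]) (use s(2) in auto)
      then have "(\<lambda>k. ennreal ((norm (X (u k) w - X s w))\<^sup>2)) \<longlonglongrightarrow> ennreal ((norm (X s w - X s w))\<^sup>2)"
        by (intro tendsto_ennrealI tendsto_intros)
      then show "(\<lambda>k. ennreal ((norm (X (u k) w - X s w))\<^sup>2)) \<longlonglongrightarrow> 0" by simp
    qed
  qed (use Xm s Sm in auto)
  then show ?thesis by simp
qed

lemma coefficient_prog:
  fixes X :: "('a, real ^ 'n) process" and \<phi> :: "'a \<Rightarrow> real \<Rightarrow> real ^ 'n \<Rightarrow> (real ^ 'n) measure \<Rightarrow> 'c::euclidean_space"
  assumes \<phi>: "\<And>x \<mu>. \<mu> \<in> prob_measures \<Longrightarrow> prog_measurable G T (\<lambda>t w. \<phi> w t x \<mu>)"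
    and C: "0 < C" and \<Omega>0: "\<Omega>0 \<in> sets M" "measure M \<Omega>0 = 1"
    and lip: "\<And>w t. w \<in> \<Omega>0 \<Longrightarrow> t \<in> {0..T} \<Longrightarrow> lipschitz_W2 C (\<phi> w t)"
    and X: "\<And>t. t \<in> {0..T} \<Longrightarrow> X t \<in> borel_measurable (G t)"
    and c: "\<And>w. continuous_on {0..T} (\<lambda>t. X t w)"
    and fin: "nn_sup_sq M {0..T} X < \<infinity>"
  shows "prog_measurable G T (\<lambda>t w. if w \<in> \<Omega>0 then \<phi> w t (X t w) (distr M borel (X t)) else 0)"
  unfolding prog_measurable_def
proof
  fix t assume t: "t \<in> {0..T}"
  let ?N = "G t \<Otimes>\<^sub>M restrict_space borel {0..t}"
  have Xm: "X t \<in> borel_measurable M" if "t \<in> {0..T}" for t using measurable_GM[OF X[OF that] that] .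
  have \<Omega>t: "\<Omega>0 \<in> sets (G t)" by (rule Omega_adapted[OF \<Omega>0 t])
  have Ind: "{x \<in> space ?N. fst x \<in> \<Omega>0} \<in> sets ?N"
    using measurable_sets[OF measurable_fst[of "G t" "restrict_space borel {0..t}"] \<Omega>t]
    by (simp add: vimage_def Int_def conj_commute)
  have XN: "(\<lambda>x. X (snd x) (fst x)) \<in> borel_measurable ?N"
    using continuous_adapted_prog[OF X c] t by (simp add: prog_measurable_def case_prod_unfold)
  define \<psi> where "\<psi> x y \<mu> = (if fst x \<in> \<Omega>0 then \<phi> (fst x) (snd x) y \<mu> else 0)" for x y \<mu>
  have \<psi>m: "(\<lambda>x. \<psi> x y \<mu>) \<in> borel_measurable ?N" if "\<mu> \<in> prob_measures" for y \<mu>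
    unfolding \<psi>_def using \<phi>[OF that, of y] t Ind
    by (intro measurable_If) (auto simp: prog_measurable_def case_prod_unfold)
  have lip\<psi>: "ennreal ((norm (\<psi> x y (distr M borel U) - \<psi> x z (distr M borel V)))\<^sup>2) \<le>
      ennreal (2 * C\<^sup>2) * (ennreal ((norm (y - z))\<^sup>2) + nn_sq M (\<lambda>w. U w - V w))"
    if "x \<in> space ?N" "U \<in> borel_measurable M" "V \<in> borel_measurable M" for x y z U V
  proof (cases "fst x \<in> \<Omega>0")
    case True
    have "snd x \<in> {0..T}" using that(1) t by (auto simp: space_pair_measure space_restrict_space)
    then show ?thesis using lipschitz_W2_sq[OF lip[OF True] C that(2,3)] True by (simp add: \<psi>_def)
  qed (simp add: \<psi>_def)
  have conv0: "f \<longlonglongrightarrow> g" if "(\<lambda>k. ennreal ((norm (f k - g))\<^sup>2)) \<longlonglongrightarrow> 0" for f :: "nat \<Rightarrow> 'c" and g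
  proof -
    have "(\<lambda>k. (norm (f k - g))\<^sup>2) \<longlonglongrightarrow> 0"
      using that by (subst (asm) ennreal_0[symmetric], subst (asm) tendsto_ennreal_iff) auto
    then have "(\<lambda>k. sqrt ((norm (f k - g))\<^sup>2)) \<longlonglongrightarrow> sqrt 0" by (rule tendsto_real_sqrt)
    then show ?thesis by (simp add: tendsto_norm_zero_iff LIM_zero_iff)
  qed
  \<comment> \<open>First the state: \<open>X\<close> is approximated by simple functions on the
    product space while the law is held fixed.\<close>
  have step1: "(\<lambda>x. \<psi> x (X (snd x) (fst x)) (distr M borel U)) \<in> borel_measurable ?N"
    if U: "U \<in> borel_measurable M" for U
  proof -
    obtain H where H: "\<And>i. simple_function ?N (H i)" "\<And>x. x \<in> space ?N \<Longrightarrow> (\<lambda>i. H i x) \<longlonglongrightarrow> X (snd x) (fst x)"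
      using borel_measurable_implies_sequence_metric[OF XN, of 0] by auto
    show ?thesis
    proof (rule borel_measurable_LIMSEQ_metric)
      fix i
      show "(\<lambda>x. \<psi> x (H i x) (distr M borel U)) \<in> borel_measurable ?N"
      proof (rule measurable_compose_countable'[where f = "\<lambda>y x. \<psi> x y (distr M borel U)" and I = "H i ` space ?N"])
        show "(\<lambda>x. \<psi> x y (distr M borel U)) \<in> borel_measurable ?N" for y
          by (rule \<psi>m[OF distr_prob_measure[OF U]])
        show "H i \<in> ?N \<rightarrow>\<^sub>M count_space (H i ` space ?N)"
          using H(1)[of i] unfolding simple_function_def
          by (subst measurable_count_space_eq_countable) (auto intro: countable_finite)
        show "countable (H i ` space ?N)" using H(1)[of i] by (intro countable_finite) (simp add: simple_function_def)
      qed
    next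
      fix x assume x: "x \<in> space ?N"
      show "(\<lambda>i. \<psi> x (H i x) (distr M borel U)) \<longlonglongrightarrow> \<psi> x (X (snd x) (fst x)) (distr M borel U)"
      proof (rule conv0, rule tendsto_sandwich[OF _ _ tendsto_const])
        show "\<forall>\<^sub>F i in sequentially. ennreal ((norm (\<psi> x (H i x) (distr M borel U) - \<psi> x (X (snd x) (fst x)) (distr M borel U)))\<^sup>2) \<le>
          ennreal (2 * C\<^sup>2) * ennreal ((norm (H i x - X (snd x) (fst x)))\<^sup>2)"
          using lip\<psi>[OF x U U] by (intro always_eventually allI) simp
        have "(\<lambda>i. ennreal ((norm (H i x - X (snd x) (fst x)))\<^sup>2)) \<longlonglongrightarrow> ennreal ((norm (X (snd x) (fst x) - X (snd x) (fst x)))\<^sup>2)"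
          by (intro tendsto_ennrealI tendsto_intros H x)
        then show "(\<lambda>i. ennreal (2 * C\<^sup>2) * ennreal ((norm (H i x - X (snd x) (fst x)))\<^sup>2)) \<longlonglongrightarrow> 0"
          using ennreal_tendsto_cmult[of "ennreal (2 * C\<^sup>2)" "\<lambda>i. ennreal ((norm (H i x - X (snd x) (fst x)))\<^sup>2)" 0] by simp
      qed simp
    qed
  qed
  \<comment> \<open>Then the law, frozen at grid times. It is deterministic, so \<open>step1\<close>
    asks of the sampled variable only measurability with respect to \<open>M\<close>.\<close>
  let ?u = "\<lambda>k s. min T (T * real (time_index T k s) / 2 ^ k)"
  have uT: "?u k s \<in> {0..T}" for k s using T_pos by auto
  have "(\<lambda>x. \<psi> x (X (snd x) (fst x)) (distr M borel (X (snd x)))) \<in> borel_measurable ?N"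
  proof (rule borel_measurable_LIMSEQ_metric)
    fix k
    have gi: "(\<lambda>x. time_index T k (snd x)) \<in> ?N \<rightarrow>\<^sub>M count_space UNIV"
      by (rule measurable_compose[OF measurable_snd measurable_restrict_space1[OF time_index_measurable]])
    show "(\<lambda>x. \<psi> x (X (snd x) (fst x)) (distr M borel (X (?u k (snd x))))) \<in> borel_measurable ?N"
      by (rule measurable_compose_countable[OF _ gi]) (rule step1, rule Xm, use T_pos in auto)
  next
    fix x assume x: "x \<in> space ?N"
    then have s: "snd x \<in> {0..T}" using t by (auto simp: space_pair_measure space_restrict_space)
    have "(\<lambda>k. ?u k (snd x)) \<longlonglongrightarrow> min T (snd x)"
      by (intro tendsto_min tendsto_const time_index_tendsto[OF T_pos s])
    then have lim: "(\<lambda>k. ?u k (snd x)) \<longlonglongrightarrow> snd x" using s by simp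
    have msc: "(\<lambda>k. \<integral>\<^sup>+w. ennreal ((norm (X (?u k (snd x)) w - X (snd x) w))\<^sup>2) \<partial>M) \<longlonglongrightarrow> 0"
      by (rule mean_square_continuous[where u = "\<lambda>k. ?u k (snd x)", OF X c fin s uT lim])
    show "(\<lambda>k. \<psi> x (X (snd x) (fst x)) (distr M borel (X (?u k (snd x))))) \<longlonglongrightarrow> \<psi> x (X (snd x) (fst x)) (distr M borel (X (snd x)))"
    proof (rule conv0, rule tendsto_sandwich[OF _ _ tendsto_const])
      show "\<forall>\<^sub>F k in sequentially. ennreal ((norm (\<psi> x (X (snd x) (fst x)) (distr M borel (X (?u k (snd x)))) - \<psi> x (X (snd x) (fst x)) (distr M borel (X (snd x)))))\<^sup>2)
         \<le> ennreal (2 * C\<^sup>2) * nn_sq M (\<lambda>w. X (?u k (snd x)) w - X (snd x) w)"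
      proof (intro always_eventually allI)
        fix k
        show "ennreal ((norm (\<psi> x (X (snd x) (fst x)) (distr M borel (X (?u k (snd x)))) - \<psi> x (X (snd x) (fst x)) (distr M borel (X (snd x)))))\<^sup>2)
         \<le> ennreal (2 * C\<^sup>2) * nn_sq M (\<lambda>w. X (?u k (snd x)) w - X (snd x) w)"
          using lip\<psi>[OF x Xm[OF uT[of k "snd x"]] Xm[OF s], of "X (snd x) (fst x)" "X (snd x) (fst x)"] by simp
      qed
      show "(\<lambda>k. ennreal (2 * C\<^sup>2) * nn_sq M (\<lambda>w. X (?u k (snd x)) w - X (snd x) w)) \<longlonglongrightarrow> 0"
        using ennreal_tendsto_cmult[OF _ msc, of "ennreal (2 * C\<^sup>2)"] by simp
    qed simp
  qed
  then show "(\<lambda>(w, s). if w \<in> \<Omega>0 then \<phi> w s (X s w) (distr M borel (X s)) else 0) \<in> borel_measurable ?N"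
    by (simp add: \<psi>_def case_prod_unfold)
qed

text \<open>Countably many dyadic times share one null event, and continuity extends the equality
  from them to all times.\<close>

lemma indistinguishable:
  fixes X Y :: "('a, 'v::euclidean_space) process"
  assumes X: "AE w in M. continuous_on {0..T} (\<lambda>t. X t w)" and Y: "AE w in M. continuous_on {0..T} (\<lambda>t. Y t w)"
    and eq: "\<And>t. t \<in> {0..T} \<Longrightarrow> AE w in M. X t w = Y t w"
  shows "AE w in M. \<forall>t\<in>{0..T}. X t w = Y t w"
proof -
  have "AE w in M. \<forall>k. \<forall>i. i \<le> (2::nat) ^ k \<longrightarrow> X (T * real i / 2 ^ k) w = Y (T * real i / 2 ^ k) w"
    unfolding AE_all_countable using eq grid_mem[OF T_pos] by auto
  then show ?thesis
    using X Y
  proof eventually_elim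
    case (elim w)
    show ?case
    proof
      fix t assume t: "t \<in> {0..T}"
      then obtain i where i: "\<And>k. i k \<le> (2::nat) ^ k" "(\<lambda>k. T * real (i k) / 2 ^ k) \<longlonglongrightarrow> t"
        using grid_approx[OF T_pos] by auto
      have "(\<lambda>k. X (T * real (i k) / 2 ^ k) w) \<longlonglongrightarrow> X t w"
        by (rule continuous_on_tendsto_compose[OF elim(2) i(2) t]) (use grid_mem[OF T_pos i(1)] in \<open>auto intro!: always_eventually\<close>)
      moreover have "(\<lambda>k. Y (T * real (i k) / 2 ^ k) w) \<longlonglongrightarrow> Y t w"
        by (rule continuous_on_tendsto_compose[OF elim(3) i(2) t]) (use grid_mem[OF T_pos i(1)] in \<open>auto intro!: always_eventually\<close>)
      moreover have "X (T * real (i k) / 2 ^ k) w = Y (T * real (i k) / 2 ^ k) w" for k using elim(1) i(1) by blast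
      ultimately show "X t w = Y t w" using LIMSEQ_unique by auto
    qed
  qed
qed

end

context complete_filtration
begin

lemma tonelli_prog:
  fixes g :: "('a, ennreal) process"
  assumes g: "prog_measurable G T g" and t: "t \<in> {0..T}"
  shows "(\<integral>\<^sup>+w. (\<integral>\<^sup>+s\<in>{0..t}. g s w \<partial>lborel) \<partial>M) = (\<integral>\<^sup>+s\<in>{0..t}. (\<integral>\<^sup>+w. g s w \<partial>M) \<partial>lborel)"
    "(\<lambda>s. (\<integral>\<^sup>+w. g s w \<partial>M) * indicator {0..t} s) \<in> borel_measurable borel"
proof -
  note bmn = borel_measurable_nn_integral
  interpret pair_sigma_finite M lborel ..
  have id: "(\<lambda>w. w) \<in> M \<rightarrow>\<^sub>M G t" using subalg[OF t] by (intro measurableI) (auto simp: subalgebra_def)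
  have "(\<lambda>x. (fst x, snd x)) \<in> M \<Otimes>\<^sub>M lborel \<rightarrow>\<^sub>M G t \<Otimes>\<^sub>M borel"
    using measurable_compose[OF measurable_fst id] by (intro measurable_Pair) auto
  from measurable_compose[OF this prog_measurable_clip[OF g t]]
  have "(\<lambda>x. g (max 0 (min t (snd x))) (fst x)) \<in> borel_measurable (M \<Otimes>\<^sub>M lborel)" by simp
  then have m: "(\<lambda>(w, s). g (max 0 (min t s)) w * indicator {0..t} s) \<in> borel_measurable (M \<Otimes>\<^sub>M lborel)"
    by (simp add: case_prod_unfold borel_measurable_times_ennreal)
  have eq: "g (max 0 (min t s)) w * indicator {0..t} s = g s w * indicator {0..t} s" for s w
  proof -
    have "s \<in> {0..t} \<Longrightarrow> max 0 (min t s) = s" using t by auto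
    then show ?thesis by (cases "s \<in> {0..t}") auto
  qed
  have m': "(\<lambda>(w, s). g s w * indicator {0..t} s) \<in> borel_measurable (M \<Otimes>\<^sub>M lborel)"
    using m by (simp only: eq)
  have mult: "(\<integral>\<^sup>+w. g s w * indicator {0..t} s \<partial>M) = (\<integral>\<^sup>+w. g s w \<partial>M) * indicator {0..t} s" for s
    by (cases "s \<in> {0..t}") auto
  show "(\<integral>\<^sup>+w. (\<integral>\<^sup>+s\<in>{0..t}. g s w \<partial>lborel) \<partial>M) = (\<integral>\<^sup>+s\<in>{0..t}. (\<integral>\<^sup>+w. g s w \<partial>M) \<partial>lborel)"
    using Fubini'[OF m'] by (simp add: mult)
  have "(\<lambda>(s, w). g s w * indicator {0..t} s) \<in> borel_measurable (lborel \<Otimes>\<^sub>M M)"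
    using measurable_pair_swap[OF m'] by (simp add: case_prod_unfold)
  from bmn[OF this]
  show "(\<lambda>s. (\<integral>\<^sup>+w. g s w \<partial>M) * indicator {0..t} s) \<in> borel_measurable borel"
    by (simp add: mult)
qed

end

section \<open>Well-posedness of the mean-field equation\<close>

locale mean_field_sde = driver M F T Z L \<kappa>
  for M :: "'a measure" and F :: "real \<Rightarrow> 'a measure" and T :: real and Z :: "('a, real ^ 'd) process"
    and L :: "('a, real) process" and \<kappa> :: real +
  fixes b \<delta> :: "'a \<Rightarrow> real \<Rightarrow> real ^ 'n \<Rightarrow> (real ^ 'n) measure \<Rightarrow> real ^ 'n"
    and \<sigma> :: "'a \<Rightarrow> real \<Rightarrow> real ^ 'n \<Rightarrow> (real ^ 'n) measure \<Rightarrow> real ^ 'd ^ 'n"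
    and C0 :: real and \<Omega>0 :: "'a set" and x0 :: "real ^ 'n"
  assumes b_prog: "\<mu> \<in> prob_measures \<Longrightarrow> prog_measurable F T (\<lambda>t w. b w t x \<mu>)"
    and \<delta>_prog: "\<mu> \<in> prob_measures \<Longrightarrow> prog_measurable F T (\<lambda>t w. \<delta> w t x \<mu>)"
    and \<sigma>_prog: "\<mu> \<in> prob_measures \<Longrightarrow> prog_measurable F T (\<lambda>t w. \<sigma> w t x \<mu>)"
    and b_zero: "(\<integral>\<^sup>+w. nn_sq_on lborel {0..T} (\<lambda>s. b w s 0 (return borel 0)) \<partial>M) < \<infinity>"
    and \<delta>_zero: "clock_norm T (\<lambda>s w. \<delta> w s 0 (return borel 0)) < \<infinity>"
    and \<sigma>_zero: "clock_norm T (\<lambda>s w. \<sigma> w s 0 (return borel 0)) < \<infinity>"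
    and C0: "0 < C0" and \<Omega>0: "\<Omega>0 \<in> sets M" "measure M \<Omega>0 = 1"
    and b_lip: "w \<in> \<Omega>0 \<Longrightarrow> t \<in> {0..T} \<Longrightarrow> lipschitz_W2 C0 (b w t)"
    and \<delta>_lip: "w \<in> \<Omega>0 \<Longrightarrow> t \<in> {0..T} \<Longrightarrow> lipschitz_W2 C0 (\<delta> w t)"
    and \<sigma>_lip: "w \<in> \<Omega>0 \<Longrightarrow> t \<in> {0..T} \<Longrightarrow> lipschitz_W2 C0 (\<sigma> w t)"
begin

lemma AE_\<Omega>0: "AE w in M. w \<in> \<Omega>0"
  using \<Omega>0 AE_in_set_eq_1 by blast

abbreviation law :: "('a \<Rightarrow> real ^ 'n) \<Rightarrow> (real ^ 'n) measure" where "law U \<equiv> distr M borel U"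

abbreviation (input) along :: "('a \<Rightarrow> real \<Rightarrow> real ^ 'n \<Rightarrow> (real ^ 'n) measure \<Rightarrow> 'c) \<Rightarrow> ('a, real ^ 'n) process \<Rightarrow> real \<Rightarrow> 'a \<Rightarrow> 'c" where
  "along \<phi> X s w \<equiv> \<phi> w s (X s w) (law (X s))"

abbreviation (input) at_zero :: "('a \<Rightarrow> real \<Rightarrow> real ^ 'n \<Rightarrow> (real ^ 'n) measure \<Rightarrow> 'c) \<Rightarrow> real \<Rightarrow> 'a \<Rightarrow> 'c" where
  "at_zero \<phi> s w \<equiv> \<phi> w s 0 (return borel 0)"

abbreviation (input) equation :: "('a, real ^ 'n) process \<Rightarrow> ('a, real ^ 'n) process \<Rightarrow> ('a, real ^ 'n) process \<Rightarrow> bool" where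
  "equation X' X I \<equiv> AE w in M.
     set_integrable lborel {0..T} (\<lambda>s. along b X' s w) \<and>
     set_integrable (path_measure L w) {0..T} (\<lambda>s. along \<delta> X' s w) \<and>
     (\<forall>t\<in>{0..T}. X t w = x0 + (LINT s:{0..t}|lborel. along b X' s w)
        + (LINT s:{0..t}|path_measure L w. along \<delta> X' s w) + I t w)"

abbreviation (input) dominated :: "('a, real ^ 'n) process \<Rightarrow> ('a \<Rightarrow> ennreal) \<Rightarrow> bool" where
  "dominated X \<Phi> \<equiv> AE w in M. nn_sq_on lborel {0..T} (\<lambda>s. along b X s w) \<le> \<Phi> w \<and>
     nn_sq_on (path_measure L w) {0..T} (\<lambda>s. along \<delta> X s w) \<le> \<Phi> w \<and>
     nn_sq_on (path_measure L w) {0..T} (\<lambda>s. along \<sigma> X s w) \<le> \<Phi> w"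

section \<open>Mean square distance and estimates for the coefficients\<close>

definition msd :: "('a, real ^ 'n) process \<Rightarrow> ('a, real ^ 'n) process \<Rightarrow> real \<Rightarrow> ennreal" where
  "msd X Y s = nn_sq M (\<lambda>w. X s w - Y s w)"

text \<open>The time integral of the pathwise Lipschitz bound: the state contributes its own squared
  difference, the law contributes \<open>msd\<close>. Both parts have the same expectation, whence
  the factor 2 in \<open>gap_expectation\<close>.\<close>

definition gap :: "('a, real ^ 'n) process \<Rightarrow> ('a, real ^ 'n) process \<Rightarrow> real \<Rightarrow> 'a \<Rightarrow> ennreal" where
  "gap X Y t w = (\<integral>\<^sup>+s\<in>{0..t}. (ennreal ((norm (X s w - Y s w))\<^sup>2) + msd X Y s) \<partial>lborel)"

abbreviation "lip \<equiv> ennreal (2 * C0\<^sup>2)"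

lemma prog_measurableM: "prog_measurable F T X \<Longrightarrow> s \<in> {0..T} \<Longrightarrow> X s \<in> borel_measurable M"
  using measurable_GM[OF prog_measurable_section[of F T X s s]] by auto

lemma gap_integrand_measurable:
  assumes X: "prog_measurable F T X" and Y: "prog_measurable F T Y" and t: "t \<in> {0..T}" and w: "w \<in> space M"
  shows "(\<lambda>s. ennreal ((norm (X s w - Y s w))\<^sup>2) * indicator {0..t} s) \<in> borel_measurable borel"
    "(\<lambda>s. msd X Y s * indicator {0..t} s) \<in> borel_measurable borel"
    "(\<lambda>s. (ennreal ((norm (X s w - Y s w))\<^sup>2) + msd X Y s) * indicator {0..t} s) \<in> borel_measurable borel"
proof -
  have p: "prog_measurable F T (\<lambda>s w. ennreal ((norm (X s w - Y s w))\<^sup>2))"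
    by (rule prog_measurable_norm_sq[OF prog_measurable_diff[OF X Y]])
  show 1: "(\<lambda>s. ennreal ((norm (X s w - Y s w))\<^sup>2) * indicator {0..t} s) \<in> borel_measurable borel"
    by (rule prog_path_measurable[OF p t w])
  show 2: "(\<lambda>s. msd X Y s * indicator {0..t} s) \<in> borel_measurable borel"
    unfolding msd_def by (rule tonelli_prog(2)[OF p t])
  show "(\<lambda>s. (ennreal ((norm (X s w - Y s w))\<^sup>2) + msd X Y s) * indicator {0..t} s) \<in> borel_measurable borel"
    unfolding distrib_right by (rule borel_measurable_add[OF 1 2])
qed

lemma gap_eq:
  assumes X: "prog_measurable F T X" and Y: "prog_measurable F T Y" and t: "t \<in> {0..T}" and w: "w \<in> space M"
  shows "gap X Y t w = nn_sq_on lborel {0..t} (\<lambda>s. X s w - Y s w) + (\<integral>\<^sup>+s\<in>{0..t}. msd X Y s \<partial>lborel)"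
  unfolding gap_def distrib_right using gap_integrand_measurable[OF assms] by (intro nn_integral_add) auto

lemma gap_expectation:
  assumes X: "prog_measurable F T X" and Y: "prog_measurable F T Y" and t: "t \<in> {0..T}"
  shows "gap X Y t \<in> borel_measurable M" "(\<integral>\<^sup>+w. gap X Y t w \<partial>M) = 2 * (\<integral>\<^sup>+s\<in>{0..t}. msd X Y s \<partial>lborel)"
proof -
  have p: "prog_measurable F T (\<lambda>s w. ennreal ((norm (X s w - Y s w))\<^sup>2))"
    by (rule prog_measurable_norm_sq[OF prog_measurable_diff[OF X Y]])
  have m: "(\<lambda>w. \<integral>\<^sup>+s\<in>{0..t}. ennreal ((norm (X s w - Y s w))\<^sup>2) \<partial>lborel) \<in> borel_measurable M"
    using measurable_GM[OF nn_integral_lborel_adapted[OF p t] t] .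
  then have m2: "(\<lambda>w. nn_sq_on lborel {0..t} (\<lambda>s. X s w - Y s w) + (\<integral>\<^sup>+s\<in>{0..t}. msd X Y s \<partial>lborel)) \<in> borel_measurable M"
    by simp
  then show "gap X Y t \<in> borel_measurable M"
    by (rule measurable_cong[THEN iffD1, rotated]) (rule gap_eq[OF X Y t, symmetric])
  have "(\<integral>\<^sup>+w. gap X Y t w \<partial>M) = (\<integral>\<^sup>+w. nn_sq_on lborel {0..t} (\<lambda>s. X s w - Y s w) + (\<integral>\<^sup>+s\<in>{0..t}. msd X Y s \<partial>lborel) \<partial>M)"
    by (rule nn_integral_cong) (rule gap_eq[OF X Y t])
  also have "\<dots> = (\<integral>\<^sup>+w. nn_sq_on lborel {0..t} (\<lambda>s. X s w - Y s w) \<partial>M) + (\<integral>\<^sup>+s\<in>{0..t}. msd X Y s \<partial>lborel)"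
    using m by (subst nn_integral_add) (auto simp: emeasure_space_1)
  also have "(\<integral>\<^sup>+w. nn_sq_on lborel {0..t} (\<lambda>s. X s w - Y s w) \<partial>M) = (\<integral>\<^sup>+s\<in>{0..t}. msd X Y s \<partial>lborel)"
    unfolding msd_def by (rule tonelli_prog(1)[OF p t])
  finally show "(\<integral>\<^sup>+w. gap X Y t w \<partial>M) = 2 * (\<integral>\<^sup>+s\<in>{0..t}. msd X Y s \<partial>lborel)" by (simp add: mult_2)
qed

lemma gap_mono: "s \<le> t \<Longrightarrow> gap X Y s w \<le> gap X Y t w"
  unfolding gap_def by (intro nn_integral_mono mult_left_mono) (auto simp: indicator_def)

text \<open>For a merely progressively measurable \<open>X\<close> the coefficients along
  \<open>X\<close> are not known to be measurable. \<open>nn_integral\<close> is monotone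
  regardless, so it is the dominating integrand \<open>?g\<close> that has to be measurable.\<close>

lemma coefficient_gap:
  fixes \<phi> :: "'a \<Rightarrow> real \<Rightarrow> real ^ 'n \<Rightarrow> (real ^ 'n) measure \<Rightarrow> 'c::euclidean_space"
  assumes X: "prog_measurable F T X" and Y: "prog_measurable F T Y"
    and lip: "\<And>w t. w \<in> \<Omega>0 \<Longrightarrow> t \<in> {0..T} \<Longrightarrow> lipschitz_W2 C0 (\<phi> w t)"
    and t: "t \<in> {0..T}" and w: "w \<in> \<Omega>0" "w \<in> space M"
  shows "nn_sq_on lborel {0..t} (\<lambda>s. along \<phi> X s w - along \<phi> Y s w) \<le> lip * gap X Y t w"
    "reg w \<Longrightarrow> (nn_sq_on (path_measure L w) {0..t} (\<lambda>s. along \<phi> X s w - along \<phi> Y s w)) \<le> ennreal (1 / \<kappa>) * (lip * gap X Y t w)"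
proof -
  let ?d = "\<lambda>s. ennreal ((norm (along \<phi> X s w - along \<phi> Y s w))\<^sup>2) * indicator {0..t} s"
  let ?g = "\<lambda>s. lip * ((ennreal ((norm (X s w - Y s w))\<^sup>2) + msd X Y s) * indicator {0..t} s)"
  have le: "?d s \<le> ?g s" for s
  proof (cases "s \<in> {0..t}")
    case True
    then have s: "s \<in> {0..T}" using t by auto
    have "ennreal ((norm (along \<phi> X s w - along \<phi> Y s w))\<^sup>2) \<le> lip * (ennreal ((norm (X s w - Y s w))\<^sup>2) + msd X Y s)"
      unfolding msd_def
      by (rule lipschitz_W2_sq[OF lip[OF w(1) s] C0 prog_measurableM[OF X s] prog_measurableM[OF Y s]])
    then show ?thesis using True by simp
  qed simp
  have eq: "(\<integral>\<^sup>+s. ?g s \<partial>lborel) = lip * gap X Y t w"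
    unfolding gap_def using gap_integrand_measurable(3)[OF X Y t w(2)] by (intro nn_integral_cmult) auto
  show "(\<integral>\<^sup>+s. ?d s \<partial>lborel) \<le> lip * gap X Y t w"
    unfolding eq[symmetric] by (rule nn_integral_mono) (rule le)
  show "(\<integral>\<^sup>+s. ?d s \<partial>path_measure L w) \<le> ennreal (1 / \<kappa>) * (lip * gap X Y t w)" if "reg w"
  proof -
    have "(\<integral>\<^sup>+s. ?d s \<partial>path_measure L w) \<le> (\<integral>\<^sup>+s. ?g s \<partial>path_measure L w)" by (rule nn_integral_mono) (rule le)
    also have "\<dots> \<le> ennreal (1 / \<kappa>) * (\<integral>\<^sup>+s. ?g s \<partial>lborel)" by (rule path_le[OF that])
    finally show ?thesis unfolding eq .
  qed
qed

text \<open>Comparison with the zero process, whose law is the Dirac measure that occurs in the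
  integrability hypothesis.\<close>

lemma coefficient_bound:
  fixes \<phi> :: "'a \<Rightarrow> real \<Rightarrow> real ^ 'n \<Rightarrow> (real ^ 'n) measure \<Rightarrow> 'c::euclidean_space"
  assumes X: "prog_measurable F T X"
    and \<phi>: "prog_measurable F T (at_zero \<phi>)"
    and lip: "\<And>w t. w \<in> \<Omega>0 \<Longrightarrow> t \<in> {0..T} \<Longrightarrow> lipschitz_W2 C0 (\<phi> w t)"
    and w: "w \<in> \<Omega>0" "w \<in> space M"
  shows "nn_sq_on lborel {0..T} (\<lambda>s. along \<phi> X s w) \<le>
      2 * (lip * gap X (\<lambda>s w. 0) T w) + 2 * nn_sq_on lborel {0..T} (\<lambda>s. at_zero \<phi> s w)"
    "reg w \<Longrightarrow> (nn_sq_on (path_measure L w) {0..T} (\<lambda>s. along \<phi> X s w)) \<le>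
      2 * (ennreal (1 / \<kappa>) * (lip * gap X (\<lambda>s w. 0) T w)) + 2 * nn_sq_on (path_measure L w) {0..T} (\<lambda>s. at_zero \<phi> s w)"
proof -
  have T: "T \<in> {0..T}" using T_pos by simp
  let ?z = "\<lambda>(s::real) (w::'a). 0 :: real ^ 'n"
  have z: "prog_measurable F T ?z" by (simp add: prog_measurable_def)
  have p0: "(\<lambda>s. ennreal ((norm (at_zero \<phi> s w))\<^sup>2) * indicator {0..T} s) \<in> borel_measurable borel"
    by (rule prog_path_measurable[OF prog_measurable_norm_sq[OF \<phi>] T w(2)])
  let ?g = "\<lambda>s. lip * ((ennreal ((norm (X s w - ?z s w))\<^sup>2) + msd X ?z s) * indicator {0..T} s)"
  let ?h = "\<lambda>s. ennreal ((norm (at_zero \<phi> s w))\<^sup>2) * indicator {0..T} s"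
  have gm: "?g \<in> borel_measurable borel" using gap_integrand_measurable(3)[OF X z T w(2)] by simp
  have le: "ennreal ((norm (along \<phi> X s w))\<^sup>2) * indicator {0..T} s \<le> 2 * ?g s + 2 * ?h s" for s
  proof (cases "s \<in> {0..T}")
    case True
    have "ennreal ((norm (along \<phi> X s w - at_zero \<phi> s w))\<^sup>2) \<le> lip * (ennreal ((norm (X s w - ?z s w))\<^sup>2) + msd X ?z s)"
      unfolding msd_def distr_zero[symmetric]
      by (rule lipschitz_W2_sq[OF lip[OF w(1) True] C0 prog_measurableM[OF X True]]) simp
    then have "2 * ennreal ((norm (along \<phi> X s w - at_zero \<phi> s w))\<^sup>2) + 2 * ennreal ((norm (at_zero \<phi> s w))\<^sup>2)
       \<le> 2 * (lip * (ennreal ((norm (X s w - ?z s w))\<^sup>2) + msd X ?z s)) + 2 * ennreal ((norm (at_zero \<phi> s w))\<^sup>2)"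
      by (intro add_right_mono mult_left_mono) auto
    moreover have "ennreal ((norm (along \<phi> X s w))\<^sup>2) \<le> 2 * ennreal ((norm (along \<phi> X s w - at_zero \<phi> s w))\<^sup>2) + 2 * ennreal ((norm (at_zero \<phi> s w))\<^sup>2)"
      using ennreal_norm_add_sq_le[of "along \<phi> X s w - at_zero \<phi> s w" "at_zero \<phi> s w"] by simp
    ultimately show ?thesis using True by (simp add: order_trans)
  qed simp
  have eq: "(\<integral>\<^sup>+s. ?g s \<partial>lborel) = lip * gap X ?z T w"
    unfolding gap_def using gap_integrand_measurable(3)[OF X z T w(2)] by (intro nn_integral_cmult) auto
  have sum: "(\<integral>\<^sup>+s. 2 * ?g s + 2 * ?h s \<partial>N) = 2 * (\<integral>\<^sup>+s. ?g s \<partial>N) + 2 * (\<integral>\<^sup>+s. ?h s \<partial>N)" if "sets N = sets borel" for N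
  proof -
    have gN: "?g \<in> borel_measurable N" and hN: "?h \<in> borel_measurable N"
      using gm p0 unfolding measurable_cong_sets[OF that refl] by blast+
    have "(\<integral>\<^sup>+s. 2 * ?g s + 2 * ?h s \<partial>N) = (\<integral>\<^sup>+s. 2 * ?g s \<partial>N) + (\<integral>\<^sup>+s. 2 * ?h s \<partial>N)"
      by (rule nn_integral_add[OF borel_measurable_times_ennreal[OF borel_measurable_const gN]
            borel_measurable_times_ennreal[OF borel_measurable_const hN]])
    then show ?thesis unfolding nn_integral_cmult[OF gN] nn_integral_cmult[OF hN] .
  qed
  show "nn_sq_on lborel {0..T} (\<lambda>s. along \<phi> X s w) \<le>
      2 * (lip * gap X ?z T w) + 2 * (\<integral>\<^sup>+s. ?h s \<partial>lborel)"
    unfolding eq[symmetric] sum[OF sets_lborel, symmetric] by (rule nn_integral_mono) (rule le)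
  show "nn_sq_on (path_measure L w) {0..T} (\<lambda>s. along \<phi> X s w) \<le>
      2 * (ennreal (1 / \<kappa>) * (lip * gap X ?z T w)) + 2 * (\<integral>\<^sup>+s. ?h s \<partial>path_measure L w)" if "reg w"
  proof -
    have "nn_sq_on (path_measure L w) {0..T} (\<lambda>s. along \<phi> X s w) \<le> (\<integral>\<^sup>+s. 2 * ?g s + 2 * ?h s \<partial>path_measure L w)"
      by (rule nn_integral_mono) (rule le)
    also have "\<dots> = 2 * (\<integral>\<^sup>+s. ?g s \<partial>path_measure L w) + 2 * (\<integral>\<^sup>+s. ?h s \<partial>path_measure L w)"
      by (rule sum) simp
    also have "\<dots> \<le> 2 * (ennreal (1 / \<kappa>) * (\<integral>\<^sup>+s. ?g s \<partial>lborel)) + 2 * (\<integral>\<^sup>+s. ?h s \<partial>path_measure L w)"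
      by (intro add_right_mono mult_left_mono path_le[OF that]) simp
    finally show ?thesis unfolding eq .
  qed
qed

definition mean_square :: "('a, real ^ 'n) process \<Rightarrow> bool" where
  "mean_square X \<longleftrightarrow> prog_measurable F T X \<and> (\<integral>\<^sup>+w. nn_sq_on lborel {0..T} (\<lambda>s. X s w) \<partial>M) < \<infinity>"

lemma mean_square_prog_L2: "mean_square X \<longleftrightarrow> X \<in> prog_L2 M F T"
  by (simp add: mean_square_def prog_L2_def)

lemma gap_zero_finite:
  assumes "mean_square X"
  shows "(\<integral>\<^sup>+w. gap X (\<lambda>s w. 0) T w \<partial>M) < \<infinity>"
proof -
  have X: "prog_measurable F T X" using assms by (simp add: mean_square_def)
  have z: "prog_measurable F T (\<lambda>s w. 0 :: real ^ 'n)" by (simp add: prog_measurable_def)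
  have T: "T \<in> {0..T}" using T_pos by simp
  have "(\<integral>\<^sup>+s\<in>{0..T}. msd X (\<lambda>s w. 0) s \<partial>lborel) = (\<integral>\<^sup>+w. nn_sq_on lborel {0..T} (\<lambda>s. X s w) \<partial>M)"
    unfolding msd_def by (simp add: tonelli_prog(1)[OF prog_measurable_norm_sq[OF X] T])
  then show ?thesis
    using assms unfolding gap_expectation(2)[OF X z T] mean_square_def by (simp add: ennreal_mult_less_top)
qed

text \<open>The square integrals of the coefficients are not shown to be measurable in
  \<open>w\<close>. A measurable and integrable \<open>\<Phi>\<close> above all three takes their
  place wherever an expectation or almost sure finiteness is wanted.\<close>

lemma coefficient_envelope:
  assumes X: "mean_square X"
  obtains \<Phi> where "\<Phi> \<in> borel_measurable M" "(\<integral>\<^sup>+w. \<Phi> w \<partial>M) < \<infinity>"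
    "dominated X \<Phi>"
proof -
  have T: "T \<in> {0..T}" using T_pos by simp
  have Xp: "prog_measurable F T X" using X by (simp add: mean_square_def)
  have z: "prog_measurable F T (\<lambda>s w. 0 :: real ^ 'n)" by (simp add: prog_measurable_def)
  have r: "return borel (0 :: real ^ 'n) \<in> prob_measures"
    unfolding distr_zero[symmetric] by (rule distr_prob_measure) simp
  let ?g = "\<lambda>w. gap X (\<lambda>s w. 0) T w"
  let ?b = "\<lambda>w. \<integral>\<^sup>+s\<in>{0..T}. ennreal ((norm (at_zero b s w))\<^sup>2) \<partial>lborel"
  let ?d = "\<lambda>w. \<integral>\<^sup>+s\<in>{0..T}. ennreal ((norm (at_zero \<delta> s w))\<^sup>2) \<partial>path_measure L w"
  let ?s = "\<lambda>w. \<integral>\<^sup>+s\<in>{0..T}. ennreal ((norm (at_zero \<sigma> s w))\<^sup>2) \<partial>path_measure L w"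
  have gm: "?g \<in> borel_measurable M" by (rule gap_expectation(1)[OF Xp z T])
  have bm: "?b \<in> borel_measurable M"
    using measurable_GM[OF nn_integral_lborel_adapted[OF prog_measurable_norm_sq[OF b_prog[OF r]] T] T] .
  have dm: "?d \<in> borel_measurable M" by (rule clock_norm_inner_measurable[OF \<delta>_prog[OF r] T])
  have sm: "?s \<in> borel_measurable M" by (rule clock_norm_inner_measurable[OF \<sigma>_prog[OF r] T])
  define \<Phi> where "\<Phi> w = 2 * (lip * ?g w) + 2 * (ennreal (1 / \<kappa>) * (lip * ?g w)) + (2 * ?b w + 2 * ?d w + 2 * ?s w)" for w
  show ?thesis
  proof (rule that)
    show "\<Phi> \<in> borel_measurable M" unfolding \<Phi>_def using gm bm dm sm by measurable
    have "(\<integral>\<^sup>+w. \<Phi> w \<partial>M) = 2 * (lip * (\<integral>\<^sup>+w. ?g w \<partial>M)) + 2 * (ennreal (1 / \<kappa>) * (lip * (\<integral>\<^sup>+w. ?g w \<partial>M))) +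
       (2 * (\<integral>\<^sup>+w. ?b w \<partial>M) + 2 * (\<integral>\<^sup>+w. ?d w \<partial>M) + 2 * (\<integral>\<^sup>+w. ?s w \<partial>M))"
      unfolding \<Phi>_def using gm bm dm sm by (simp add: nn_integral_add nn_integral_cmult)
    also have "\<dots> < \<infinity>"
      using gap_zero_finite[OF X] b_zero \<delta>_zero \<sigma>_zero unfolding clock_norm_def by (simp add: ennreal_mult_less_top)
    finally show "(\<integral>\<^sup>+w. \<Phi> w \<partial>M) < \<infinity>" .
    show "dominated X \<Phi>"
      using AE_\<Omega>0 L_regular AE_space
    proof eventually_elim
      case (elim w)
      have aux: "p + u \<le> p + q + (u + v + w)" "q + v \<le> p + q + (u + v + w)" "q + w \<le> p + q + (u + v + w)"
        for p q u v w :: ennreal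
      proof -
        have e1: "p + q + (u + v + w) = (p + u) + (q + v + w)" and e2: "p + q + (u + v + w) = (q + v) + (p + u + w)"
          and e3: "p + q + (u + v + w) = (q + w) + (p + u + v)" by (simp_all only: ac_simps)
        show "p + u \<le> p + q + (u + v + w)" unfolding e1 by (rule add_increasing2[OF zero_le order_refl])
        show "q + v \<le> p + q + (u + v + w)" unfolding e2 by (rule add_increasing2[OF zero_le order_refl])
        show "q + w \<le> p + q + (u + v + w)" unfolding e3 by (rule add_increasing2[OF zero_le order_refl])
      qed
      have 1: "2 * (lip * ?g w) + 2 * ?b w \<le> \<Phi> w" unfolding \<Phi>_def by (rule aux)
      have 2: "2 * (ennreal (1 / \<kappa>) * (lip * ?g w)) + 2 * ?d w \<le> \<Phi> w" unfolding \<Phi>_def by (rule aux)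
      have 3: "2 * (ennreal (1 / \<kappa>) * (lip * ?g w)) + 2 * ?s w \<le> \<Phi> w" unfolding \<Phi>_def by (rule aux)
      show ?case
        using order_trans[OF coefficient_bound(1)[OF Xp b_prog[OF r] b_lip elim(1,3)] 1]
          order_trans[OF coefficient_bound(2)[OF Xp \<delta>_prog[OF r] \<delta>_lip elim(1,3,2)] 2]
          order_trans[OF coefficient_bound(2)[OF Xp \<sigma>_prog[OF r] \<sigma>_lip elim(1,3,2)] 3] by blast
    qed
  qed
qed

text \<open>A relation rather than a map, since \<open>X\<close> is determined by \<open>X'\<close>
  only up to indistinguishability. Solutions are its fixed points among the mean-square
  processes.\<close>

definition picard :: "('a, real ^ 'n) process \<Rightarrow> ('a, real ^ 'n) process \<Rightarrow> bool" where
  "picard X' X \<longleftrightarrow> (\<exists>I. ito_integral M F Z L T (along \<sigma> X') I \<and>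
       (equation X' X I))"

lemma strong_solution_picard:
  "strong_solution M F Z L T b \<delta> \<sigma> x0 X \<longleftrightarrow> mean_square X \<and> picard X X"
  by (simp add: strong_solution_def picard_def mean_square_prog_L2)

lemma path_Icc_le: "reg w \<Longrightarrow> t \<in> {0..T} \<Longrightarrow> emeasure (path_measure L w) {0..t} \<le> ennreal (T / \<kappa>)"
  using path_Icc[of w 0 t] regD(3)[of w 0 t] \<kappa>_pos divide_right_mono[of t T \<kappa>] by (auto intro!: ennreal_leI)

text \<open>The input has to be square-integrable only over time; one passage through the equation
  already makes the supremum square-integrable. For \<open>X' = X\<close> this is the moment bound
  of the theorem.\<close>

lemma picard_sup:
  assumes X': "mean_square X'" and P: "picard X' X"
  shows "nn_sup_sq M {0..T} X < \<infinity>"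
proof -
  obtain I where I: "ito_integral M F Z L T (along \<sigma> X') I"
    and eq: "equation X' X I" using P unfolding picard_def by blast
  obtain \<Phi> where \<Phi>: "\<Phi> \<in> borel_measurable M" "(\<integral>\<^sup>+w. \<Phi> w \<partial>M) < \<infinity>"
    "dominated X' \<Phi>"
    by (rule coefficient_envelope[OF X'])
  let ?S = "\<lambda>w. SUP t\<in>{0..T}. ennreal ((norm (I t w))\<^sup>2)"
  have Sm: "?S \<in> borel_measurable M"
    by (rule measurable_SUP_continuous[OF complete T_pos _ ito_integral_continuous[OF I]])
      (rule measurable_GM[OF ito_integral_adapted[OF I]])
  let ?B = "\<lambda>w. 3 * (2 * ennreal ((norm x0)\<^sup>2) + 2 * (ennreal T * \<Phi> w)) + 3 * (ennreal (T / \<kappa>) * \<Phi> w) + 3 * ?S w"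
  have "nn_sup_sq M {0..T} X \<le> (\<integral>\<^sup>+w. ?B w \<partial>M)"
  proof (rule nn_integral_mono_AE)
    show "AE w in M. (SUP t\<in>{0..T}. ennreal ((norm (X t w))\<^sup>2)) \<le> ?B w"
      using eq \<Phi>(3) L_regular
    proof eventually_elim
      case (elim w)
      show ?case
      proof (rule SUP_least)
        fix t assume t: "t \<in> {0..T}"
        let ?b = "LINT s:{0..t}|lborel. along b X' s w"
        let ?d = "LINT s:{0..t}|path_measure L w. along \<delta> X' s w"
        have "ennreal ((norm ?b)\<^sup>2) \<le> emeasure lborel {0..t} * nn_sq_on lborel {0..t} (\<lambda>s. along b X' s w)"
          by (rule ennreal_norm_set_integral_sq_le, rule set_integrable_subset[of _ "{0..T}"]) (use elim t in auto)
        also have "\<dots> \<le> ennreal T * nn_sq_on lborel {0..T} (\<lambda>s. along b X' s w)"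
          using t by (intro mult_mono nn_integral_mono) (auto simp: indicator_def intro: ennreal_leI)
        also have "\<dots> \<le> ennreal T * \<Phi> w" using elim by (intro mult_left_mono) auto
        finally have 1: "ennreal ((norm ?b)\<^sup>2) \<le> ennreal T * \<Phi> w" .
        have "ennreal ((norm ?d)\<^sup>2) \<le> emeasure (path_measure L w) {0..t} * nn_sq_on (path_measure L w) {0..t} (\<lambda>s. along \<delta> X' s w)"
          by (rule ennreal_norm_set_integral_sq_le, rule set_integrable_subset[of _ "{0..T}"]) (use elim t in auto)
        also have "\<dots> \<le> ennreal (T / \<kappa>) * nn_sq_on (path_measure L w) {0..T} (\<lambda>s. along \<delta> X' s w)"
          using t elim by (intro mult_mono nn_integral_mono path_Icc_le) (auto simp: indicator_def)
        also have "\<dots> \<le> ennreal (T / \<kappa>) * \<Phi> w" using elim by (intro mult_left_mono) auto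
        finally have 2: "ennreal ((norm ?d)\<^sup>2) \<le> ennreal (T / \<kappa>) * \<Phi> w" .
        have "ennreal ((norm (X t w))\<^sup>2) = ennreal ((norm ((x0 + ?b) + ?d + I t w))\<^sup>2)" using elim t by auto
        also have "\<dots> \<le> 3 * ennreal ((norm (x0 + ?b))\<^sup>2) + 3 * ennreal ((norm ?d)\<^sup>2) + 3 * ennreal ((norm (I t w))\<^sup>2)"
          by (rule ennreal_norm_add3_sq_le)
        also have "\<dots> \<le> 3 * (2 * ennreal ((norm x0)\<^sup>2) + 2 * ennreal ((norm ?b)\<^sup>2)) + 3 * ennreal ((norm ?d)\<^sup>2) + 3 * ?S w"
          by (rule add_mono[OF add_mono[OF mult_left_mono[OF ennreal_norm_add_sq_le] order_refl] mult_left_mono[OF SUP_upper[OF t]]]) simp_all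
        also have "\<dots> \<le> ?B w"
          by (rule add_mono[OF add_mono[OF mult_left_mono[OF add_mono[OF order_refl mult_left_mono[OF 1]]] mult_left_mono[OF 2]] order_refl]) simp_all
        finally show "ennreal ((norm (X t w))\<^sup>2) \<le> ?B w" .
      qed
    qed
  qed
  also have "(\<integral>\<^sup>+w. ?B w \<partial>M) = 3 * (2 * ennreal ((norm x0)\<^sup>2) + 2 * (ennreal T * (\<integral>\<^sup>+w. \<Phi> w \<partial>M))) + 3 * (ennreal (T / \<kappa>) * (\<integral>\<^sup>+w. \<Phi> w \<partial>M)) + 3 * (\<integral>\<^sup>+w. ?S w \<partial>M)"
    using \<Phi>(1) Sm by (simp add: nn_integral_add nn_integral_cmult emeasure_space_1)
  also have "\<dots> < \<infinity>"
    using \<Phi>(2) ito_integral_sup_finite[OF I] by (simp add: ennreal_mult_less_top)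
  finally show ?thesis .
qed

text \<open>By definition a solution is only progressively measurable; continuity of its paths comes
  from the equation and is what turns equality at each time into indistinguishability.\<close>

lemma picard_continuous:
  assumes X': "mean_square X'" and P: "picard X' X"
  shows "AE w in M. continuous_on {0..T} (\<lambda>t. X t w)"
proof -
  obtain I where I: "ito_integral M F Z L T (along \<sigma> X') I"
    and eq: "equation X' X I" using P unfolding picard_def by blast
  obtain \<Phi> where \<Phi>: "\<Phi> \<in> borel_measurable M" "(\<integral>\<^sup>+w. \<Phi> w \<partial>M) < \<infinity>"
    "dominated X' \<Phi>"
    by (rule coefficient_envelope[OF X'])
  have "AE w in M. \<Phi> w \<noteq> \<infinity>" using \<Phi> by (intro nn_integral_noteq_infinite) auto
  then show ?thesis
    using eq \<Phi>(3) L_regular ito_integral_continuous[OF I]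
  proof eventually_elim
    case (elim w)
    have fin: "\<Phi> w < \<infinity>" using elim(1) by (simp add: less_top)
    have "continuous_on {0..T} (\<lambda>t. LINT s:{0..t}|lborel. along b X' s w)"
      by (rule norm_integral_interval_continuous[where c = 1])
        (use elim le_less_trans[OF _ fin] in \<open>auto intro!: ennreal_leI\<close>)
    moreover have "continuous_on {0..T} (\<lambda>t. LINT s:{0..t}|path_measure L w. along \<delta> X' s w)"
    proof (rule norm_integral_interval_continuous[where c = "1 / \<kappa>"])
      show "emeasure (path_measure L w) {s<..t} \<le> ennreal (1 / \<kappa> * (t - s))" if "0 \<le> s" "s \<le> t" "t \<le> T" for s t
        using path_Ioc[OF elim(4) that(2)] regD(3)[OF elim(4) that(2)] by (auto intro!: ennreal_leI)
    qed (use elim \<kappa>_pos le_less_trans[OF _ fin] in auto)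
    ultimately have "continuous_on {0..T} (\<lambda>t. x0 + (LINT s:{0..t}|lborel. along b X' s w)
       + (LINT s:{0..t}|path_measure L w. along \<delta> X' s w) + I t w)"
      using elim(5) by (intro continuous_intros)
    then show ?case by (rule continuous_on_cong[THEN iffD1, rotated -1]) (use elim(2) in auto)
  qed
qed

end

text \<open>On a set of finite mass, \<open>x \<le> 1 + x^2\<close> reduces integrability to
  square-integrability.\<close>

lemma set_integrable_of_square:
  fixes f :: "real \<Rightarrow> 'v::euclidean_space"
  assumes sN: "sets N = sets borel" and em: "emeasure N {0..T} < \<infinity>"
    and m: "(\<lambda>s. indicator {0..T} s *\<^sub>R f s) \<in> borel_measurable borel"
    and fin: "nn_sq_on N {0..T} f < \<infinity>"
  shows "set_integrable N {0..T} f"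
  unfolding set_integrable_def
proof (rule integrableI_bounded)
  have mN: "(\<lambda>s. indicator {0..T} s *\<^sub>R f s) \<in> borel_measurable N"
    using m unfolding measurable_cong_sets[OF sN refl] .
  then show "(\<lambda>s. indicator {0..T} s *\<^sub>R f s) \<in> borel_measurable N" .
  have m2: "(\<lambda>s. ennreal ((norm (f s))\<^sup>2) * indicator {0..T} s) \<in> borel_measurable N"
  proof -
    have "(\<lambda>s. ennreal ((norm (indicator {0..T} s *\<^sub>R f s))\<^sup>2)) \<in> borel_measurable N"
      using mN by measurable
    moreover have "ennreal ((norm (indicator {0..T} s *\<^sub>R f s))\<^sup>2) = ennreal ((norm (f s))\<^sup>2) * indicator {0..T} s" for s
      by (auto simp: indicator_def)
    ultimately show ?thesis by (simp only:)
  qed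
  have "(\<integral>\<^sup>+ s. ennreal (norm (indicator {0..T} s *\<^sub>R f s)) \<partial>N) \<le> (\<integral>\<^sup>+ s. indicator {0..T} s + ennreal ((norm (f s))\<^sup>2) * indicator {0..T} s \<partial>N)"
  proof (rule nn_integral_mono)
    fix s
    have "norm (f s) \<le> 1 + (norm (f s))\<^sup>2"
      using sum_squares_bound[of "norm (f s)" 1] norm_ge_zero[of "f s"]
      by (smt (verit) mult_cancel_left1 power_one)
    then have "ennreal (norm (f s)) \<le> 1 + ennreal ((norm (f s))\<^sup>2)"
      by (metis ennreal_1 ennreal_leI ennreal_plus zero_le_one zero_le_power2)
    then show "ennreal (norm (indicator {0..T} s *\<^sub>R f s)) \<le> indicator {0..T} s + ennreal ((norm (f s))\<^sup>2) * indicator {0..T} s"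
      by (auto simp: indicator_def)
  qed
  also have "\<dots> = emeasure N {0..T} + nn_sq_on N {0..T} f"
    using m2 sN by (subst nn_integral_add) auto
  also have "\<dots> < \<infinity>" using em fin by simp
  finally show "(\<integral>\<^sup>+ s. ennreal (norm (indicator {0..T} s *\<^sub>R f s)) \<partial>N) < \<infinity>" .
qed

section \<open>Contraction, uniqueness and existence\<close>

context mean_field_sde
begin

text \<open>The summands belong to the \<open>dt\<close>, \<open>dL\<close> and Ito terms. The 3s
  come from squaring a sum of three terms, \<open>T\<close> and \<open>T / \<kappa>\<close> from
  Cauchy-Schwarz in time, \<open>1 / \<kappa>\<close> from domination of \<open>dL\<close>, 64 from
  \<open>ito_integral_diff_sup\<close>, and each \<open>lip * 2\<close> from the expectation of
  \<open>gap\<close>.\<close>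

definition growth :: ennreal where
  "growth = 3 * (ennreal T * (lip * 2)) + 3 * (ennreal (T / \<kappa>) * (ennreal (1 / \<kappa>) * (lip * 2))) + 3 * (64 * (ennreal (1 / \<kappa>) * (lip * 2)))"

lemma growth: "growth = ennreal (enn2real growth)"
proof -
  have "growth < top" unfolding growth_def by (simp add: ennreal_mult_less_top)
  then show ?thesis by simp
qed

lemma clock_norm_coefficient_diff:
  assumes X': "mean_square X'" and Y': "mean_square Y'" and t: "t \<in> {0..T}"
  shows "clock_norm t (\<lambda>s w. along \<sigma> X' s w - along \<sigma> Y' s w) \<le>
    ennreal (1 / \<kappa>) * (lip * (2 * (\<integral>\<^sup>+s\<in>{0..t}. msd X' Y' s \<partial>lborel)))"
proof -
  have p: "prog_measurable F T X'" "prog_measurable F T Y'" using X' Y' by (auto simp: mean_square_def)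
  have "clock_norm t (\<lambda>s w. along \<sigma> X' s w - along \<sigma> Y' s w) \<le> (\<integral>\<^sup>+w. ennreal (1 / \<kappa>) * (lip * gap X' Y' t w) \<partial>M)"
    unfolding clock_norm_def
  proof (rule nn_integral_mono_AE)
    show "AE w in M. nn_sq_on (path_measure L w) {0..t} (\<lambda>s. along \<sigma> X' s w - along \<sigma> Y' s w) \<le> ennreal (1 / \<kappa>) * (lip * gap X' Y' t w)"
      using AE_\<Omega>0 L_regular AE_space
      by eventually_elim (rule coefficient_gap(2)[OF p \<sigma>_lip t])
  qed
  also have "\<dots> = ennreal (1 / \<kappa>) * (lip * (\<integral>\<^sup>+w. gap X' Y' t w \<partial>M))"
    using gap_expectation(1)[OF p t] by (simp add: nn_integral_cmult)
  finally show ?thesis unfolding gap_expectation(2)[OF p t] .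
qed

text \<open>The first estimate can be iterated, because its left side is of the form that stands
  under the integral on the right; the second then upgrades the outcome to uniform convergence in
  time.\<close>

lemma picard_contraction:
  assumes X': "mean_square X'" and Y': "mean_square Y'" and PX: "picard X' X" and PY: "picard Y' Y"
  shows "t \<in> {0..T} \<Longrightarrow> msd X Y t \<le> growth * (\<integral>\<^sup>+s\<in>{0..t}. msd X' Y' s \<partial>lborel)"
    and "nn_sup_sq M {0..T} (\<lambda>t w. X t w - Y t w) \<le> growth * (\<integral>\<^sup>+s\<in>{0..T}. msd X' Y' s \<partial>lborel)"
proof -
  have T: "T \<in> {0..T}" using T_pos by simp
  have p: "prog_measurable F T X'" "prog_measurable F T Y'" using X' Y' by (auto simp: mean_square_def)
  let ?bX = "\<lambda>w s. along b X' s w" and ?bY = "\<lambda>w s. along b Y' s w"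
  let ?dX = "\<lambda>w s. along \<delta> X' s w" and ?dY = "\<lambda>w s. along \<delta> Y' s w"
  obtain I where I: "ito_integral M F Z L T (along \<sigma> X') I"
    and eqX: "AE w in M. set_integrable lborel {0..T} (?bX w) \<and> set_integrable (path_measure L w) {0..T} (?dX w) \<and>
          (\<forall>t\<in>{0..T}. X t w = x0 + (LINT s:{0..t}|lborel. ?bX w s) + (LINT s:{0..t}|path_measure L w. ?dX w s) + I t w)"
    using PX unfolding picard_def by blast
  obtain J where J: "ito_integral M F Z L T (along \<sigma> Y') J"
    and eqY: "AE w in M. set_integrable lborel {0..T} (?bY w) \<and> set_integrable (path_measure L w) {0..T} (?dY w) \<and>
          (\<forall>t\<in>{0..T}. Y t w = x0 + (LINT s:{0..t}|lborel. ?bY w s) + (LINT s:{0..t}|path_measure L w. ?dY w s) + J t w)"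
    using PY unfolding picard_def by blast
  let ?c = "\<lambda>u. 3 * (ennreal T * u) + 3 * (ennreal (T / \<kappa>) * (ennreal (1 / \<kappa>) * u))"
  \<comment> \<open>The null event is common to all times, so this pathwise estimate serves both a
    fixed time and the supremum.\<close>
  have path: "AE w in M. \<forall>t\<in>{0..T}. ennreal ((norm (X t w - Y t w))\<^sup>2) \<le>
      ?c (lip * gap X' Y' t w) + 3 * ennreal ((norm (I t w - J t w))\<^sup>2)"
    using eqX eqY AE_\<Omega>0 L_regular AE_space
  proof eventually_elim
    case (elim w)
    show ?case
    proof
      fix t assume t: "t \<in> {0..T}"
      have si: "set_integrable lborel {0..t} (?bX w)" "set_integrable lborel {0..t} (?bY w)"
        "set_integrable (path_measure L w) {0..t} (?dX w)" "set_integrable (path_measure L w) {0..t} (?dY w)"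
        by (rule set_integrable_subset[of _ "{0..T}"], use elim t in auto)+
      let ?B = "LINT s:{0..t}|lborel. ?bX w s - ?bY w s" and ?D = "LINT s:{0..t}|path_measure L w. ?dX w s - ?dY w s"
      have "X t w - Y t w = ?B + ?D + (I t w - J t w)"
        using elim t by (simp add: set_integral_diff(2)[OF si(1,2)] set_integral_diff(2)[OF si(3,4)])
      then have "ennreal ((norm (X t w - Y t w))\<^sup>2) \<le> 3 * ennreal ((norm ?B)\<^sup>2) + 3 * ennreal ((norm ?D)\<^sup>2) + 3 * ennreal ((norm (I t w - J t w))\<^sup>2)"
        using ennreal_norm_add3_sq_le[of ?B ?D "I t w - J t w"] by simp
      moreover have "ennreal ((norm ?B)\<^sup>2) \<le> ennreal T * (lip * gap X' Y' t w)"
      proof -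
        have "ennreal ((norm ?B)\<^sup>2) \<le> emeasure lborel {0..t} * nn_sq_on lborel {0..t} (\<lambda>s. ?bX w s - ?bY w s)"
          by (rule ennreal_norm_set_integral_sq_le, rule set_integral_diff(1)[OF si(1,2)]) simp
        also have "\<dots> \<le> ennreal T * (lip * gap X' Y' t w)"
          by (rule mult_mono[OF _ coefficient_gap(1)[OF p b_lip t elim(3,5)]]) (use t in \<open>auto intro: ennreal_leI\<close>)
        finally show ?thesis .
      qed
      moreover have "ennreal ((norm ?D)\<^sup>2) \<le> ennreal (T / \<kappa>) * (ennreal (1 / \<kappa>) * (lip * gap X' Y' t w))"
      proof -
        have "ennreal ((norm ?D)\<^sup>2) \<le> emeasure (path_measure L w) {0..t} * nn_sq_on (path_measure L w) {0..t} (\<lambda>s. ?dX w s - ?dY w s)"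
          by (rule ennreal_norm_set_integral_sq_le, rule set_integral_diff(1)[OF si(3,4)]) simp
        also have "\<dots> \<le> ennreal (T / \<kappa>) * (ennreal (1 / \<kappa>) * (lip * gap X' Y' t w))"
          by (rule mult_mono[OF path_Icc_le[OF elim(4) t] coefficient_gap(2)[OF p \<delta>_lip t elim(3,5,4)]]) auto
        finally show ?thesis .
      qed
      ultimately show "ennreal ((norm (X t w - Y t w))\<^sup>2) \<le> ?c (lip * gap X' Y' t w) + 3 * ennreal ((norm (I t w - J t w))\<^sup>2)"
        by (elim order_trans) (rule add_mono[OF add_mono[OF mult_left_mono mult_left_mono] order_refl], simp_all)
    qed
  qed
  have gE: "(\<integral>\<^sup>+w. ?c (lip * gap X' Y' t w) \<partial>M) = ?c (lip * (2 * (\<integral>\<^sup>+s\<in>{0..t}. msd X' Y' s \<partial>lborel)))" if "t \<in> {0..T}" for t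
    unfolding gap_expectation(2)[OF p that, symmetric] using gap_expectation(1)[OF p that]
    by (simp add: nn_integral_add nn_integral_cmult)
  have gm: "(\<lambda>w. ?c (lip * gap X' Y' t w)) \<in> borel_measurable M" if "t \<in> {0..T}" for t
    using gap_expectation(1)[OF p that] by measurable
  have alg: "?c (lip * (2 * W)) + 3 * (64 * (ennreal (1 / \<kappa>) * (lip * (2 * W)))) = growth * W" for W
    unfolding growth_def by (simp only: distrib_right mult.assoc)
  let ?\<sigma> = "\<lambda>s w. along \<sigma> X' s w - along \<sigma> Y' s w"
  have IJm: "I t \<in> borel_measurable M" "J t \<in> borel_measurable M" if "t \<in> {0..T}" for t
    using measurable_GM[OF ito_integral_adapted[OF I that] that] measurable_GM[OF ito_integral_adapted[OF J that] that] by auto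
  show "msd X Y t \<le> growth * (\<integral>\<^sup>+s\<in>{0..t}. msd X' Y' s \<partial>lborel)" if t: "t \<in> {0..T}"
  proof -
    have "msd X Y t \<le> (\<integral>\<^sup>+w. ?c (lip * gap X' Y' t w) + 3 * ennreal ((norm (I t w - J t w))\<^sup>2) \<partial>M)"
      unfolding msd_def by (rule nn_integral_mono_AE) (use path t in \<open>auto elim: eventually_mono\<close>)
    also have "\<dots> = (\<integral>\<^sup>+w. ?c (lip * gap X' Y' t w) \<partial>M) + 3 * nn_sq M (\<lambda>w. I t w - J t w)"
      using gm[OF t] IJm[OF t] by (simp add: nn_integral_add nn_integral_cmult)
    also have "\<dots> \<le> ?c (lip * (2 * (\<integral>\<^sup>+s\<in>{0..t}. msd X' Y' s \<partial>lborel))) + 3 * (64 * (ennreal (1 / \<kappa>) * (lip * (2 * (\<integral>\<^sup>+s\<in>{0..t}. msd X' Y' s \<partial>lborel)))))"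
      unfolding gE[OF t]
    proof (rule add_left_mono, rule mult_left_mono)
      have "nn_sq M (\<lambda>w. I t w - J t w) \<le> 16 * clock_norm t ?\<sigma>"
        by (rule ito_integral_diff[OF I J t])
      \<comment> \<open>The constant 16 of the fixed-time estimate is raised to 64 so that one
        \<open>growth\<close> serves both claims.\<close>
      also have "\<dots> \<le> 64 * clock_norm t ?\<sigma>" by (rule mult_right_mono) auto
      also have "\<dots> \<le> 64 * (ennreal (1 / \<kappa>) * (lip * (2 * (\<integral>\<^sup>+s\<in>{0..t}. msd X' Y' s \<partial>lborel))))"
        by (rule mult_left_mono[OF clock_norm_coefficient_diff[OF X' Y' t]]) simp
      finally show "nn_sq M (\<lambda>w. I t w - J t w) \<le> 64 * (ennreal (1 / \<kappa>) * (lip * (2 * (\<integral>\<^sup>+s\<in>{0..t}. msd X' Y' s \<partial>lborel))))" .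
    qed simp
    finally show ?thesis unfolding alg .
  qed
  show "nn_sup_sq M {0..T} (\<lambda>t w. X t w - Y t w) \<le> growth * (\<integral>\<^sup>+s\<in>{0..T}. msd X' Y' s \<partial>lborel)"
  proof -
    let ?S = "\<lambda>w. SUP t\<in>{0..T}. ennreal ((norm (I t w - J t w))\<^sup>2)"
    have Sm: "?S \<in> borel_measurable M"
    proof (rule measurable_SUP_continuous[OF complete T_pos])
      show "(\<lambda>w. I t w - J t w) \<in> borel_measurable M" if "t \<in> {0..T}" for t using IJm[OF that] by measurable
      show "AE w in M. continuous_on {0..T} (\<lambda>t. I t w - J t w)"
        using ito_integral_continuous[OF I] ito_integral_continuous[OF J] by eventually_elim (rule continuous_on_diff)
    qed
    have "nn_sup_sq M {0..T} (\<lambda>t w. X t w - Y t w) \<le> (\<integral>\<^sup>+w. ?c (lip * gap X' Y' T w) + 3 * ?S w \<partial>M)"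
    proof (rule nn_integral_mono_AE)
      show "AE w in M. (SUP t\<in>{0..T}. ennreal ((norm (X t w - Y t w))\<^sup>2)) \<le> ?c (lip * gap X' Y' T w) + 3 * ?S w"
        using path
      proof eventually_elim
        case (elim w)
        show ?case
        proof (rule SUP_least)
          fix t assume t: "t \<in> {0..T}"
          have g: "lip * gap X' Y' t w \<le> lip * gap X' Y' T w" using t by (intro mult_left_mono gap_mono) auto
          have "ennreal ((norm (X t w - Y t w))\<^sup>2) \<le> ?c (lip * gap X' Y' t w) + 3 * ennreal ((norm (I t w - J t w))\<^sup>2)"
            using elim t by blast
          also have "\<dots> \<le> ?c (lip * gap X' Y' T w) + 3 * ?S w"
            by (rule add_mono[OF add_mono[OF mult_left_mono[OF mult_left_mono[OF g]] mult_left_mono[OF mult_left_mono[OF mult_left_mono[OF g]]]] mult_left_mono[OF SUP_upper[OF t]]]) simp_all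
          finally show "ennreal ((norm (X t w - Y t w))\<^sup>2) \<le> ?c (lip * gap X' Y' T w) + 3 * ?S w" .
        qed
      qed
    qed
    also have "\<dots> = (\<integral>\<^sup>+w. ?c (lip * gap X' Y' T w) \<partial>M) + 3 * (\<integral>\<^sup>+w. ?S w \<partial>M)"
      using nn_integral_add[OF gm[OF T] borel_measurable_times_ennreal[OF borel_measurable_const Sm]] nn_integral_cmult[OF Sm]
      by simp
    also have "\<dots> \<le> ?c (lip * (2 * (\<integral>\<^sup>+s\<in>{0..T}. msd X' Y' s \<partial>lborel))) + 3 * (64 * (ennreal (1 / \<kappa>) * (lip * (2 * (\<integral>\<^sup>+s\<in>{0..T}. msd X' Y' s \<partial>lborel)))))"
      unfolding gE[OF T]
    proof (rule add_left_mono, rule mult_left_mono)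
      show "(\<integral>\<^sup>+w. ?S w \<partial>M) \<le> 64 * (ennreal (1 / \<kappa>) * (lip * (2 * (\<integral>\<^sup>+s\<in>{0..T}. msd X' Y' s \<partial>lborel))))"
        by (rule order_trans[OF ito_integral_diff_sup[OF I J] mult_left_mono[OF clock_norm_coefficient_diff[OF X' Y' T]]]) simp
    qed simp
    finally show ?thesis unfolding alg .
  qed
qed

text \<open>The class to which \<open>coefficient_prog\<close> applies. Continuity is asked of every
  path and not of almost every one, because joint measurability there is argued for all
  \<open>w\<close>.\<close>

definition regular_process :: "('a, real ^ 'n) process \<Rightarrow> bool" where
  "regular_process X \<longleftrightarrow> (\<forall>t\<in>{0..T}. X t \<in> borel_measurable (F t)) \<and> (\<forall>w. continuous_on {0..T} (\<lambda>t. X t w)) \<and>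
     (nn_sup_sq M {0..T} X) < \<infinity>"

lemma regular_measurable: "regular_process X \<Longrightarrow> t \<in> {0..T} \<Longrightarrow> X t \<in> borel_measurable M"
  unfolding regular_process_def by (rule measurable_GM) auto

lemma regular_SUP_measurable:
  "regular_process X \<Longrightarrow> (\<lambda>w. SUP t\<in>{0..T}. ennreal ((norm (X t w))\<^sup>2)) \<in> borel_measurable M"
  by (rule measurable_SUP_continuous[OF complete T_pos regular_measurable]) (auto simp: regular_process_def)

lemma regular_mean_square:
  assumes X: "regular_process X" shows "mean_square X"
  unfolding mean_square_def
proof
  show "prog_measurable F T X"
    using X unfolding regular_process_def by (intro continuous_adapted_prog) auto
  let ?S = "\<lambda>w. SUP t\<in>{0..T}. ennreal ((norm (X t w))\<^sup>2)"
  have Sm: "?S \<in> borel_measurable M"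
    by (rule regular_SUP_measurable[OF X])
  have "(\<integral>\<^sup>+w. nn_sq_on lborel {0..T} (\<lambda>s. X s w) \<partial>M) \<le> (\<integral>\<^sup>+w. ?S w * ennreal T \<partial>M)"
  proof (rule nn_integral_mono)
    fix w
    have "nn_sq_on lborel {0..T} (\<lambda>s. X s w) \<le> (\<integral>\<^sup>+s\<in>{0..T}. ?S w \<partial>lborel)"
    proof (rule nn_integral_mono)
      fix s show "ennreal ((norm (X s w))\<^sup>2) * indicator {0..T} s \<le> ?S w * indicator {0..T} s"
        by (cases "s \<in> {0..T}") (auto intro: SUP_upper)
    qed
    also have "\<dots> = ?S w * ennreal T" using T_pos by (simp add: nn_integral_cmult_indicator)
    finally show "nn_sq_on lborel {0..T} (\<lambda>s. X s w) \<le> ?S w * ennreal T" .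
  qed
  also have "\<dots> = (\<integral>\<^sup>+w. ?S w \<partial>M) * ennreal T" by (rule nn_integral_multc[OF Sm])
  also have "\<dots> < \<infinity>" using X unfolding regular_process_def by (simp add: ennreal_mult_less_top)
  finally show "(\<integral>\<^sup>+w. nn_sq_on lborel {0..T} (\<lambda>s. X s w) \<partial>M) < \<infinity>" .
qed

lemma picard_cong:
  assumes P: "picard X' X" and eq: "AE w in M. \<forall>t\<in>{0..T}. X t w = Y t w"
  shows "picard X' Y"
proof -
  obtain I where I: "ito_integral M F Z L T (along \<sigma> X') I"
    and eqX: "equation X' X I"
    using P unfolding picard_def by blast
  have "equation X' Y I"
    using eqX eq by eventually_elim auto
  then show ?thesis using I unfolding picard_def by blast
qed

lemma prog_indicator_measurable:
  fixes K :: "('a, 'v::euclidean_space) process"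
  assumes K: "prog_measurable F T K" and w: "w \<in> space M"
  shows "(\<lambda>s. indicator {0..T} s *\<^sub>R K s w) \<in> borel_measurable borel"
proof -
  have "(\<lambda>s. indicator {0..T} s *\<^sub>R K (max 0 (min T s)) w) \<in> borel_measurable borel"
    using prog_measurable_path[OF K, of w] w space_G[of T] T_pos by (intro borel_measurable_scaleR) auto
  moreover have "indicator {0..T} s *\<^sub>R K (max 0 (min T s)) w = indicator {0..T} s *\<^sub>R K s w" for s
    by (cases "s \<in> {0..T}") (auto simp: max_def min_def)
  ultimately show ?thesis by simp
qed

lemma picard_exists:
  assumes X': "regular_process X'"
  shows "\<exists>X. regular_process X \<and> picard X' X"
proof -
  have T: "T \<in> {0..T}" using T_pos by simp
  have ms: "mean_square X'" by (rule regular_mean_square[OF X'])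
  have X'm: "\<And>t. t \<in> {0..T} \<Longrightarrow> X' t \<in> borel_measurable (F t)" and X'c: "\<And>w. continuous_on {0..T} (\<lambda>t. X' t w)"
    and X'f: "nn_sup_sq M {0..T} X' < \<infinity>"
    using X' by (auto simp: regular_process_def)
  \<comment> \<open>Versions of the coefficients that vanish off \<open>\<Omega>0\<close>; they are
    progressively measurable and agree with the coefficients almost surely at all times.\<close>
  define Kb where "Kb t w = (if w \<in> \<Omega>0 then along b X' t w else 0)" for t w
  define Kd where "Kd t w = (if w \<in> \<Omega>0 then along \<delta> X' t w else 0)" for t w
  define Ks where "Ks t w = (if w \<in> \<Omega>0 then along \<sigma> X' t w else 0)" for t w
  have pb: "prog_measurable F T Kb" unfolding Kb_def by (rule coefficient_prog[OF b_prog C0 \<Omega>0 b_lip X'm X'c X'f])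
  have pd: "prog_measurable F T Kd" unfolding Kd_def by (rule coefficient_prog[OF \<delta>_prog C0 \<Omega>0 \<delta>_lip X'm X'c X'f])
  have ps: "prog_measurable F T Ks" unfolding Ks_def by (rule coefficient_prog[OF \<sigma>_prog C0 \<Omega>0 \<sigma>_lip X'm X'c X'f])
  obtain \<Phi> where \<Phi>: "\<Phi> \<in> borel_measurable M" "(\<integral>\<^sup>+w. \<Phi> w \<partial>M) < \<infinity>"
    "dominated X' \<Phi>"
    by (rule coefficient_envelope[OF ms])
  have fin: "AE w in M. \<Phi> w \<noteq> \<infinity>" using \<Phi> by (intro nn_integral_noteq_infinite) auto
  have Ks_eq: "AE w in M. \<forall>s\<in>{0..T}. Ks s w = along \<sigma> X' s w"
    using AE_\<Omega>0 by eventually_elim (auto simp: Ks_def)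
  have "clock_norm T Ks = clock_norm T (along \<sigma> X')" by (rule clock_norm_cong[OF Ks_eq T])
  also have "\<dots> \<le> (\<integral>\<^sup>+w. \<Phi> w \<partial>M)"
    unfolding clock_norm_def by (rule nn_integral_mono_AE) (use \<Phi>(3) in \<open>auto elim: eventually_mono\<close>)
  finally have "clock_norm T Ks < \<infinity>" using \<Phi>(2) by (rule le_less_trans)
  then obtain I where I0: "ito_integral M F Z L T Ks I" using ito_integral_exists[OF ps] by blast
  have I: "ito_integral M F Z L T (along \<sigma> X') I" by (rule ito_integral_cong[OF I0 Ks_eq])
  have int: "AE w in M. set_integrable lborel {0..T} (\<lambda>s. Kb s w) \<and> set_integrable (path_measure L w) {0..T} (\<lambda>s. Kd s w)"
    using fin \<Phi>(3) AE_\<Omega>0 L_regular AE_space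
  proof eventually_elim
    case (elim w)
    have f: "\<Phi> w < \<infinity>" using elim(1) by (simp add: less_top)
    have "set_integrable lborel {0..T} (\<lambda>s. Kb s w)"
    proof (rule set_integrable_of_square)
      show "nn_sq_on lborel {0..T} (\<lambda>s. Kb s w) < \<infinity>"
        using elim le_less_trans[OF _ f] by (simp add: Kb_def)
      show "emeasure lborel {0..T} < \<infinity>" using T_pos by simp
    qed (use prog_indicator_measurable[OF pb elim(5)] in auto)
    moreover have "set_integrable (path_measure L w) {0..T} (\<lambda>s. Kd s w)"
    proof (rule set_integrable_of_square)
      show "nn_sq_on (path_measure L w) {0..T} (\<lambda>s. Kd s w) < \<infinity>"
        using elim le_less_trans[OF _ f] by (simp add: Kd_def)
      show "emeasure (path_measure L w) {0..T} < \<infinity>"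
        using le_less_trans[OF path_Icc_le[OF elim(4) T]] by simp
    qed (use prog_indicator_measurable[OF pd elim(5)] in auto)
    ultimately show ?case by simp
  qed
  define V where "V t w = x0 + (LINT s:{0..t}|lborel. Kb s w) + (LINT s:{0..t}|path_measure L w. Kd s w) + I t w" for t w
  have Vm: "V t \<in> borel_measurable (F t)" if t: "t \<in> {0..T}" for t
  proof -
    have "(\<lambda>w. LINT s:{0..t}|lborel. Kb s w) \<in> borel_measurable (F t)"
    proof (rule set_lebesgue_integral_adapted[OF nn_integral_lborel_adapted[OF _ t] pb t])
      show "AE w in M. set_integrable lborel {0..t} (\<lambda>s. Kb s w)"
        using int by eventually_elim (rule set_integrable_subset[of _ "{0..T}"], use t in auto)
    qed
    moreover have "(\<lambda>w. LINT s:{0..t}|path_measure L w. Kd s w) \<in> borel_measurable (F t)"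
    proof (rule set_lebesgue_integral_adapted[OF nn_integral_path_adapted[OF _ t] pd t])
      show "AE w in M. set_integrable (path_measure L w) {0..t} (\<lambda>s. Kd s w)"
        using int by eventually_elim (rule set_integrable_subset[of _ "{0..T}"], use t in auto)
    qed
    ultimately show ?thesis
      unfolding V_def[abs_def] using ito_integral_adapted[OF I t] by (intro borel_measurable_add borel_measurable_const)
  qed
  have PV: "picard X' V"
    unfolding picard_def
  proof (intro exI conjI)
    show "equation X' V I"
      using int AE_\<Omega>0 by eventually_elim (simp add: V_def Kb_def Kd_def)
  qed (rule I)
  have Vc: "AE w in M. continuous_on {0..T} (\<lambda>t. V t w)" by (rule picard_continuous[OF ms PV])
  \<comment> \<open>Discontinuous paths, which form a null event, are replaced by zero. This gives
    continuity of every path, and completeness of the filtration keeps adaptedness.\<close>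
  define X where "X t w = (if continuous_on {0..T} (\<lambda>t. V t w) then V t w else 0)" for t w
  have eq: "AE w in M. \<forall>t\<in>{0..T}. V t w = X t w" using Vc by eventually_elim (simp add: X_def)
  have PX: "picard X' X" by (rule picard_cong[OF PV eq])
  have "regular_process X"
    unfolding regular_process_def
  proof (intro conjI ballI allI)
    fix t assume t: "t \<in> {0..T}"
    show "X t \<in> borel_measurable (F t)"
      by (rule measurable_AE_cong[OF complete subalg[OF t] null[OF t] Vm[OF t]]) (use eq t in \<open>auto elim: eventually_mono\<close>)
  next
    fix w
    show "continuous_on {0..T} (\<lambda>t. X t w)" by (cases "continuous_on {0..T} (\<lambda>t. V t w)") (simp_all add: X_def)
  next
    show "nn_sup_sq M {0..T} X < \<infinity>" by (rule picard_sup[OF ms PX])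
  qed
  then show ?thesis using PX by blast
qed

lemma msd_zero_AE:
  assumes m: "X t \<in> borel_measurable M" "Y t \<in> borel_measurable M" and z: "msd X Y t = 0"
  shows "AE w in M. X t w = Y t w"
proof -
  have "AE w in M. ennreal ((norm (X t w - Y t w))\<^sup>2) = 0"
    using z m unfolding msd_def by (subst (asm) nn_integral_0_iff_AE) auto
  then show ?thesis by eventually_elim simp
qed

text \<open>Both processes are mean-square only, so at first nothing bounds \<open>msd Y X\<close>
  at a fixed time. One application of the contraction turns its integral over \<open>{0..T}\<close>
  into a uniform bound \<open>c\<close>; iteration with a constant sequence then sends it to
  zero.\<close>

lemma solution_unique:
  assumes X: "mean_square X" "picard X X" and Y: "mean_square Y" "picard Y Y"
  shows "AE w in M. \<forall>t\<in>{0..T}. Y t w = X t w"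
proof (rule indistinguishable[OF picard_continuous[OF Y] picard_continuous[OF X]])
  fix t assume t: "t \<in> {0..T}"
  have T: "T \<in> {0..T}" using T_pos by simp
  have p: "prog_measurable F T Y" "prog_measurable F T X" using X Y by (auto simp: mean_square_def)
  let ?K = "enn2real growth"
  have le: "msd Y X t \<le> ennreal ?K * (\<integral>\<^sup>+s\<in>{0..t}. msd Y X s \<partial>lborel)" if "t \<in> {0..T}" for t
    using picard_contraction(1)[OF Y(1) X(1) Y(2) X(2) that] growth by simp
  have "(\<integral>\<^sup>+s\<in>{0..T}. msd Y X s \<partial>lborel) = (\<integral>\<^sup>+w. nn_sq_on lborel {0..T} (\<lambda>s. Y s w - X s w) \<partial>M)"
    unfolding msd_def by (rule tonelli_prog(1)[OF prog_measurable_norm_sq[OF prog_measurable_diff[OF p]] T, symmetric])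
  also have "\<dots> \<le> (\<integral>\<^sup>+w. 2 * nn_sq_on lborel {0..T} (\<lambda>s. Y s w) + 2 * nn_sq_on lborel {0..T} (\<lambda>s. X s w) \<partial>M)"
  proof (rule nn_integral_mono)
    fix w assume w: "w \<in> space M"
    have m: "(\<lambda>s. ennreal ((norm (Y s w))\<^sup>2) * indicator {0..T} s) \<in> borel_measurable lborel"
      "(\<lambda>s. ennreal ((norm (X s w))\<^sup>2) * indicator {0..T} s) \<in> borel_measurable lborel"
      using prog_path_measurable[OF prog_measurable_norm_sq[OF p(1)] T w] prog_path_measurable[OF prog_measurable_norm_sq[OF p(2)] T w] by auto
    have "nn_sq_on lborel {0..T} (\<lambda>s. Y s w - X s w) \<le>
      (\<integral>\<^sup>+s. 2 * (ennreal ((norm (Y s w))\<^sup>2) * indicator {0..T} s) + 2 * (ennreal ((norm (X s w))\<^sup>2) * indicator {0..T} s) \<partial>lborel)"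
      by (rule nn_integral_mono) (auto simp: indicator_def intro: ennreal_norm_diff_sq_le)
    also have "\<dots> = 2 * nn_sq_on lborel {0..T} (\<lambda>s. Y s w) + 2 * nn_sq_on lborel {0..T} (\<lambda>s. X s w)"
      unfolding nn_integral_add[OF borel_measurable_times_ennreal[OF borel_measurable_const m(1)] borel_measurable_times_ennreal[OF borel_measurable_const m(2)]]
        nn_integral_cmult[OF m(1)] nn_integral_cmult[OF m(2)] ..
    finally show "nn_sq_on lborel {0..T} (\<lambda>s. Y s w - X s w) \<le>
      2 * nn_sq_on lborel {0..T} (\<lambda>s. Y s w) + 2 * nn_sq_on lborel {0..T} (\<lambda>s. X s w)" .
  qed
  also have "\<dots> = 2 * (\<integral>\<^sup>+w. nn_sq_on lborel {0..T} (\<lambda>s. Y s w) \<partial>M) + 2 * (\<integral>\<^sup>+w. nn_sq_on lborel {0..T} (\<lambda>s. X s w) \<partial>M)"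
    using measurable_GM[OF nn_integral_lborel_adapted[OF prog_measurable_norm_sq[OF p(1)] T] T]
      measurable_GM[OF nn_integral_lborel_adapted[OF prog_measurable_norm_sq[OF p(2)] T] T]
    by (simp add: nn_integral_add nn_integral_cmult)
  also have "\<dots> < \<infinity>" using X(1) Y(1) by (simp add: mean_square_def ennreal_mult_less_top)
  finally have W: "(\<integral>\<^sup>+s\<in>{0..T}. msd Y X s \<partial>lborel) < \<infinity>" .
  define c where "c = enn2real (ennreal ?K * (\<integral>\<^sup>+s\<in>{0..T}. msd Y X s \<partial>lborel))"
  have c: "ennreal c = ennreal ?K * (\<integral>\<^sup>+s\<in>{0..T}. msd Y X s \<partial>lborel)" "0 \<le> c"
    using W by (auto simp: c_def ennreal_mult_less_top)
  have "msd Y X t \<le> ennreal (c * ((?K * t) ^ k / fact k))" for k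
  proof (rule gronwall_iterate[where h = "\<lambda>_. msd Y X" and T = T and K = ?K])
    fix s assume s: "s \<in> {0..T}"
    have "msd Y X s \<le> ennreal ?K * (\<integral>\<^sup>+r\<in>{0..s}. msd Y X r \<partial>lborel)" by (rule le[OF s])
    also have "\<dots> \<le> ennreal c" unfolding c(1) using s by (intro mult_left_mono nn_integral_mono) (auto simp: indicator_def)
    finally show "msd Y X s \<le> ennreal c" .
  qed (use c t le in auto)
  moreover have "(\<lambda>k. ennreal (c * ((?K * t) ^ k / fact k))) \<longlonglongrightarrow> ennreal (c * 0)"
    by (intro tendsto_ennrealI tendsto_mult tendsto_const exp_series_term_tendsto_0)
  ultimately have "msd Y X t \<le> ennreal (c * 0)" by (intro LIMSEQ_le_const) auto
  then have "msd Y X t = 0" by simp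
  then show "AE w in M. Y t w = X t w" by (rule msd_zero_AE[where X = Y and Y = X, OF prog_measurableM[OF p(1) t] prog_measurableM[OF p(2) t]])
qed

lemma msd_le_sup: "t \<in> {0..T} \<Longrightarrow> msd X Y t \<le> nn_sup_sq M {0..T} (\<lambda>t w. X t w - Y t w)"
  unfolding msd_def by (intro nn_integral_mono SUP_upper)

lemma solution_exists: "\<exists>X. mean_square X \<and> picard X X"
proof -
  have T: "T \<in> {0..T}" using T_pos by simp
  let ?K = "enn2real growth"
  have const: "regular_process (\<lambda>t w. x0)"
    using T_pos unfolding regular_process_def by (auto simp: emeasure_space_1)
  define Xs where "Xs = rec_nat (\<lambda>t w. x0) (\<lambda>k X'. SOME X. regular_process X \<and> picard X' X)"
  have Xs0: "Xs 0 = (\<lambda>t w. x0)" and XsS: "Xs (Suc k) = (SOME X. regular_process X \<and> picard (Xs k) X)" for k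
    by (simp_all add: Xs_def)
  have R: "regular_process (Xs k)" for k
  proof (induction k)
    case 0 show ?case unfolding Xs0 by (rule const)
  next
    case (Suc k) show ?case unfolding XsS using someI_ex[OF picard_exists[OF Suc]] by blast
  qed
  have P: "picard (Xs k) (Xs (Suc k))" for k
    unfolding XsS[of k] using someI_ex[OF picard_exists[OF R[of k]]] by blast
  note MS = regular_mean_square[OF R]
  have con: "msd (Xs (Suc (Suc k))) (Xs (Suc k)) t \<le> ennreal ?K * (\<integral>\<^sup>+s\<in>{0..t}. msd (Xs (Suc k)) (Xs k) s \<partial>lborel)"
    if "t \<in> {0..T}" for k t
    using picard_contraction(1)[OF MS MS P P that] growth by simp
  have Sfin: "nn_sup_sq M {0..T} (\<lambda>t w. U t w - V t w) < \<infinity>" if U: "regular_process U" and V: "regular_process V" for U V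
  proof -
    let ?S = "\<lambda>U w. SUP t\<in>{0..T}. ennreal ((norm (U t w))\<^sup>2)"
    have Sm: "?S U \<in> borel_measurable M" if "regular_process U" for U
      by (rule regular_SUP_measurable[OF that])
    have "nn_sup_sq M {0..T} (\<lambda>t w. U t w - V t w) \<le> (\<integral>\<^sup>+w. 2 * ?S U w + 2 * ?S V w \<partial>M)"
    proof (intro nn_integral_mono SUP_least)
      fix w t assume t: "t \<in> {0..T}"
      have "ennreal ((norm (U t w - V t w))\<^sup>2) \<le> 2 * ennreal ((norm (U t w))\<^sup>2) + 2 * ennreal ((norm (V t w))\<^sup>2)"
        by (rule ennreal_norm_diff_sq_le)
      also have "\<dots> \<le> 2 * ?S U w + 2 * ?S V w"
        by (rule add_mono[OF mult_left_mono[OF SUP_upper[OF t]] mult_left_mono[OF SUP_upper[OF t]]]) simp_all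
      finally show "ennreal ((norm (U t w - V t w))\<^sup>2) \<le> 2 * ?S U w + 2 * ?S V w" .
    qed
    also have "\<dots> = 2 * (\<integral>\<^sup>+w. ?S U w \<partial>M) + 2 * (\<integral>\<^sup>+w. ?S V w \<partial>M)"
      unfolding nn_integral_add[OF borel_measurable_times_ennreal[OF borel_measurable_const Sm[OF U]] borel_measurable_times_ennreal[OF borel_measurable_const Sm[OF V]]]
        nn_integral_cmult[OF Sm[OF U]] nn_integral_cmult[OF Sm[OF V]] ..
    also have "\<dots> < \<infinity>" using U V by (simp add: regular_process_def ennreal_mult_less_top)
    finally show ?thesis .
  qed
  define c where "c = enn2real (nn_sup_sq M {0..T} (\<lambda>t w. Xs 1 t w - Xs 0 t w))"
  have c: "nn_sup_sq M {0..T} (\<lambda>t w. Xs 1 t w - Xs 0 t w) = ennreal c" "0 \<le> c"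
    using Sfin[OF R[of 1] R[of 0]] by (auto simp: c_def)
  have g: "msd (Xs (Suc k)) (Xs k) t \<le> ennreal (c * ((?K * t) ^ k / fact k))" if "t \<in> {0..T}" for k t
  proof (rule gronwall_iterate[where h = "\<lambda>k. msd (Xs (Suc k)) (Xs k)" and T = T and K = ?K])
    show "msd (Xs (Suc 0)) (Xs 0) t \<le> ennreal c" if "t \<in> {0..T}" for t
      using msd_le_sup[OF that, of "Xs 1" "Xs 0"] c by simp
  qed (use con that c in auto)
  \<comment> \<open>With \<open>K\<close> for \<open>?K\<close>, the term
    \<open>(K T)^k / k!\<close> equals \<open>(16 K T)^k / k!\<close> times \<open>(1/16)^k\<close>
    and is at most \<open>exp (16 K T)\<close> times \<open>(1/16)^k\<close>: the factorial is
    traded for the rate that \<open>uniform_limit_process\<close> expects.\<close>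
  define C where "C = ?K * (T * (c * exp (16 * (?K * T))))"
  have C: "0 \<le> C" using c T_pos by (simp add: C_def)
  have bound: "nn_sup_sq M {0..T} (\<lambda>t w. Xs (Suc (Suc k)) t w - Xs (Suc k) t w) \<le> ennreal (C * (1/16) ^ k)" for k
  proof -
    let ?e = "exp (16 * (?K * T)) * (1/16) ^ k"
    have KT: "0 \<le> ?K * T" using T_pos by simp
    have e: "(?K * t) ^ k / fact k \<le> ?e" if "t \<in> {0..T}" for t
    proof -
      have "(?K * t) ^ k / fact k \<le> (?K * T) ^ k / fact k"
        using that by (intro divide_right_mono power_mono mult_left_mono) auto
      also have "\<dots> = ((16 * (?K * T)) ^ k / fact k) * (1/16) ^ k" by (simp add: power_mult_distrib power_divide)
      also have "\<dots> \<le> ?e" using KT by (intro mult_right_mono exp_series_term_le) auto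
      finally show ?thesis .
    qed
    have "nn_sup_sq M {0..T} (\<lambda>t w. Xs (Suc (Suc k)) t w - Xs (Suc k) t w) \<le> ennreal ?K * (\<integral>\<^sup>+s\<in>{0..T}. msd (Xs (Suc k)) (Xs k) s \<partial>lborel)"
      using picard_contraction(2)[OF MS MS P P] growth by simp
    also have "(\<integral>\<^sup>+s\<in>{0..T}. msd (Xs (Suc k)) (Xs k) s \<partial>lborel) \<le> (\<integral>\<^sup>+s\<in>{0..T}. ennreal (c * ?e) \<partial>lborel)"
    proof (rule nn_integral_mono)
      fix s
      show "msd (Xs (Suc k)) (Xs k) s * indicator {0..T} s \<le> ennreal (c * ?e) * indicator {0..T} s"
        using order_trans[OF g[of s k] ennreal_leI[OF mult_left_mono[OF e[of s] c(2)]]] by (cases "s \<in> {0..T}") auto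
    qed
    also have "\<dots> = ennreal (c * ?e) * ennreal T" using T_pos by (simp add: nn_integral_cmult_indicator)
    finally have "nn_sup_sq M {0..T} (\<lambda>t w. Xs (Suc (Suc k)) t w - Xs (Suc k) t w) \<le> ennreal ?K * (ennreal (c * ?e) * ennreal T)"
      by (simp add: mult_left_mono)
    also have "\<dots> = ennreal (?K * ((c * ?e) * T))"
      using c T_pos by (subst ennreal_mult[symmetric], simp, simp, subst ennreal_mult[symmetric]) auto
    also have "?K * ((c * ?e) * T) = C * (1/16) ^ k" by (simp add: C_def)
    finally show ?thesis .
  qed
  \<comment> \<open>The sequence starts with the first iterate, because the supremum of a difference
    is estimated only after a Picard step.\<close>
  have Rm: "\<And>k t. t \<in> {0..T} \<Longrightarrow> Xs (Suc k) t \<in> borel_measurable (F t)" and Rc: "\<And>k. AE w in M. continuous_on {0..T} (\<lambda>t. Xs (Suc k) t w)"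
    using R by (auto simp: regular_process_def)
  obtain Xi where Xi: "\<And>t. t \<in> {0..T} \<Longrightarrow> Xi t \<in> borel_measurable (F t)" "\<And>w. continuous_on {0..T} (\<lambda>t. Xi t w)"
    and lim: "(\<lambda>k. \<integral>\<^sup>+w. (SUP t\<in>{0..T}. ennreal ((norm (Xi t w - Xs (Suc k) t w))\<^sup>2)) \<partial>M) \<longlonglongrightarrow> 0"
    by (rule uniform_limit_process[where Y = "\<lambda>k. Xs (Suc k)", OF _ _ bound C]) (rule Rm, assumption, rule Rc, rule that, assumption+)
  let ?D = "\<lambda>k. \<integral>\<^sup>+w. (SUP t\<in>{0..T}. ennreal ((norm (Xi t w - Xs (Suc k) t w))\<^sup>2)) \<partial>M"
  have Sm: "(\<lambda>w. SUP t\<in>{0..T}. ennreal ((norm (U t w))\<^sup>2)) \<in> borel_measurable M"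
    if "\<And>t. t \<in> {0..T} \<Longrightarrow> U t \<in> borel_measurable M" "\<And>w. continuous_on {0..T} (\<lambda>t. U t w)" for U :: "('a, real ^ 'n) process"
    by (rule measurable_SUP_continuous[OF complete T_pos that(1)]) (use that(2) in auto)
  have RXi: "regular_process Xi"
    unfolding regular_process_def
  proof (intro conjI ballI allI)
    have "\<forall>\<^sub>F k in sequentially. ?D k < 1" using lim by (rule order_tendstoD) simp
    then obtain k where k: "?D k < 1" by (auto simp: eventually_sequentially)
    have m1: "(\<lambda>w. SUP t\<in>{0..T}. ennreal ((norm (Xi t w - Xs (Suc k) t w))\<^sup>2)) \<in> borel_measurable M"
    proof (rule Sm)
      show "(\<lambda>w. Xi t w - Xs (Suc k) t w) \<in> borel_measurable M" if "t \<in> {0..T}" for t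
        by (rule borel_measurable_diff[OF measurable_GM[OF Xi(1)[OF that] that] measurable_GM[OF Rm[OF that] that]])
      show "continuous_on {0..T} (\<lambda>t. Xi t w - Xs (Suc k) t w)" for w
        using Xi(2)[of w] R[of "Suc k"] by (intro continuous_on_diff) (auto simp: regular_process_def)
    qed
    have m2: "(\<lambda>w. SUP t\<in>{0..T}. ennreal ((norm (Xs (Suc k) t w))\<^sup>2)) \<in> borel_measurable M"
      by (rule regular_SUP_measurable[OF R])
    have "nn_sup_sq M {0..T} Xi \<le>
      (\<integral>\<^sup>+w. 2 * (SUP t\<in>{0..T}. ennreal ((norm (Xi t w - Xs (Suc k) t w))\<^sup>2)) + 2 * (SUP t\<in>{0..T}. ennreal ((norm (Xs (Suc k) t w))\<^sup>2)) \<partial>M)"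
    proof (intro nn_integral_mono SUP_least)
      fix w t assume t: "t \<in> {0..T}"
      have "ennreal ((norm (Xi t w))\<^sup>2) \<le> 2 * ennreal ((norm (Xi t w - Xs (Suc k) t w))\<^sup>2) + 2 * ennreal ((norm (Xs (Suc k) t w))\<^sup>2)"
        using ennreal_norm_add_sq_le[of "Xi t w - Xs (Suc k) t w" "Xs (Suc k) t w"] by simp
      also have "\<dots> \<le> 2 * (SUP t\<in>{0..T}. ennreal ((norm (Xi t w - Xs (Suc k) t w))\<^sup>2)) + 2 * (SUP t\<in>{0..T}. ennreal ((norm (Xs (Suc k) t w))\<^sup>2))"
        by (rule add_mono[OF mult_left_mono[OF SUP_upper[OF t]] mult_left_mono[OF SUP_upper[OF t]]]) simp_all
      finally show "ennreal ((norm (Xi t w))\<^sup>2) \<le> 2 * (SUP t\<in>{0..T}. ennreal ((norm (Xi t w - Xs (Suc k) t w))\<^sup>2)) + 2 * (SUP t\<in>{0..T}. ennreal ((norm (Xs (Suc k) t w))\<^sup>2))" .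
    qed
    also have "\<dots> = 2 * ?D k + 2 * nn_sup_sq M {0..T} (\<lambda>t w. Xs (Suc k) t w)"
      unfolding nn_integral_add[OF borel_measurable_times_ennreal[OF borel_measurable_const m1] borel_measurable_times_ennreal[OF borel_measurable_const m2]]
        nn_integral_cmult[OF m1] nn_integral_cmult[OF m2] ..
    also have "\<dots> < \<infinity>" using less_trans[OF k, of top] R[of "Suc k"] by (simp add: regular_process_def ennreal_mult_less_top)
    finally show "nn_sup_sq M {0..T} Xi < \<infinity>" .
  qed (use Xi in auto)
  note MSi = regular_mean_square[OF RXi]
  \<comment> \<open>The equation is not passed to the limit term by term. \<open>Y\<close> is a
    Picard image of the limit, and both \<open>Y\<close> and \<open>Xi\<close> are mean square
    limits of the iterates, hence indistinguishable.\<close>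
  obtain Y where Y: "regular_process Y" "picard Xi Y" using picard_exists[OF RXi] by blast
  have Ym: "Y t \<in> borel_measurable M" "Xi t \<in> borel_measurable M" "Xs k t \<in> borel_measurable M" if "t \<in> {0..T}" for t k
    using that by (rule regular_measurable[OF Y(1)] regular_measurable[OF RXi] regular_measurable[OF R])+
  have "AE w in M. \<forall>t\<in>{0..T}. Y t w = Xi t w"
  proof (rule indistinguishable)
    fix t assume t: "t \<in> {0..T}"
    have le: "msd Y Xi t \<le> 2 * (growth * (?D k * ennreal T)) + 2 * ?D (Suc k)" for k
    proof -
      have "msd Y Xi t \<le> (\<integral>\<^sup>+w. 2 * ennreal ((norm (Y t w - Xs (Suc (Suc k)) t w))\<^sup>2) + 2 * ennreal ((norm (Xi t w - Xs (Suc (Suc k)) t w))\<^sup>2) \<partial>M)"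
        unfolding msd_def
      proof (rule nn_integral_mono)
        fix w
        show "ennreal ((norm (Y t w - Xi t w))\<^sup>2) \<le> 2 * ennreal ((norm (Y t w - Xs (Suc (Suc k)) t w))\<^sup>2) + 2 * ennreal ((norm (Xi t w - Xs (Suc (Suc k)) t w))\<^sup>2)"
          using ennreal_norm_diff_sq_le[of "Y t w - Xs (Suc (Suc k)) t w" "Xi t w - Xs (Suc (Suc k)) t w"] by simp
      qed
      also have "\<dots> = 2 * msd Y (Xs (Suc (Suc k))) t + 2 * msd Xi (Xs (Suc (Suc k))) t"
        unfolding msd_def using Ym[OF t] by (simp add: nn_integral_add nn_integral_cmult)
      also have "\<dots> \<le> 2 * (growth * (?D k * ennreal T)) + 2 * ?D (Suc k)"
      proof (rule add_mono[OF mult_left_mono mult_left_mono])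
        have "msd Y (Xs (Suc (Suc k))) t \<le> growth * (\<integral>\<^sup>+s\<in>{0..t}. msd Xi (Xs (Suc k)) s \<partial>lborel)"
          by (rule picard_contraction(1)[OF MSi MS Y(2) P t])
        also have "\<dots> \<le> growth * (\<integral>\<^sup>+s\<in>{0..T}. ?D k \<partial>lborel)"
        proof (rule mult_left_mono[OF nn_integral_mono])
          fix s
          show "msd Xi (Xs (Suc k)) s * indicator {0..t} s \<le> ?D k * indicator {0..T} s"
            using msd_le_sup[of s Xi "Xs (Suc k)"] t by (cases "s \<in> {0..t}") auto
        qed simp
        also have "(\<integral>\<^sup>+s\<in>{0..T}. ?D k \<partial>lborel) = ?D k * ennreal T" using T_pos by (simp add: nn_integral_cmult_indicator)
        finally show "msd Y (Xs (Suc (Suc k))) t \<le> growth * (?D k * ennreal T)" .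
        show "msd Xi (Xs (Suc (Suc k))) t \<le> ?D (Suc k)" by (rule msd_le_sup[OF t])
      qed simp_all
      finally show ?thesis .
    qed
    have gT: "growth < top" using growth by (metis ennreal_less_top)
    have "(\<lambda>k. growth * (ennreal T * ?D k)) \<longlonglongrightarrow> growth * (ennreal T * 0)"
      by (intro ennreal_tendsto_cmult gT lim) simp
    then have "(\<lambda>k. growth * (?D k * ennreal T)) \<longlonglongrightarrow> growth * (0 * ennreal T)"
      by (simp only: mult.commute[of _ "ennreal T"])
    from tendsto_add[OF ennreal_tendsto_cmult[where c = 2, OF _ this] ennreal_tendsto_cmult[where c = 2, OF _ LIMSEQ_Suc[OF lim]]]
    have "(\<lambda>k. 2 * (growth * (?D k * ennreal T)) + 2 * ?D (Suc k)) \<longlonglongrightarrow> 0" by simp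
    then have "msd Y Xi t \<le> 0" by (rule LIMSEQ_le_const) (use le in auto)
    then show "AE w in M. Y t w = Xi t w" using Ym[OF t] by (intro msd_zero_AE) auto
  qed (use Y(1) RXi in \<open>auto simp: regular_process_def\<close>)
  then have "picard Xi Xi" by (rule picard_cong[OF Y(2)])
  then show ?thesis using MSi by blast
qed

theorem well_posed:
  "(\<exists>X. strong_solution M F Z L T b \<delta> \<sigma> x0 X) \<and>
    (\<forall>X Y. strong_solution M F Z L T b \<delta> \<sigma> x0 X \<and> strong_solution M F Z L T b \<delta> \<sigma> x0 Y \<longrightarrow>
       (AE w in M. \<forall>t\<in>{0..T}. Y t w = X t w)) \<and>
    (\<forall>X. strong_solution M F Z L T b \<delta> \<sigma> x0 X \<longrightarrow>
       (nn_sup_sq M {0..T} X) < \<infinity>)"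
  unfolding strong_solution_picard
proof (intro conjI allI impI)
  show "\<exists>X. mean_square X \<and> picard X X" by (rule solution_exists)
  show "AE w in M. \<forall>t\<in>{0..T}. Y t w = X t w"
    if "(mean_square X \<and> picard X X) \<and> mean_square Y \<and> picard Y Y" for X Y
    using that by (intro solution_unique) auto
  show "nn_sup_sq M {0..T} X < \<infinity>"
    if "mean_square X \<and> picard X X" for X
    using that picard_sup by blast
qed

end

section \<open>Brownian motion subordinated by an inverse clock\<close>

lemma linear_growth_exceeds:
  fixes f :: "real \<Rightarrow> real"
  assumes \<kappa>: "0 < \<kappa>" and f0: "f 0 = 0" and growth: "\<And>s t. 0 \<le> s \<Longrightarrow> s \<le> t \<Longrightarrow> \<kappa> * (t - s) \<le> f t - f s"
  shows "{r. 0 < r \<and> f r > t} \<noteq> {}"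
proof -
  have r: "0 < \<bar>t\<bar> / \<kappa> + 1" using \<kappa> by (intro add_nonneg_pos) auto
  have "\<kappa> * (\<bar>t\<bar> / \<kappa> + 1) = \<bar>t\<bar> + \<kappa>" using \<kappa> by (simp add: distrib_left)
  then have "t < \<kappa> * (\<bar>t\<bar> / \<kappa> + 1)" using \<kappa> by linarith
  also have "\<dots> \<le> f (\<bar>t\<bar> / \<kappa> + 1)" using growth[of 0 "\<bar>t\<bar> / \<kappa> + 1"] f0 r by simp
  finally show ?thesis using r by blast
qed

text \<open>If \<open>f\<close> exceeds \<open>s\<close> at \<open>r\<close>, the growth condition
  makes it exceed \<open>t\<close> at \<open>r + (t - s) / \<kappa>\<close>; so the crossing of
  \<open>t\<close> comes at most \<open>(t - s) / \<kappa>\<close> after that of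
  \<open>s\<close>.\<close>

lemma inverse_clock_regular:
  fixes f :: "real \<Rightarrow> real"
  assumes \<kappa>: "0 < \<kappa>" and f0: "f 0 = 0" and growth: "\<And>s t. 0 \<le> s \<Longrightarrow> s \<le> t \<Longrightarrow> \<kappa> * (t - s) \<le> f t - f s"
  shows "regular_clock \<kappa> (\<lambda>t. Inf {r. 0 < r \<and> f r > t})"
proof -
  let ?A = "\<lambda>t. {r. 0 < r \<and> f r > t}"
  have ge: "\<kappa> * r \<le> f r" if "0 \<le> r" for r using growth[of 0 r] f0 that by simp
  have bdd: "bdd_below (?A t)" for t by (rule bdd_belowI[of _ 0]) auto
  have ne: "?A t \<noteq> {}" for t by (rule linear_growth_exceeds[OF \<kappa> f0 growth])
  show ?thesis
    unfolding regular_clock_def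
  proof (intro conjI allI impI)
    fix t :: real assume t: "t \<le> 0"
    have "?A t = {0<..}"
    proof (intro set_eqI iffI)
      fix r :: real assume "r \<in> {0<..}"
      then have r: "0 < r" by simp
      then have "0 < \<kappa> * r" using \<kappa> by simp
      then show "r \<in> ?A t" using ge[of r] r t by simp
    qed auto
    then show "Inf (?A t) = 0" by simp
  next
    fix s t :: real assume st: "s \<le> t"
    show "Inf (?A s) \<le> Inf (?A t)" by (rule cInf_superset_mono[OF ne bdd]) (use st in auto)
    have "Inf (?A t) - (t - s) / \<kappa> \<le> Inf (?A s)"
    proof (rule cInf_greatest[OF ne])
      fix r assume r: "r \<in> ?A s"
      have "\<kappa> * ((t - s) / \<kappa>) \<le> f (r + (t - s) / \<kappa>) - f r"
        using growth[of r "r + (t - s) / \<kappa>"] r st \<kappa> by simp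
      then have "t < f (r + (t - s) / \<kappa>)" using r \<kappa> by simp
      then have "r + (t - s) / \<kappa> \<in> ?A t" using r st \<kappa> by (simp add: add_pos_nonneg)
      then have "Inf (?A t) \<le> r + (t - s) / \<kappa>" by (rule cInf_lower[OF _ bdd])
      then show "Inf (?A t) - (t - s) / \<kappa> \<le> r" by simp
    qed
    then show "Inf (?A t) - Inf (?A s) \<le> (t - s) / \<kappa>" by simp
  qed
qed

lemma sets_AE_cong:
  assumes cm: "complete_measure M" and sub: "subalgebra M N" "null_sets M \<subseteq> sets N"
    and A: "A \<in> sets N" and ae: "AE x in M. x \<in> A \<longleftrightarrow> x \<in> A'" and A': "A' \<subseteq> space M"
  shows "A' \<in> sets N"
proof -
  have "(indicator A' :: _ \<Rightarrow> real) \<in> borel_measurable N"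
    by (rule measurable_AE_cong[OF cm sub, of "indicator A"])
      (use A ae in \<open>auto elim!: eventually_mono simp: indicator_def\<close>)
  then have "A' \<inter> space N \<in> sets N" by (rule borel_measurable_indicator_iff[THEN iffD1])
  moreover have "A' \<inter> space N = A'" using A' sub(1) by (auto simp: subalgebra_def)
  ultimately show ?thesis by simp
qed

text \<open>Rounding goes up and not down: when the rounded clock equals a grid time, the clock
  itself is at most that time, so the rounded clock is still a stopping time.\<close>

definition dyadic_ceil :: "nat \<Rightarrow> real \<Rightarrow> nat" where
  "dyadic_ceil n x = nat \<lceil>2 ^ n * x\<rceil>"

lemma dyadic_ceil_ge: "x \<le> real (dyadic_ceil n x) / 2 ^ n"
proof -
  have "2 ^ n * x \<le> real (dyadic_ceil n x)" unfolding dyadic_ceil_def by linarith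
  then show ?thesis by (simp add: field_simps)
qed

lemma dyadic_ceil_le:
  assumes "0 \<le> x" shows "real (dyadic_ceil n x) / 2 ^ n \<le> x + (1 / 2) ^ n"
proof -
  have "0 \<le> 2 ^ n * x" using assms by simp
  then have "real (dyadic_ceil n x) \<le> 2 ^ n * x + 1" unfolding dyadic_ceil_def by linarith
  then have "real (dyadic_ceil n x) / 2 ^ n \<le> (2 ^ n * x + 1) / 2 ^ n" by (rule divide_right_mono) simp
  also have "\<dots> = x + (1 / 2) ^ n" by (simp add: add_divide_distrib power_divide)
  finally show ?thesis .
qed

lemma dyadic_ceil_mono: "x \<le> y \<Longrightarrow> dyadic_ceil n x \<le> dyadic_ceil n y"
  unfolding dyadic_ceil_def by (intro nat_mono ceiling_mono mult_left_mono) auto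

lemma dyadic_ceil_tendsto:
  assumes "0 \<le> x" shows "(\<lambda>n. real (dyadic_ceil n x) / 2 ^ n) \<longlonglongrightarrow> x"
proof (rule tendsto_sandwich[of "\<lambda>_. x"])
  have "(\<lambda>n. x + (1 / 2) ^ n) \<longlonglongrightarrow> x + 0" by (intro tendsto_intros LIMSEQ_power_zero) auto
  then show "(\<lambda>n. x + (1 / 2) ^ n) \<longlonglongrightarrow> x" by simp
qed (use dyadic_ceil_ge dyadic_ceil_le[OF assms] in auto)

lemma dyadic_ceil_measurable [measurable]: "dyadic_ceil n \<in> borel \<rightarrow>\<^sub>M count_space UNIV"
  unfolding dyadic_ceil_def[abs_def] by measurable

locale subordinated_brownian_motion = prob_space M for M :: "'a measure" +
  fixes B :: "('a, real ^ 'd) process" and S :: "('a, real) process" and \<kappa> :: real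
  assumes complete: "complete_measure M" and bm: "standard_brownian_motion M B" and \<kappa>_pos: "0 < \<kappa>"
    and S_meas: "0 \<le> t \<Longrightarrow> S t \<in> borel_measurable M"
    and S_growth: "AE w in M. S 0 w = 0 \<and> (\<forall>s t. 0 \<le> s \<longrightarrow> s \<le> t \<longrightarrow> \<kappa> * (t - s) \<le> S t w - S s w)"
    and indep: "indep_set (process_events M B {0..}) (process_events M S {0..})"
begin

abbreviation "L \<equiv> inverse_subordinator S"
abbreviation "Z \<equiv> subdiffusion B L"

lemma B_measurable: "0 \<le> t \<Longrightarrow> B t \<in> borel_measurable M"
  and B_zero: "AE w in M. B 0 w = 0"
  and B_increment: "0 \<le> s \<Longrightarrow> s < t \<Longrightarrow> distributed M lborel (\<lambda>w. B t w - B s w)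
          (\<lambda>x. ennreal (\<Prod>i\<in>UNIV. normal_density 0 (sqrt (t - s)) (x $ i)))"
  and B_indep: "independent_increments M B"
  and B_cont: "AE w in M. continuous_on {0..} (\<lambda>t. B t w)"
  using bm by (auto simp: standard_brownian_motion_def)

lemma clock_regular: "AE w in M. regular_clock \<kappa> (\<lambda>t. L t w)"
  using S_growth
proof eventually_elim
  case (elim w)
  then show ?case
    unfolding inverse_subordinator_def by (intro inverse_clock_regular[OF \<kappa>_pos]) auto
qed

section \<open>The history of \<open>B\<close> enlarged by the path of \<open>S\<close>\<close>

definition snapshot :: "nat \<Rightarrow> real \<Rightarrow> 'a \<Rightarrow> nat \<Rightarrow> real ^ 'd" where
  "snapshot m l w = (\<lambda>j\<in>{..2 ^ m}. B (l * real j / 2 ^ m) w)"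

text \<open>Events decided by \<open>B\<close> on a finite dyadic grid of \<open>{0..l}\<close>.
  Finite grids match the finite families in \<open>independent_increments\<close>, and since they
  are nested in \<open>m\<close>, the union over \<open>m\<close> is closed under
  intersection.\<close>

definition past :: "nat \<Rightarrow> real \<Rightarrow> 'a set set" where
  "past m l = {snapshot m l -` E \<inter> space M | E. E \<in> sets (Pi\<^sub>M {..2 ^ m} (\<lambda>_. borel))}"

lemma process_events_sets: "sets (sigma (space M) (process_events M X I)) = process_events M X I"
proof -
  let ?G = "{X t -` A \<inter> space M | t A. t \<in> I \<and> A \<in> sets borel}"
  have G: "?G \<subseteq> Pow (space M)" by blast
  have 1: "sigma_sets (space M) ?G \<subseteq> Pow (space M)"
    by (rule subsetI, rule PowI, rule sigma_sets_into_sp[OF G])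
  show ?thesis
    unfolding process_events_def sets_measure_of[OF 1] by (rule sigma_sets_sigma_sets_eq[OF G])
qed

lemma B_process_events: "0 \<le> t \<Longrightarrow> B t \<in> borel_measurable (sigma (space M) (process_events M B {0..}))"
proof (rule measurableI)
  fix A :: "(real ^ 'd) set" assume "0 \<le> t" "A \<in> sets borel"
  then have "B t -` A \<inter> space M \<in> process_events M B {0..}"
    unfolding process_events_def by (intro sigma_sets.Basic) blast
  then show "B t -` A \<inter> space (sigma (space M) (process_events M B {0..})) \<in> sets (sigma (space M) (process_events M B {0..}))"
    by (simp only: process_events_sets space_measure_of_conv)
qed simp

lemma snapshot_measurable:
  assumes "\<And>j. j \<le> 2 ^ m \<Longrightarrow> B (l * real j / 2 ^ m) \<in> borel_measurable N"
  shows "snapshot m l \<in> N \<rightarrow>\<^sub>M Pi\<^sub>M {..2 ^ m} (\<lambda>_. borel)"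
  unfolding snapshot_def by (rule measurable_restrict) (use assms in auto)

lemma past_process_events:
  assumes "0 \<le> l" "D \<in> past m l" shows "D \<in> process_events M B {0..}"
proof -
  have "snapshot m l \<in> sigma (space M) (process_events M B {0..}) \<rightarrow>\<^sub>M Pi\<^sub>M {..2 ^ m} (\<lambda>_. borel)"
    using assms(1) by (intro snapshot_measurable B_process_events) auto
  from measurable_sets[OF this] assms(2) show ?thesis
    unfolding past_def by (auto simp: process_events_sets space_measure_of_conv)
qed

lemma process_events_events:
  assumes "\<And>t. t \<in> I \<Longrightarrow> X t \<in> borel_measurable M" shows "process_events M X I \<subseteq> events"
  unfolding process_events_def by (rule sets.sigma_sets_subset) (use assms in auto)

lemma past_events: "0 \<le> l \<Longrightarrow> past m l \<subseteq> events"
  using past_process_events process_events_events[of "{0..}" B] B_measurable by auto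

text \<open>Point \<open>j\<close> of one grid is point \<open>2 * j\<close> of the next.\<close>

lemma past_Suc: "past m l \<subseteq> past (Suc m) l"
proof
  fix D assume "D \<in> past m l"
  then obtain E where E: "E \<in> sets (Pi\<^sub>M {..2 ^ m} (\<lambda>_. borel))" "D = snapshot m l -` E \<inter> space M"
    by (auto simp: past_def)
  let ?h = "\<lambda>x :: nat \<Rightarrow> real ^ 'd. \<lambda>j\<in>{..(2::nat) ^ m}. x (2 * j)"
  have h: "?h \<in> Pi\<^sub>M {..2 ^ Suc m} (\<lambda>_. borel) \<rightarrow>\<^sub>M Pi\<^sub>M {..2 ^ m} (\<lambda>_. borel)"
    by (rule measurable_restrict, rule measurable_component_singleton) auto
  have "snapshot m l w = ?h (snapshot (Suc m) l w)" for w
    by (auto simp: snapshot_def fun_eq_iff restrict_def)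
  then have "D = snapshot (Suc m) l -` (?h -` E \<inter> space (Pi\<^sub>M {..2 ^ Suc m} (\<lambda>_. borel))) \<inter> space M"
    unfolding E(2) by (auto simp: snapshot_def space_PiM)
  then show "D \<in> past (Suc m) l"
    unfolding past_def using measurable_sets[OF h E(1)] by blast
qed

lemma past_mono: "m \<le> n \<Longrightarrow> past m l \<subseteq> past n l"
  by (rule lift_Suc_mono_le[where f = "\<lambda>m. past m l", OF past_Suc])

lemma past_Int: "D \<in> past m l \<Longrightarrow> D' \<in> past m l \<Longrightarrow> D \<inter> D' \<in> past m l"
proof -
  assume "D \<in> past m l" "D' \<in> past m l"
  then obtain E E' where E: "E \<in> sets (Pi\<^sub>M {..2 ^ m} (\<lambda>_. borel))" "D = snapshot m l -` E \<inter> space M"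
    "E' \<in> sets (Pi\<^sub>M {..2 ^ m} (\<lambda>_. borel))" "D' = snapshot m l -` E' \<inter> space M" by (auto simp: past_def)
  then have "D \<inter> D' = snapshot m l -` (E \<inter> E') \<inter> space M" by auto
  then show "D \<inter> D' \<in> past m l" unfolding past_def using sets.Int[OF E(1,3)] by blast
qed

lemma space_past: "space M \<in> past m l"
proof -
  have "space M = snapshot m l -` space (Pi\<^sub>M {..2 ^ m} (\<lambda>_. borel)) \<inter> space M"
    by (auto simp: snapshot_def space_PiM)
  then show ?thesis unfolding past_def using sets.top by blast
qed

lemma past_increment_indep:
  assumes ab: "0 \<le> a" "a \<le> b" and D: "D \<in> past m a" and E: "E \<in> sets borel"
  shows "prob (D \<inter> ((\<lambda>w. B b w - B a w) -` E \<inter> space M)) = prob D * prob ((\<lambda>w. B b w - B a w) -` E \<inter> space M)"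
proof -
  define N :: nat where "N = 2 ^ m"
  have N: "0 < N" by (simp add: N_def)
  \<comment> \<open>A nondecreasing sequence with \<open>N\<close> equal steps up to
    \<open>a\<close>, constantly \<open>b\<close> afterwards. Its increment with index
    \<open>N\<close> is \<open>B b - B a\<close>, and the earlier ones determine the
    snapshot.\<close>
  define p where "p i = (if i \<le> N then a * real i / N else b)" for i
  define X where "X i w = B (p (Suc i)) w - B (p i) w" for i :: nat and w
  have pN: "p N = a" "p (Suc N) = b" "p 0 = 0" using N by (auto simp: p_def)
  have "mono p"
  proof (rule monoI)
    fix i j :: nat assume ij: "i \<le> j"
    have le_a: "a * real i / N \<le> a" if "i \<le> N" for i
    proof -
      have "a * real i \<le> a * real N" using that ab by (intro mult_left_mono) auto
      then show ?thesis using N by (simp add: field_simps)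
    qed
    show "p i \<le> p j"
      using ij ab le_a[of i] by (auto simp: p_def intro!: divide_right_mono mult_left_mono)
  qed
  then have iv: "indep_vars (\<lambda>_. borel) X {..<Suc N}"
    using B_indep pN unfolding independent_increments_def X_def by auto
  have iv2: "indep_var (Pi\<^sub>M {..<N} (\<lambda>_. borel)) (\<lambda>w. \<lambda>i\<in>{..<N}. X i w) (Pi\<^sub>M {N} (\<lambda>_. borel)) (\<lambda>w. \<lambda>i\<in>{N}. X i w)"
    by (rule indep_var_restrict[OF iv]) auto
  \<comment> \<open>Partial sums recover the values of \<open>B\<close> from the increments where
    \<open>B 0\<close> vanishes; hence the detour through the almost surely equal event
    \<open>?D'\<close>.\<close>
  let ?h = "\<lambda>x :: nat \<Rightarrow> real ^ 'd. \<lambda>j\<in>{..N}. (\<Sum>i<j. x i)"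
  have h: "?h \<in> Pi\<^sub>M {..<N} (\<lambda>_. borel) \<rightarrow>\<^sub>M Pi\<^sub>M {..N} (\<lambda>_. borel)"
    by (rule measurable_restrict, rule borel_measurable_sum, rule measurable_component_singleton) auto
  have iv3: "indep_var (Pi\<^sub>M {..N} (\<lambda>_. borel)) (?h \<circ> (\<lambda>w. \<lambda>i\<in>{..<N}. X i w)) (Pi\<^sub>M {N} (\<lambda>_. borel)) (id \<circ> (\<lambda>w. \<lambda>i\<in>{N}. X i w))"
    by (rule indep_var_compose[OF iv2 h measurable_ident])
  obtain E1 where E1: "E1 \<in> sets (Pi\<^sub>M {..N} (\<lambda>_. borel))" "D = snapshot m a -` E1 \<inter> space M"
    using D by (auto simp: past_def N_def)
  let ?U = "?h \<circ> (\<lambda>w. \<lambda>i\<in>{..<N}. X i w)" and ?W = "id \<circ> (\<lambda>w. \<lambda>i\<in>{N}. X i w)" and ?E = "{x \<in> space (Pi\<^sub>M {N} (\<lambda>_. borel)). x N \<in> E}"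
  have g: "(\<lambda>x. x N) \<in> Pi\<^sub>M {N} (\<lambda>_. borel) \<rightarrow>\<^sub>M (borel :: (real ^ 'd) measure)"
    by (rule measurable_component_singleton) simp
  have E': "?E \<in> sets (Pi\<^sub>M {N} (\<lambda>_. borel))"
    using measurable_sets[OF g E] by (simp add: vimage_def Int_def conj_commute)
  have U: "?U w = snapshot m a w" if "B 0 w = 0" for w
  proof -
    have "(\<Sum>i<j. X i w) = B (a * real j / N) w" if "j \<le> N" for j
    proof -
      have "(\<Sum>i<j. X i w) = B (p j) w - B (p 0) w"
        unfolding X_def by (rule sum_lessThan_telescope)
      then show ?thesis using that \<open>B 0 w = 0\<close> by (simp add: pN p_def)
    qed
    then show ?thesis by (auto simp: snapshot_def fun_eq_iff restrict_def N_def)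
  qed
  have Um: "?U \<in> M \<rightarrow>\<^sub>M Pi\<^sub>M {..N} (\<lambda>_. borel)" and Wm: "?W \<in> M \<rightarrow>\<^sub>M Pi\<^sub>M {N} (\<lambda>_. borel)"
    using iv3 by (auto dest: indep_var_rv1 indep_var_rv2)
  let ?D' = "?U -` E1 \<inter> space M" and ?Y = "(\<lambda>w. B b w - B a w) -` E \<inter> space M"
  have Y: "?W -` ?E \<inter> space M = ?Y" by (auto simp: X_def pN space_PiM)
  have D': "?D' \<in> events" and Ye: "?Y \<in> events" using measurable_sets[OF Um E1(1)] measurable_sets[OF Wm E'] Y by auto
  have De: "D \<in> events" using past_events[OF ab(1)] D by blast
  have ae: "AE w in M. w \<in> D \<longleftrightarrow> w \<in> ?D'" using B_zero by eventually_elim (use U E1(2) in auto)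
  have "prob (D \<inter> ?Y) = prob (?D' \<inter> ?Y)"
    by (rule finite_measure_eq_AE) (use ae De D' Ye in \<open>auto elim: eventually_mono\<close>)
  also have "?D' \<inter> ?Y = (\<lambda>x. (?U x, ?W x)) -` (E1 \<times> ?E) \<inter> space M" unfolding Y[symmetric] by auto
  also have "prob \<dots> = prob ?D' * prob ?Y"
    unfolding Y[symmetric] by (rule indep_varD[OF iv3 E1(1) E'])
  also have "prob ?D' = prob D"
    by (rule finite_measure_eq_AE) (use ae De D' in \<open>auto elim: eventually_mono\<close>)
  finally show ?thesis .
qed

text \<open>The whole path of \<open>S\<close> belongs to every history, which makes each \<open>L u\<close> a stopping time.\<close>

definition history_generator :: "real \<Rightarrow> 'a set set" where
  "history_generator l = {D \<inter> C | D C. (\<exists>m. D \<in> past m l) \<and> C \<in> process_events M S {0..}} \<union> null_sets M"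

definition history :: "real \<Rightarrow> 'a measure" where
  "history l = sigma (space M) (history_generator l)"

lemma S_events: "process_events M S {0..} \<subseteq> events"
  by (rule process_events_events) (auto intro: S_meas)

lemma history_generator_events: "0 \<le> l \<Longrightarrow> history_generator l \<subseteq> events"
  unfolding history_generator_def using past_events[of l] S_events by blast

lemma sets_history: "0 \<le> l \<Longrightarrow> sets (history l) = sigma_sets (space M) (history_generator l)"
  unfolding history_def by (rule sets_measure_of) (use history_generator_events[of l] sets.space_closed in blast)

lemma subalgebra_history: "0 \<le> l \<Longrightarrow> subalgebra M (history l)"
  unfolding subalgebra_def
  by (simp add: sets_history sets.sigma_sets_subset[OF history_generator_events]) (simp add: history_def space_measure_of_conv)

lemma null_history: "0 \<le> l \<Longrightarrow> null_sets M \<subseteq> sets (history l)"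
  unfolding sets_history history_generator_def by (auto intro: sigma_sets.Basic)

lemma history_Int_stable: assumes l: "0 \<le> l" shows "Int_stable (history_generator l)"
proof (rule Int_stableI)
  fix A A' assume A: "A \<in> history_generator l" and A': "A' \<in> history_generator l"
  have ev: "A \<in> events" "A' \<in> events" using history_generator_events[OF l] A A' by auto
  show "A \<inter> A' \<in> history_generator l"
  proof (cases "A \<in> null_sets M \<or> A' \<in> null_sets M")
    case True
    then have "A \<inter> A' \<in> null_sets M" using ev by (auto intro: null_set_Int1 null_set_Int2)
    then show ?thesis by (simp add: history_generator_def)
  next
    case False
    then obtain D C m D' C' m' where *: "A = D \<inter> C" "D \<in> past m l" "C \<in> process_events M S {0..}"
      "A' = D' \<inter> C'" "D' \<in> past m' l" "C' \<in> process_events M S {0..}"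
      using A A' by (auto simp: history_generator_def)
    have "D \<in> past (max m m') l" "D' \<in> past (max m m') l"
      using *(2,5) past_mono[of m "max m m'" l] past_mono[of m' "max m m'" l] by auto
    then have "D \<inter> D' \<in> past (max m m') l" by (rule past_Int)
    moreover have "C \<inter> C' \<in> process_events M S {0..}"
      using *(3,6) sets.Int[of C "sigma (space M) (process_events M S {0..})" C'] unfolding process_events_sets by blast
    moreover have "A \<inter> A' = (D \<inter> D') \<inter> (C \<inter> C')" using * by auto
    ultimately show ?thesis unfolding history_generator_def by blast
  qed
qed

text \<open>By Dynkin's theorem it is enough to treat generators \<open>D \<inter> C\<close> and an
  event \<open>V\<close> of the increment. \<open>D \<inter> V\<close> belongs to \<open>B\<close>
  and \<open>C\<close> to \<open>S\<close>, so \<open>C\<close> splits off; then \<open>D\<close>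
  and \<open>V\<close> are independent because the increments of \<open>B\<close> are.\<close>

lemma history_increment_indep:
  assumes ab: "0 \<le> a" "a \<le> b"
  shows "indep_set (sets (history a)) (sigma_sets (space M) {(\<lambda>w. B b w - B a w) -` E \<inter> space M | E. E \<in> sets borel})"
  unfolding sets_history[OF ab(1)]
proof (rule indep_set_sigma_sets[OF indep_setI])
  let ?Y = "\<lambda>E. (\<lambda>w. B b w - B a w) -` E \<inter> space M"
  have Ym: "(\<lambda>w. B b w - B a w) \<in> borel_measurable (sigma (space M) (process_events M B {0..}))"
    using ab by (intro borel_measurable_diff B_process_events) auto
  have YB: "?Y E \<in> process_events M B {0..}" if "E \<in> sets borel" for E
    using measurable_sets[OF Ym that] by (simp add: process_events_sets space_measure_of_conv)
  have Be: "process_events M B {0..} \<subseteq> events" by (rule process_events_events) (auto intro: B_measurable)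
  show "history_generator a \<subseteq> events" by (rule history_generator_events[OF ab(1)])
  show "{?Y E | E. E \<in> sets borel} \<subseteq> events" using YB Be by auto
  show "Int_stable (history_generator a)" by (rule history_Int_stable[OF ab(1)])
  show "Int_stable {?Y E | E. E \<in> sets borel}"
  proof (rule Int_stableI)
    fix U V assume "U \<in> {?Y E | E. E \<in> sets borel}" "V \<in> {?Y E | E. E \<in> sets borel}"
    then obtain E E' where "U = ?Y E" "V = ?Y E'" "E \<in> sets borel" "E' \<in> sets borel" by auto
    then show "U \<inter> V \<in> {?Y E | E. E \<in> sets borel}" by (auto intro!: exI[of _ "E \<inter> E'"])
  qed
  fix G V assume G: "G \<in> history_generator a" and "V \<in> {?Y E | E. E \<in> sets borel}"
  then obtain E where E: "V = ?Y E" "E \<in> sets borel" by auto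
  show "prob (G \<inter> V) = prob G * prob V"
  proof (cases "G \<in> null_sets M")
    case True
    then have "G \<inter> V \<in> null_sets M" using YB[OF E(2)] Be E(1) by (intro null_set_Int2) auto
    then show ?thesis using True by (simp add: measure_eq_0_null_sets)
  next
    case False
    then obtain D C m where *: "G = D \<inter> C" "D \<in> past m a" "C \<in> process_events M S {0..}"
      using G by (auto simp: history_generator_def)
    have DB: "D \<in> process_events M B {0..}" using past_process_events[OF ab(1) *(2)] .
    have DV: "D \<inter> V \<in> process_events M B {0..}"
      using sets.Int[of D "sigma (space M) (process_events M B {0..})" V] DB YB[OF E(2)] E(1) unfolding process_events_sets by blast
    have "prob (G \<inter> V) = prob ((D \<inter> V) \<inter> C)" unfolding *(1) by (simp add: Int_ac)
    also have "\<dots> = prob (D \<inter> V) * prob C" by (rule indep_setD[OF indep DV *(3)])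
    also have "prob (D \<inter> V) = prob D * prob V" unfolding E(1) by (rule past_increment_indep[OF ab *(2) E(2)])
    also have "prob D * prob V * prob C = prob (D \<inter> C) * prob V" using indep_setD[OF indep DB *(3)] by simp
    finally show ?thesis unfolding *(1) .
  qed
qed

lemma history_increment_integral:
  fixes f :: "real ^ 'd \<Rightarrow> real"
  assumes ab: "0 \<le> a" "a \<le> b" and G: "G \<in> sets (history a)" and f: "f \<in> borel_measurable borel"
    and fi: "integrable M (\<lambda>w. f (B b w - B a w))"
  shows "integrable M (\<lambda>w. indicator G w * f (B b w - B a w))"
    "(\<integral>w. indicator G w * f (B b w - B a w) \<partial>M) = prob G * (\<integral>w. f (B b w - B a w) \<partial>M)"
proof -
  let ?Y = "\<lambda>w. B b w - B a w"
  have GM: "G \<in> events" using G subalgebra_history[OF ab(1)] by (auto simp: subalgebra_def)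
  have "indep_var borel (indicator G :: _ \<Rightarrow> real) borel (\<lambda>w. f (?Y w))"
    unfolding indep_var_eq
  proof (intro conjI)
    show "indep_set (sigma_sets (space M) {(indicator G :: _ \<Rightarrow> real) -` A \<inter> space M |A. A \<in> sets borel})
      (sigma_sets (space M) {(\<lambda>w. f (?Y w)) -` A \<inter> space M |A. A \<in> sets borel})"
    proof (rule indep_setI)
      have 1: "sigma_sets (space M) {(indicator G :: _ \<Rightarrow> real) -` A \<inter> space M |A. A \<in> sets borel} \<subseteq> sets (history a)"
      proof -
        have "(indicator G :: _ \<Rightarrow> real) \<in> borel_measurable (history a)" using G by simp
        then have "{(indicator G :: _ \<Rightarrow> real) -` A \<inter> space M |A. A \<in> sets borel} \<subseteq> sets (history a)"
          using subalgebra_history[OF ab(1)] by (auto simp: subalgebra_def dest: measurable_sets)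
        moreover have "space (history a) = space M" using subalgebra_history[OF ab(1)] by (simp add: subalgebra_def)
        ultimately show ?thesis using sets.sigma_sets_subset[of _ "history a"] by simp
      qed
      have 2: "sigma_sets (space M) {(\<lambda>w. f (?Y w)) -` A \<inter> space M |A. A \<in> sets borel} \<subseteq>
         sigma_sets (space M) {?Y -` E \<inter> space M | E. E \<in> sets borel}"
      proof (rule sigma_sets_mono')
        show "{(\<lambda>w. f (?Y w)) -` A \<inter> space M |A. A \<in> sets borel} \<subseteq> {?Y -` E \<inter> space M | E. E \<in> sets borel}"
        proof
          fix V assume "V \<in> {(\<lambda>w. f (?Y w)) -` A \<inter> space M |A. A \<in> sets borel}"
          then obtain A where A: "A \<in> sets borel" "V = ?Y -` (f -` A) \<inter> space M" by auto
          have "f -` A \<in> sets borel" using measurable_sets[OF f A(1)] by simp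
          then show "V \<in> {?Y -` E \<inter> space M | E. E \<in> sets borel}" using A(2) by blast
        qed
      qed
      show "sigma_sets (space M) {(indicator G :: _ \<Rightarrow> real) -` A \<inter> space M |A. A \<in> sets borel} \<subseteq> events"
        using 1 subalgebra_history[OF ab(1)] by (auto simp: subalgebra_def)
      show "sigma_sets (space M) {(\<lambda>w. f (?Y w)) -` A \<inter> space M |A. A \<in> sets borel} \<subseteq> events"
        by (rule sets.sigma_sets_subset) (use fi in \<open>auto dest!: borel_measurable_integrable dest: measurable_sets\<close>)
      show "prob (U \<inter> V) = prob U * prob V"
        if "U \<in> sigma_sets (space M) {(indicator G :: _ \<Rightarrow> real) -` A \<inter> space M |A. A \<in> sets borel}"
          "V \<in> sigma_sets (space M) {(\<lambda>w. f (?Y w)) -` A \<inter> space M |A. A \<in> sets borel}" for U V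
        by (rule indep_setD[OF history_increment_indep[OF ab]]) (use that 1 2 in auto)
    qed
  qed (use GM fi in auto)
  then have iv: "indep_var borel (indicator G :: _ \<Rightarrow> real) borel (\<lambda>w. f (?Y w))" .
  have Gi: "integrable M (indicator G :: _ \<Rightarrow> real)" using GM by (simp add: emeasure_eq_measure)
  show "integrable M (\<lambda>w. indicator G w * f (?Y w))" by (rule indep_var_integrable[OF iv Gi fi])
  show "(\<integral>w. indicator G w * f (?Y w) \<partial>M) = prob G * (\<integral>w. f (?Y w) \<partial>M)"
    using indep_var_lebesgue_integral[OF iv Gi fi] GM by simp
qed

text \<open>The generators contain values of \<open>B\<close> at grid points only; other times
  follow from path continuity, since null sets belong to the history.\<close>

lemma B_history:
  assumes "0 \<le> s" "s \<le> l" shows "B s \<in> borel_measurable (history l)"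
proof -
  have l: "0 \<le> l" using assms by simp
  have sp: "space (history l) = space M" using subalgebra_history[OF l] by (simp add: subalgebra_def)
  have grid: "B (l * real j / 2 ^ m) \<in> borel_measurable (history l)" if "j \<le> 2 ^ m" for j m
  proof (rule measurableI)
    fix A :: "(real ^ 'd) set" assume A: "A \<in> sets borel"
    have "(\<lambda>x. x j) \<in> Pi\<^sub>M {..2 ^ m} (\<lambda>_. borel) \<rightarrow>\<^sub>M (borel :: (real ^ 'd) measure)"
      by (rule measurable_component_singleton) (use that in simp)
    from measurable_sets[OF this A]
    have "(\<lambda>x. x j) -` A \<inter> space (Pi\<^sub>M {..2 ^ m} (\<lambda>_. borel)) \<in> sets (Pi\<^sub>M {..2 ^ m} (\<lambda>_. borel))" .
    moreover have "B (l * real j / 2 ^ m) -` A \<inter> space M = snapshot m l -` ((\<lambda>x. x j) -` A \<inter> space (Pi\<^sub>M {..2 ^ m} (\<lambda>_. borel))) \<inter> space M"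
      using that by (auto simp: snapshot_def space_PiM)
    ultimately have "B (l * real j / 2 ^ m) -` A \<inter> space M \<in> past m l" unfolding past_def by blast
    moreover have "space M \<in> process_events M S {0..}" unfolding process_events_def by (rule sigma_sets_top)
    moreover have "B (l * real j / 2 ^ m) -` A \<inter> space M = (B (l * real j / 2 ^ m) -` A \<inter> space M) \<inter> space M" by auto
    ultimately have "B (l * real j / 2 ^ m) -` A \<inter> space M \<in> history_generator l" unfolding history_generator_def by blast
    then show "B (l * real j / 2 ^ m) -` A \<inter> space (history l) \<in> sets (history l)"
      unfolding sp sets_history[OF l] by (rule sigma_sets.Basic)
  qed auto
  show ?thesis
  proof (cases "l = 0")
    case True
    then show ?thesis using grid[of 0 0] assms by simp
  next
    case False
    then obtain i where i: "\<And>k. i k \<le> (2::nat) ^ k" "(\<lambda>k. l * real (i k) / 2 ^ k) \<longlonglongrightarrow> s"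
      using grid_approx[of l s] assms l by auto
    show ?thesis
    proof (rule measurable_AE_LIMSEQ[OF complete subalgebra_history[OF l] null_history[OF l] grid[OF i(1)]])
      show "AE w in M. (\<lambda>k. B (l * real (i k) / 2 ^ k) w) \<longlonglongrightarrow> B s w"
        using B_cont
      proof eventually_elim
        case (elim w)
        show ?case by (rule continuous_on_tendsto_compose[OF elim i(2)]) (use assms l in auto)
      qed
    qed
  qed
qed

lemma L_history: assumes l: "0 \<le> l" shows "L t \<in> borel_measurable (history l)"
proof (rule borel_measurableI_less)
  fix a :: real
  have sp: "space (history l) = space M" using subalgebra_history[OF l] by (simp add: subalgebra_def)
  \<comment> \<open>\<open>L t w < a\<close> means that \<open>S\<close> exceeds \<open>t\<close>
    somewhere before \<open>a\<close>, and by monotonicity at a rational time. This event involves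
    \<open>S\<close> alone and so lies in every history.\<close>
  let ?A = "\<Union>q\<in>\<rat> \<inter> {0<..<a}. {w \<in> space M. S q w > t}"
  have "{w \<in> space M. S q w > t} \<in> sets (history l)" if "q \<in> {0<..<a}" for q
  proof -
    have "{w \<in> space M. S q w > t} = S q -` {t<..} \<inter> space M" by auto
    then have "{w \<in> space M. S q w > t} \<in> process_events M S {0..}"
      unfolding process_events_def using that by (intro sigma_sets.Basic) (auto intro!: exI[of _ q] exI[of _ "{t<..}"])
    moreover have "{w \<in> space M. S q w > t} = space M \<inter> {w \<in> space M. S q w > t}" by auto
    ultimately have "{w \<in> space M. S q w > t} \<in> history_generator l"
      unfolding history_generator_def using space_past[of 0 l] by blast
    then show ?thesis unfolding sets_history[OF l] by (rule sigma_sets.Basic)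
  qed
  then have A: "?A \<in> sets (history l)" by (intro sets.countable_UN'') (auto simp: countable_rat)
  show "{w \<in> space (history l). L t w < a} \<in> sets (history l)"
    unfolding sp
  proof (rule sets_AE_cong[OF complete subalgebra_history[OF l] null_history[OF l] A])
    show "AE w in M. w \<in> ?A \<longleftrightarrow> w \<in> {w \<in> space M. L t w < a}"
      using S_growth AE_space
    proof eventually_elim
      case (elim w)
      let ?R = "{r. 0 < r \<and> S r w > t}"
      have bdd: "bdd_below ?R" by (rule bdd_belowI[of _ 0]) auto
      have mono: "S r w \<le> S r' w" if "0 \<le> r" "r \<le> r'" for r r'
      proof -
        have "0 \<le> \<kappa> * (r' - r)" using that \<kappa>_pos by simp
        also have "\<dots> \<le> S r' w - S r w" using elim that by blast
        finally show ?thesis by simp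
      qed
      have ne: "?R \<noteq> {}" by (rule linear_growth_exceeds[OF \<kappa>_pos]) (use elim in auto)
      have "(\<exists>q\<in>\<rat> \<inter> {0<..<a}. S q w > t) \<longleftrightarrow> (\<exists>r\<in>?R. r < a)"
      proof
        assume "\<exists>r\<in>?R. r < a"
        then obtain r where r: "0 < r" "S r w > t" "r < a" by auto
        obtain q where q: "q \<in> \<rat>" "r < q" "q < a" using Rats_dense_in_real[OF r(3)] by auto
        have "S q w > t" using mono[of r q] r q by auto
        then show "\<exists>q\<in>\<rat> \<inter> {0<..<a}. S q w > t" using q r by (intro bexI[of _ q]) auto
      qed auto
      also have "\<dots> \<longleftrightarrow> Inf ?R < a" using cInf_less_iff[OF ne bdd] by blast
      finally show ?case using elim by (auto simp: inverse_subordinator_def)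
    qed
  qed auto
qed

end

section \<open>Events prior to the clock\<close>

context subordinated_brownian_motion
begin

lemma history_space: "0 \<le> l \<Longrightarrow> space (history l) = space M"
  using subalgebra_history[of l] by (simp add: subalgebra_def)

lemma L_measurable: "L t \<in> borel_measurable M"
  by (rule measurable_subalgebra[OF subalgebra_history L_history]) auto

abbreviation (input) "L_le u l \<equiv> {w \<in> space M. L u w \<le> l}"

text \<open>The sigma-algebra of events prior to a stopping time, here for \<open>L u\<close> and
  the filtration \<open>history\<close>.\<close>

definition stopped_events :: "real \<Rightarrow> 'a set set" where
  "stopped_events u = {A \<in> events. \<forall>l\<ge>0. A \<inter> L_le u l \<in> sets (history l)}"

definition stopped :: "real \<Rightarrow> 'a measure" where
  "stopped u = sigma (space M) (stopped_events u)"

lemma L_le_history: "0 \<le> l \<Longrightarrow> L_le u l \<in> sets (history l)"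
  using borel_measurable_le[OF L_history[of l u] borel_measurable_const[of l]] by (simp add: history_space)

lemma sets_stopped: "sets (stopped u) = stopped_events u"
proof -
  have "sigma_algebra (space M) (stopped_events u)"
    unfolding sigma_algebra_iff2
  proof (intro conjI ballI allI impI)
    show "stopped_events u \<subseteq> Pow (space M)" by (auto simp: stopped_events_def dest: sets.sets_into_space)
    show "{} \<in> stopped_events u" by (simp add: stopped_events_def)
    fix A assume A: "A \<in> stopped_events u"
    show "space M - A \<in> stopped_events u"
      unfolding stopped_events_def
    proof (intro CollectI conjI allI impI)
      fix l :: real assume l: "0 \<le> l"
      have "(space M - A) \<inter> L_le u l = L_le u l - A \<inter> L_le u l" by auto
      then show "(space M - A) \<inter> L_le u l \<in> sets (history l)"
        using A l L_le_history[OF l, of u] by (auto simp: stopped_events_def)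
    qed (use A in \<open>auto simp: stopped_events_def\<close>)
  next
    fix A :: "nat \<Rightarrow> 'a set" assume A: "range A \<subseteq> stopped_events u"
    show "(\<Union>i. A i) \<in> stopped_events u"
      unfolding stopped_events_def
    proof (intro CollectI conjI allI impI)
      fix l :: real assume l: "0 \<le> l"
      have "(\<Union>i. A i) \<inter> L_le u l = (\<Union>i. A i \<inter> L_le u l)" by auto
      moreover have "A i \<inter> L_le u l \<in> sets (history l)" for i
        using A l unfolding stopped_events_def by blast
      ultimately show "(\<Union>i. A i) \<inter> L_le u l \<in> sets (history l)"
        by (simp only: sets.countable_UN'' countableI_type)
    qed (use A in \<open>auto simp: stopped_events_def\<close>)
  qed
  then show ?thesis unfolding stopped_def by (rule sigma_algebra.sets_measure_of_eq)
qed

lemma space_stopped [simp]: "space (stopped u) = space M"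
  by (simp add: stopped_def space_measure_of_conv)

lemma subalgebra_stopped: "subalgebra M (stopped u)"
  unfolding subalgebra_def sets_stopped by (auto simp: stopped_events_def)

lemma null_stopped: "null_sets M \<subseteq> sets (stopped u)"
proof
  fix A assume A: "A \<in> null_sets M"
  have "A \<inter> L_le u l \<in> sets (history l)" if "0 \<le> l" for l
    using A null_history[OF that] L_le_history[OF that, of u] by auto
  then show "A \<in> sets (stopped u)" using A unfolding sets_stopped stopped_events_def by auto
qed

text \<open>This includes \<open>r > u\<close>: every history contains the whole path of
  \<open>S\<close> and therefore the whole clock.\<close>

lemma L_stopped: "L r \<in> borel_measurable (stopped u)"
proof (rule measurableI)
  fix A :: "real set" assume A: "A \<in> sets borel"
  have "L r -` A \<inter> space M \<inter> L_le u l \<in> sets (history l)" if l: "0 \<le> l" for l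
    using measurable_sets[OF L_history[OF l, of r] A] L_le_history[OF l, of u] by (simp add: history_space[OF l])
  then show "L r -` A \<inter> space (stopped u) \<in> sets (stopped u)"
    using measurable_sets[OF L_measurable A] by (simp add: sets_stopped stopped_events_def)
qed simp

lemma clock_facts: "AE w in M. (\<forall>t. 0 \<le> L t w) \<and> (\<forall>s t. s \<le> t \<longrightarrow> L s w \<le> L t w) \<and> (\<forall>s t. s \<le> t \<longrightarrow> L t w - L s w \<le> (t - s) / \<kappa>) \<and> (\<forall>t\<le>0. L t w = 0)"
  using clock_regular
proof eventually_elim
  case (elim w)
  have "0 \<le> L t w" for t
  proof (cases "0 \<le> t")
    case True
    then have "L 0 w \<le> L t w" "L 0 w = 0" using elim unfolding regular_clock_def by blast+
    then show ?thesis by simp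
  qed (use elim in \<open>auto simp: regular_clock_def\<close>)
  then show ?case using elim by (auto simp: regular_clock_def)
qed

text \<open>With the clock rounded to dyadic values and capped at \<open>l\<close>, the expression
  is a countable selection among \<open>B s\<close> with \<open>s \<le> l\<close>; continuity
  removes the rounding. The \<open>max 0\<close> guards against negative values of \<open>L\<close>
  on a null event.\<close>

lemma Z_min_history:
  assumes l: "0 \<le> l" shows "(\<lambda>w. B (min (max 0 (L r w)) l) w) \<in> borel_measurable (history l)"
proof (rule measurable_AE_LIMSEQ[OF complete subalgebra_history[OF l] null_history[OF l]])
  let ?f = "\<lambda>n w. B (min (real (dyadic_ceil n (L r w)) / 2 ^ n) l) w"
  show "?f n \<in> borel_measurable (history l)" for n
  proof (rule measurable_compose_countable[where f = "\<lambda>i. B (min (real i / 2 ^ n) l)" and g = "\<lambda>w. dyadic_ceil n (L r w)"])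
    show "B (min (real i / 2 ^ n) l) \<in> borel_measurable (history l)" for i by (rule B_history) (use l in auto)
    show "(\<lambda>w. dyadic_ceil n (L r w)) \<in> history l \<rightarrow>\<^sub>M count_space UNIV"
      by (rule measurable_compose[OF L_history[OF l] dyadic_ceil_measurable])
  qed
  show "AE w in M. (\<lambda>n. ?f n w) \<longlonglongrightarrow> B (min (max 0 (L r w)) l) w"
    using B_cont clock_facts
  proof eventually_elim
    case (elim w)
    have L0: "0 \<le> L r w" using elim by blast
    have "(\<lambda>n. min (real (dyadic_ceil n (L r w)) / 2 ^ n) l) \<longlonglongrightarrow> min (L r w) l"
      by (intro tendsto_min dyadic_ceil_tendsto[OF L0] tendsto_const)
    then show ?case
      using L0 l by (intro continuous_on_tendsto_compose[OF elim(1)]) auto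
  qed
qed

lemma Z_measurable: "Z r \<in> borel_measurable M"
proof (rule measurable_AE_LIMSEQ[OF complete subalgebra_refl])
  show "(\<lambda>w. B (min (max 0 (L r w)) (real n)) w) \<in> borel_measurable M" for n
    by (rule measurable_subalgebra[OF subalgebra_history Z_min_history]) auto
  show "AE w in M. (\<lambda>n. B (min (max 0 (L r w)) (real n)) w) \<longlonglongrightarrow> Z r w"
    using clock_facts
  proof eventually_elim
    case (elim w)
    have "eventually (\<lambda>n. L r w \<le> real n) sequentially" using eventually_nat_real[of "\<lambda>x. L r w \<le> x"] by (simp add: eventually_ge_at_top)
    then have "eventually (\<lambda>n. B (min (max 0 (L r w)) (real n)) w = Z r w) sequentially"
      by eventually_elim (use elim in \<open>auto simp: subdiffusion_def min_absorb1 max_absorb2\<close>)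
    then show ?case by (rule tendsto_eventually)
  qed
qed auto

text \<open>Where \<open>L u \<le> l\<close>, the capped clock of \<open>Z_min_history\<close>
  equals \<open>L r\<close>, so there \<open>Z r\<close> is decided by the history up to
  \<open>l\<close>.\<close>

lemma Z_stopped:
  assumes ru: "r \<le> u" shows "Z r \<in> borel_measurable (stopped u)"
proof (rule measurableI)
  fix A :: "(real ^ 'd) set" assume A: "A \<in> sets borel"
  have "Z r -` A \<inter> space M \<inter> L_le u l \<in> sets (history l)" if l: "0 \<le> l" for l
  proof (rule sets_AE_cong[OF complete subalgebra_history[OF l] null_history[OF l]])
    let ?A = "(\<lambda>w. B (min (max 0 (L r w)) l) w) -` A \<inter> space M \<inter> L_le u l"
    show "?A \<in> sets (history l)"
      using measurable_sets[OF Z_min_history[OF l, of r] A] L_le_history[OF l, of u] by (simp add: history_space[OF l])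
    show "AE w in M. w \<in> ?A \<longleftrightarrow> w \<in> Z r -` A \<inter> space M \<inter> L_le u l"
      using clock_facts
    proof eventually_elim
      case (elim w)
      have 0: "0 \<le> L r w" "L r w \<le> L u w" using elim ru by blast+
      have "min (max 0 (L r w)) l = L r w" if "L u w \<le> l" using 0 that by auto
      then show ?case by (auto simp: subdiffusion_def)
    qed
  qed auto
  then show "Z r -` A \<inter> space (stopped u) \<in> sets (stopped u)"
    using measurable_sets[OF Z_measurable A] by (simp add: sets_stopped stopped_events_def)
qed simp

definition dyadic_L :: "nat \<Rightarrow> real \<Rightarrow> 'a \<Rightarrow> real" where
  "dyadic_L n r w = real (dyadic_ceil n (L r w)) / 2 ^ n"

abbreviation (input) dyadic_increment :: "(real ^ 'd \<Rightarrow> real \<Rightarrow> real) \<Rightarrow> nat \<Rightarrow> real \<Rightarrow> real \<Rightarrow> 'a \<Rightarrow> real" where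
  "dyadic_increment \<phi> n s t w \<equiv> \<phi> (B (dyadic_L n t w) w - B (dyadic_L n s w) w) (dyadic_L n t w - dyadic_L n s w)"

text \<open>On \<open>{dyadic_L n s = i / 2^n}\<close> an event that is prior to \<open>L s\<close> lies in the history at \<open>i / 2^n\<close>, hence is
  independent of the later increments of \<open>B\<close>; finitely many pairs of grid times occur up to \<open>t\<close>.\<close>

lemma stopped_increment_nonpos:
  fixes \<phi> :: "real ^ 'd \<Rightarrow> real \<Rightarrow> real"
  assumes st: "s \<le> t" and A: "A \<in> sets (stopped s)"
    and \<phi>m: "\<And>v. (\<lambda>x. \<phi> x v) \<in> borel_measurable borel"
    and \<phi>i: "\<And>a b. 0 \<le> a \<Longrightarrow> a \<le> b \<Longrightarrow> integrable M (\<lambda>w. \<phi> (B b w - B a w) (b - a))"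
    and \<phi>0: "\<And>a b. 0 \<le> a \<Longrightarrow> a \<le> b \<Longrightarrow> (\<integral>w. \<phi> (B b w - B a w) (b - a) \<partial>M) \<le> 0"
  shows "integrable M (\<lambda>w. indicator A w * dyadic_increment \<phi> n s t w)" (is "integrable M ?X")
    and "(\<integral>w. indicator A w * dyadic_increment \<phi> n s t w \<partial>M) \<le> 0"
proof -
  \<comment> \<open>\<open>L t\<close> is at most \<open>t / \<kappa>\<close>, or 0 for negative
    \<open>t\<close>, so \<open>R\<close> bounds every grid index that occurs and the sums below are
    finite.\<close>
  define R where "R = dyadic_ceil n (t / \<kappa>)"
  define g where "g i = real i / 2 ^ n" for i :: nat
  define G where "G i j = A \<inter> {w \<in> space M. dyadic_ceil n (L s w) = i \<and> dyadic_ceil n (L t w) = j}" for i j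
  have g: "0 \<le> g i" "i \<le> j \<Longrightarrow> g i \<le> g j" for i j by (auto simp: g_def divide_right_mono)
  have G: "G i j \<in> sets (history (g i))" for i j
  proof -
    have m: "(\<lambda>w. dyadic_ceil n (L r w)) \<in> history (g i) \<rightarrow>\<^sub>M count_space UNIV" for r
      by (rule measurable_compose[OF L_history[OF g(1)] dyadic_ceil_measurable])
    have eq: "{w \<in> space M. dyadic_ceil n (L r w) = k} \<in> sets (history (g i))" for r k
      using measurable_sets[OF m, of "{k}" r] by (simp add: history_space[OF g(1)] vimage_def Int_def conj_commute)
    \<comment> \<open>Here rounding up is used: index \<open>i\<close> certifies
      \<open>L s \<le> g i\<close>, which places this part of \<open>A\<close> in the history at
      \<open>g i\<close>.\<close>
    have "L s w \<le> g i" if "dyadic_ceil n (L s w) = i" for w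
      using dyadic_ceil_ge[of "L s w" n] that by (simp add: g_def)
    then have "G i j = (A \<inter> L_le s (g i)) \<inter> ({w \<in> space M. dyadic_ceil n (L s w) = i} \<inter> {w \<in> space M. dyadic_ceil n (L t w) = j})"
      by (auto simp: G_def)
    moreover have "A \<inter> L_le s (g i) \<in> sets (history (g i))"
      using A g(1) by (simp add: sets_stopped stopped_events_def)
    ultimately show ?thesis using eq by auto
  qed
  \<comment> \<open>At most one indicator is nonzero for a given \<open>w\<close>, almost surely
    with \<open>i \<le> j\<close> because the clock is nondecreasing.\<close>
  let ?Y = "\<lambda>w. \<Sum>i\<le>R. \<Sum>j\<in>{i..R}. indicator (G i j) w * \<phi> (B (g j) w - B (g i) w) (g j - g i)"
  have i: "integrable M (\<lambda>w. indicator (G i j) w * \<phi> (B (g j) w - B (g i) w) (g j - g i))"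
    and le: "(\<integral>w. indicator (G i j) w * \<phi> (B (g j) w - B (g i) w) (g j - g i) \<partial>M) \<le> 0" if "i \<le> j" for i j
    using history_increment_integral[OF g(1) g(2)[OF that] G \<phi>m \<phi>i[OF g(1) g(2)[OF that]]] \<phi>0[OF g(1) g(2)[OF that]]
    by (auto simp: mult_nonneg_nonpos)
  have Yi: "integrable M ?Y" using i by (intro Bochner_Integration.integrable_sum) auto
  have "(\<integral>w. ?Y w \<partial>M) = (\<Sum>i\<le>R. \<Sum>j\<in>{i..R}. \<integral>w. indicator (G i j) w * \<phi> (B (g j) w - B (g i) w) (g j - g i) \<partial>M)"
  proof -
    have "(\<integral>w. (\<Sum>j\<in>{i..R}. indicator (G i j) w * \<phi> (B (g j) w - B (g i) w) (g j - g i)) \<partial>M) =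
      (\<Sum>j\<in>{i..R}. \<integral>w. indicator (G i j) w * \<phi> (B (g j) w - B (g i) w) (g j - g i) \<partial>M)" for i
      by (rule Bochner_Integration.integral_sum) (use i in simp)
    moreover have "(\<integral>w. ?Y w \<partial>M) = (\<Sum>i\<le>R. \<integral>w. (\<Sum>j\<in>{i..R}. indicator (G i j) w * \<phi> (B (g j) w - B (g i) w) (g j - g i)) \<partial>M)"
      by (rule Bochner_Integration.integral_sum, rule Bochner_Integration.integrable_sum) (use i in simp)
    ultimately show ?thesis by simp
  qed
  also have "\<dots> \<le> 0" using le by (intro sum_nonpos) auto
  finally have Y0: "(\<integral>w. ?Y w \<partial>M) \<le> 0" .
  have ae: "AE w in M. ?Y w = ?X w"
    using clock_facts AE_space
  proof eventually_elim
    case (elim w)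
    let ?i = "dyadic_ceil n (L s w)" and ?j = "dyadic_ceil n (L t w)"
    have ij: "?i \<le> ?j" using elim st by (intro dyadic_ceil_mono) blast
    have "L t w \<le> t / \<kappa> \<or> L t w = 0"
    proof (cases "0 \<le> t")
      case True
      then have "L t w - L 0 w \<le> (t - 0) / \<kappa>" "L 0 w = 0" using elim by blast+
      then show ?thesis by simp
    qed (use elim in auto)
    then have jR: "?j \<le> R"
    proof
      assume "L t w \<le> t / \<kappa>" then show ?thesis unfolding R_def by (rule dyadic_ceil_mono)
    qed (simp add: dyadic_ceil_def)
    have ind: "indicator (G i j) w = (if i = ?i \<and> j = ?j then indicator A w else (0::real))" for i j
      using elim by (auto simp: G_def indicator_def)
    have "?Y w = (\<Sum>i\<le>R. if i = ?i then \<Sum>j\<in>{?i..R}. (if j = ?j then ?X w else 0) else 0)"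
    proof (intro sum.cong refl)
      fix i assume "i \<in> {..R}"
      show "(\<Sum>j\<in>{i..R}. indicator (G i j) w * \<phi> (B (g j) w - B (g i) w) (g j - g i)) =
          (if i = ?i then \<Sum>j\<in>{?i..R}. (if j = ?j then ?X w else 0) else 0)"
      proof (cases "i = ?i")
        case True
        show ?thesis unfolding if_P[OF True] using True by (intro sum.cong) (auto simp: ind g_def dyadic_L_def)
      qed (simp add: ind)
    qed
    also have "\<dots> = ?X w" using ij jR by (simp add: sum.delta)
    finally show ?case .
  qed
  have Xm: "?X \<in> borel_measurable M"
    by (rule measurable_AE_cong[OF complete subalgebra_refl _ _ ae]) (use Yi in auto)
  show "integrable M ?X" by (rule integrable_cong_AE_imp[OF Yi Xm ae])
  have "(\<integral>w. ?X w \<partial>M) = (\<integral>w. ?Y w \<partial>M)"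
    by (rule integral_cong_AE) (use Yi Xm ae in \<open>auto elim: eventually_mono\<close>)
  then show "(\<integral>w. ?X w \<partial>M) \<le> 0" using Y0 by simp
qed

text \<open>The one-sided lemma is applied to \<open>\<phi>\<close> and to its negative. The
  inequality is the primary form because it also controls second moments, through compensated
  squares whose mean is only known to be nonpositive.\<close>

lemma stopped_increment_zero:
  fixes \<phi> :: "real ^ 'd \<Rightarrow> real \<Rightarrow> real"
  assumes st: "s \<le> t" and A: "A \<in> sets (stopped s)"
    and \<phi>m: "\<And>v. (\<lambda>x. \<phi> x v) \<in> borel_measurable borel"
    and \<phi>i: "\<And>a b. 0 \<le> a \<Longrightarrow> a \<le> b \<Longrightarrow> integrable M (\<lambda>w. \<phi> (B b w - B a w) (b - a))"
    and \<phi>0: "\<And>a b. 0 \<le> a \<Longrightarrow> a \<le> b \<Longrightarrow> (\<integral>w. \<phi> (B b w - B a w) (b - a) \<partial>M) = 0"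
  shows "(\<integral>w. indicator A w * dyadic_increment \<phi> n s t w \<partial>M) = 0"
proof (rule antisym)
  show "(\<integral>w. indicator A w * dyadic_increment \<phi> n s t w \<partial>M) \<le> 0"
    by (rule stopped_increment_nonpos(2)[OF st A \<phi>m \<phi>i]) (use \<phi>0 in auto)
  have "(\<integral>w. indicator A w * - dyadic_increment \<phi> n s t w \<partial>M) \<le> 0"
    by (rule stopped_increment_nonpos(2)[OF st A, of "\<lambda>x v. - \<phi> x v"]) (use \<phi>m \<phi>i \<phi>0 in auto)
  then show "0 \<le> (\<integral>w. indicator A w * dyadic_increment \<phi> n s t w \<partial>M)" by simp
qed

end

section \<open>Gaussian vectors\<close>

lemma prod_two_points:
  fixes u v :: "'c::comm_monoid_mult"
  assumes "i \<noteq> j"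
  shows "(\<Prod>k::'d::finite\<in>UNIV. if k = i then u else if k = j then v else 1) = u * v"
proof -
  have "(\<Prod>k\<in>UNIV. if k = i then u else if k = j then v else 1) =
      (\<Prod>k\<in>UNIV. (if k = i then u else 1) * (if k = j then v else 1))"
    using assms by (intro prod.cong) auto
  then show ?thesis by (simp add: prod.distrib)
qed

context prob_space
begin

context
  fixes Y :: "'a \<Rightarrow> real ^ 'd" and \<sigma> :: real
  assumes Y: "distributed M lborel Y (\<lambda>x. ennreal (\<Prod>i\<in>UNIV. normal_density 0 \<sigma> (x $ i)))" and \<sigma>: "0 < \<sigma>"
begin

text \<open>The product density splits the integral over the coordinates; \<open>idx\<close>
  translates between basis vectors, over which Lebesgue measure is a product, and coordinate
  indices.\<close>

lemma gaussian_vector_prod: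
  assumes g [measurable]: "\<And>k. g k \<in> borel_measurable borel"
  shows "(\<integral>\<^sup>+w. (\<Prod>k\<in>UNIV. g k (Y w $ k)) \<partial>M) = (\<Prod>k\<in>UNIV. \<integral>\<^sup>+y. ennreal (normal_density 0 \<sigma> y) * g k y \<partial>lborel)"
proof -
  let ?n = "normal_density 0 \<sigma>"
  have B: "Basis = range (\<lambda>k::'d. axis k (1::real))" by (auto simp: Basis_vec_def)
  have inj: "inj (\<lambda>k::'d. axis k (1::real))" by (auto simp: inj_on_def axis_eq_axis)
  define idx where "idx = the_inv (\<lambda>k::'d. axis k (1::real))"
  have idx: "idx (axis k 1) = k" for k unfolding idx_def by (rule the_inv_f_f[OF inj])
  have "(\<integral>\<^sup>+w. (\<Prod>k\<in>UNIV. g k (Y w $ k)) \<partial>M) = (\<integral>\<^sup>+x. ennreal (\<Prod>i\<in>UNIV. ?n (x $ i)) * (\<Prod>k\<in>UNIV. g k (x $ k)) \<partial>lborel)"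
    by (rule distributed_nn_integral[OF Y, symmetric]) measurable
  also have "\<dots> = (\<integral>\<^sup>+x. (\<Prod>b\<in>Basis. ennreal (?n (x \<bullet> b)) * g (idx b) (x \<bullet> b)) \<partial>(lborel :: (real ^ 'd) measure))"
  proof (rule nn_integral_cong)
    fix x :: "real ^ 'd"
    have "(\<Prod>b\<in>Basis. ennreal (?n (x \<bullet> b)) * g (idx b) (x \<bullet> b)) = (\<Prod>k\<in>UNIV. ennreal (?n (x $ k)) * g k (x $ k))"
      unfolding B prod.reindex[OF inj] by (simp add: idx inner_axis)
    then show "ennreal (\<Prod>i\<in>UNIV. ?n (x $ i)) * (\<Prod>k\<in>UNIV. g k (x $ k)) = (\<Prod>b\<in>Basis. ennreal (?n (x \<bullet> b)) * g (idx b) (x \<bullet> b))"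
      by (simp add: prod.distrib prod_ennreal)
  qed
  also have "\<dots> = (\<Prod>b\<in>(Basis :: (real ^ 'd) set). \<integral>\<^sup>+y. ennreal (?n y) * g (idx b) y \<partial>lborel)"
    by (rule nn_integral_lborel_prod) auto
  also have "\<dots> = (\<Prod>k\<in>UNIV. \<integral>\<^sup>+y. ennreal (?n y) * g k y \<partial>lborel)"
    unfolding B prod.reindex[OF inj] by (simp add: idx)
  finally show ?thesis .
qed

lemma nn_integral_gaussian_mass: "(\<integral>\<^sup>+y. ennreal (normal_density 0 \<sigma> y) \<partial>lborel) = 1"
proof -
  interpret N: prob_space "density lborel (normal_density 0 \<sigma>)" by (rule prob_space_normal_density[OF \<sigma>])
  show ?thesis using N.emeasure_space_1 by (simp add: emeasure_density)
qed

lemma gaussian_vector_nn_integral2: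
  assumes [measurable]: "g \<in> borel_measurable borel" "h \<in> borel_measurable borel" and ij: "i \<noteq> j"
  shows "(\<integral>\<^sup>+w. g (Y w $ i) * h (Y w $ j) \<partial>M) =
    (\<integral>\<^sup>+y. ennreal (normal_density 0 \<sigma> y) * g y \<partial>lborel) * (\<integral>\<^sup>+y. ennreal (normal_density 0 \<sigma> y) * h y \<partial>lborel)"
proof -
  define G where "G k = (if k = i then g else if k = j then h else (\<lambda>_. 1))" for k
  have "(\<Prod>k\<in>UNIV. G k (y k)) = g (y i) * h (y j)" for y :: "'d \<Rightarrow> real"
  proof -
    have "(\<Prod>k\<in>UNIV. G k (y k)) = (\<Prod>k\<in>UNIV. if k = i then g (y i) else if k = j then h (y j) else 1)"
      by (intro prod.cong) (auto simp: G_def)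
    then show ?thesis by (simp add: prod_two_points[OF ij])
  qed
  moreover have "(\<Prod>k\<in>UNIV. \<integral>\<^sup>+y. ennreal (normal_density 0 \<sigma> y) * G k y \<partial>lborel) =
    (\<integral>\<^sup>+y. ennreal (normal_density 0 \<sigma> y) * g y \<partial>lborel) * (\<integral>\<^sup>+y. ennreal (normal_density 0 \<sigma> y) * h y \<partial>lborel)" (is "_ = ?u * ?v")
  proof -
    have "(\<Prod>k\<in>UNIV. \<integral>\<^sup>+y. ennreal (normal_density 0 \<sigma> y) * G k y \<partial>lborel) =
        (\<Prod>k\<in>UNIV. if k = i then ?u else if k = j then ?v else 1)"
      by (intro prod.cong) (auto simp: G_def nn_integral_gaussian_mass)
    then show ?thesis by (simp only: prod_two_points[OF ij])
  qed
  moreover have "G k \<in> borel_measurable borel" for k by (simp add: G_def)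
  ultimately show ?thesis using gaussian_vector_prod[of G] by simp
qed

lemma gaussian_vector_nn_integral1:
  assumes [measurable]: "g \<in> borel_measurable borel"
  shows "(\<integral>\<^sup>+w. g (Y w $ i) \<partial>M) = (\<integral>\<^sup>+y. ennreal (normal_density 0 \<sigma> y) * g y \<partial>lborel)"
proof -
  define G where "G k = (if k = i then g else (\<lambda>_. 1))" for k
  have "(\<Prod>k\<in>UNIV. G k (y k)) = (\<Prod>k\<in>UNIV. if k = i then g (y i) else 1)" for y :: "'d \<Rightarrow> real"
    by (intro prod.cong) (auto simp: G_def)
  then have "(\<Prod>k\<in>UNIV. G k (y k)) = g (y i)" for y :: "'d \<Rightarrow> real" by simp
  moreover have "(\<Prod>k\<in>UNIV. \<integral>\<^sup>+y. ennreal (normal_density 0 \<sigma> y) * G k y \<partial>lborel) =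
     (\<Prod>k\<in>UNIV. if k = i then \<integral>\<^sup>+y. ennreal (normal_density 0 \<sigma> y) * g y \<partial>lborel else 1)"
    by (intro prod.cong) (auto simp: G_def nn_integral_gaussian_mass)
  moreover have "G k \<in> borel_measurable borel" for k by (simp add: G_def)
  ultimately show ?thesis using gaussian_vector_prod[of G] by simp
qed

lemma gaussian_vector_measurable [measurable]: "Y \<in> borel_measurable M"
  using distributed_measurable[OF Y] by simp

lemma gaussian_component: "distributed M lborel (\<lambda>w. Y w $ i) (normal_density 0 \<sigma>)"
  unfolding distributed_def
proof (intro conjI measure_eqI)
  fix A assume "A \<in> sets (distr M lborel (\<lambda>w. Y w $ i))"
  then have [measurable]: "A \<in> sets borel" by simp
  have "emeasure (distr M lborel (\<lambda>w. Y w $ i)) A = (\<integral>\<^sup>+w. indicator A (Y w $ i) \<partial>M)"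
    using nn_integral_distr[of "\<lambda>w. Y w $ i" M lborel "indicator A :: real \<Rightarrow> ennreal"] by simp
  then show "emeasure (distr M lborel (\<lambda>w. Y w $ i)) A = emeasure (density lborel (normal_density 0 \<sigma>)) A"
    by (simp add: gaussian_vector_nn_integral1 emeasure_density)
qed auto

lemma gaussian_components_indep:
  assumes ij: "i \<noteq> j" shows "indep_var borel (\<lambda>w. Y w $ i) borel (\<lambda>w. Y w $ j)"
  unfolding indep_var_distribution_eq
proof (intro conjI pair_measure_eqI)
  fix A C :: "real set" assume "A \<in> sets (distr M borel (\<lambda>w. Y w $ i))" "C \<in> sets (distr M borel (\<lambda>w. Y w $ j))"
  then have AC [measurable]: "A \<in> sets borel" "C \<in> sets borel" by auto
  have 1: "emeasure (distr M borel (\<lambda>w. Y w $ i)) A = (\<integral>\<^sup>+w. indicator A (Y w $ i) \<partial>M)" if "A \<in> sets borel" for A and i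
    using that nn_integral_distr[of "\<lambda>w. Y w $ i" M borel "indicator A :: real \<Rightarrow> ennreal"] by simp
  have "emeasure (distr M (borel \<Otimes>\<^sub>M borel) (\<lambda>w. (Y w $ i, Y w $ j))) (A \<times> C) =
      (\<integral>\<^sup>+w. indicator (A \<times> C) (Y w $ i, Y w $ j) \<partial>M)"
    using nn_integral_distr[of "\<lambda>w. (Y w $ i, Y w $ j)" M "borel \<Otimes>\<^sub>M borel" "indicator (A \<times> C) :: _ \<Rightarrow> ennreal"] by simp
  also have "\<dots> = (\<integral>\<^sup>+w. indicator A (Y w $ i) * indicator C (Y w $ j) \<partial>M)" by (simp add: indicator_times)
  also have "\<dots> = emeasure (distr M borel (\<lambda>w. Y w $ i)) A * emeasure (distr M borel (\<lambda>w. Y w $ j)) C"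
    unfolding 1[OF AC(1)] 1[OF AC(2)] by (simp add: gaussian_vector_nn_integral1 gaussian_vector_nn_integral2[OF _ _ ij])
  finally show "emeasure (distr M borel (\<lambda>w. Y w $ i)) A * emeasure (distr M borel (\<lambda>w. Y w $ j)) C =
    emeasure (distr M (borel \<Otimes>\<^sub>M borel) (\<lambda>w. (Y w $ i, Y w $ j))) (A \<times> C)" by simp
next
  show "sigma_finite_measure (distr M borel (\<lambda>w. Y w $ i))"
    by (intro prob_space_imp_sigma_finite prob_space_distr) simp
  show "sigma_finite_measure (distr M borel (\<lambda>w. Y w $ j))"
    by (intro prob_space_imp_sigma_finite prob_space_distr) simp
  show "sets (distr M borel (\<lambda>w. Y w $ i) \<Otimes>\<^sub>M distr M borel (\<lambda>w. Y w $ j)) =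
      sets (distr M (borel \<Otimes>\<^sub>M borel) (\<lambda>w. (Y w $ i, Y w $ j)))"
    unfolding sets_distr by (intro sets_pair_measure_cong sets_distr)
qed measurable

lemma gaussian_moments:
  shows "integrable M (\<lambda>w. Y w $ i)" "(\<integral>w. Y w $ i \<partial>M) = 0"
    "integrable M (\<lambda>w. (Y w $ i)\<^sup>2)" "(\<integral>w. (Y w $ i)\<^sup>2 \<partial>M) = \<sigma>\<^sup>2"
    "integrable M (\<lambda>w. (Y w $ i) ^ 4)" "(\<integral>w. (Y w $ i) ^ 4 \<partial>M) = 3 * \<sigma> ^ 4"
proof -
  have nn: "0 \<le> normal_density 0 \<sigma> x" for x by simp
  have *: "integrable M (\<lambda>w. (Y w $ i) ^ m)" "(\<integral>w. (Y w $ i) ^ m \<partial>M) = c"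
    if "has_bochner_integral lborel (\<lambda>x. normal_density 0 \<sigma> x * x ^ m) c" for m c
    using distributed_integrable[OF gaussian_component, of "\<lambda>x. x ^ m" i]
      distributed_integral[OF gaussian_component, of "\<lambda>x. x ^ m" i] that nn
    by (auto simp: has_bochner_integral_iff)
  have 1: "has_bochner_integral lborel (\<lambda>x. normal_density 0 \<sigma> x * x ^ 1) 0"
    using normal_moment_odd[OF \<sigma>, of 0 0] by simp
  have 2: "has_bochner_integral lborel (\<lambda>x. normal_density 0 \<sigma> x * x\<^sup>2) (\<sigma>\<^sup>2)"
    using normal_moment_even[OF \<sigma>, of 0 1] \<sigma> by (simp add: fact_numeral field_simps power2_eq_square)
  have "fact (2 * 2) / ((2 / \<sigma>\<^sup>2) ^ 2 * fact 2) = 3 * \<sigma> ^ 4"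
    using \<sigma> by (simp add: fact_numeral field_simps power_divide)
  then have 4: "has_bochner_integral lborel (\<lambda>x. normal_density 0 \<sigma> x * x ^ 4) (3 * \<sigma> ^ 4)"
    using normal_moment_even[OF \<sigma>, of 0 2] by simp
  show "integrable M (\<lambda>w. Y w $ i)" "(\<integral>w. Y w $ i \<partial>M) = 0" using *[OF 1] by simp_all
  show "integrable M (\<lambda>w. (Y w $ i)\<^sup>2)" "(\<integral>w. (Y w $ i)\<^sup>2 \<partial>M) = \<sigma>\<^sup>2" using *[OF 2] by simp_all
  show "integrable M (\<lambda>w. (Y w $ i) ^ 4)" "(\<integral>w. (Y w $ i) ^ 4 \<partial>M) = 3 * \<sigma> ^ 4" using *[OF 4] by simp_all
qed

lemma gaussian_product_moments:
  shows "integrable M (\<lambda>w. Y w $ i * Y w $ j)" "(\<integral>w. Y w $ i * Y w $ j \<partial>M) = (if i = j then \<sigma>\<^sup>2 else 0)"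
    "integrable M (\<lambda>w. (Y w $ i * Y w $ j)\<^sup>2)" "(\<integral>w. (Y w $ i * Y w $ j)\<^sup>2 \<partial>M) \<le> 3 * \<sigma> ^ 4"
proof -
  have "integrable M (\<lambda>w. Y w $ i * Y w $ j) \<and> (\<integral>w. Y w $ i * Y w $ j \<partial>M) = (if i = j then \<sigma>\<^sup>2 else 0)"
  proof (cases "i = j")
    case True then show ?thesis using gaussian_moments(3,4)[of j] by (simp add: power2_eq_square)
  next
    case False
    show ?thesis
      using indep_var_integrable[OF gaussian_components_indep[OF False] gaussian_moments(1) gaussian_moments(1)]
        indep_var_lebesgue_integral[OF gaussian_components_indep[OF False] gaussian_moments(1) gaussian_moments(1)] False
      by (simp add: gaussian_moments(2))
  qed
  then show "integrable M (\<lambda>w. Y w $ i * Y w $ j)" "(\<integral>w. Y w $ i * Y w $ j \<partial>M) = (if i = j then \<sigma>\<^sup>2 else 0)" by auto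
  \<comment> \<open>One inequality covers equal and distinct coordinates and reduces the bound to
    fourth moments of single coordinates.\<close>
  have le: "(x * y)\<^sup>2 \<le> (x ^ 4 + y ^ 4) / 2" for x y :: real
  proof -
    have "0 \<le> (x\<^sup>2 - y\<^sup>2)\<^sup>2" by simp
    also have "\<dots> = x ^ 4 + y ^ 4 - 2 * (x * y)\<^sup>2"
      by (simp add: power2_eq_square power4_eq_xxxx algebra_simps)
    finally show ?thesis by simp
  qed
  have bi: "integrable M (\<lambda>w. ((Y w $ i) ^ 4 + (Y w $ j) ^ 4) / 2)" using gaussian_moments(5) by simp
  show pi: "integrable M (\<lambda>w. (Y w $ i * Y w $ j)\<^sup>2)"
    by (rule Bochner_Integration.integrable_bound[OF bi]) (use le in \<open>auto simp: abs_of_nonneg\<close>)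
  have "(\<integral>w. (Y w $ i * Y w $ j)\<^sup>2 \<partial>M) \<le> (\<integral>w. ((Y w $ i) ^ 4 + (Y w $ j) ^ 4) / 2 \<partial>M)"
    by (rule integral_mono[OF pi bi le])
  also have "\<dots> = 3 * \<sigma> ^ 4" using gaussian_moments(5,6) by simp
  finally show "(\<integral>w. (Y w $ i * Y w $ j)\<^sup>2 \<partial>M) \<le> 3 * \<sigma> ^ 4" .
qed

end

end

section \<open>Martingale identities for the subordinated process\<close>

text \<open>Carries a second moment bound and vanishing integrals over a fixed event to an almost
  sure limit. It is applied to finer and finer dyadic clocks and to times decreasing to
  \<open>s\<close>.\<close>

lemma (in prob_space) indicator_integral_limit:
  fixes X :: "nat \<Rightarrow> 'a \<Rightarrow> real"
  assumes lim: "AE w in M. (\<lambda>n. X n w) \<longlonglongrightarrow> Y w"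
    and m [measurable]: "\<And>n. X n \<in> borel_measurable M" "Y \<in> borel_measurable M"
    and bd: "\<And>n. (\<integral>\<^sup>+w. ennreal ((X n w)\<^sup>2) \<partial>M) \<le> ennreal C"
    and A [measurable]: "A \<in> events" and z: "\<And>n. (\<integral>w. indicator A w * X n w \<partial>M) = 0"
  shows "integrable M Y" "(\<integral>\<^sup>+w. ennreal ((Y w)\<^sup>2) \<partial>M) \<le> ennreal C" "(\<integral>w. indicator A w * Y w \<partial>M) = 0"
proof -
  show "integrable M Y" "(\<integral>\<^sup>+w. ennreal ((Y w)\<^sup>2) \<partial>M) \<le> ennreal C"
    by (rule tendsto_integral_L2_bounded[OF lim m bd])+
  have "(\<lambda>n. \<integral>w. indicator A w * X n w \<partial>M) \<longlonglongrightarrow> (\<integral>w. indicator A w * Y w \<partial>M)"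
  proof (rule tendsto_integral_L2_bounded(3))
    show "AE w in M. (\<lambda>n. indicator A w * X n w) \<longlonglongrightarrow> indicator A w * Y w"
      using lim by eventually_elim (rule tendsto_mult_left)
    have "(\<integral>\<^sup>+w. ennreal ((indicator A w * X n w)\<^sup>2) \<partial>M) \<le> (\<integral>\<^sup>+w. ennreal ((X n w)\<^sup>2) \<partial>M)" for n
      by (intro nn_integral_mono) (auto simp: indicator_def)
    then show "(\<integral>\<^sup>+w. ennreal ((indicator A w * X n w)\<^sup>2) \<partial>M) \<le> ennreal C" for n using bd order_trans by blast
  qed auto
  then show "(\<integral>w. indicator A w * Y w \<partial>M) = 0" by (simp add: z LIMSEQ_const_iff)
qed

text \<open>Turns a one-sided estimate for a compensated square into a bound that is independent of
  the grid.\<close>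

lemma (in prob_space) nn_integral_le_compensated:
  fixes f h :: "'a \<Rightarrow> real"
  assumes i: "integrable M (\<lambda>w. f w - h w)" and le: "(\<integral>w. f w - h w \<partial>M) \<le> 0"
    and h [measurable]: "h \<in> borel_measurable M" and hK: "AE w in M. 0 \<le> h w \<and> h w \<le> K" and f: "\<And>w. 0 \<le> f w"
  shows "(\<integral>\<^sup>+w. ennreal (f w) \<partial>M) \<le> ennreal K"
proof -
  have hi: "integrable M h"
    by (rule integrable_const_bound[of _ K]) (use hK in \<open>auto elim: eventually_mono\<close>)
  have fi: "integrable M f" using Bochner_Integration.integrable_add[OF i hi] by simp
  have "(\<integral>w. h w \<partial>M) \<le> (\<integral>w. K \<partial>M)" by (rule integral_mono_AE) (use hi hK in \<open>auto elim: eventually_mono\<close>)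
  then have "(\<integral>w. f w \<partial>M) \<le> K" using le fi hi by (simp add: prob_space)
  moreover have "(\<integral>\<^sup>+w. ennreal (f w) \<partial>M) = ennreal (\<integral>w. f w \<partial>M)" by (rule nn_integral_eq_integral[OF fi]) (simp add: f)
  ultimately show ?thesis by (simp add: ennreal_leI)
qed

context subordinated_brownian_motion
begin

lemma B_increment_moments:
  assumes ab: "0 \<le> a" "a \<le> b"
  shows "integrable M (\<lambda>w. (B b w - B a w) $ i)" "(\<integral>w. (B b w - B a w) $ i \<partial>M) = 0"
    "integrable M (\<lambda>w. (B b w - B a w) $ i * (B b w - B a w) $ j)"
    "(\<integral>w. (B b w - B a w) $ i * (B b w - B a w) $ j \<partial>M) = (if i = j then b - a else 0)"
    "integrable M (\<lambda>w. ((B b w - B a w) $ i * (B b w - B a w) $ j)\<^sup>2)"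
    "(\<integral>w. ((B b w - B a w) $ i * (B b w - B a w) $ j)\<^sup>2 \<partial>M) \<le> 3 * (b - a)\<^sup>2"
proof -
  have "integrable M (\<lambda>w. (B b w - B a w) $ i) \<and> (\<integral>w. (B b w - B a w) $ i \<partial>M) = 0 \<and>
    integrable M (\<lambda>w. (B b w - B a w) $ i * (B b w - B a w) $ j) \<and>
    (\<integral>w. (B b w - B a w) $ i * (B b w - B a w) $ j \<partial>M) = (if i = j then b - a else 0) \<and>
    integrable M (\<lambda>w. ((B b w - B a w) $ i * (B b w - B a w) $ j)\<^sup>2) \<and>
    (\<integral>w. ((B b w - B a w) $ i * (B b w - B a w) $ j)\<^sup>2 \<partial>M) \<le> 3 * (b - a)\<^sup>2"
  proof (cases "a = b")
    case False
    have v: "0 < sqrt (b - a)" using ab False by simp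
    have "(sqrt (b - a)) ^ 4 = ((sqrt (b - a))\<^sup>2)\<^sup>2" by (simp only: power_mult[symmetric]) simp
    then have 4: "(sqrt (b - a)) ^ 4 = (b - a)\<^sup>2" using ab by simp
    have d: "distributed M lborel (\<lambda>w. B b w - B a w) (\<lambda>x. ennreal (\<Prod>i\<in>UNIV. normal_density 0 (sqrt (b - a)) (x $ i)))"
      by (rule B_increment) (use ab False in auto)
    show ?thesis
      using gaussian_moments(1,2)[OF d v, of i] gaussian_product_moments[OF d v, of i j] ab
      unfolding 4 real_sqrt_pow2[of "b - a", simplified] by simp
  qed simp
  then show "integrable M (\<lambda>w. (B b w - B a w) $ i)" "(\<integral>w. (B b w - B a w) $ i \<partial>M) = 0"
    "integrable M (\<lambda>w. (B b w - B a w) $ i * (B b w - B a w) $ j)"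
    "(\<integral>w. (B b w - B a w) $ i * (B b w - B a w) $ j \<partial>M) = (if i = j then b - a else 0)"
    "integrable M (\<lambda>w. ((B b w - B a w) $ i * (B b w - B a w) $ j)\<^sup>2)"
    "(\<integral>w. ((B b w - B a w) $ i * (B b w - B a w) $ j)\<^sup>2 \<partial>M) \<le> 3 * (b - a)\<^sup>2" by blast+
qed

text \<open>The compensated product of two coordinates. That its integrals over past events vanish
  is the statement that the matrix of brackets is the clock times the identity.\<close>

definition cov :: "'d \<Rightarrow> 'd \<Rightarrow> real ^ 'd \<Rightarrow> real \<Rightarrow> real" where
  "cov i j x v = x $ i * x $ j - (if i = j then v else 0)"

text \<open>With \<open>P\<close> the product of two coordinates and \<open>c\<close> its mean, the
  second moment of \<open>P - c\<close> is that of \<open>P\<close> minus \<open>c^2\<close>, hence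
  at most \<open>3 * (b - a)^2\<close>; the constant 8 leaves room.\<close>

lemma cov_moments:
  assumes ab: "0 \<le> a" "a \<le> b"
  shows "integrable M (\<lambda>w. cov i j (B b w - B a w) (b - a))" "(\<integral>w. cov i j (B b w - B a w) (b - a) \<partial>M) = 0"
    "integrable M (\<lambda>w. (cov i j (B b w - B a w) (b - a))\<^sup>2 - 8 * (b - a)\<^sup>2)"
    "(\<integral>w. (cov i j (B b w - B a w) (b - a))\<^sup>2 - 8 * (b - a)\<^sup>2 \<partial>M) \<le> 0"
proof -
  note m = B_increment_moments(3-6)[OF ab, of i j]
  let ?P = "\<lambda>w. (B b w - B a w) $ i * (B b w - B a w) $ j" and ?c = "if i = j then b - a else 0"
  show "integrable M (\<lambda>w. cov i j (B b w - B a w) (b - a))"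
    unfolding cov_def by (intro Bochner_Integration.integrable_diff m(1)) simp
  have "(\<integral>w. ?P w - ?c \<partial>M) = (\<integral>w. ?P w \<partial>M) - (\<integral>w. ?c \<partial>M)" by (rule Bochner_Integration.integral_diff[OF m(1)]) simp
  then show "(\<integral>w. cov i j (B b w - B a w) (b - a) \<partial>M) = 0"
    unfolding cov_def m(2) by (simp add: prob_space)
  have eq: "(cov i j (B b w - B a w) (b - a))\<^sup>2 - 8 * (b - a)\<^sup>2 = ((?P w)\<^sup>2 - 2 * ?c * ?P w) + (?c\<^sup>2 - 8 * (b - a)\<^sup>2)" for w
    unfolding cov_def power2_diff by simp
  have i1: "integrable M (\<lambda>w. (?P w)\<^sup>2 - 2 * ?c * ?P w)"
    by (intro Bochner_Integration.integrable_diff m(3) integrable_mult_right m(1))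
  show "integrable M (\<lambda>w. (cov i j (B b w - B a w) (b - a))\<^sup>2 - 8 * (b - a)\<^sup>2)"
    unfolding eq by (intro Bochner_Integration.integrable_add i1) simp
  have "(\<integral>w. ((?P w)\<^sup>2 - 2 * ?c * ?P w) + (?c\<^sup>2 - 8 * (b - a)\<^sup>2) \<partial>M) =
      (\<integral>w. (?P w)\<^sup>2 - 2 * ?c * ?P w \<partial>M) + (\<integral>w. (?c\<^sup>2 - 8 * (b - a)\<^sup>2) \<partial>M)"
    by (rule Bochner_Integration.integral_add[OF i1]) simp
  also have "(\<integral>w. (?P w)\<^sup>2 - 2 * ?c * ?P w \<partial>M) = (\<integral>w. (?P w)\<^sup>2 \<partial>M) - (\<integral>w. 2 * ?c * ?P w \<partial>M)"
    by (rule Bochner_Integration.integral_diff[OF m(3)]) (intro integrable_mult_right m(1))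
  also have "(\<integral>w. 2 * ?c * ?P w \<partial>M) = 2 * ?c * ?c" using m(2) by simp
  also have "(\<integral>w. (?c\<^sup>2 - 8 * (b - a)\<^sup>2) \<partial>M) = ?c\<^sup>2 - 8 * (b - a)\<^sup>2" by (simp add: prob_space)
  also have "(\<integral>w. (?P w)\<^sup>2 \<partial>M) - 2 * ?c * ?c + (?c\<^sup>2 - 8 * (b - a)\<^sup>2) \<le> 0"
  proof -
    have "0 \<le> (b - a)\<^sup>2" "0 \<le> ?c\<^sup>2" "2 * ?c * ?c = 2 * ?c\<^sup>2" by (auto simp: power2_eq_square)
    then show ?thesis using m(4) by linarith
  qed
  finally show "(\<integral>w. (cov i j (B b w - B a w) (b - a))\<^sup>2 - 8 * (b - a)\<^sup>2 \<partial>M) \<le> 0" unfolding eq .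
qed

lemma dyadic_L_measurable [measurable]: "dyadic_L n r \<in> borel_measurable M"
proof -
  have [measurable]: "L r \<in> borel_measurable M" by (rule L_measurable)
  show ?thesis unfolding dyadic_L_def by measurable
qed

lemma B_dyadic_measurable [measurable]: "(\<lambda>w. B (dyadic_L n r w) w) \<in> borel_measurable M"
  unfolding dyadic_L_def
proof (rule measurable_compose_countable[where f = "\<lambda>i. B (real i / 2 ^ n)" and g = "\<lambda>w. dyadic_ceil n (L r w)"])
  show "B (real i / 2 ^ n) \<in> borel_measurable M" for i by (rule B_measurable) simp
  show "(\<lambda>w. dyadic_ceil n (L r w)) \<in> M \<rightarrow>\<^sub>M count_space UNIV"
    by (rule measurable_compose[OF L_measurable dyadic_ceil_measurable])
qed

lemma cov_measurable [measurable]: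
  assumes [measurable]: "f \<in> borel_measurable N" "h \<in> borel_measurable N"
  shows "(\<lambda>w. cov i j (f w) (h w)) \<in> borel_measurable N"
  unfolding cov_def by (cases "i = j") simp_all

text \<open>The identities hold for the rounded clocks and pass to the limit because the second
  moment bounds do not depend on the grid.\<close>

lemma stopped_increment_strict:
  assumes st: "s < t" and A: "A \<in> sets (stopped s)"
  shows "integrable M (\<lambda>w. (Z t w - Z s w) $ i)" "(\<integral>\<^sup>+w. ennreal (((Z t w - Z s w) $ i)\<^sup>2) \<partial>M) \<le> ennreal (2 * (t - s) / \<kappa>)"
    "(\<integral>w. indicator A w * (Z t w - Z s w) $ i \<partial>M) = 0"
    "integrable M (\<lambda>w. cov i j (Z t w - Z s w) (L t w - L s w))"
    "(\<integral>\<^sup>+w. ennreal ((cov i j (Z t w - Z s w) (L t w - L s w))\<^sup>2) \<partial>M) \<le> ennreal (8 * (2 * (t - s) / \<kappa>)\<^sup>2)"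
    "(\<integral>w. indicator A w * cov i j (Z t w - Z s w) (L t w - L s w) \<partial>M) = 0"
proof -
  have [measurable]: "L r \<in> borel_measurable M" "Z r \<in> borel_measurable M" for r by (rule L_measurable Z_measurable)+
  have AM: "A \<in> events" using A subalgebra_stopped by (auto simp: subalgebra_def)
  \<comment> \<open>The clock increment is at most \<open>(t - s) / \<kappa>\<close>, and rounding
    up adds less than the same amount once the grid is fine enough; hence the factor 2, and the
    assumption \<open>s < t\<close>.\<close>
  define K where "K = 2 * (t - s) / \<kappa>"
  have "(\<lambda>n. (1 / 2 :: real) ^ n) \<longlonglongrightarrow> 0" by (rule LIMSEQ_power_zero) simp
  moreover have "0 < (t - s) / \<kappa>" using st \<kappa>_pos by simp
  ultimately have "eventually (\<lambda>n. (1 / 2) ^ n < (t - s) / \<kappa>) sequentially" by (rule order_tendstoD)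
  then obtain N where N: "\<And>n. N \<le> n \<Longrightarrow> (1 / 2) ^ n < (t - s) / \<kappa>" by (auto simp: eventually_sequentially)
  define D where "D n w = B (dyadic_L (n + N) t w) w - B (dyadic_L (n + N) s w) w" for n w
  define l where "l n w = dyadic_L (n + N) t w - dyadic_L (n + N) s w" for n w
  have [measurable]: "D n \<in> borel_measurable M" "l n \<in> borel_measurable M" for n
    unfolding D_def l_def by measurable
  have lK: "AE w in M. 0 \<le> l n w \<and> l n w \<le> K" for n
    using clock_facts
  proof eventually_elim
    case (elim w)
    have *: "0 \<le> L t w" "L s w \<le> L t w" "L t w - L s w \<le> (t - s) / \<kappa>" using elim st less_imp_le by blast+
    have "dyadic_L (n + N) s w \<le> dyadic_L (n + N) t w"
      unfolding dyadic_L_def by (intro divide_right_mono of_nat_mono dyadic_ceil_mono *) simp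
    moreover have "dyadic_L (n + N) t w \<le> L t w + (1 / 2) ^ (n + N)" "L s w \<le> dyadic_L (n + N) s w"
      unfolding dyadic_L_def by (intro dyadic_ceil_le dyadic_ceil_ge *)+
    moreover have "(1 / 2) ^ (n + N) < (t - s) / \<kappa>" by (rule N) simp
    moreover have "K = (t - s) / \<kappa> + (t - s) / \<kappa>" by (simp add: K_def)
    ultimately show ?case using * unfolding l_def by linarith
  qed
  have lim: "AE w in M. (\<lambda>n. D n w) \<longlonglongrightarrow> Z t w - Z s w \<and> (\<lambda>n. l n w) \<longlonglongrightarrow> L t w - L s w"
    using clock_facts B_cont
  proof eventually_elim
    case (elim w)
    have L: "(\<lambda>n. dyadic_L (n + N) r w) \<longlonglongrightarrow> L r w" for r
      unfolding dyadic_L_def using elim by (intro LIMSEQ_ignore_initial_segment[OF dyadic_ceil_tendsto]) blast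
    have "(\<lambda>n. B (dyadic_L (n + N) r w) w) \<longlonglongrightarrow> Z r w" for r
      unfolding subdiffusion_def
      by (rule continuous_on_tendsto_compose[OF elim(2) L]) (use elim in \<open>auto simp: dyadic_L_def\<close>)
    then show ?case unfolding D_def l_def using L by (intro conjI tendsto_diff) auto
  qed
  \<comment> \<open>Second moments are taken over the whole space, so the lemma for events is used
    with the trivial event.\<close>
  have all: "space M \<in> sets (stopped s)" using sets.top[of "stopped s"] by simp
  have one: "integrable M (\<lambda>w. indicator (space M) w * f w) \<longleftrightarrow> integrable M f"
    "(\<integral>w. indicator (space M) w * f w \<partial>M) = (\<integral>w. f w \<partial>M)" for f :: "'a \<Rightarrow> real"
    by (auto intro!: Bochner_Integration.integrable_cong Bochner_Integration.integral_cong)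
  note st' = less_imp_le[OF st]
  have D2: "(\<integral>\<^sup>+w. ennreal ((D n w $ i)\<^sup>2) \<partial>M) \<le> ennreal K" for n
  proof (rule nn_integral_le_compensated[OF _ _ _ lK])
    have m: "(\<lambda>x :: real ^ 'd. (x $ i)\<^sup>2 - v) \<in> borel_measurable borel" for v by simp
    have p: "integrable M (\<lambda>w. ((B b w - B a w) $ i)\<^sup>2 - (b - a))" "(\<integral>w. ((B b w - B a w) $ i)\<^sup>2 - (b - a) \<partial>M) \<le> 0"
      if "0 \<le> a" "a \<le> b" for a b
      using cov_moments(1,2)[OF that, of i i] by (simp_all add: cov_def power2_eq_square)
    show "integrable M (\<lambda>w. (D n w $ i)\<^sup>2 - l n w)" "(\<integral>w. (D n w $ i)\<^sup>2 - l n w \<partial>M) \<le> 0"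
      using stopped_increment_nonpos[OF st' all, of "\<lambda>x v. (x $ i)\<^sup>2 - v" "n + N", OF m p]
      unfolding one D_def l_def by auto
  qed auto
  have C2: "(\<integral>\<^sup>+w. ennreal ((cov i j (D n w) (l n w))\<^sup>2) \<partial>M) \<le> ennreal (8 * K\<^sup>2)" for n
  proof (rule nn_integral_le_compensated[where h = "\<lambda>w. 8 * (l n w)\<^sup>2"])
    have m: "(\<lambda>x :: real ^ 'd. (cov i j x v)\<^sup>2 - 8 * v\<^sup>2) \<in> borel_measurable borel" for v by measurable
    show "integrable M (\<lambda>w. (cov i j (D n w) (l n w))\<^sup>2 - 8 * (l n w)\<^sup>2)"
      "(\<integral>w. (cov i j (D n w) (l n w))\<^sup>2 - 8 * (l n w)\<^sup>2 \<partial>M) \<le> 0"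
      using stopped_increment_nonpos[OF st' all, of "\<lambda>x v. (cov i j x v)\<^sup>2 - 8 * v\<^sup>2" "n + N", OF m cov_moments(3,4)]
      unfolding one D_def l_def by auto
    show "AE w in M. 0 \<le> 8 * (l n w)\<^sup>2 \<and> 8 * (l n w)\<^sup>2 \<le> 8 * K\<^sup>2"
      using lK[of n] by eventually_elim (auto intro: power_mono)
  qed auto
  have limD: "AE w in M. (\<lambda>n. D n w $ i) \<longlonglongrightarrow> (Z t w - Z s w) $ i"
    using lim by eventually_elim (intro tendsto_vec_nth, simp)
  have zD: "(\<integral>w. indicator A w * D n w $ i \<partial>M) = 0" for n
    unfolding D_def
    by (rule stopped_increment_zero[OF st' A, of "\<lambda>x v. x $ i"]) (use B_increment_moments(1,2) in auto)
  show "integrable M (\<lambda>w. (Z t w - Z s w) $ i)" "(\<integral>\<^sup>+w. ennreal (((Z t w - Z s w) $ i)\<^sup>2) \<partial>M) \<le> ennreal (2 * (t - s) / \<kappa>)"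
    "(\<integral>w. indicator A w * (Z t w - Z s w) $ i \<partial>M) = 0"
    unfolding K_def[symmetric] by (rule indicator_integral_limit[OF limD _ _ D2 AM zD]; simp)+
  have limC: "AE w in M. (\<lambda>n. cov i j (D n w) (l n w)) \<longlonglongrightarrow> cov i j (Z t w - Z s w) (L t w - L s w)"
    using lim unfolding cov_def by eventually_elim (intro tendsto_intros tendsto_vec_nth; cases "i = j"; simp)
  have zC: "(\<integral>w. indicator A w * cov i j (D n w) (l n w) \<partial>M) = 0" for n
    unfolding D_def l_def
    by (rule stopped_increment_zero[OF st' A _ cov_moments(1,2)]) measurable
  show "integrable M (\<lambda>w. cov i j (Z t w - Z s w) (L t w - L s w))"
    "(\<integral>\<^sup>+w. ennreal ((cov i j (Z t w - Z s w) (L t w - L s w))\<^sup>2) \<partial>M) \<le> ennreal (8 * (2 * (t - s) / \<kappa>)\<^sup>2)"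
    "(\<integral>w. indicator A w * cov i j (Z t w - Z s w) (L t w - L s w) \<partial>M) = 0"
    unfolding K_def[symmetric] by (rule indicator_integral_limit[OF limC _ _ C2 AM zC]; measurable)+
qed

end

section \<open>The augmented filtration\<close>

text \<open>A Borel-Cantelli argument: the squares are summable in mean, so their series converges
  almost surely and its terms tend to zero.\<close>

lemma AE_tendsto_zero_geometric:
  fixes X :: "nat \<Rightarrow> 'a \<Rightarrow> real"
  assumes [measurable]: "\<And>k. X k \<in> borel_measurable M"
    and le: "\<And>k. (\<integral>\<^sup>+w. ennreal ((X k w)\<^sup>2) \<partial>M) \<le> ennreal (C * (1 / 2) ^ k)" and C: "0 \<le> C"
  shows "AE w in M. (\<lambda>k. X k w) \<longlonglongrightarrow> 0"
proof -
  have "(\<integral>\<^sup>+w. (\<Sum>k. ennreal ((X k w)\<^sup>2)) \<partial>M) = (\<Sum>k. \<integral>\<^sup>+w. ennreal ((X k w)\<^sup>2) \<partial>M)"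
    by (rule nn_integral_suminf) measurable
  also have "\<dots> \<le> (\<Sum>k. ennreal (C * (1 / 2) ^ k))" by (intro suminf_le le) auto
  also have "\<dots> = ennreal (\<Sum>k. C * (1 / 2) ^ k)"
    using C by (intro suminf_ennreal2 summable_mult summable_geometric) auto
  finally have "(\<integral>\<^sup>+w. (\<Sum>k. ennreal ((X k w)\<^sup>2)) \<partial>M) \<noteq> \<infinity>" by (auto simp: top_unique)
  then have "AE w in M. (\<Sum>k. ennreal ((X k w)\<^sup>2)) \<noteq> \<infinity>" by (rule nn_integral_PInf_AE[rotated]) measurable
  then show ?thesis
  proof eventually_elim
    case (elim w)
    then have "summable (\<lambda>k. (X k w)\<^sup>2)" by (intro summable_suminf_not_top) auto
    then have "(\<lambda>k. (X k w)\<^sup>2) \<longlonglongrightarrow> 0" by (rule summable_LIMSEQ_zero)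
    then have "(\<lambda>k. sqrt ((X k w)\<^sup>2)) \<longlonglongrightarrow> sqrt 0" by (rule tendsto_real_sqrt)
    then show ?case by (simp add: tendsto_rabs_zero_iff)
  qed
qed

lemma (in prob_space) nn_integral_orthogonal_sum:
  fixes W :: "nat \<Rightarrow> 'a \<Rightarrow> real"
  assumes W: "\<And>j. j < n \<Longrightarrow> L2 M (W j)" and orth: "\<And>i j. i < j \<Longrightarrow> j < n \<Longrightarrow> (\<integral>w. W i w * W j w \<partial>M) = 0"
    and le: "\<And>j. j < n \<Longrightarrow> (\<integral>\<^sup>+w. ennreal ((W j w)\<^sup>2) \<partial>M) \<le> ennreal c" and c: "0 \<le> c"
  shows "(\<integral>\<^sup>+w. ennreal ((\<Sum>j<n. W j w)\<^sup>2) \<partial>M) \<le> ennreal (n * c)"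
  using W orth le
proof (induction n)
  case (Suc n)
  let ?S = "\<lambda>w. \<Sum>j<n. W j w"
  have S: "L2 M ?S" by (intro L2_sum Suc.prems(1)) simp
  have Wn: "L2 M (W n)" by (rule Suc.prems(1)) simp
  have SW: "integrable M (\<lambda>w. W j w * W n w)" if "j < n" for j
    using L2_inner_integrable[OF Suc.prems(1)[of j] Wn] that by simp
  have sq: "integrable M (\<lambda>w. (f w)\<^sup>2)" "(\<integral>\<^sup>+w. ennreal ((f w)\<^sup>2) \<partial>M) = ennreal (\<integral>w. (f w)\<^sup>2 \<partial>M)"
    if "L2 M f" for f :: "'a \<Rightarrow> real"
    using that L2_nn_integral[OF that] by (simp_all add: L2_def)
  have "(\<integral>w. ?S w * W n w \<partial>M) = (\<Sum>j<n. \<integral>w. W j w * W n w \<partial>M)"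
    unfolding sum_distrib_right by (rule Bochner_Integration.integral_sum) (use SW in simp)
  also have "\<dots> = 0" by (intro sum.neutral ballI Suc.prems(2)) auto
  finally have 0: "(\<integral>w. ?S w * W n w \<partial>M) = 0" .
  have i: "integrable M (\<lambda>w. 2 * (?S w * W n w))"
    using L2_inner_integrable[OF S Wn] by simp
  have eq: "(\<Sum>j<Suc n. W j w)\<^sup>2 = (?S w)\<^sup>2 + (W n w)\<^sup>2 + 2 * (?S w * W n w)" for w
    by (simp add: power2_sum)
  have "(\<integral>w. (\<Sum>j<Suc n. W j w)\<^sup>2 \<partial>M) = (\<integral>w. (?S w)\<^sup>2 \<partial>M) + (\<integral>w. (W n w)\<^sup>2 \<partial>M)"
    unfolding eq using sq(1)[OF S] sq(1)[OF Wn] i 0 by simp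
  moreover have "(\<integral>w. (?S w)\<^sup>2 \<partial>M) \<le> n * c"
    using Suc.IH Suc.prems c sq(2)[OF S] by (simp add: ennreal_le_iff)
  moreover have "(\<integral>w. (W n w)\<^sup>2 \<partial>M) \<le> c"
    using Suc.prems(3)[of n] c sq(2)[OF Wn] by (simp add: ennreal_le_iff)
  ultimately have "(\<integral>w. (\<Sum>j<Suc n. W j w)\<^sup>2 \<partial>M) \<le> Suc n * c" by (simp add: algebra_simps)
  moreover have "L2 M (\<lambda>w. \<Sum>j<Suc n. W j w)" by (intro L2_sum Suc.prems(1)) simp
  ultimately show ?case using sq(2) by (simp only: ennreal_leI)
qed simp

context subordinated_brownian_motion
begin

abbreviation "F \<equiv> augmented_filtration M Z"

definition observed :: "real \<Rightarrow> 'a set set" where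
  "observed u = sigma_sets (space M) (process_events M Z {0..u} \<union> null_sets M)"

abbreviation (input) "observed_measure u \<equiv> sigma (space M) (observed u)"

lemma generator_Z_stopped: "process_events M Z {0..u} \<union> null_sets M \<subseteq> sets (stopped u)"
proof -
  have "Z r -` A \<inter> space M \<in> sets (stopped u)" if "r \<le> u" "A \<in> sets borel" for r A
    using measurable_sets[OF Z_stopped[OF that(1)] that(2)] by simp
  then have "{Z t -` A \<inter> space M | t A. t \<in> {0..u} \<and> A \<in> sets borel} \<subseteq> sets (stopped u)" by auto
  then have "process_events M Z {0..u} \<subseteq> sets (stopped u)"
    unfolding process_events_def using sets.sigma_sets_subset[of _ "stopped u"] by simp
  then show ?thesis using null_stopped by blast
qed

lemma observed_stopped: "observed u \<subseteq> sets (stopped u)"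
  unfolding observed_def using sets.sigma_sets_subset[OF generator_Z_stopped[of u]] by simp

lemma observed_mono: "u \<le> v \<Longrightarrow> observed u \<subseteq> observed v"
  unfolding observed_def process_events_def
  by (intro sigma_sets_subseteq Un_mono subset_refl) force

lemma observed_events: "observed u \<subseteq> events"
  using observed_stopped[of u] subalgebra_stopped[of u] by (auto simp: subalgebra_def)

lemma sets_observed: "sets (sigma (space M) (observed u)) = observed u"
proof -
  have 1: "observed u \<subseteq> Pow (space M)" using observed_events[of u] sets.space_closed by blast
  have 2: "process_events M Z {0..u} \<union> null_sets M \<subseteq> Pow (space M)"
    using subset_trans[OF generator_Z_stopped[of u] sets.space_closed] by simp
  show ?thesis unfolding sets_measure_of[OF 1] unfolding observed_def by (rule sigma_sets_sigma_sets_eq[OF 2])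
qed

text \<open>An intersection of sigma-algebras is already one, so the closure in the definition of
  the filtration adds nothing.\<close>

lemma sets_F: "sets (F t) = (\<Inter>u\<in>{t<..}. observed u)"
proof -
  let ?X = "\<Inter>u\<in>{t<..}. observed u"
  have u1: "t + 1 \<in> {t<..}" by simp
  have X: "?X \<subseteq> Pow (space M)" using observed_events[of "t + 1"] sets.space_closed u1 by blast
  have "sigma_sets (space M) ?X \<subseteq> observed u" if "u \<in> {t<..}" for u
    using that sigma_sets_mono[of ?X "space M" "process_events M Z {0..u} \<union> null_sets M"] unfolding observed_def by blast
  then have "sigma_sets (space M) ?X = ?X" using sigma_sets_superset_generator[of ?X "space M"] by blast
  then show ?thesis
    unfolding augmented_filtration_def observed_def[symmetric] using sets_measure_of[OF X] by simp
qed

text \<open>An event of \<open>F t\<close> is observed by every time after \<open>t\<close>, though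
  not necessarily by \<open>t\<close> itself; hence the strict inequality, and the limit in
  \<open>F_increment\<close>.\<close>

lemma F_stopped: "t < u \<Longrightarrow> sets (F t) \<subseteq> sets (stopped u)"
  unfolding sets_F using observed_stopped[of u] by auto

lemma space_F: "space (F t) = space M"
  by (simp add: augmented_filtration_def space_measure_of_conv)

lemma F_subalgebra: "subalgebra M (F t)"
  unfolding subalgebra_def space_F using F_stopped[of t "t + 1"] subalgebra_stopped[of "t + 1"] by (auto simp: subalgebra_def)

lemma null_observed: "null_sets M \<subseteq> observed t"
  unfolding observed_def by blast

lemma observed_F: "observed t \<subseteq> sets (F t)"
  unfolding sets_F by (intro INT_greatest observed_mono) simp

lemma observed_measurable_F:
  assumes "f \<in> borel_measurable (observed_measure t)" shows "f \<in> borel_measurable (F t)"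
  by (rule measurable_subalgebra[OF _ assms])
    (use observed_F in \<open>auto simp: subalgebra_def space_F space_measure_of_conv sets_observed\<close>)

lemma Z_observed:
  assumes "0 \<le> r" "r \<le> t" shows "Z r \<in> borel_measurable (observed_measure t)"
proof (rule measurableI)
  fix A :: "(real ^ 'd) set" assume "A \<in> sets borel"
  then have "Z r -` A \<inter> space M \<in> process_events M Z {0..t}"
    unfolding process_events_def using assms by (intro sigma_sets.Basic) auto
  then have "Z r -` A \<inter> space M \<in> observed t" unfolding observed_def by blast
  then show "Z r -` A \<inter> space (observed_measure t) \<in> sets (observed_measure t)"
    by (simp only: sets_observed space_measure_of_conv)
qed simp

text \<open>The compensated squares \<open>W j\<close> are orthogonal, because \<open>W a\<close> is
  prior to the clock at \<open>p j\<close> for \<open>a < j\<close>. There are \<open>2 ^ k\<close>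
  of them with second moments of order \<open>(1/4) ^ k\<close>. The total of order
  \<open>(1/2) ^ k\<close> is summable, so the full dyadic sequence converges almost surely and no
  subsequence is taken.\<close>

lemma quadratic_variation_bound:
  assumes t: "0 < t"
  shows "(\<integral>\<^sup>+w. ennreal (((\<Sum>j<2 ^ k. ((Z (t * real (Suc j) / 2 ^ k) w - Z (t * real j / 2 ^ k) w) $ i)\<^sup>2) - (L t w - L 0 w))\<^sup>2) \<partial>M)
     \<le> ennreal (32 * t\<^sup>2 / \<kappa>\<^sup>2 * (1 / 2) ^ k)"
proof -
  define p where "p j = t * real j / 2 ^ k" for j
  have p: "p j < p (Suc j)" for j unfolding p_def using t by (intro divide_strict_right_mono mult_strict_left_mono) auto
  have pm: "i \<le> j \<Longrightarrow> p i \<le> p j" for i j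
    unfolding p_def using t by (intro divide_right_mono mult_left_mono) auto
  define W where "W j w = cov i i (Z (p (Suc j)) w - Z (p j) w) (L (p (Suc j)) w - L (p j) w)" for j w
  note all = sets.top[of "stopped _", unfolded space_stopped]
  have d: "p (Suc j) - p j = t / 2 ^ k" for j by (simp add: p_def diff_divide_distrib[symmetric] right_diff_distrib[symmetric])
  have Wm: "W j \<in> borel_measurable (stopped u)" if "p (Suc j) \<le> u" for j u
  proof -
    have [measurable]: "Z (p (Suc j)) \<in> borel_measurable (stopped u)" "Z (p j) \<in> borel_measurable (stopped u)"
      "L r \<in> borel_measurable (stopped u)" for r
      using that p[of j] by (auto intro!: Z_stopped L_stopped)
    show ?thesis unfolding W_def by measurable
  qed
  have W2: "(\<integral>\<^sup>+w. ennreal ((W j w)\<^sup>2) \<partial>M) \<le> ennreal (8 * (2 * (t / 2 ^ k) / \<kappa>)\<^sup>2)" for j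
    using stopped_increment_strict(5)[OF p all, of i i j] unfolding W_def d .
  have WL2: "L2 M (W j)" for j
    unfolding L2_iff_nn using measurable_subalgebra[OF subalgebra_stopped Wm[OF order_refl, of j]] le_less_trans[OF W2[of j], of \<infinity>] by simp
  have orth: "(\<integral>w. W a w * W j w \<partial>M) = 0" if "a < j" for a j
  proof (rule orth_subalgebra[OF subalgebra_stopped[of "p j"]])
    show "integrable M (W j)" by (rule L2_integrable[OF WL2])
    show "(\<integral>w. indicator A w * W j w \<partial>M) = 0" if "A \<in> sets (stopped (p j))" for A
      unfolding W_def by (rule stopped_increment_strict(6)[OF p that])
    show "W a \<in> borel_measurable (stopped (p j))" using that by (intro Wm pm) simp
    show "integrable M (\<lambda>w. W a w * W j w)" using L2_inner_integrable[OF WL2 WL2, of a j] by simp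
  qed
  have "(\<Sum>j<2 ^ k. W j w) = (\<Sum>j<2 ^ k. ((Z (p (Suc j)) w - Z (p j) w) $ i)\<^sup>2) - (L t w - L 0 w)" for w
  proof -
    have "(\<Sum>j<2 ^ k. L (p (Suc j)) w - L (p j) w) = L (p (2 ^ k)) w - L (p 0) w" by (rule sum_lessThan_telescope)
    then show ?thesis by (simp add: W_def cov_def sum_subtractf power2_eq_square p_def)
  qed
  moreover have "(\<integral>\<^sup>+w. ennreal ((\<Sum>j<2 ^ k. W j w)\<^sup>2) \<partial>M) \<le> ennreal (real (2 ^ k) * (8 * (2 * (t / 2 ^ k) / \<kappa>)\<^sup>2))"
    by (rule nn_integral_orthogonal_sum[OF WL2 orth W2]) auto
  moreover have "real (2 ^ k) * (8 * (2 * (t / 2 ^ k) / \<kappa>)\<^sup>2) = 32 * t\<^sup>2 / \<kappa>\<^sup>2 * (1 / 2) ^ k"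
    by (simp add: power2_eq_square field_simps)
  ultimately show ?thesis by (simp add: p_def)
qed

text \<open>The clock is recovered from the path of \<open>Z\<close> as the limit of its dyadic quadratic variations.\<close>

lemma L_observed:
  assumes t: "0 \<le> t" shows "L t \<in> borel_measurable (observed_measure t)"
proof -
  have sub: "subalgebra M (observed_measure t)" "null_sets M \<subseteq> sets (observed_measure t)"
    using observed_events[of t] null_observed[of t] by (auto simp: subalgebra_def sets_observed space_measure_of_conv)
  show ?thesis
  proof (cases "t = 0")
    case True
    have ae: "AE w in M. 0 = L t w" using clock_facts by eventually_elim (use True in auto)
    show ?thesis by (rule measurable_AE_cong[OF complete sub _ ae]) simp
  next
    case False
    then have t: "0 < t" using t by simp
    \<comment> \<open>Any single coordinate of \<open>Z\<close> recovers the clock.\<close>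
    fix i :: 'd
    define Q where "Q k w = (\<Sum>j<2 ^ k. ((Z (t * real (Suc j) / 2 ^ k) w - Z (t * real j / 2 ^ k) w) $ i)\<^sup>2)" for k :: nat and w
    have Qm: "Q k \<in> borel_measurable (observed_measure t)" for k
    proof -
      have Z': "Z (t * real j / 2 ^ k) \<in> borel_measurable (observed_measure t)" if "j \<le> 2 ^ k" for j
      proof (rule Z_observed)
        have "real j \<le> 2 ^ k" using that of_nat_le_iff[of j "2 ^ k", where ?'a = real] by simp
        then have "t * real j \<le> t * 2 ^ k" using t by (intro mult_left_mono) auto
        then show "t * real j / 2 ^ k \<le> t" by (simp add: divide_le_eq)
      qed (use t in auto)
      have "(\<lambda>w. ((Z (t * real (Suc j) / 2 ^ k) w - Z (t * real j / 2 ^ k) w) $ i)\<^sup>2) \<in> borel_measurable (observed_measure t)"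
        if "j < 2 ^ k" for j
        using Z'[OF Suc_leI[OF that]] Z'[OF less_imp_le[OF that]] by measurable
      then show ?thesis unfolding Q_def by (intro borel_measurable_sum) auto
    qed
    have "AE w in M. (\<lambda>k. Q k w - (L t w - L 0 w)) \<longlonglongrightarrow> 0"
    proof (rule AE_tendsto_zero_geometric)
      show "(\<lambda>w. Q k w - (L t w - L 0 w)) \<in> borel_measurable M" for k
        using measurable_subalgebra[OF sub(1) Qm[of k]] L_measurable[of t] L_measurable[of 0] by measurable
      show "(\<integral>\<^sup>+w. ennreal ((Q k w - (L t w - L 0 w))\<^sup>2) \<partial>M) \<le> ennreal (32 * t\<^sup>2 / \<kappa>\<^sup>2 * (1 / 2) ^ k)" for k
        unfolding Q_def by (rule quadratic_variation_bound[OF t])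
    qed simp
    then have "AE w in M. (\<lambda>k. Q k w) \<longlonglongrightarrow> L t w"
      using clock_facts
    proof eventually_elim
      case (elim w)
      have "L 0 w = 0" using elim by blast
      then show ?case using elim(1) by (simp add: LIM_zero_iff)
    qed
    then show ?thesis by (rule measurable_AE_LIMSEQ[OF complete sub Qm])
  qed
qed

lemma Z_cont: "AE w in M. continuous_on {0..} (\<lambda>t. Z t w) \<and> continuous_on UNIV (\<lambda>t. L t w)"
  using B_cont clock_regular clock_facts
proof eventually_elim
  case (elim w)
  have L: "continuous_on UNIV (\<lambda>t. L t w)" by (rule regular_clock_continuous[OF elim(2) \<kappa>_pos])
  have "continuous_on {0..} (\<lambda>t. Z t w)"
    unfolding subdiffusion_def
    by (rule continuous_on_compose2[OF elim(1) continuous_on_subset[OF L]]) (use elim in auto)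
  then show ?case using L by simp
qed

text \<open>For \<open>A\<close> in \<open>F s\<close> the identities hold from each later time
  \<open>u k\<close> on, since \<open>A\<close> is prior to the clock there; path continuity and
  uniform second moments let \<open>u k\<close> decrease to \<open>s\<close>.\<close>

lemma F_increment:
  assumes st: "0 \<le> s" "s \<le> t" and A: "A \<in> sets (F s)"
  shows "(\<integral>w. indicator A w * (Z t w - Z s w) $ i \<partial>M) = 0"
    "(\<integral>w. indicator A w * cov i j (Z t w - Z s w) (L t w - L s w) \<partial>M) = 0"
proof -
  have "(\<integral>w. indicator A w * (Z t w - Z s w) $ i \<partial>M) = 0 \<and> (\<integral>w. indicator A w * cov i j (Z t w - Z s w) (L t w - L s w) \<partial>M) = 0"
  proof (cases "s = t")
    case False
    then have st': "s < t" using st by simp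
    have [measurable]: "L r \<in> borel_measurable M" "Z r \<in> borel_measurable M" for r by (rule L_measurable Z_measurable)+
    have AM: "A \<in> events" using A F_subalgebra by (auto simp: subalgebra_def)
    \<comment> \<open>The shift to \<open>Suc (Suc k)\<close> keeps \<open>u k\<close> strictly
      between \<open>s\<close> and \<open>t\<close>, as \<open>stopped_increment_strict\<close>
      demands.\<close>
    define u where "u k = s + (t - s) * inverse (real (Suc (Suc k)))" for k
    have u: "s < u k" "u k < t" for k
    proof -
      have 1: "0 < inverse (real (Suc (Suc k)))" "inverse (real (Suc (Suc k))) < 1" by (auto intro!: one_less_inverse simp: inverse_less_1_iff)
      show "s < u k" using mult_pos_pos[OF _ 1(1), of "t - s"] st' by (simp add: u_def)
      have "(t - s) * inverse (real (Suc (Suc k))) < (t - s) * 1" using 1 st' by (intro mult_strict_left_mono) auto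
      then show "u k < t" by (simp add: u_def)
    qed
    have "(\<lambda>k. s + (t - s) * inverse (real (Suc (Suc k)))) \<longlonglongrightarrow> s + (t - s) * 0"
      by (intro tendsto_intros LIMSEQ_Suc[OF LIMSEQ_inverse_real_of_nat])
    then have ul: "u \<longlonglongrightarrow> s" by (simp add: u_def[abs_def])
    have AS: "A \<in> sets (stopped (u k))" for k using A F_stopped[OF u(1)] by blast
    have lim: "AE w in M. (\<lambda>k. Z (u k) w) \<longlonglongrightarrow> Z s w \<and> (\<lambda>k. L (u k) w) \<longlonglongrightarrow> L s w"
      using Z_cont
    proof eventually_elim
      case (elim w)
      have "u k \<in> {0..}" for k using u(1)[of k] st by simp
      then show ?case using elim st
        by (auto intro!: continuous_on_tendsto_compose[OF _ ul])
    qed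
    have tu: "2 * (t - u k) / \<kappa> \<le> 2 * (t - s) / \<kappa>" "0 \<le> 2 * (t - u k) / \<kappa>" for k
      using u[of k] \<kappa>_pos by (auto intro!: divide_right_mono)
    have "(\<integral>w. indicator A w * (Z t w - Z s w) $ i \<partial>M) = 0"
    proof (rule indicator_integral_limit(3)[OF _ _ _ _ AM])
      show "AE w in M. (\<lambda>k. (Z t w - Z (u k) w) $ i) \<longlonglongrightarrow> (Z t w - Z s w) $ i"
        using lim by eventually_elim (intro tendsto_vec_nth tendsto_diff tendsto_const, simp)
      show "(\<integral>\<^sup>+w. ennreal (((Z t w - Z (u k) w) $ i)\<^sup>2) \<partial>M) \<le> ennreal (2 * (t - s) / \<kappa>)" for k
        by (rule order_trans[OF stopped_increment_strict(2)[OF u(2) AS] ennreal_leI[OF tu(1)]])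
      show "(\<integral>w. indicator A w * (Z t w - Z (u k) w) $ i \<partial>M) = 0" for k
        by (rule stopped_increment_strict(3)[OF u(2) AS])
    qed auto
    moreover have "(\<integral>w. indicator A w * cov i j (Z t w - Z s w) (L t w - L s w) \<partial>M) = 0"
    proof (rule indicator_integral_limit(3)[OF _ _ _ _ AM])
      show "AE w in M. (\<lambda>k. cov i j (Z t w - Z (u k) w) (L t w - L (u k) w)) \<longlonglongrightarrow> cov i j (Z t w - Z s w) (L t w - L s w)"
        using lim unfolding cov_def by eventually_elim (intro tendsto_intros tendsto_vec_nth; cases "i = j"; simp add: tendsto_intros)
      show "(\<integral>\<^sup>+w. ennreal ((cov i j (Z t w - Z (u k) w) (L t w - L (u k) w))\<^sup>2) \<partial>M) \<le> ennreal (8 * (2 * (t - s) / \<kappa>)\<^sup>2)" for k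
      proof (rule order_trans[OF stopped_increment_strict(5)[OF u(2) AS] ennreal_leI])
        show "8 * (2 * (t - u k) / \<kappa>)\<^sup>2 \<le> 8 * (2 * (t - s) / \<kappa>)\<^sup>2" using power_mono[OF tu(1)[of k] tu(2)[of k], of 2] by simp
      qed
      show "(\<integral>w. indicator A w * cov i j (Z t w - Z (u k) w) (L t w - L (u k) w) \<partial>M) = 0" for k
        by (rule stopped_increment_strict(6)[OF u(2) AS])
    qed measurable
    ultimately show ?thesis ..
  qed (simp add: cov_def)
  then show "(\<integral>w. indicator A w * (Z t w - Z s w) $ i \<partial>M) = 0"
    "(\<integral>w. indicator A w * cov i j (Z t w - Z s w) (L t w - L s w) \<partial>M) = 0" by blast+
qed

lemma Z_L2:
  assumes t: "0 \<le> t" shows "L2 M (Z t)"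
proof -
  have [measurable]: "Z r \<in> borel_measurable M" for r by (rule Z_measurable)
  have "L2 M (\<lambda>w. Z t w - Z 0 w)"
  proof (cases "t = 0")
    case False
    then have t: "0 < t" using t by simp
    have eq: "ennreal ((norm (Z t w - Z 0 w))\<^sup>2) = (\<Sum>i\<in>UNIV. ennreal (((Z t w - Z 0 w) $ i)\<^sup>2))" for w
      unfolding power2_norm_eq_inner inner_vec_def by (simp add: power2_eq_square)
    have "nn_sq M (\<lambda>w. Z t w - Z 0 w) = (\<Sum>i\<in>UNIV. \<integral>\<^sup>+w. ennreal (((Z t w - Z 0 w) $ i)\<^sup>2) \<partial>M)"
      unfolding eq by (rule nn_integral_sum) measurable
    also have "\<dots> \<le> (\<Sum>i\<in>(UNIV :: 'd set). ennreal (2 * (t - 0) / \<kappa>))"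
      by (intro sum_mono stopped_increment_strict(2)[OF t sets.top])
    also have "\<dots> < \<infinity>" by (simp add: ennreal_mult_less_top of_nat_less_top)
    finally show ?thesis unfolding L2_iff_nn by simp
  qed simp
  moreover have "AE w in M. Z t w - Z 0 w = Z t w"
    using B_zero clock_facts
  proof eventually_elim
    case (elim w)
    have "L 0 w = 0" using elim by blast
    then show ?case using elim(1) by (simp add: subdiffusion_def)
  qed
  ultimately show ?thesis by (rule L2_AE_cong[OF complete])
qed

lemma driver: assumes T: "0 < T" shows "driver M F T Z L \<kappa>"
proof (intro driver.intro complete_filtration.intro complete_filtration_axioms.intro driver_axioms.intro)
  show "prob_space M" by (rule prob_space_axioms)
  show "complete_measure M" "0 < T" "0 < \<kappa>" by (fact complete T \<kappa>_pos)+
  show "subalgebra M (F t)" for t by (rule F_subalgebra)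
  show "null_sets M \<subseteq> sets (F t)" for t using null_observed observed_F by blast
  show "sets (F s) \<subseteq> sets (F t)" if "s \<le> t" for s t unfolding sets_F using that by auto
  show "Z t \<in> borel_measurable (F t)" if "t \<in> {0..T}" for t
    by (rule observed_measurable_F[OF Z_observed]) (use that in auto)
  show "AE w in M. continuous_on {0..T} (\<lambda>t. Z t w)"
    using Z_cont by eventually_elim (auto elim: continuous_on_subset)
  show "L2 M (Z t)" if "t \<in> {0..T}" for t using that by (intro Z_L2) simp
  show "L t \<in> borel_measurable (F t)" if "t \<in> {0..T}" for t
    by (rule observed_measurable_F[OF L_observed]) (use that in simp)
  show "AE w in M. regular_clock \<kappa> (\<lambda>t. L t w)" by (rule clock_regular)
  show "(\<integral>w. indicator A w * (Z t w $ i - Z s w $ i) \<partial>M) = 0"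
    if "0 \<le> s" "s \<le> t" "t \<le> T" "A \<in> sets (F s)" for s t A i
    using F_increment(1)[OF that(1,2,4), of i] by simp
  show "(\<integral>w. indicator A w * ((Z t w $ i - Z s w $ i) * (Z t w $ j - Z s w $ j) - (if i = j then L t w - L s w else 0)) \<partial>M) = 0"
    if "0 \<le> s" "s \<le> t" "t \<le> T" "A \<in> sets (F s)" for s t A i j
    using F_increment(2)[OF that(1,2,4), of i j] by (simp add: cov_def)
qed

end

lemma subordinated_brownian_motionI:
  assumes "prob_space M" "complete_measure M" "standard_brownian_motion M B" "\<kappa> > 0" "is_subordinator M 0 \<nu> S0"
    and S_eq: "\<And>t w. 0 \<le> t \<Longrightarrow> w \<in> space M \<Longrightarrow> S t w = \<kappa> * t + S0 t w"
    and "prob_space.indep_set M (process_events M B {0..}) (process_events M S {0..})"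
  shows "subordinated_brownian_motion M B S \<kappa>"
proof -
  have S0: "0 \<le> t \<Longrightarrow> S0 t \<in> borel_measurable M" "AE w in M. S0 0 w = 0" "AE w in M. mono_on {0..} (\<lambda>t. S0 t w)" for t
    using assms(5) by (auto simp: is_subordinator_def elim: eventually_mono)
  have S: "S t \<in> borel_measurable M" if "0 \<le> t" for t
  proof -
    have "(\<lambda>w. \<kappa> * t + S0 t w) \<in> borel_measurable M" using S0(1)[OF that] by simp
    then show ?thesis using measurable_cong[of M "S t" "\<lambda>w. \<kappa> * t + S0 t w" borel] S_eq[OF that] by simp
  qed
  have "AE w in M. S 0 w = 0 \<and> (\<forall>s t. 0 \<le> s \<longrightarrow> s \<le> t \<longrightarrow> \<kappa> * (t - s) \<le> S t w - S s w)"
    using S0(2,3) AE_space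
  proof eventually_elim
    case (elim w)
    have "\<kappa> * (t - s) \<le> S t w - S s w" if "0 \<le> s" "s \<le> t" for s t
    proof -
      have "S0 s w \<le> S0 t w" using mono_onD[OF elim(2), of s t] that by simp
      then show ?thesis using S_eq[OF that(1) elim(3)] S_eq[of t w] that elim(3) by (simp add: right_diff_distrib)
    qed
    then show ?case using S_eq[of 0 w] elim by simp
  qed
  with S show ?thesis
    using assms unfolding subordinated_brownian_motion_def subordinated_brownian_motion_axioms_def by blast
qed

theorem theorem3p3:
  fixes M :: "'a measure"
    and B :: "real \<Rightarrow> 'a \<Rightarrow> real ^ 'd"
    and S0 S L :: "real \<Rightarrow> 'a \<Rightarrow> real"
    and Z :: "real \<Rightarrow> 'a \<Rightarrow> real ^ 'd"
    and F :: "real \<Rightarrow> 'a measure"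
    and \<nu> :: "real measure"
    and \<kappa> T C0 :: real
    and b \<delta> :: "'a \<Rightarrow> real \<Rightarrow> real ^ 'n \<Rightarrow> (real ^ 'n) measure \<Rightarrow> real ^ 'n"
    and \<sigma> :: "'a \<Rightarrow> real \<Rightarrow> real ^ 'n \<Rightarrow> (real ^ 'n) measure \<Rightarrow> real ^ 'd ^ 'n"
    and \<Omega>0 :: "'a set"
    and x0 :: "real ^ 'n"
  assumes "prob_space M" and "complete_measure M"
    and "standard_brownian_motion M B"
    and "\<kappa> > 0" and "is_subordinator M 0 \<nu> S0"
    and S_eq: "\<And>t \<omega>. 0 \<le> t \<Longrightarrow> \<omega> \<in> space M \<Longrightarrow> S t \<omega> = \<kappa> * t + S0 t \<omega>"
    and "prob_space.indep_set M (process_events M B {0..}) (process_events M S {0..})"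
    and L_eq: "L = inverse_subordinator S"
    and Z_eq: "Z = subdiffusion B L"
    and F_eq: "F = augmented_filtration M Z"
    and "T > 0"
    and "\<And>x \<mu>. \<mu> \<in> prob_measures \<Longrightarrow> prog_measurable F T (\<lambda>t \<omega>. b \<omega> t x \<mu>)"
    and "\<And>x \<mu>. \<mu> \<in> prob_measures \<Longrightarrow> prog_measurable F T (\<lambda>t \<omega>. \<delta> \<omega> t x \<mu>)"
    and "\<And>x \<mu>. \<mu> \<in> prob_measures \<Longrightarrow> prog_measurable F T (\<lambda>t \<omega>. \<sigma> \<omega> t x \<mu>)"
    and i: "(\<integral>\<^sup>+ \<omega>. (\<integral>\<^sup>+ s\<in>{0..T}. ennreal ((norm (b \<omega> s 0 (return borel 0)))\<^sup>2) \<partial>lborel) +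
              (\<integral>\<^sup>+ s\<in>{0..T}. ennreal ((norm (\<delta> \<omega> s 0 (return borel 0)))\<^sup>2
                 + (norm (\<sigma> \<omega> s 0 (return borel 0)))\<^sup>2) \<partial>path_measure L \<omega>) \<partial>M) < \<infinity>"
    and ii: "C0 > 0" "\<Omega>0 \<in> sets M" "measure M \<Omega>0 = 1"
      "\<And>\<omega> t. \<omega> \<in> \<Omega>0 \<Longrightarrow> t \<in> {0..T} \<Longrightarrow>
         lipschitz_W2 C0 (b \<omega> t) \<and> lipschitz_W2 C0 (\<delta> \<omega> t) \<and> lipschitz_W2 C0 (\<sigma> \<omega> t)"
  shows "(\<exists>X. strong_solution M F Z L T b \<delta> \<sigma> x0 X) \<and>
    (\<forall>X Y. strong_solution M F Z L T b \<delta> \<sigma> x0 X \<and> strong_solution M F Z L T b \<delta> \<sigma> x0 Y \<longrightarrow>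
       (AE \<omega> in M. \<forall>t\<in>{0..T}. Y t \<omega> = X t \<omega>)) \<and>
    (\<forall>X. strong_solution M F Z L T b \<delta> \<sigma> x0 X \<longrightarrow>
       (\<integral>\<^sup>+ \<omega>. (SUP t\<in>{0..T}. ennreal ((norm (X t \<omega>))\<^sup>2)) \<partial>M) < \<infinity>)"
proof -
  interpret sbm: subordinated_brownian_motion M B S \<kappa>
    by (rule subordinated_brownian_motionI[OF assms(1-5) S_eq assms(7)])
  have driver: "driver M F T Z L \<kappa>"
    unfolding L_eq Z_eq F_eq by (rule sbm.driver) fact
  interpret driver M F T Z L \<kappa> by (rule driver)
  let ?n = "\<lambda>\<phi> w s. ennreal ((norm (\<phi> w s 0 (return borel 0)))\<^sup>2)"
  \<comment> \<open>The hypothesis bounds one combined integral; each of the three integrals wanted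
    below lies under it by monotonicity, so the expectation is never split.\<close>
  have le: "h < \<infinity>" if "h \<le> (\<integral>\<^sup>+w. (\<integral>\<^sup>+s\<in>{0..T}. ?n b w s \<partial>lborel) + (\<integral>\<^sup>+s\<in>{0..T}. ennreal ((norm (\<delta> w s 0 (return borel 0)))\<^sup>2
                 + (norm (\<sigma> w s 0 (return borel 0)))\<^sup>2) \<partial>path_measure L w) \<partial>M)" for h
    using le_less_trans[OF that i] .
  interpret mean_field_sde M F T Z L \<kappa> b \<delta> \<sigma> C0 \<Omega>0 x0
  proof unfold_locales
    show "(\<integral>\<^sup>+w. (\<integral>\<^sup>+s\<in>{0..T}. ?n b w s \<partial>lborel) \<partial>M) < \<infinity>"
      by (rule le, rule nn_integral_mono) simp
    show "clock_norm T (\<lambda>s w. \<delta> w s 0 (return borel 0)) < \<infinity>"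
      unfolding clock_norm_def
      by (rule le, rule nn_integral_mono, rule order_trans[OF nn_integral_mono add_increasing[OF _ order_refl]])
        (auto intro!: mult_right_mono ennreal_leI)
    show "clock_norm T (\<lambda>s w. \<sigma> w s 0 (return borel 0)) < \<infinity>"
      unfolding clock_norm_def
      by (rule le, rule nn_integral_mono, rule order_trans[OF nn_integral_mono add_increasing[OF _ order_refl]])
        (auto intro!: mult_right_mono ennreal_leI)
  qed (use assms in auto)
  show ?thesis by (rule well_posed)
qed

end
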